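(* Let $R$ be a skew-invertible Hecke symmetry over $\mathbb{C}[[h]]$, $R(u)$ the associated $R$-matrix with additive spectral parameter and $\mathbf{Y}^+(R)$ the associated algebra with unit $1$ (all defined in the context). For any $c\in\mathbb{C}$ there exists a unique formal power series $L^-(u)$ in $\mathrm{End}\,\mathbb{C}^N\otimes\mathrm{Hom}(\mathbf{Y}^+(R),\mathbf{Y}^+(R)((u))_h)$ satisfying $L^-(u)1=I\otimes1$ and such that for all integers $n\geqslant1$ and variables $v=(v_1,\dots,v_n)$ \begin{align*} &L^{-}_0(u)\,(RP)_{01}\cdots(RP)_{0n}\,L_{[n]}^{+}(v)=R_{01}(u-v_1+hc/2)^{-1}\cdots R_{0n}(u-v_n+hc/2)^{-1}\\ &\qquad\times L_{[n]}^{+}(v)\,(RP)_{10}\cdots(RP)_{n0}\,R_{n0}(u-v_n-hc/2)\cdots R_{10}(u-v_1-hc/2). \end{align*} Moreover, $L^-(u)$ is invertible in $\mathrm{End}\,\mathbb{C}^N\otimes\mathrm{Hom}(\mathbf{Y}^+(R),\mathbf{Y}^+(R)((u))_h)$ and it satisfies the following identities for operators on $\mathbf{Y}^+(R)$: \begin{align*} R_{12}(u-v)\,L_1^-(u)\,(RP)_{12}\,L_2^-(v)&=L_2^-(v)\,(RP)_{21}\,L_1^-(u)\,R_{21}(u-v),\\ R_{12}(u-v+hc/2)\,L_1^-(u)\,(RP)_{12}\,L_2^+(v)&=L_2^+(v)\,(RP)_{21}\,L_1^-(u)\,R_{21}(u-v-hc/2). \end{align*}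
   Context: Hecke symmetries. $N\geqslant 2$ is an integer, $h$ a formal parameter, $P=\sum_{i,j}e_{ij}\otimes e_{ji}$ and $I$ (identity) on $\mathbb{C}^N\otimes\mathbb{C}^N$ ($I$ also denotes the identity matrix in $\mathrm{End}\,\mathbb{C}^N$). For $A\in(\mathrm{End}\,\mathbb{C}^N)^{\otimes 2}$ (with any coefficients), $A_{rs}$ denotes $A$ acting on tensor factors $r$ and $s$ (first leg in factor $r$, second leg in factor $s$); e.g. $A_{21}=PA_{12}P$. A Hecke symmetry is $R\in(\mathrm{End}\,\mathbb{C}^N)^{\otimes 2}[[h]]$ with $R_{12}R_{23}R_{12}=R_{23}R_{12}R_{23}$ and $(R-e^hI)(R+e^{-h}I)=0$; it is skew-invertible if there is $\Psi\in(\mathrm{End}\,\mathbb{C}^N)^{\otimes 2}[[h]]$ with $\mathrm{tr}_2R_{12}\Psi_{23}=P_{13}=\mathrm{tr}_2\Psi_{12}R_{23}$. Normalizing series. Fix an integer $M>0$ and $0\ne a\in\mathbb{C}$. Let $\overline g(x)\in 1+x\mathbb{C}[[x,h]]$ be the unique series with $\prod_{k=0}^{M-1}\overline g(xe^{-2kh})=\frac{1-xe^{-2(M-1)h}}{1-x}$, and $\overline f(x)=\frac{1-x}{1-xe^{-2h}}\,\overline g(x)$ (expansions in nonnegative powers of $x$). Each coefficient of $h^k$ in $\overline f(x)$ is a rational function of $x$ with poles only at $x=1$; $f(u)\in\mathbb{C}((u))[[h]]$ is obtained from $\overline f(x)$ by the substitution $x=e^{-2u/a}$ followed by expansion into Laurent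 series in $u$. Additive $R$-matrix. $R(u)=\psi f(u)\big(PR+\frac{e^h-e^{-h}}{e^{2u/a}-1}P\big)\in(\mathrm{End}\,\mathbb{C}^N)^{\otimes 2}((u))[[h]]$, where $\psi$ is an invertible element of $\mathbb{C}[[h]]$ chosen so that $R_{12}(u)R_{21}(-u)=1$. Expansion convention: negative powers of a sum of variables are expanded in negative powers of the variable written first (here $u$ in $u-v+bh$). Modules. For a $\mathbb{C}[[h]]$-module $V$, $V((u))_h$ is the set of $\sum_{r\in\mathbb{Z}}a_ru^r$, $a_r\in V$, with $a_r\to0$ $h$-adically as $r\to-\infty$. Tensor products of $\mathbb{C}[[h]]$-modules are $h$-adically completed. Algebra. $\mathbf{Y}^+(R)$ is the topologically free associative unital $\mathbb{C}[[h]]$-algebra generated by $l_{ij}^{(-r)}$ ($1\leqslant i,j\leqslant N$, $r\geqslant1$) subject to $R_{12}(u-v)L_1^+(u)(RP)_{12}L_2^+(v)=L_2^+(v)(RP)_{21}L_1^+(u)R_{21}(u-v)$, where $L^+(u)=\sum_{i,j}e_{ij}\otimes l^+_{ij}(u)$, $l^+_{ij}(u)=\delta_{ij}-\sum_{r\geqslant1}l_{ij}^{(-r)}u^{r-1}$, and a subscript $k$ indicates that the matrix part sits in the $k$-th copy of $\mathrm{End}\,\mathbb{C}^N$. (Topologically free: the quotient of the $h$-adically completed free algebra by the smallest $h$-adically closed two-sided ideal $J$ containing the relations and such that $ha\in J$ implies $a\in J$.) Notation. $L_{[n]}^+(v)=\prod_{i=1}^{n}L_i^+(v_i)(RP)_{i\,i+1}\cdots(RP)_{i\,n}$,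 the factors for $i=1,\dots,n$ being ordered from left to right. In the formula defining $L^-$, copies of $\mathrm{End}\,\mathbb{C}^N$ are labelled $0,1,\dots,n$ and $L^+_{[n]}(v)$ (in copies $1,\dots,n$) is regarded as a series of elements of $\mathbf{Y}^+(R)$; in the operator identities $L^+$ acts by left multiplication. *)

theory Defs
  imports
    "HOL-Analysis.Analysis"
    "HOL-Computational_Algebra.Computational_Algebra"
    "HOL-Library.Poly_Mapping"
    "HOL-Algebra.Algebraic_Closure_Type"
begin

text \<open>
  \<open>\<complex>[[h]]\<close> is \<^typ>\<open>complex fps\<close> and \<open>\<complex>((u))[[h]]\<close> is \<^typ>\<open>complex fls fps\<close> (the outer series is the one in
  \<open>h\<close>); \<open>\<complex>((u))[[h]][[v]]\<close> is \<^typ>\<open>complex fls fps fps\<close>.  Elements of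
  \<open>(End \<complex>\<^sup>N)\<^sup>\<otimes>\<^sup>2\<close> are matrices indexed by pairs: the entry at \<open>(i,k)\<close>, \<open>(j,l)\<close> is the coefficient of
  \<open>e\<^sub>i\<^sub>j \<otimes> e\<^sub>k\<^sub>l\<close>.
\<close>

type_synonym ('a, 'n) mat2 = "'a ^ ('n \<times> 'n) ^ ('n \<times> 'n)"

definition fps_map :: "('a \<Rightarrow> 'b) \<Rightarrow> 'a fps \<Rightarrow> 'b fps" where
  "fps_map \<phi> F = Abs_fps (\<lambda>m. \<phi> (fps_nth F m))"

text \<open>Only used with \<open>\<phi> 0 = 0\<close>, so that the argument of \<^const>\<open>Abs_fls\<close> is a Laurent series.\<close>

definition fls_map :: "('a::zero \<Rightarrow> 'b::zero) \<Rightarrow> 'a fls \<Rightarrow> 'b fls" where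
  "fls_map \<phi> F = Abs_fls (\<lambda>k. \<phi> (fls_nth F k))"

text \<open>The coefficient of \<open>u\<^sup>k\<close>, as a power series in \<open>h\<close>.\<close>

definition ucoeff :: "int \<Rightarrow> 'a::zero fls fps \<Rightarrow> 'a fps" where
  "ucoeff k = fps_map (\<lambda>F. fls_nth F k)"


section \<open>Tensor powers of \<open>End \<complex>\<^sup>N\<close>\<close>

text \<open>
  Elements of \<open>(End \<complex>\<^sup>N)\<^sup>\<otimes>\<^sup>m\<close> with coefficients in \<^typ>\<open>'a\<close> are functions of two multi-indices, i.e. lists of
  length \<open>m\<close>; tensor factors are numbered from 0.
\<close>

type_synonym ('a, 'n) tens = "'n list \<Rightarrow> 'n list \<Rightarrow> 'a"

definition tmul :: "nat \<Rightarrow> ('a::semiring_0, 'n) tens \<Rightarrow> ('a, 'n) tens \<Rightarrow> ('a, 'n) tens" where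
  "tmul m A B I J = (\<Sum>K | length K = m. A I K * B K J)"

definition leg :: "nat \<Rightarrow> nat \<Rightarrow> ('a::zero, 'n::finite) mat2 \<Rightarrow> ('a, 'n) tens" where
  "leg r s A I J =
     (if \<forall>k<length I. k \<noteq> r \<and> k \<noteq> s \<longrightarrow> I ! k = J ! k then A $ (I ! r, I ! s) $ (J ! r, J ! s) else 0)"

definition Pm :: "('a::zero_neq_one, 'n::finite) mat2" where
  "Pm = (\<chi> x y. if y = prod.swap x then 1 else 0)"

definition flip :: "('a::semiring_1, 'n::finite) mat2 \<Rightarrow> ('a, 'n) mat2" where
  "flip A = Pm ** A ** Pm"

definition hecke_symmetry :: "(complex fps, 'n::finite) mat2 \<Rightarrow> bool" where
  "hecke_symmetry R \<longleftrightarrow>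
     (\<forall>I J. length I = 3 \<and> length J = 3 \<longrightarrow>
        tmul 3 (tmul 3 (leg 0 1 R) (leg 1 2 R)) (leg 0 1 R) I J =
        tmul 3 (tmul 3 (leg 1 2 R) (leg 0 1 R)) (leg 1 2 R) I J) \<and>
     (R - mat (fps_exp 1)) ** (R + mat (fps_exp (- 1))) = 0"

text \<open>The product \<open>A\<^sub>1\<^sub>2 B\<^sub>2\<^sub>3\<close>, traced over the second factor.\<close>

definition tr2 :: "(complex fps, 'n::finite) mat2 \<Rightarrow> (complex fps, 'n) mat2 \<Rightarrow> (complex fps, 'n) mat2" where
  "tr2 A B = (\<chi> x y. \<Sum>k\<in>UNIV.
     tmul 3 (leg 0 1 A) (leg 1 2 B) [fst x, k, snd x] [fst y, k, snd y])"

definition skew_invertible :: "(complex fps, 'n::finite) mat2 \<Rightarrow> bool" where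
  "skew_invertible R \<longleftrightarrow> (\<exists>\<Psi>. tr2 R \<Psi> = Pm \<and> tr2 \<Psi> R = Pm)"


section \<open>The normalizing series and the additive \<open>R\<close>-matrix\<close>

text \<open>\<open>\<complex>[[x,h]]\<close> is \<^typ>\<open>complex fps fps\<close> with the outer series in \<open>x\<close>.  The next function substitutes
  \<open>x e\<^sup>t\<^sup>h\<close> for \<open>x\<close>.\<close>

definition scale_x :: "complex \<Rightarrow> complex fps fps \<Rightarrow> complex fps fps" where
  "scale_x t F = Abs_fps (\<lambda>j. fps_exp (of_nat j * t) * fps_nth F j)"

definition gbar :: "nat \<Rightarrow> complex fps fps" where
  "gbar M = (THE g. fps_nth g 0 = 1 \<and>
     (\<Prod>k<M. scale_x (- 2 * of_nat k) g) =
       (1 - fps_const (fps_exp (- 2 * (of_nat M - 1))) * fps_X) * inverse (1 - fps_X))"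

definition fbar :: "nat \<Rightarrow> complex fps fps" where
  "fbar M = (1 - fps_X) * inverse (1 - fps_const (fps_exp (- 2)) * fps_X) * gbar M"

text \<open>For a power series \<open>F\<close> that expands a rational function \<open>p(x) / (1 - x)\<^sup>d\<close>: the Laurent series
  at \<open>u = 0\<close> of that rational function at \<open>x = e\<^sup>-\<^sup>2\<^sup>u\<^sup>/\<^sup>a\<close>.\<close>

definition exp_subst :: "complex \<Rightarrow> complex fps \<Rightarrow> complex fls" where
  "exp_subst a F = (THE \<phi>. \<exists>p d. F * (1 - fps_X) ^ d = fps_of_poly p \<and>
     \<phi> = poly (map_poly fls_const p) (fps_to_fls (fps_exp (- 2 / a)))
           / (1 - fps_to_fls (fps_exp (- 2 / a))) ^ d)"

definition fser :: "nat \<Rightarrow> complex \<Rightarrow> complex fls fps" where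
  "fser M a = Abs_fps (\<lambda>k. exp_subst a (Abs_fps (\<lambda>j. fps_nth (fps_nth (fbar M) j) k)))"

definition Rmat :: "nat \<Rightarrow> complex \<Rightarrow> complex fps \<Rightarrow> (complex fps, 'n::finite) mat2 \<Rightarrow> (complex fls fps, 'n) mat2"
  where
  "Rmat M a \<psi> R = (\<chi> x y. fps_map fls_const \<psi> * fser M a *
     (fps_map fls_const ((Pm ** R) $ x $ y) +
      fps_map fls_const (fps_exp 1 - fps_exp (- 1))
        * fps_const (inverse (fps_to_fls (fps_exp (2 / a)) - 1)) * Pm $ x $ y))"

definition neg_u :: "complex fls fps \<Rightarrow> complex fls fps" where
  "neg_u = fps_map (\<lambda>F. fls_compose_fps F (- fps_X))"

definition unitary :: "(complex fls fps, 'n::finite) mat2 \<Rightarrow> bool" where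
  "unitary Ru \<longleftrightarrow> Ru ** flip (map_matrix neg_u Ru) = mat 1"

text \<open>
  \<open>F(u - v + b h)\<close> for \<open>F(u) \<in> \<complex>((u))[[h]]\<close>, expanded in negative powers of \<open>u\<close>, i.e. the Taylor
  expansion \<open>\<Sum>\<^sub>t (b h - v)\<^sup>t F\<^sup>(\<^sup>t\<^sup>)(u) / t!\<close>.  With \<open>t = q + i\<close> the coefficient of \<open>v\<^sup>q h\<^sup>i\<close> in \<open>(b h - v)\<^sup>t\<close> is
  \<open>(-1)\<^sup>q b\<^sup>i (t choose q)\<close>.
\<close>

definition shift_arg :: "complex \<Rightarrow> complex fls fps \<Rightarrow> complex fls fps fps" where
  "shift_arg b F = Abs_fps (\<lambda>q. Abs_fps (\<lambda>m. \<Sum>i\<le>m.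
     fls_const ((- 1) ^ q * b ^ i * of_nat ((q + i) choose q) / fact (q + i))
       * (fls_deriv ^^ (q + i)) (fps_nth F (m - i))))"


section \<open>The completed free algebra\<close>

datatype 'g free_monoid = Word (letters: "'g list")

instantiation free_monoid :: (type) monoid_add
begin
definition zero_free_monoid :: "'a free_monoid" where "0 = Word []"
definition plus_free_monoid :: "'a free_monoid \<Rightarrow> 'a free_monoid \<Rightarrow> 'a free_monoid" where
  "v + w = Word (letters v @ letters w)"
instance
  by standard (simp_all add: zero_free_monoid_def plus_free_monoid_def)
end

text \<open>
  The free algebra over \<open>\<complex>\<close> is the monoid algebra of the free monoid; power series in \<open>h\<close> over it
  form the \<open>h\<close>-adic completion of the free \<open>\<complex>[[h]]\<close>-algebra.  The letter \<open>(i, j, k)\<close> stands for the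
  generator \<open>l\<^sub>i\<^sub>j\<^sup>(\<^sup>-\<^sup>r\<^sup>)\<close> with \<open>r = k + 1\<close>.
\<close>

type_synonym 'n free_alg = "('n \<times> 'n \<times> nat) free_monoid \<Rightarrow>\<^sub>0 complex"

definition gen :: "'n \<Rightarrow> 'n \<Rightarrow> nat \<Rightarrow> 'n free_alg" where
  "gen i j k = Poly_Mapping.single (Word [(i, j, k)]) 1"

definition emb :: "complex \<Rightarrow> 'n free_alg" where
  "emb z = Poly_Mapping.single 0 z"

definition scal :: "complex fps \<Rightarrow> 'n free_alg fps" where
  "scal = fps_map emb"

definition scal_u :: "complex fls fps \<Rightarrow> 'n free_alg fls fps" where
  "scal_u = fps_map (fls_map emb)"

definition lift_u :: "'n free_alg fps \<Rightarrow> 'n free_alg fls fps" where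
  "lift_u = fps_map fls_const"

definition lplus :: "'n \<Rightarrow> 'n \<Rightarrow> 'n free_alg fps" \<comment> \<open>a series in \<open>u\<close>, not in \<open>h\<close>\<close>
  where
  "lplus i j = Abs_fps (\<lambda>k. (if i = j \<and> k = 0 then 1 else 0) - gen i j k)"

definition L1_u :: "('n free_alg fls fps fps, 'n::finite) mat2" where
  "L1_u = (\<chi> x y. if snd x = snd y
     then fps_const (fps_const (fps_to_fls (lplus (fst x) (fst y)))) else 0)"

definition L2_v :: "('n free_alg fls fps fps, 'n::finite) mat2" where
  "L2_v = (\<chi> x y. if fst x = fst y
     then fps_map (\<lambda>z. fps_const (fls_const z)) (lplus (snd x) (snd y)) else 0)"

definition RP :: "(complex fps, 'n::finite) mat2 \<Rightarrow> (complex fps, 'n) mat2" where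
  "RP R = R ** Pm"

definition Rshift :: "complex \<Rightarrow> (complex fls fps, 'n::finite) mat2 \<Rightarrow> (complex fls fps fps, 'n) mat2" where
  "Rshift b Ru = map_matrix (shift_arg b) Ru"

definition defining_relation ::
  "(complex fps, 'n::finite) mat2 \<Rightarrow> (complex fls fps, 'n) mat2 \<Rightarrow> ('n free_alg fls fps fps, 'n) mat2" where
  "defining_relation R Ru =
     map_matrix (fps_map scal_u) (Rshift 0 Ru) ** L1_u
       ** map_matrix (\<lambda>s. fps_const (lift_u (scal s))) (RP R) ** L2_v
     - L2_v ** map_matrix (\<lambda>s. fps_const (lift_u (scal s))) (flip (RP R)) ** L1_u
       ** map_matrix (fps_map scal_u) (flip (Rshift 0 Ru))"

text \<open>The topology on formal power series is the \<open>h\<close>-adic one.\<close>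

definition rel_ideal ::
  "(complex fps, 'n::finite) mat2 \<Rightarrow> (complex fls fps, 'n) mat2 \<Rightarrow> 'n free_alg fps set" where
  "rel_ideal R Ru = \<Inter> {J. ideal J ring_of_type_algebra \<and> closed J \<and>
     (\<forall>x. fps_X * x \<in> J \<longrightarrow> x \<in> J) \<and>
     (\<forall>x y q k. ucoeff k (fps_nth (defining_relation R Ru $ x $ y) q) \<in> J)}"


section \<open>The algebra \<open>Y\<^sup>+(R)\<close>\<close>

definition ycls ::
  "(complex fps, 'n::finite) mat2 \<Rightarrow> (complex fls fps, 'n) mat2 \<Rightarrow> 'n free_alg fps \<Rightarrow> 'n free_alg fps set" where
  "ycls R Ru x = rel_ideal R Ru +>\<^bsub>ring_of_type_algebra\<^esub> x"

definition Yplus ::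
  "(complex fps, 'n::finite) mat2 \<Rightarrow> (complex fls fps, 'n) mat2 \<Rightarrow> (complex fps, 'n free_alg fps set) module" where
  "Yplus R Ru = (let Q = ring_of_type_algebra Quot rel_ideal R Ru in
     \<lparr>carrier = carrier Q, mult = mult Q, one = one Q, zero = zero Q, add = add Q,
      smult = (\<lambda>s y. ycls R Ru (scal s) \<otimes>\<^bsub>Q\<^esub> y)\<rparr>)"


section \<open>\<open>h\<close>-adic notions for \<open>\<complex>[[h]]\<close>-modules\<close>

definition hsub :: "(complex fps, 'y, 'z) module_scheme \<Rightarrow> nat \<Rightarrow> 'y set" where
  "hsub V m = (\<lambda>x. fps_X ^ m \<odot>\<^bsub>V\<^esub> x) ` carrier V"

text \<open>\<open>V((u))\<^sub>h\<close>, a series being given by its coefficients.\<close>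

definition laurent_h :: "(complex fps, 'y, 'z) module_scheme \<Rightarrow> (int \<Rightarrow> 'y) set" where
  "laurent_h V = {a. (\<forall>r. a r \<in> carrier V) \<and> (\<forall>m. \<exists>B. \<forall>r<B. a r \<in> hsub V m)}"

text \<open>\<open>Hom(V, V((u))\<^sub>h)\<close>.\<close>

definition hom_laurent :: "(complex fps, 'y, 'z) module_scheme \<Rightarrow> ('y \<Rightarrow> int \<Rightarrow> 'y) set" where
  "hom_laurent V = {\<phi> \<in> carrier V \<rightarrow>\<^sub>E laurent_h V.
     (\<forall>x\<in>carrier V. \<forall>y\<in>carrier V. \<forall>r. \<phi> (x \<oplus>\<^bsub>V\<^esub> y) r = \<phi> x r \<oplus>\<^bsub>V\<^esub> \<phi> y r) \<and>
     (\<forall>s. \<forall>x\<in>carrier V. \<forall>r. \<phi> (s \<odot>\<^bsub>V\<^esub> x) r = s \<odot>\<^bsub>V\<^esub> \<phi> x r)}"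

text \<open>Unconditional \<open>h\<close>-adic convergence of \<open>\<Sum>\<^sub>i\<^sub>\<in>\<^sub>S f i\<close> to \<open>t\<close>.\<close>

definition has_hsum :: "(complex fps, 'y, 'z) module_scheme \<Rightarrow> ('i \<Rightarrow> 'y) \<Rightarrow> 'i set \<Rightarrow> 'y \<Rightarrow> bool" where
  "has_hsum V f S t \<longleftrightarrow> t \<in> carrier V \<and> (\<forall>i\<in>S. f i \<in> carrier V) \<and>
     (\<forall>m. \<exists>F0. finite F0 \<and> F0 \<subseteq> S \<and>
       (\<forall>F. finite F \<and> F0 \<subseteq> F \<and> F \<subseteq> S \<longrightarrow> (\<Oplus>\<^bsub>V\<^esub>i\<in>F. f i) \<ominus>\<^bsub>V\<^esub> t \<in> hsub V m))"

text \<open>\<open>End \<complex>\<^sup>N \<otimes> Hom(V, V((u))\<^sub>h)\<close>: \<open>L i j x r\<close> is the coefficient of \<open>u\<^sup>r\<close> in \<open>L\<^sub>i\<^sub>j(u) x\<close>.\<close>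

type_synonym ('y, 'n) opmat = "'n \<Rightarrow> 'n \<Rightarrow> 'y \<Rightarrow> int \<Rightarrow> 'y"

definition opmats :: "(complex fps, 'y, 'z) module_scheme \<Rightarrow> ('y, 'n) opmat set" where
  "opmats V = {L. \<forall>i j. L i j \<in> hom_laurent V}"

text \<open>\<open>A(u) B(u) = I\<close>; the coefficients of the product are infinite sums, whose convergence is part of
  the condition since it is not automatic.\<close>

definition op_prod_is_one :: "(complex fps, 'y, 'z) module_scheme \<Rightarrow> ('y, 'n::finite) opmat \<Rightarrow> ('y, 'n) opmat \<Rightarrow> bool"
  where
  "op_prod_is_one V A B \<longleftrightarrow> (\<forall>x\<in>carrier V. \<forall>i j r.
     has_hsum V (\<lambda>(k, b). A i k (B k j x b) (r - b)) UNIV (if i = j \<and> r = 0 then x else \<zero>\<^bsub>V\<^esub>))"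

definition op_invertible :: "(complex fps, 'y, 'z) module_scheme \<Rightarrow> ('y, 'n::finite) opmat \<Rightarrow> bool" where
  "op_invertible V L \<longleftrightarrow> (\<exists>K\<in>opmats V. op_prod_is_one V L K \<and> op_prod_is_one V K L)"

text \<open>
  The operator identity
  \<open>R\<^sub>1\<^sub>2(u-v+bh) A\<^sub>1(u) (RP)\<^sub>1\<^sub>2 B\<^sub>2(v) = B\<^sub>2(v) (RP)\<^sub>2\<^sub>1 A\<^sub>1(u) R\<^sub>2\<^sub>1(u-v-bh)\<close> on \<open>V\<close>.  For every \<open>x\<close> in \<open>V\<close>, every matrix entry
  and every monomial \<open>u\<^sup>r v\<^sup>s\<close>, the coefficients of both sides converge to the same element \<open>t\<close>; they are
  sums over the intermediate matrix indices and over the exponents \<open>p\<close>, \<open>q\<close> of \<open>u\<close>, \<open>v\<close> taken from \<open>R(u-v\<plusminus>bh)\<close>.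
\<close>

definition rll_relation ::
  "(complex fps, 'y, 'z) module_scheme \<Rightarrow> (complex fps, 'n::finite) mat2 \<Rightarrow> (complex fls fps, 'n) mat2 \<Rightarrow>
   complex \<Rightarrow> ('y, 'n) opmat \<Rightarrow> ('y, 'n) opmat \<Rightarrow> bool" where
  "rll_relation V R Ru b A B \<longleftrightarrow>
     (\<forall>x\<in>carrier V. \<forall>i1 i2 j1 j2 r s. \<exists>t.
        has_hsum V
          (\<lambda>(k1, k2, l1, l2, p, q).
             (ucoeff p (fps_nth (Rshift b Ru $ (i1, i2) $ (k1, k2)) q) * RP R $ (l1, k2) $ (j1, l2))
               \<odot>\<^bsub>V\<^esub> A k1 l1 (B l2 j2 x (s - int q)) (r - p)) UNIV t \<and>
        has_hsum V
          (\<lambda>(k1, k2, l1, l2, p, q).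
             (flip (RP R) $ (i1, l2) $ (l1, k2)
               * ucoeff p (fps_nth (flip (Rshift (- b) Ru) $ (k1, k2) $ (j1, j2)) q))
               \<odot>\<^bsub>V\<^esub> B i2 l2 (A l1 k1 x (r - p)) (s - int q)) UNIV t)"

text \<open>\<open>L\<^sup>+\<close> acting by left multiplication.\<close>

definition Lplus_op ::
  "(complex fps, 'n::finite) mat2 \<Rightarrow> (complex fls fps, 'n) mat2 \<Rightarrow> ('n free_alg fps set, 'n) opmat" where
  "Lplus_op R Ru i j y r =
     (if r \<ge> 0 then ycls R Ru (fps_const (fps_nth (lplus i j) (nat r))) \<otimes>\<^bsub>Yplus R Ru\<^esub> y else \<zero>\<^bsub>Yplus R Ru\<^esub>)"


section \<open>Series in \<open>v\<^sub>1, \<dots>, v\<^sub>n\<close> with values in \<open>(End \<complex>\<^sup>N)\<^sup>\<otimes>\<^sup>(\<^sup>n\<^sup>+\<^sup>1\<^sup>)\<close>\<close>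

text \<open>The first argument is the list of the \<open>n\<close> exponents (so \<open>e ! (k - 1)\<close> is the exponent of \<open>v\<^sub>k\<close>);
  the tensor factors are \<open>0, \<dots>, n\<close>.\<close>

type_synonym ('a, 'n) vtens = "nat list \<Rightarrow> ('a, 'n) tens"

definition vmul :: "nat \<Rightarrow> ('a::semiring_0, 'n) vtens \<Rightarrow> ('a, 'n) vtens \<Rightarrow> ('a, 'n) vtens" where
  "vmul n S T e I J =
     (\<Sum>d | length d = n \<and> (\<forall>k<n. d ! k \<le> e ! k). tmul (Suc n) (S d) (T (map2 (-) e d)) I J)"

definition vone :: "nat \<Rightarrow> ('a::zero_neq_one, 'n) vtens" where
  "vone n e I J = (if e = replicate n 0 \<and> I = J then 1 else 0)"

definition vprod :: "nat \<Rightarrow> ('a::semiring_1, 'n) vtens list \<Rightarrow> ('a, 'n) vtens" where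
  "vprod n Ss = foldr (vmul n) Ss (vone n)"

definition vconst :: "nat \<Rightarrow> ('a::zero, 'n) tens \<Rightarrow> ('a, 'n) vtens" where
  "vconst n A e I J = (if e = replicate n 0 then A I J else 0)"

text \<open>\<open>A\<^sub>r\<^sub>s(v\<^sub>k)\<close> for a matrix \<open>A\<close> of power series in one variable.\<close>

definition vleg :: "nat \<Rightarrow> nat \<Rightarrow> nat \<Rightarrow> nat \<Rightarrow> ('a::zero fps, 'n::finite) mat2 \<Rightarrow> ('a, 'n) vtens" where
  "vleg n k r s A e I J =
     (if \<forall>j<n. Suc j \<noteq> k \<longrightarrow> e ! j = 0
      then leg r s (map_matrix (\<lambda>F. fps_nth F (e ! (k - 1))) A) I J else 0)"

text \<open>\<open>L\<^sub>k\<^sup>+(v\<^sub>k)\<close>.\<close>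

definition vL :: "nat \<Rightarrow> nat \<Rightarrow> ('n free_alg fps, 'n) vtens" where
  "vL n k e I J =
     (if (\<forall>j<n. Suc j \<noteq> k \<longrightarrow> e ! j = 0) \<and> (\<forall>j\<le>n. j \<noteq> k \<longrightarrow> I ! j = J ! j)
      then fps_const (fps_nth (lplus (I ! k) (J ! k)) (e ! (k - 1))) else 0)"

text \<open>\<open>L\<^sup>+\<^sub>[\<^sub>n\<^sub>](v)\<close>, with entries in the completed free algebra; it is trivial on the tensor factor 0.\<close>

definition Lbracket :: "nat \<Rightarrow> (complex fps, 'n::finite) mat2 \<Rightarrow> ('n free_alg fps, 'n) vtens" where
  "Lbracket n R = vprod n (concat (map
     (\<lambda>i. vL n i # map (\<lambda>k. vconst n (leg i k (map_matrix scal (RP R)))) [Suc i..<Suc n]) [1..<Suc n]))"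

text \<open>\<open>(RP)\<^sub>0\<^sub>1 \<cdots> (RP)\<^sub>0\<^sub>n L\<^sup>+\<^sub>[\<^sub>n\<^sub>](v)\<close>\<close>

definition Lminus_arg :: "nat \<Rightarrow> (complex fps, 'n::finite) mat2 \<Rightarrow> ('n free_alg fps, 'n) vtens" where
  "Lminus_arg n R =
     vprod n (map (\<lambda>k. vconst n (leg 0 k (map_matrix scal (RP R)))) [1..<Suc n] @ [Lbracket n R])"

text \<open>\<open>R\<^sub>0\<^sub>1(u-v\<^sub>1+hc/2)\<^sup>-\<^sup>1 \<cdots> R\<^sub>0\<^sub>n(u-v\<^sub>n+hc/2)\<^sup>-\<^sup>1 L\<^sup>+\<^sub>[\<^sub>n\<^sub>](v) (RP)\<^sub>1\<^sub>0 \<cdots> (RP)\<^sub>n\<^sub>0 R\<^sub>n\<^sub>0(u-v\<^sub>n-hc/2) \<cdots> R\<^sub>1\<^sub>0(u-v\<^sub>1-hc/2)\<close>\<close>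

definition Lminus_value ::
  "nat \<Rightarrow> (complex fps, 'n::finite) mat2 \<Rightarrow> (complex fls fps, 'n) mat2 \<Rightarrow> complex \<Rightarrow> ('n free_alg fls fps, 'n) vtens" where
  "Lminus_value n R Ru c = vprod n
     (map (\<lambda>k. vleg n k 0 k (map_matrix (fps_map scal_u) (matrix_inv (Rshift (c / 2) Ru)))) [1..<Suc n]
      @ [\<lambda>e I J. lift_u (Lbracket n R e I J)]
      @ map (\<lambda>k. vconst n (leg k 0 (map_matrix (\<lambda>s. lift_u (scal s)) (RP R)))) [1..<Suc n]
      @ map (\<lambda>k. vleg n k k 0 (map_matrix (fps_map scal_u) (Rshift (- (c / 2)) Ru))) (rev [1..<Suc n]))"

definition Lminus_characterization ::
  "(complex fps, 'n::finite) mat2 \<Rightarrow> (complex fls fps, 'n) mat2 \<Rightarrow> complex \<Rightarrow>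
   ('n free_alg fps set, 'n) opmat \<Rightarrow> bool" where
  "Lminus_characterization R Ru c L \<longleftrightarrow>
     L \<in> opmats (Yplus R Ru) \<and>
     (\<forall>i j r. L i j \<one>\<^bsub>Yplus R Ru\<^esub> r = (if i = j \<and> r = 0 then \<one>\<^bsub>Yplus R Ru\<^esub> else \<zero>\<^bsub>Yplus R Ru\<^esub>)) \<and>
     (\<forall>n\<ge>1. \<forall>e i0 I J r. length e = n \<and> length I = n \<and> length J = Suc n \<longrightarrow>
        (\<Oplus>\<^bsub>Yplus R Ru\<^esub>k0\<in>UNIV. L i0 k0 (ycls R Ru (Lminus_arg n R e (k0 # I) J)) r)
          = ycls R Ru (ucoeff r (Lminus_value n R Ru c e (i0 # I) J)))"

end

theory Submission
  imports Defs "HOL-Library.Function_Algebras" "HOL-Combinatorics.Transposition"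
begin

text \<open>
  The case \<open>n = 1\<close> of the formula for \<open>L\<^sup>-\<close>, multiplied by \<open>L\<^sup>+\<close>'s on the right, is a recursion on the length of
  words: as \<open>R\<close> is skew-invertible, \<open>(RP)\<^sub>0\<^sub>1\<close> can be cancelled between \<open>L\<^sup>-\<^sub>0(u)\<close> and \<open>L\<^sup>+\<^sub>1(v)\<close>, and the recursion
  defines \<open>L\<^sup>-\<close> on the completed free algebra over \<open>\<complex>((u))[[h]]\<close>.  Up to invertible scalars \<open>R(u - v)\<close> is the
  Baxterization \<open>e\<^sup>2\<^sup>u\<^sup>/\<^sup>a PR - e\<^sup>2\<^sup>v\<^sup>/\<^sup>a PR\<^sup>-\<^sup>1\<close>, so the Yang--Baxter equation moves \<open>L\<^sup>-\<close> through products of \<open>L\<^sup>+\<close>'s.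
  This gives the formula for all \<open>n\<close>, and shows that \<open>L\<^sup>-\<close> maps the right multiples of the relations of
  \<open>Y\<^sup>+(R)\<close> into the ideal they generate, hence descends to the quotient.  The difference \<open>X\<close> of the two sides of
  the \<open>L\<^sup>-L\<^sup>-\<close> relation satisfies a linear recursion on words with \<open>X 1 = 0\<close>, hence vanishes.  Modulo \<open>h\<close> one has
  \<open>R\<^sup>2 = 1\<close> and the recursion yields \<open>L\<^sup>- = 1\<close>, so a geometric series inverts \<open>L\<^sup>-\<close>.  Uniqueness follows by
  cancelling the factors \<open>(RP)\<^sub>i\<^sub>j\<close> from the right: the remaining products of \<open>L\<^sup>+\<close>'s span a dense submodule.
\<close>

text \<open>The obstacle is that the closed saturated ideal of Y^+(R) offers no normal form to
  compute with, while L^- takes Laurent values on the quotient. All computations are therefore done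
  in monoid algebras over a varying base ring: constants, series in u, series in u and v. There L^-
  is a linear map over the base ring, hence h-adically continuous, and Laurent-valued operators are
  composed as linear maps after base change. Coefficients of u and v are extracted at the end, as
  sums that are finite in each order of h.

  The normalization of R(u) is absorbed in a scalar, which is a unit because R(u) is unitary. The
  remaining factor z PR - w PR^{-1}, with z = e^{2u/a} and w = e^{2v/a}, is polynomial, so it makes
  sense for two power series variables, where R(v_1 - v_2) has a pole. It is also homogeneous in (z,
  w): the shifts by hc/2 multiply the parameters of L^-(u) and L^-(v) by the same unit, which is why
  they do not show in the relation between two operators L^-.\<close>

no_notation fps_nth (infixl "$" 75)

subsection \<open>Ring homomorphisms and formal series\<close>

definition rhom :: "('a::ring_1 \<Rightarrow> 'b::ring_1) \<Rightarrow> bool" where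
  "rhom \<phi> \<longleftrightarrow> Modules.additive \<phi> \<and> \<phi> 1 = 1 \<and> (\<forall>x y. \<phi> (x * y) = \<phi> x * \<phi> y)"

lemma rhomI:
  assumes "\<And>x y. \<phi> (x + y) = \<phi> x + \<phi> y" "\<phi> 1 = 1" "\<And>x y. \<phi> (x * y) = \<phi> x * \<phi> y"
  shows "rhom \<phi>"
  using assms by (auto simp: rhom_def Modules.additive_def)

lemma rhomD:
  assumes "rhom \<phi>"
  shows rhom_additive: "Modules.additive \<phi>" and rhom_one: "\<phi> 1 = 1" and rhom_mult: "\<phi> (x * y) = \<phi> x * \<phi> y"
    and rhom_add: "\<phi> (x + y) = \<phi> x + \<phi> y" and rhom_zero: "\<phi> 0 = 0"
    and rhom_diff: "\<phi> (x - y) = \<phi> x - \<phi> y" and rhom_minus: "\<phi> (- x) = - \<phi> x"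
    and rhom_sum: "\<phi> (sum f S) = (\<Sum>i\<in>S. \<phi> (f i))"
  using assms
  by (auto simp: rhom_def additive.add additive.zero additive.diff additive.minus additive.sum)

lemma rhom_comp: "rhom \<phi> \<Longrightarrow> rhom \<psi> \<Longrightarrow> rhom (\<lambda>x. \<phi> (\<psi> x))"
  by (auto simp: rhom_def Modules.additive_def)

lemma additive_comp: "Modules.additive \<phi> \<Longrightarrow> Modules.additive \<psi> \<Longrightarrow> Modules.additive (\<lambda>x. \<phi> (\<psi> x))"
  by (auto simp: Modules.additive_def)

lemma nth_matrix_mult: "(A ** B) $ i $ j = (\<Sum>k\<in>UNIV. A $ i $ k * B $ k $ j)"
  by (simp add: matrix_matrix_mult_def)

lemma map_matrix_mult: "rhom \<phi> \<Longrightarrow> map_matrix \<phi> (A ** B) = map_matrix \<phi> A ** map_matrix \<phi> B"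
  by (simp add: vec_eq_iff nth_matrix_mult rhom_sum rhom_mult)

lemma map_matrix_one: "rhom \<phi> \<Longrightarrow> map_matrix \<phi> (mat 1) = mat 1"
  by (simp add: vec_eq_iff mat_def rhom_one rhom_zero)

lemma map_matrix_diff: "rhom \<phi> \<Longrightarrow> map_matrix \<phi> (A - B) = map_matrix \<phi> A - map_matrix \<phi> B"
  by (simp add: vec_eq_iff rhom_diff)

lemma map_matrix_comp: "map_matrix \<phi> (map_matrix \<psi> A) = map_matrix (\<lambda>x. \<phi> (\<psi> x)) A"
  by (simp add: vec_eq_iff)

lemma nth_fps_map [simp]: "fps_nth (fps_map \<phi> F) m = \<phi> (fps_nth F m)"
  by (simp add: fps_map_def)

lemma additive_fps_map: "Modules.additive \<phi> \<Longrightarrow> Modules.additive (fps_map \<phi>)"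
  by (auto simp: Modules.additive_def fps_eq_iff)

lemma rhom_fps_map: "rhom \<phi> \<Longrightarrow> rhom (fps_map \<phi>)"
  by (rule rhomI) (auto simp: fps_eq_iff rhom_add rhom_one rhom_zero fps_mult_nth rhom_sum rhom_mult)

lemma fps_map_comp: "fps_map \<phi> (fps_map \<psi> F) = fps_map (\<lambda>x. \<phi> (\<psi> x)) F"
  by (simp add: fps_eq_iff)

lemma fps_map_const: "\<phi> 0 = 0 \<Longrightarrow> fps_map \<phi> (fps_const c) = fps_const (\<phi> c)"
  by (simp add: fps_eq_iff)

lemma rhom_fps_const: "rhom (fps_const :: 'a::ring_1 \<Rightarrow> 'a fps)"
  by (rule rhomI) auto

lemma rhom_fps_nth_0: "rhom (\<lambda>x :: 'a::ring_1 fps. fps_nth x 0)"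
  by (rule rhomI) auto

lemma rhom_fls_const: "rhom (fls_const :: 'a::ring_1 \<Rightarrow> 'a fls)"
  by (rule rhomI) (auto simp: fls_const_mult_const fls_plus_const)

lemma rhom_fps_to_fls: "rhom (fps_to_fls :: 'a::ring_1 fps \<Rightarrow> 'a fls)"
  by (rule rhomI) (auto simp: fls_times_fps_to_fls)

lemma fls_nth_bounded: "\<exists>B::int. \<forall>k<B. fls_nth F k = 0"
  by (rule exI[of _ "fls_subdegree F"]) auto

lemma nth_Abs_fls_bounded: "(\<And>k::int. k < B \<Longrightarrow> f k = 0) \<Longrightarrow> fls_nth (Abs_fls f) k = f k"
  by (subst nth_Abs_fls_lower_bound[of B]) auto

lemma nth_fls_map: "\<phi> 0 = 0 \<Longrightarrow> fls_nth (fls_map \<phi> F) k = \<phi> (fls_nth F k)"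
proof -
  assume 0: "\<phi> 0 = 0"
  obtain B where "\<forall>k<B. fls_nth F k = 0" using fls_nth_bounded by blast
  then show ?thesis unfolding fls_map_def by (subst nth_Abs_fls_bounded[of B]) (auto simp: 0)
qed

text \<open>Coefficientwise maps do not preserve the subdegree, so the product formula is wanted
  with arbitrary lower bounds for the supports as summation limits.\<close>

lemma nth_fls_mult:
  fixes f g :: "'a::semiring_0 fls"
  assumes f: "\<And>i. i < a \<Longrightarrow> fls_nth f i = 0" and g: "\<And>i. i < b \<Longrightarrow> fls_nth g i = 0"
  shows "fls_nth (f * g) n = (\<Sum>i=a..n-b. fls_nth f i * fls_nth g (n - i))"
proof -
  let ?h = "\<lambda>i. fls_nth f i * fls_nth g (n - i)"
  have "fls_nth (f * g) n = sum ?h {fls_subdegree f..n - fls_subdegree g}"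
    by (rule fls_times_nth(2))
  also have "\<dots> = sum ?h ({fls_subdegree f..n - fls_subdegree g} \<inter> {a..n-b})"
    by (rule sum.mono_neutral_right) (auto simp: not_le f g)
  also have "\<dots> = sum ?h {a..n-b}"
    by (rule sum.mono_neutral_left) (auto simp: not_le)
  finally show ?thesis .
qed

lemma rhom_fls_map: "rhom \<phi> \<Longrightarrow> rhom (fls_map \<phi>)"
proof (rule rhomI)
  assume h: "rhom \<phi>"
  have [simp]: "fls_nth (fls_map \<phi> F) k = \<phi> (fls_nth F k)" for F k
    by (rule nth_fls_map) (rule rhom_zero[OF h])
  show "fls_map \<phi> (x + y) = fls_map \<phi> x + fls_map \<phi> y" for x y
    by (simp add: fls_eq_iff rhom_add[OF h])
  show "fls_map \<phi> 1 = 1"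
    by (auto simp: fls_eq_iff rhom_one[OF h] rhom_zero[OF h])
  show "fls_map \<phi> (x * y) = fls_map \<phi> x * fls_map \<phi> y" for x y
    unfolding fls_eq_iff
  proof
    fix n
    have "fls_nth (fls_map \<phi> x * fls_map \<phi> y) n =
        (\<Sum>i=fls_subdegree x..n - fls_subdegree y. fls_nth (fls_map \<phi> x) i * fls_nth (fls_map \<phi> y) (n - i))"
      by (rule nth_fls_mult) (auto simp: rhom_zero[OF h])
    then show "fls_nth (fls_map \<phi> (x * y)) n = fls_nth (fls_map \<phi> x * fls_map \<phi> y) n"
      by (simp add: fls_times_nth(2) rhom_sum[OF h] rhom_mult[OF h])
  qed
qed

section \<open>Exchanging and identifying the variables of iterated series\<close>

definition fps_swap :: "'a fps fps \<Rightarrow> 'a fps fps" where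
  "fps_swap z = Abs_fps (\<lambda>m. Abs_fps (\<lambda>k. fps_nth (fps_nth z k) m))"

lemma rhom_fps_swap: "rhom (fps_swap :: 'a::ring_1 fps fps \<Rightarrow> _)"
proof (rule rhomI)
  show "fps_swap (x * y) = fps_swap x * fps_swap y" for x y :: "'a fps fps"
    by (simp add: fps_swap_def fps_eq_iff fps_mult_nth fps_sum_nth, intro allI, rule sum.swap)
qed (auto simp: fps_swap_def fps_eq_iff)

text \<open>Reads a series over \<open>B[[h]]\<close> in a variable \<open>v\<close> as an element of \<open>B((v))[[h]]\<close>.\<close>

definition hv_swap :: "'a::zero fps fps \<Rightarrow> 'a fls fps" where
  "hv_swap z = fps_map fps_to_fls (fps_swap z)"

lemma rhom_hv_swap: "rhom (hv_swap :: 'a::ring_1 fps fps \<Rightarrow> _)"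
  using rhom_comp[OF rhom_fps_map[OF rhom_fps_to_fls] rhom_fps_swap] by (simp add: hv_swap_def[abs_def])

lemma nth_ucoeff [simp]: "fps_nth (ucoeff k z) m = fls_nth (fps_nth z m) k"
  by (simp add: ucoeff_def)

lemma additive_ucoeff: "Modules.additive (ucoeff k :: 'a::ab_group_add fls fps \<Rightarrow> _)"
  by (auto simp: Modules.additive_def fps_eq_iff)

lemma ucoeff_hv_swap: "ucoeff k (hv_swap z) = (if k \<ge> 0 then fps_nth z (nat k) else 0)"
  by (auto simp: fps_eq_iff hv_swap_def fps_swap_def)

text \<open>The substitution that identifies the two variables of B[[h]][[h]]. It merges an h
  produced by a Taylor shift, or by the values of an operator on words, with the h already
  present.\<close>

definition fps_diag :: "'a::comm_monoid_add fps fps \<Rightarrow> 'a fps" where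
  "fps_diag z = Abs_fps (\<lambda>m. \<Sum>i\<le>m. fps_nth (fps_nth z (m - i)) i)"

lemma rhom_fps_diag: "rhom (fps_diag :: 'a::ring_1 fps fps \<Rightarrow> _)"
proof (rule rhomI)
  show "fps_diag (x * y) = fps_diag x * fps_diag y" for x y :: "'a fps fps"
    unfolding fps_eq_iff
  proof
    fix m
    let ?X = "\<lambda>p i. fps_nth (fps_nth x p) i" and ?Y = "\<lambda>p i. fps_nth (fps_nth y p) i"
    have "fps_nth (fps_diag (x * y)) m =
        (\<Sum>i\<le>m. \<Sum>p\<in>{0..m-i}. \<Sum>i'\<in>{0..i}. ?X p i' * ?Y (m - i - p) (i - i'))"
      by (simp add: fps_diag_def fps_mult_nth fps_sum_nth)
    also have "\<dots> = (\<Sum>(i,p,i')\<in>Sigma {..m} (\<lambda>i. {0..m-i} \<times> {0..i}). ?X p i' * ?Y (m - i - p) (i - i'))"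
      by (simp add: sum.Sigma sum.cartesian_product)
    \<comment> \<open>n and m - n are the total degrees contributed by x and y, i and j the inner
      ones.\<close>
    also have "\<dots> = (\<Sum>(n,i,j)\<in>Sigma {0..m} (\<lambda>n. {..n} \<times> {..m-n}). ?X (n - i) i * ?Y (m - n - j) j)"
      by (rule sum.reindex_bij_witness[where i = "\<lambda>(n,i,j). (i + j, n - i, i)" and j = "\<lambda>(i,p,i'). (p + i', i', i - i')"])
         (auto simp: add.commute)
    also have "\<dots> = fps_nth (fps_diag x * fps_diag y) m"
      by (simp add: fps_diag_def fps_mult_nth sum_product sum.Sigma sum.cartesian_product)
    finally show "fps_nth (fps_diag (x * y)) m = fps_nth (fps_diag x * fps_diag y) m" .
  qed
qed (auto simp: fps_diag_def fps_eq_iff sum.distrib intro!: sum.neutral)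

subsection \<open>The Taylor shift\<close>

lemma funpow_leibniz:
  fixes D :: "'a::comm_ring_1 \<Rightarrow> 'a"
  assumes D: "Modules.additive D" and leib: "\<And>f g. D (f * g) = D f * g + f * D g"
  shows "(D ^^ n) (f * g) = (\<Sum>i\<le>n. of_nat (n choose i) * ((D ^^ i) f * (D ^^ (n - i)) g))"
proof (induction n)
  case (Suc n)
  note add = additive.add[OF D] and zero = additive.zero[OF D] and sum = additive.sum[OF D]
  have nat: "D (of_nat k * x) = of_nat k * D x" for k x
    by (induction k) (auto simp: algebra_simps add zero)
  let ?t = "\<lambda>i j. (D ^^ i) f * (D ^^ j) g"
  have "(D ^^ Suc n) (f * g) =
      (\<Sum>i\<le>n. of_nat (n choose i) * ?t (Suc i) (n - i)) + (\<Sum>i\<le>n. of_nat (n choose i) * ?t i (Suc n - i))"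
    by (simp add: Suc.IH sum nat sum.distrib[symmetric] del: binomial_Suc_Suc)
       (rule sum.cong, auto simp: nat leib Suc_diff_le distrib_left)
  also have "(\<Sum>i\<le>n. of_nat (n choose i) * ?t (Suc i) (n - i)) =
      (\<Sum>i\<le>Suc n. (if i = 0 then 0 else of_nat (n choose (i - 1)) * ?t i (Suc n - i)))"
    by (subst sum.atMost_Suc_shift) simp
  also have "(\<Sum>i\<le>n. of_nat (n choose i) * ?t i (Suc n - i)) = (\<Sum>i\<le>Suc n. of_nat (n choose i) * ?t i (Suc n - i))"
    by (simp add: binomial_eq_0)
  also have "(\<Sum>i\<le>Suc n. if i = 0 then 0 else of_nat (n choose (i - 1)) * ?t i (Suc n - i)) + \<dots> =
      (\<Sum>i\<le>Suc n. of_nat (Suc n choose i) * ?t i (Suc n - i))"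
    unfolding sum.distrib[symmetric]
  proof (rule sum.cong[OF refl])
    fix i
    show "(if i = 0 then 0 else of_nat (n choose (i - 1)) * ?t i (Suc n - i)) + of_nat (n choose i) * ?t i (Suc n - i) =
        of_nat (Suc n choose i) * ?t i (Suc n - i)"
      by (cases i) (simp_all add: distrib_right)
  qed
  finally show ?case .
qed simp

text \<open>The exponential of a derivation is multiplicative by the Leibniz rule. The scalars
  \<open>c n\<close> stand for t^n / n!; stated through binomial coefficients, their property makes
  sense in a ring without division.\<close>

lemma rhom_exp_derivation:
  fixes D :: "'a::comm_ring_1 \<Rightarrow> 'a"
  assumes D: "Modules.additive D" and leib: "\<And>f g. D (f * g) = D f * g + f * D g"
    and c: "c 0 = 1" "\<And>n i. i \<le> n \<Longrightarrow> c n * of_nat (n choose i) = c i * c (n - i)"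
  shows "rhom (\<lambda>f. Abs_fps (\<lambda>n. c n * (D ^^ n) f))"
proof (rule rhomI)
  have D1: "D 1 = 0" using leib[of 1 1] by simp
  have "(D ^^ Suc n) 1 = 0" for n
    by (induction n) (simp_all add: D1 additive.zero[OF D])
  then have Dn1: "(D ^^ n) 1 = (if n = 0 then 1 else 0)" for n
    by (cases n) simp_all
  have Dn: "(D ^^ n) (x + y) = (D ^^ n) x + (D ^^ n) y" for n x y
    by (induction n) (auto simp: additive.add[OF D])
  show "Abs_fps (\<lambda>n. c n * (D ^^ n) (x + y)) = Abs_fps (\<lambda>n. c n * (D ^^ n) x) + Abs_fps (\<lambda>n. c n * (D ^^ n) y)" for x y
    by (simp add: fps_eq_iff Dn algebra_simps)
  show "Abs_fps (\<lambda>n. c n * (D ^^ n) 1) = 1"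
    by (simp add: fps_eq_iff Dn1 c)
  show "Abs_fps (\<lambda>n. c n * (D ^^ n) (x * y)) = Abs_fps (\<lambda>n. c n * (D ^^ n) x) * Abs_fps (\<lambda>n. c n * (D ^^ n) y)" for x y
  proof -
    have "c n * (D ^^ n) (x * y) = (\<Sum>i\<le>n. c i * (D ^^ i) x * (c (n - i) * (D ^^ (n - i)) y))" for n
    proof -
      have "c n * (D ^^ n) (x * y) = (\<Sum>i\<le>n. c n * of_nat (n choose i) * ((D ^^ i) x * (D ^^ (n - i)) y))"
        by (simp add: funpow_leibniz[OF D leib] sum_distrib_left mult.assoc)
      then show ?thesis by (simp add: c mult_ac)
    qed
    then show ?thesis by (simp add: fps_eq_iff fps_mult_nth atMost_atLeast0)
  qed
qed

lemma binomial_fact_split: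
  fixes b :: complex
  assumes "i \<le> n"
  shows "b ^ n / fact n * of_nat (n choose i) = b ^ i / fact i * (b ^ (n - i) / fact (n - i))"
  using assms by (simp add: binomial_fact field_simps power_add[symmetric])

lemma additive_fls_deriv: "Modules.additive (fls_deriv :: complex fls \<Rightarrow> _)"
  by (auto simp: Modules.additive_def)

lemma funpow_fps_map:
  fixes D :: "'a \<Rightarrow> 'a"
  shows "(fps_map D ^^ n) F = fps_map (D ^^ n) F"
  by (induction n) (auto simp: fps_eq_iff)

text \<open>exp(b h d/du), the shift of u by b h. The variable of the exponential is a second h,
  which \<open>fps_diag\<close> merges with the h of the series.\<close>

definition taylor_h :: "complex \<Rightarrow> complex fls fps \<Rightarrow> complex fls fps" where
  "taylor_h b F = fps_diag (fps_map (\<lambda>f. Abs_fps (\<lambda>n. fls_const (b ^ n / fact n) * (fls_deriv ^^ n) f)) F)"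

text \<open>exp(-v d/du), the shift of u by -v, with v kept as a new outer variable.\<close>

definition taylor_v :: "complex fls fps \<Rightarrow> complex fls fps fps" where
  "taylor_v F = Abs_fps (\<lambda>q. fps_const (fls_const ((- 1) ^ q / fact q)) * (fps_map fls_deriv ^^ q) F)"

lemma fls_const_of_nat: "fls_const (of_nat n) = (of_nat n :: 'a::ring_1 fls)"
  by (induction n) (auto simp: fls_plus_const[symmetric])

lemma fls_binomial_fact_split:
  "i \<le> n \<Longrightarrow> fls_const (b ^ n / fact n) * of_nat (n choose i) =
     fls_const (b ^ i / fact i) * fls_const (b ^ (n - i) / fact (n - i))" for b :: complex
proof -
  assume "i \<le> n"
  have "fls_const (b ^ n / fact n) * of_nat (n choose i) = fls_const (b ^ n / fact n * of_nat (n choose i))"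
    by (subst fls_const_of_nat[symmetric], rule fls_const_mult_const)
  then show ?thesis
    unfolding binomial_fact_split[OF \<open>i \<le> n\<close>] by (simp only: fls_const_mult_const)
qed

lemma rhom_taylor_h: "rhom (taylor_h b)"
  unfolding taylor_h_def[abs_def]
  by (rule rhom_comp[OF rhom_fps_diag], rule rhom_fps_map, rule rhom_exp_derivation)
     (rule additive_fls_deriv, simp add: add.commute, simp, erule fls_binomial_fact_split)

lemma rhom_taylor_v: "rhom taylor_v"
  unfolding taylor_v_def[abs_def]
proof (rule rhom_exp_derivation)
  show "fps_map fls_deriv (f * g) = fps_map fls_deriv f * g + f * fps_map fls_deriv g" for f g :: "complex fls fps"
    by (simp add: fps_eq_iff fps_mult_nth fls_deriv_sum sum.distrib add.commute)
  show "fps_const (fls_const ((-1::complex) ^ n / fact n)) * of_nat (n choose i) =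
      fps_const (fls_const ((-1) ^ i / fact i)) * fps_const (fls_const ((-1) ^ (n - i) / fact (n - i)))"
    if "i \<le> n" for n i
    unfolding fps_of_nat[symmetric] fps_const_mult by (subst fls_binomial_fact_split[OF that]) (rule refl)
qed (auto simp: additive_fps_map additive_fls_deriv)

lemma fls_deriv_funpow_cmult: "(fls_deriv ^^ n) (fls_const c * f) = fls_const c * (fls_deriv ^^ n) f"
  for f :: "complex fls"
  by (induction n) (auto simp: fls_deriv_mult_const_left)

lemma fls_deriv_funpow_sum: "(fls_deriv ^^ n) (sum f S) = (\<Sum>i\<in>S. (fls_deriv ^^ n) (f i :: complex fls))"
  by (induction n) (auto simp: fls_deriv_sum)

text \<open>Since (q + i choose q) / (q + i)! = 1 / (q! i!), the exponential of (b h - v) d/du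
  splits into two factors. Each is a ring homomorphism, hence so is
  \<open>shift_arg\<close>.\<close>

lemma shift_arg_taylor: "shift_arg b F = taylor_v (taylor_h b F)"
proof -
  have choose: "(- 1) ^ q * b ^ i * complex_of_nat ((q + i) choose q) / fact (q + i)
      = (- 1) ^ q / fact q * (b ^ i / fact i)" for q i
    by (simp add: binomial_fact field_simps)
  have "fps_nth (fps_nth (shift_arg b F) q) m = fps_nth (fps_nth (taylor_v (taylor_h b F)) q) m" for q m
    unfolding shift_arg_def taylor_v_def taylor_h_def fps_diag_def
    by (simp add: funpow_fps_map fls_deriv_funpow_sum fls_deriv_funpow_cmult sum_distrib_left
        funpow_add choose del: times_divide_eq_left times_divide_eq_right)
       (simp only: fls_const_mult_const[symmetric] mult.assoc)
  then show ?thesis by (simp add: fps_eq_iff)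
qed

lemma rhom_shift_arg: "rhom (shift_arg b)"
  using rhom_comp[OF rhom_taylor_v rhom_taylor_h] by (simp add: shift_arg_taylor[abs_def])

lemma fls_deriv_funpow_const: "(fls_deriv ^^ n) (fls_const c) = (if n = 0 then fls_const c else 0)" for c :: complex
  by (induction n) auto

lemma shift_arg_const: "shift_arg b (fps_map fls_const c) = fps_const (fps_map fls_const c)"
proof -
  have "fps_nth (fps_nth (shift_arg b (fps_map fls_const c)) q) m = fps_nth (fps_nth (fps_const (fps_map fls_const c)) q) m" for q m
  proof -
    have "fps_nth (fps_nth (shift_arg b (fps_map fls_const c)) q) m =
       (\<Sum>i\<le>m. if i = 0 then (if q = 0 then fls_const (fps_nth c m) else 0) else 0)"
      unfolding shift_arg_def by (simp only: fps_nth_Abs_fps) (rule sum.cong, auto simp: fls_deriv_funpow_const)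
    then show ?thesis by simp
  qed
  then show ?thesis by (simp add: fps_eq_iff)
qed

lemma fls_deriv_funpow_exp:
  "(fls_deriv ^^ n) (fps_to_fls (fps_exp t)) = fls_const (t ^ n) * fps_to_fls (fps_exp (t::complex))"
proof (induction n)
  case (Suc n)
  have "fls_deriv (fps_to_fls (fps_exp t)) = fls_const t * fps_to_fls (fps_exp t)"
    by (simp add: fls_deriv_fps_to_fls fls_times_fps_to_fls)
  then show ?case
    by (simp add: Suc fls_deriv_mult_const_left mult_ac flip: fls_const_mult_const)
qed simp

definition exp_u :: "complex \<Rightarrow> complex fls" where "exp_u t = fps_to_fls (fps_exp t)"
definition exp_h :: "complex \<Rightarrow> complex fls fps" where "exp_h t = fps_map fls_const (fps_exp t)"
definition exp_v :: "complex \<Rightarrow> complex fls fps fps" where "exp_v t = fps_map (\<lambda>c. fps_const (fls_const c)) (fps_exp t)"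

text \<open>The functional equation of the exponential: it turns additive spectral parameters into
  products of one series in u, one in h and one in v.\<close>

lemma shift_arg_exp:
  "shift_arg b (fps_const (exp_u t)) = fps_const (fps_const (exp_u t) * exp_h (t * b)) * exp_v (- t)"
proof -
  have "fps_nth (fps_nth (shift_arg b (fps_const (exp_u t))) q) m =
      fps_nth (fps_nth (fps_const (fps_const (exp_u t) * exp_h (t * b)) * exp_v (- t)) q) m" for q m
  proof -
    have "fps_nth (fps_nth (shift_arg b (fps_const (exp_u t))) q) m =
       (\<Sum>i\<le>m. if i = m then fls_const ((- 1) ^ q * b ^ m * of_nat ((q + m) choose q) / fact (q + m)) * (fls_const (t ^ (q + m)) * exp_u t) else 0)"
      unfolding shift_arg_def exp_u_def
      by (simp only: fps_nth_Abs_fps) (rule sum.cong, auto simp: fls_deriv_funpow_exp fls_deriv_funpow_const[of _ 0, simplified])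
    also have "\<dots> = fls_const ((- 1) ^ q * b ^ m * of_nat ((q + m) choose q) / fact (q + m) * t ^ (q + m)) * exp_u t"
      by (simp add: mult.assoc[symmetric])
    also have "(- 1) ^ q * b ^ m * of_nat ((q + m) choose q) / fact (q + m) * t ^ (q + m) = (t * b) ^ m / fact m * ((- t) ^ q / fact q)"
      by (simp add: binomial_fact field_simps power_add power_mult_distrib) (simp add: power_mult_distrib[symmetric])
    finally show ?thesis
      by (simp only: exp_h_def exp_v_def fls_const_mult_const[symmetric] fps_mult_left_const_nth nth_fps_map fps_exp_nth)
         (simp add: mult_ac)
  qed
  then show ?thesis by (simp add: fps_eq_iff)
qed

text \<open>A shift by a multiple of h is invisible modulo h. This makes the two matrices with
  shifts c/2 and -c/2 agree there.\<close>

lemma shift_arg_nth_0_indep: "fps_nth (fps_nth (shift_arg b F) q) 0 = fps_nth (fps_nth (shift_arg b' F) q) 0"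
  by (simp add: shift_arg_def)

lemma exp_v_mult: "exp_v s * exp_v t = exp_v (s + t)"
proof -
  have "rhom (\<lambda>c::complex. fps_const (fls_const c))"
    by (rule rhom_comp[OF rhom_fps_const rhom_fls_const])
  from rhom_mult[OF rhom_fps_map[OF this]] show ?thesis
    by (simp add: exp_v_def fps_exp_add_mult)
qed

lemma exp_v_0: "exp_v 0 = 1"
  by (auto simp: exp_v_def fps_eq_iff)

subsection \<open>Closed saturated ideals\<close>

text \<open>Agreement below order m is a ball of radius 2^{-m} for the metric of formal power
  series, so topological closedness can be used coefficientwise.\<close>

lemma closed_fps_iff:
  fixes J :: "'a::group_add fps set"
  shows "closed J \<longleftrightarrow> (\<forall>x. (\<forall>m. \<exists>y\<in>J. \<forall>l<m. fps_nth y l = fps_nth x l) \<longrightarrow> x \<in> J)"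
proof -
  have dist: "(\<forall>l<m. fps_nth y l = fps_nth x l) \<longleftrightarrow> dist y x \<le> inverse (2 ^ m)" for x y :: "'a fps" and m
  proof (cases "x = y")
    case False
    then have nz: "y - x \<noteq> 0" by simp
    have "(\<forall>l<m. fps_nth y l = fps_nth x l) \<longleftrightarrow> (\<forall>l<m. fps_nth (y - x) l = 0)" by simp
    also have "\<dots> \<longleftrightarrow> m \<le> subdegree (y - x)"
      using subdegree_geI[OF nz, of m] nth_less_subdegree_zero[of _ "y - x"]
      by (meson order_less_le_trans)
    also have "\<dots> \<longleftrightarrow> dist y x \<le> inverse (2 ^ m)" using False by (auto simp: dist_fps_def)
    finally show ?thesis .
  qed auto
  have "closed J \<longleftrightarrow> (\<forall>x. x \<in> closure J \<longrightarrow> x \<in> J)"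
    using closure_subset[of J] closure_eq[of J] by blast
  also have "(\<lambda>x. x \<in> closure J) = (\<lambda>x. \<forall>m. \<exists>y\<in>J. \<forall>l<m. fps_nth y l = fps_nth x l)"
  proof (rule ext)
    fix x
    show "(x \<in> closure J) = (\<forall>m. \<exists>y\<in>J. \<forall>l<m. fps_nth y l = fps_nth x l)"
      unfolding dist closure_approachable_le
    proof safe
      fix m :: nat assume "\<forall>e>0. \<exists>y\<in>J. dist y x \<le> e"
      then show "\<exists>y\<in>J. dist y x \<le> inverse (2 ^ m)" by simp
    next
      fix e :: real assume *: "\<forall>m. \<exists>y\<in>J. dist y x \<le> inverse (2 ^ m)" and e: "e > 0"
      obtain m where "inverse (2 ^ m) < e"
        using reals_power_lt_ex[OF e, of 2] by (auto simp: power_one_over inverse_eq_divide)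
      with * show "\<exists>y\<in>J. dist y x \<le> e" by (meson less_imp_le order_trans)
    qed
  qed
  finally show ?thesis .
qed

text \<open>The conditions on an ideal in the definition of \<open>rel_ideal\<close>, written as
  closure rules on a type. Carriers and cosets then appear only when the quotient is formed.\<close>

definition hideal :: "'a::ring_1 fps set \<Rightarrow> bool" where
  "hideal J \<longleftrightarrow> 0 \<in> J \<and> (\<forall>x\<in>J. \<forall>y\<in>J. x + y \<in> J) \<and> (\<forall>x\<in>J. \<forall>y. x * y \<in> J \<and> y * x \<in> J) \<and>
     (\<forall>x. (\<forall>m. \<exists>y\<in>J. \<forall>l<m. fps_nth y l = fps_nth x l) \<longrightarrow> x \<in> J) \<and>
     (\<forall>x. fps_X * x \<in> J \<longrightarrow> x \<in> J)"

lemma hidealD: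
  assumes "hideal J"
  shows hideal_zero: "0 \<in> J" and hideal_add: "x \<in> J \<Longrightarrow> y \<in> J \<Longrightarrow> x + y \<in> J"
    and hideal_mult_right: "x \<in> J \<Longrightarrow> x * y \<in> J" and hideal_mult_left: "x \<in> J \<Longrightarrow> y * x \<in> J"
    and hideal_closed: "(\<And>m. \<exists>y\<in>J. \<forall>l<m. fps_nth y l = fps_nth x l) \<Longrightarrow> x \<in> J"
    and hideal_saturated: "fps_X * x \<in> J \<Longrightarrow> x \<in> J"
  using assms unfolding hideal_def by blast+

lemma hideal_uminus: "hideal J \<Longrightarrow> x \<in> J \<Longrightarrow> - x \<in> J"
  using hideal_mult_left[of J x "- 1"] by simp

lemma hideal_diff: "hideal J \<Longrightarrow> x \<in> J \<Longrightarrow> y \<in> J \<Longrightarrow> x - y \<in> J"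
  using hideal_add[of J x "- y"] hideal_uminus[of J y] by simp

lemma hideal_sum: "hideal J \<Longrightarrow> (\<And>i. i \<in> S \<Longrightarrow> f i \<in> J) \<Longrightarrow> sum f S \<in> J"
  by (induction S rule: infinite_finite_induct) (auto intro: hideal_zero hideal_add)

lemma ring_of_type: "ring (ring_of_type_algebra :: 'a::ring_1 ring)"
proof (rule ringI)
  show "abelian_group (ring_of_type_algebra :: 'a ring)"
  proof (rule abelian_groupI)
    show "\<exists>y\<in>carrier ring_of_type_algebra. y \<oplus>\<^bsub>ring_of_type_algebra\<^esub> x = \<zero>\<^bsub>ring_of_type_algebra\<^esub>" for x :: 'a
      by (rule bexI[of _ "- x"]) (simp_all add: ring_of_type_algebra_def)
  qed (simp_all add: ring_of_type_algebra_def add_ac)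
  show "Group.monoid (ring_of_type_algebra :: 'a ring)"
    by (rule Group.monoidI) (simp_all add: ring_of_type_algebra_def mult.assoc)
qed (simp_all add: ring_of_type_algebra_def distrib_left distrib_right)

lemma hideal_iff:
  "hideal J \<longleftrightarrow> ideal J ring_of_type_algebra \<and> closed J \<and> (\<forall>x. fps_X * x \<in> J \<longrightarrow> x \<in> J)"
proof
  assume J: "hideal J"
  have "ideal J ring_of_type_algebra"
  proof (rule idealI[OF ring_of_type])
    have inv: "inv\<^bsub>add_monoid (ring_of_type_algebra :: 'a fps ring)\<^esub> a = - a" for a :: "'a fps"
      by (rule group.inv_equality[OF abelian_group.a_group[OF ring.is_abelian_group[OF ring_of_type]]])
         (simp_all add: ring_of_type_algebra_def)
    show "subgroup J (add_monoid ring_of_type_algebra)"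
    proof (rule subgroup.intro)
      show "inv\<^bsub>add_monoid ring_of_type_algebra\<^esub> x \<in> J" if "x \<in> J" for x
        unfolding inv by (rule hideal_uminus[OF J that])
    qed (simp_all add: ring_of_type_algebra_def hideal_zero[OF J] hideal_add[OF J])
  qed (simp_all add: ring_of_type_algebra_def hideal_mult_left[OF J] hideal_mult_right[OF J])
  moreover have "closed J"
    unfolding closed_fps_iff by (intro allI impI, rule hideal_closed[OF J], erule spec)
  ultimately show "ideal J ring_of_type_algebra \<and> closed J \<and> (\<forall>x. fps_X * x \<in> J \<longrightarrow> x \<in> J)"
    using hideal_saturated[OF J] by iprover
next
  assume *: "ideal J ring_of_type_algebra \<and> closed J \<and> (\<forall>x. fps_X * x \<in> J \<longrightarrow> x \<in> J)"
  then interpret ideal J "ring_of_type_algebra :: 'a fps ring" by simp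
  show "hideal J"
    unfolding hideal_def
  proof (intro conjI ballI allI impI)
    show "0 \<in> J" using additive_subgroup.zero_closed[OF ideal.axioms(1)[OF ideal_axioms]] by (simp add: ring_of_type_algebra_def)
    show "x + y \<in> J" if "x \<in> J" "y \<in> J" for x y
      using additive_subgroup.a_closed[OF ideal.axioms(1)[OF ideal_axioms] that] by (simp add: ring_of_type_algebra_def)
    show "x * y \<in> J" "y * x \<in> J" if "x \<in> J" for x y
      using I_r_closed[OF that, of y] I_l_closed[OF that, of y] by (simp_all add: ring_of_type_algebra_def)
    show "x \<in> J" if "\<forall>m. \<exists>y\<in>J. \<forall>l<m. fps_nth y l = fps_nth x l" for x
      using * that unfolding closed_fps_iff by iprover
    show "x \<in> J" if "fps_X * x \<in> J" for x using * that by iprover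
  qed
qed

subsection \<open>Additive endomorphisms\<close>

text \<open>As elements of a ring, operators can serve as coefficients of matrices and power series,
  and operator identities become ring computations.\<close>

typedef (overloaded) 'a endo = "{f :: 'a::ring_1 \<Rightarrow> 'a. Modules.additive f}"
  morphisms ap Endo
  by (rule exI[of _ "\<lambda>x. x"]) (auto simp: Modules.additive_def)

setup_lifting type_definition_endo

instantiation endo :: (ring_1) ring_1
begin
lift_definition zero_endo :: "'a endo" is "\<lambda>_. 0" by (simp add: Modules.additive_def)
lift_definition one_endo :: "'a endo" is "\<lambda>x. x" by (simp add: Modules.additive_def)
lift_definition plus_endo :: "'a endo \<Rightarrow> 'a endo \<Rightarrow> 'a endo" is "\<lambda>f g x. f x + g x"
  by (simp add: Modules.additive_def add_ac)
lift_definition uminus_endo :: "'a endo \<Rightarrow> 'a endo" is "\<lambda>f x. - f x"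
  by (simp add: Modules.additive_def)
lift_definition minus_endo :: "'a endo \<Rightarrow> 'a endo \<Rightarrow> 'a endo" is "\<lambda>f g x. f x - g x"
  by (simp add: Modules.additive_def)
lift_definition times_endo :: "'a endo \<Rightarrow> 'a endo \<Rightarrow> 'a endo" is "\<lambda>f g x. f (g x)"
  by (simp add: Modules.additive_def)
instance
proof
  show "(0::'a endo) \<noteq> 1"
    by transfer (metis zero_neq_one)
qed (transfer, simp add: Modules.additive_def add_ac fun_eq_iff)+
end

lemma ap_simps [simp]:
  "ap 0 x = 0" "ap 1 x = x" "ap (f + g) x = ap f x + ap g x" "ap (- f) x = - ap f x"
  "ap (f - g) x = ap f x - ap g x" "ap (f * g) x = ap f (ap g x)"
  by (transfer, simp)+

lemma ap_additive: "Modules.additive (ap f)"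
  using ap[of f] by simp

lemma ap_arg [simp]:
  "ap f (x + y) = ap f x + ap f y" "ap f 0 = 0" "ap f (- x) = - ap f x" "ap f (x - y) = ap f x - ap f y"
  using ap_additive[of f] by (auto simp: additive.add additive.zero additive.minus additive.diff)

lemma ap_arg_sum: "ap f (sum g S) = (\<Sum>i\<in>S. ap f (g i))"
  by (rule additive.sum[OF ap_additive])

lemma ap_sum: "ap (sum F S) x = (\<Sum>i\<in>S. ap (F i) x)"
  by (induction S rule: infinite_finite_induct) auto

lemma endo_eqI: "(\<And>x. ap f x = ap g x) \<Longrightarrow> f = g"
  by transfer auto

lemma ap_Endo: "Modules.additive f \<Longrightarrow> ap (Endo f) = f"
  by (simp add: Endo_inverse)

definition mulL :: "'a::ring_1 \<Rightarrow> 'a endo" where "mulL a = Endo (\<lambda>x. a * x)"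

lemma ap_mulL [simp]: "ap (mulL a) x = a * x"
  unfolding mulL_def by (subst ap_Endo) (auto simp: Modules.additive_def distrib_left)

lemma rhom_mulL: "rhom mulL"
  by (rule rhomI; rule endo_eqI) (auto simp: distrib_right mult.assoc)

subsection \<open>Monoid algebras\<close>

definition cst :: "'k::comm_ring_1 \<Rightarrow> ('g::monoid_add \<Rightarrow>\<^sub>0 'k)" where
  "cst c = Poly_Mapping.single 0 c"

lemma poly_mapping_decomp: "p = (\<Sum>w\<in>Poly_Mapping.keys p. Poly_Mapping.single w (Poly_Mapping.lookup p w))"
  by (rule poly_mapping_eqI) (auto simp: lookup_sum lookup_single when_def in_keys_iff sum.delta)

lemma additive_poly_mapping_eq:
  assumes "Modules.additive f" "Modules.additive g"
    "\<And>w c. f (Poly_Mapping.single w c) = g (Poly_Mapping.single w c)"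
  shows "f p = g p"
  by (subst (1 2) poly_mapping_decomp) (simp add: additive.sum[OF assms(1)] additive.sum[OF assms(2)] assms(3))

lemma cst_mult_single: "cst c * Poly_Mapping.single w d = Poly_Mapping.single w (c * d)"
  "Poly_Mapping.single w d * cst c = Poly_Mapping.single w (c * d)"
  by (simp_all add: cst_def mult_single mult.commute)

lemma cst_central: "cst c * p = p * cst c"
  by (rule additive_poly_mapping_eq[where f = "\<lambda>p. cst c * p"])
     (auto simp: Modules.additive_def distrib_left distrib_right cst_mult_single)

lemma rhom_cst: "rhom cst"
  by (rule rhomI) (auto simp: cst_def single_add mult_single)

lemma additive_single: "Modules.additive (Poly_Mapping.single w)"
  by (auto simp: Modules.additive_def single_add)

lemma lookup_pmap: "\<phi> 0 = 0 \<Longrightarrow> Poly_Mapping.lookup (Poly_Mapping.map \<phi> p) w = \<phi> (Poly_Mapping.lookup p w)"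
  by (simp add: Poly_Mapping.map.rep_eq when_def)

lemma pmap_single: "\<phi> 0 = 0 \<Longrightarrow> Poly_Mapping.map \<phi> (Poly_Mapping.single w c) = Poly_Mapping.single w (\<phi> c)"
  by (rule poly_mapping_eqI) (simp add: lookup_pmap lookup_single when_def)

lemma additive_pmap: "Modules.additive \<phi> \<Longrightarrow> Modules.additive (Poly_Mapping.map \<phi>)"
  unfolding Modules.additive_def[of "Poly_Mapping.map \<phi>"]
  by (auto intro!: poly_mapping_eqI simp: lookup_pmap additive.zero additive.add lookup_add)

text \<open>A projection formula: \<open>\<theta>\<close> is linear over the smaller ring embedded
  by \<open>\<phi>\<close>. The typical case extracts a coefficient of u, with constants as the
  smaller ring.\<close>

lemma pmap_proj:
  fixes \<phi> :: "'k::comm_ring_1 \<Rightarrow> 'l::comm_ring_1" and q :: "'g::monoid_add \<Rightarrow>\<^sub>0 'l"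
  assumes \<theta>: "Modules.additive \<theta>" and \<phi>: "Modules.additive \<phi>" and proj: "\<And>a b. \<theta> (\<phi> a * b) = a * \<theta> b"
  shows "Poly_Mapping.map \<theta> (Poly_Mapping.map \<phi> p * q) = p * Poly_Mapping.map \<theta> q"
    and "Poly_Mapping.map \<theta> (q * Poly_Mapping.map \<phi> p) = Poly_Mapping.map \<theta> q * p"
proof -
  note add = additive.add[OF additive_pmap[OF \<theta>]] additive.add[OF additive_pmap[OF \<phi>]]
  note single = pmap_single[of \<theta>, OF additive.zero[OF \<theta>]] pmap_single[of \<phi>, OF additive.zero[OF \<phi>]]
  have p1: "Poly_Mapping.map \<theta> (Poly_Mapping.map \<phi> (Poly_Mapping.single w c) * q) = Poly_Mapping.single w c * Poly_Mapping.map \<theta> q" for w c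
    by (rule additive_poly_mapping_eq[where f = "\<lambda>q. Poly_Mapping.map \<theta> (Poly_Mapping.map \<phi> (Poly_Mapping.single w c) * q)"])
       (auto simp: Modules.additive_def distrib_left add single mult_single proj)
  show "Poly_Mapping.map \<theta> (Poly_Mapping.map \<phi> p * q) = p * Poly_Mapping.map \<theta> q"
    by (rule additive_poly_mapping_eq[where p = p]) (auto simp: Modules.additive_def distrib_right add p1)
  have p2: "Poly_Mapping.map \<theta> (q * Poly_Mapping.map \<phi> (Poly_Mapping.single w c)) = Poly_Mapping.map \<theta> q * Poly_Mapping.single w c" for w c
    by (rule additive_poly_mapping_eq[where f = "\<lambda>q. Poly_Mapping.map \<theta> (q * Poly_Mapping.map \<phi> (Poly_Mapping.single w c))"])
       (auto simp: Modules.additive_def distrib_right add single mult_single proj mult.commute[of _ "\<phi> c"] mult.commute[of _ c])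
  show "Poly_Mapping.map \<theta> (q * Poly_Mapping.map \<phi> p) = Poly_Mapping.map \<theta> q * p"
    by (rule additive_poly_mapping_eq[where p = p]) (auto simp: Modules.additive_def distrib_left add p2)
qed

lemma rhom_pmap:
  fixes \<phi> :: "'k::comm_ring_1 \<Rightarrow> 'l::comm_ring_1"
  assumes \<phi>: "rhom \<phi>"
  shows "rhom (Poly_Mapping.map \<phi> :: ('g::monoid_add \<Rightarrow>\<^sub>0 'k) \<Rightarrow> _)"
proof (rule rhomI)
  let ?m = "Poly_Mapping.map \<phi> :: ('g \<Rightarrow>\<^sub>0 'k) \<Rightarrow> _"
  have add: "?m (x + y) = ?m x + ?m y" for x y
    by (rule additive.add[OF additive_pmap[OF rhom_additive[OF \<phi>]]])
  then show "?m (x + y) = ?m x + ?m y" for x y .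
  have single: "?m (Poly_Mapping.single w c) = Poly_Mapping.single w (\<phi> c)" for w c
    by (rule pmap_single) (rule rhom_zero[OF \<phi>])
  show "?m 1 = 1"
    using single[of 0 1] by (simp add: rhom_one[OF \<phi>])
  have p1: "?m (Poly_Mapping.single w c * q) = ?m (Poly_Mapping.single w c) * ?m q" for w c q
    by (rule additive_poly_mapping_eq[where p = q]) (auto simp: Modules.additive_def distrib_left add single mult_single rhom_mult[OF \<phi>])
  show "?m (x * y) = ?m x * ?m y" for x y
    by (rule additive_poly_mapping_eq[where p = x]) (auto simp: Modules.additive_def distrib_right add p1)
qed

text \<open>The embedding of A \<otimes> K((u)) in A((u)) for the monoid algebra A. The recursion
  for L^- lives in the first space, the statement of the theorem in the second, where infinitely
  many words may occur in one series.\<close>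

definition iota :: "('g \<Rightarrow>\<^sub>0 'k::comm_ring_1 fls) \<Rightarrow> ('g \<Rightarrow>\<^sub>0 'k) fls" where
  "iota p = Abs_fls (\<lambda>r. Poly_Mapping.map (\<lambda>f. fls_nth f r) p)"

lemma additive_fls_nth: "Modules.additive (\<lambda>f :: 'a::ab_group_add fls. fls_nth f r)"
  by (auto simp: Modules.additive_def)

lemma nth_iota: "fls_nth (iota p) r = Poly_Mapping.map (\<lambda>f. fls_nth f r) p"
proof -
  \<comment> \<open>A common lower bound exists because only finitely many words occur in p.\<close>
  define B where "B = Min (insert 0 ((\<lambda>w. fls_subdegree (Poly_Mapping.lookup p w)) ` Poly_Mapping.keys p))"
  have "Poly_Mapping.map (\<lambda>f. fls_nth f k) p = 0" if "k < B" for k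
  proof (rule poly_mapping_eqI)
    fix w
    have "fls_nth (Poly_Mapping.lookup p w) k = 0"
    proof (cases "w \<in> Poly_Mapping.keys p")
      case True
      then have "B \<le> fls_subdegree (Poly_Mapping.lookup p w)" unfolding B_def by (intro Min_le) auto
      with that show ?thesis by simp
    qed (simp add: in_keys_iff)
    then show "Poly_Mapping.lookup (Poly_Mapping.map (\<lambda>f. fls_nth f k) p) w = Poly_Mapping.lookup 0 w"
      by (subst lookup_pmap) auto
  qed
  then show ?thesis unfolding iota_def by (rule nth_Abs_fls_bounded)
qed

lemma rhom_iota: "rhom (iota :: ('g::monoid_add \<Rightarrow>\<^sub>0 'k::comm_ring_1 fls) \<Rightarrow> _)"
proof (rule rhomI)
  let ?i = "iota :: ('g::monoid_add \<Rightarrow>\<^sub>0 'k fls) \<Rightarrow> _"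
  show add: "?i (x + y) = ?i x + ?i y" for x y
    by (simp add: fls_eq_iff nth_iota additive.add[OF additive_pmap[OF additive_fls_nth]])
  have single: "fls_nth (?i (Poly_Mapping.single w f)) r = Poly_Mapping.single w (fls_nth f r)" for w f r
    by (simp add: nth_iota pmap_single)
  show "?i 1 = 1"
    using single[of 0 1] by (simp add: fls_eq_iff)
  have ss: "?i (Poly_Mapping.single w f * Poly_Mapping.single w' g) = ?i (Poly_Mapping.single w f) * ?i (Poly_Mapping.single w' g)" for w f w' g
    unfolding fls_eq_iff
  proof
    fix r
    have "fls_nth (?i (Poly_Mapping.single w f) * ?i (Poly_Mapping.single w' g)) r =
       (\<Sum>i=fls_subdegree f..r - fls_subdegree g. Poly_Mapping.single w (fls_nth f i) * Poly_Mapping.single w' (fls_nth g (r - i)))"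
      by (subst nth_fls_mult[where a = "fls_subdegree f" and b = "fls_subdegree g"]) (auto simp: single)
    also have "\<dots> = Poly_Mapping.single (w + w') (fls_nth (f * g) r)"
      by (simp add: mult_single fls_times_nth(2) additive.sum[OF additive_single])
    finally show "fls_nth (?i (Poly_Mapping.single w f * Poly_Mapping.single w' g)) r =
        fls_nth (?i (Poly_Mapping.single w f) * ?i (Poly_Mapping.single w' g)) r"
      by (simp add: mult_single single)
  qed
  have p1: "?i (Poly_Mapping.single w c * q) = ?i (Poly_Mapping.single w c) * ?i q" for w c q
    by (rule additive_poly_mapping_eq[where p = q]) (auto simp: Modules.additive_def distrib_left add ss)
  show "?i (x * y) = ?i x * ?i y" for x y
    by (rule additive_poly_mapping_eq[where p = x]) (auto simp: Modules.additive_def distrib_right add p1)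
qed

lemma iota_cst: "fls_nth (iota (cst f)) r = cst (fls_nth f r)"
  by (simp add: nth_iota cst_def pmap_single)

subsection \<open>Coefficientwise finite sums\<close>

definition fin_sum :: "('i \<Rightarrow> 'a::ab_group_add) \<Rightarrow> 'a \<Rightarrow> bool" where
  "fin_sum f t \<longleftrightarrow> (\<exists>S. finite S \<and> (\<forall>i. i \<notin> S \<longrightarrow> f i = 0) \<and> sum f S = t)"

text \<open>In each order of h only finitely many terms are nonzero. This is stronger than h-adic
  convergence, is stated without a topology, and passes to closed ideals and to quotients.\<close>

definition fsums :: "('i \<Rightarrow> 'a::ab_group_add fps) \<Rightarrow> 'a fps \<Rightarrow> bool" where
  "fsums f t \<longleftrightarrow> (\<forall>l. fin_sum (\<lambda>i. fps_nth (f i) l) (fps_nth t l))"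

lemma fin_sumI: "finite S \<Longrightarrow> (\<And>i. i \<notin> S \<Longrightarrow> f i = 0) \<Longrightarrow> sum f S = t \<Longrightarrow> fin_sum f t"
  unfolding fin_sum_def by blast

lemma fin_sum_superset:
  assumes "fin_sum f t"
  obtains S where "finite S" "\<And>i. i \<notin> S \<Longrightarrow> f i = 0" "\<And>S'. finite S' \<Longrightarrow> S \<subseteq> S' \<Longrightarrow> sum f S' = t"
proof -
  obtain S where S: "finite S" "\<And>i. i \<notin> S \<Longrightarrow> f i = 0" "sum f S = t"
    using assms unfolding fin_sum_def by blast
  show ?thesis
    by (rule that[of S]) (use S in \<open>auto intro: sum.mono_neutral_right\<close>)
qed

lemma fin_sum_add: "fin_sum f t \<Longrightarrow> fin_sum g u \<Longrightarrow> fin_sum (\<lambda>i. f i + g i) (t + u)"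
proof -
  assume "fin_sum f t" "fin_sum g u"
  then obtain S S' where S: "finite S" "\<And>i. i \<notin> S \<Longrightarrow> f i = 0" "\<And>S'. finite S' \<Longrightarrow> S \<subseteq> S' \<Longrightarrow> sum f S' = t"
    and S': "finite S'" "\<And>i. i \<notin> S' \<Longrightarrow> g i = 0" "\<And>S''. finite S'' \<Longrightarrow> S' \<subseteq> S'' \<Longrightarrow> sum g S'' = u"
    by (metis fin_sum_superset)
  show ?thesis
    by (rule fin_sumI[of "S \<union> S'"]) (auto simp: sum.distrib S S')
qed

lemma fin_sum_zero: "fin_sum (\<lambda>i. 0) 0"
  by (rule fin_sumI[of "{}"]) auto

lemma fin_sum_sum: "(\<And>k. k \<in> K \<Longrightarrow> fin_sum (f k) (t k)) \<Longrightarrow> fin_sum (\<lambda>i. \<Sum>k\<in>K. f k i) (\<Sum>k\<in>K. t k)"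
  by (induction K rule: infinite_finite_induct) (auto intro: fin_sum_zero fin_sum_add)

lemma fin_sum_nested:
  assumes "finite S" "\<And>p q. q \<notin> S \<Longrightarrow> F p q = 0" "\<And>q. q \<in> S \<Longrightarrow> fin_sum (\<lambda>p. F p q) (t q)"
  shows "fin_sum (\<lambda>(p, q). F p q) (\<Sum>q\<in>S. t q)"
proof -
  have "\<forall>q\<in>S. \<exists>P. finite P \<and> (\<forall>p. p \<notin> P \<longrightarrow> F p q = 0) \<and> (\<Sum>p\<in>P. F p q) = t q"
    using assms(3) by (auto simp: fin_sum_def)
  then obtain P where P: "\<And>q. q \<in> S \<Longrightarrow> finite (P q) \<and> (\<forall>p. p \<notin> P q \<longrightarrow> F p q = 0) \<and> (\<Sum>p\<in>P q. F p q) = t q"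
    by metis
  show ?thesis
  proof (rule fin_sumI[of "(\<lambda>(q, p). (p, q)) ` Sigma S P"])
    show "finite ((\<lambda>(q, p). (p, q)) ` Sigma S P)" using assms(1) P by auto
    show "(case i of (p, q) \<Rightarrow> F p q) = 0" if "i \<notin> (\<lambda>(q, p). (p, q)) ` Sigma S P" for i
      using that P assms(2) by (cases i) force
    have "(\<Sum>(p, q)\<in>(\<lambda>(q, p). (p, q)) ` Sigma S P. F p q) = (\<Sum>(q, p)\<in>Sigma S P. F p q)"
      by (subst sum.reindex) (auto simp: inj_on_def intro!: sum.cong)
    also have "\<dots> = (\<Sum>q\<in>S. t q)"
      using assms(1) P by (subst sum.Sigma[symmetric]) auto
    finally show "(\<Sum>(p, q)\<in>(\<lambda>(q, p). (p, q)) ` Sigma S P. F p q) = (\<Sum>q\<in>S. t q)" .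
  qed
qed

lemma fin_sum_fls_mult:
  fixes f g :: "'a::ring fls"
  shows "fin_sum (\<lambda>b. fls_nth f b * fls_nth g (r - b)) (fls_nth (f * g) r)"
  by (rule fin_sumI[of "{fls_subdegree f..r - fls_subdegree g}"]) (auto simp: fls_times_nth(2) not_le)

lemma fin_sum_fls_mult2:
  fixes f g :: "'a::ring fls fls"
  shows "fin_sum (\<lambda>(p, q). fls_nth (fls_nth f q) p * fls_nth (fls_nth g (s - q)) (r - p)) (fls_nth (fls_nth (f * g) s) r)"
proof -
  have "fls_nth (fls_nth (f * g) s) r =
      (\<Sum>q\<in>{fls_subdegree f..s - fls_subdegree g}. fls_nth (fls_nth f q * fls_nth g (s - q)) r)"
    by (simp add: fls_times_nth(2)[of f g] additive.sum[OF additive_fls_nth])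
  then show ?thesis
    by (elim ssubst) (rule fin_sum_nested, auto simp: not_le fin_sum_fls_mult)
qed

lemma fsums_ucoeff_mult:
  fixes x y :: "'a::ring fls fps"
  shows "fsums (\<lambda>b. ucoeff b x * ucoeff (r - b) y) (ucoeff r (x * y))"
  unfolding fsums_def
  by (auto simp: fps_mult_nth additive.sum[OF additive_fls_nth] intro: fin_sum_sum fin_sum_fls_mult)

lemma fsums_ucoeff_mult2:
  fixes x y :: "'a::ring fls fls fps"
  shows "fsums (\<lambda>(p, q). ucoeff p (ucoeff q x) * ucoeff (r - p) (ucoeff (s - q) y)) (ucoeff r (ucoeff s (x * y)))"
  unfolding fsums_def
proof
  fix l
  have "fin_sum (\<lambda>i. \<Sum>k=0..l. (case i of (p, q) \<Rightarrow> fls_nth (fls_nth (fps_nth x k) q) p * fls_nth (fls_nth (fps_nth y (l - k)) (s - q)) (r - p)))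
      (\<Sum>k=0..l. fls_nth (fls_nth (fps_nth x k * fps_nth y (l - k)) s) r)"
    by (intro fin_sum_sum fin_sum_fls_mult2)
  then show "fin_sum (\<lambda>i. fps_nth (case i of (p, q) \<Rightarrow> ucoeff p (ucoeff q x) * ucoeff (r - p) (ucoeff (s - q) y)) l) (fps_nth (ucoeff r (ucoeff s (x * y))) l)"
    by (simp add: fps_mult_nth additive.sum[OF additive_fls_nth] case_prod_unfold)
qed

lemma fsums_finite_index:
  fixes f :: "'k::finite \<Rightarrow> 'i \<Rightarrow> 'a::ab_group_add fps"
  assumes "\<And>k. fsums (f k) (t k)"
  shows "fsums (\<lambda>(k, i). f k i) (\<Sum>k\<in>UNIV. t k)"
  unfolding fsums_def
proof
  fix l
  have "\<forall>k. \<exists>S. finite S \<and> (\<forall>i. i \<notin> S \<longrightarrow> fps_nth (f k i) l = 0) \<and> (\<Sum>i\<in>S. fps_nth (f k i) l) = fps_nth (t k) l"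
    using assms unfolding fsums_def fin_sum_def by blast
  then obtain S where S: "\<And>k. finite (S k) \<and> (\<forall>i. i \<notin> S k \<longrightarrow> fps_nth (f k i) l = 0) \<and> (\<Sum>i\<in>S k. fps_nth (f k i) l) = fps_nth (t k) l"
    by metis
  show "fin_sum (\<lambda>i. fps_nth (case i of (k, i) \<Rightarrow> f k i) l) (fps_nth (\<Sum>k\<in>UNIV. t k) l)"
  proof (rule fin_sumI[of "Sigma UNIV S"])
    show "(\<Sum>i\<in>Sigma UNIV S. fps_nth (case i of (k, i) \<Rightarrow> f k i) l) = fps_nth (sum t UNIV) l"
      using S by (simp add: fps_sum_nth case_prod_unfold sum.Sigma[symmetric, where A = UNIV and B = S, of "\<lambda>k i. fps_nth (f k i) l", unfolded case_prod_unfold])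
  qed (use S in auto)
qed

text \<open>A partial sum over the finite supports of all orders below m lies in J and agrees with t
  below order m; closedness of J gives the limit.\<close>

lemma hideal_fsums:
  assumes J: "hideal J" and f: "fsums f t" "\<And>i. f i \<in> J"
  shows "t \<in> J"
proof (rule hideal_closed[OF J])
  fix m
  have "\<forall>l. \<exists>S. finite S \<and> (\<forall>S'. finite S' \<longrightarrow> S \<subseteq> S' \<longrightarrow> (\<Sum>i\<in>S'. fps_nth (f i) l) = fps_nth t l)"
    using f(1) unfolding fsums_def by (meson fin_sum_superset)
  then obtain S where S: "\<And>l. finite (S l)" "\<And>l S'. finite S' \<Longrightarrow> S l \<subseteq> S' \<Longrightarrow> (\<Sum>i\<in>S'. fps_nth (f i) l) = fps_nth t l"
    by metis
  show "\<exists>y\<in>J. \<forall>l<m. fps_nth y l = fps_nth t l"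
  proof (rule bexI)
    show "sum f (\<Union>l<m. S l) \<in> J" by (rule hideal_sum[OF J]) (rule f(2))
    show "\<forall>l<m. fps_nth (sum f (\<Union>l<m. S l)) l = fps_nth t l"
      unfolding fps_sum_nth by (intro allI impI S(2)) (use S(1) in auto)
  qed
qed

subsection \<open>Linear operators on completed monoid algebras\<close>

definition scE :: "'k::comm_ring_1 fps \<Rightarrow> ('g::monoid_add \<Rightarrow>\<^sub>0 'k) fps" where
  "scE = fps_map cst"

lemma rhom_scE: "rhom scE"
  unfolding scE_def by (rule rhom_fps_map[OF rhom_cst])

lemma scE_central: "scE s * x = x * scE s"
proof -
  have "(\<Sum>i=0..n. cst (fps_nth s i) * fps_nth x (n - i)) = (\<Sum>i=0..n. fps_nth x i * cst (fps_nth s (n - i)))" for n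
    by (rule sum.reindex_bij_witness[where i = "\<lambda>i. n - i" and j = "\<lambda>i. n - i"]) (auto simp: cst_central)
  then show ?thesis by (simp add: fps_eq_iff fps_mult_nth scE_def)
qed

lemma scE_X: "scE fps_X = fps_X"
  by (simp add: scE_def fps_eq_iff rhom_zero[OF rhom_cst] rhom_one[OF rhom_cst])

definition wrd :: "'g \<Rightarrow> ('g::monoid_add \<Rightarrow>\<^sub>0 'k::comm_ring_1) fps" where
  "wrd w = fps_const (Poly_Mapping.single w 1)"

definition lin :: "(('g::monoid_add \<Rightarrow>\<^sub>0 'k::comm_ring_1) fps \<Rightarrow> ('g \<Rightarrow>\<^sub>0 'k) fps) \<Rightarrow> bool" where
  "lin T \<longleftrightarrow> Modules.additive T \<and> (\<forall>s x. T (scE s * x) = scE s * T x)"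

lemma linD:
  assumes "lin T"
  shows lin_additive: "Modules.additive T" and lin_scE: "T (scE s * x) = scE s * T x"
    and lin_add: "T (x + y) = T x + T y" and lin_zero: "T 0 = 0" and lin_diff: "T (x - y) = T x - T y"
    and lin_sum: "T (sum f S) = (\<Sum>i\<in>S. T (f i))"
  using assms by (auto simp: lin_def additive.add additive.zero additive.diff additive.sum)

lemma linI: "(\<And>x y. T (x + y) = T x + T y) \<Longrightarrow> (\<And>s x. T (scE s * x) = scE s * T x) \<Longrightarrow> lin T"
  by (simp add: lin_def Modules.additive_def)

lemma lin_X: "lin T \<Longrightarrow> T (fps_X * x) = fps_X * T x"
  using lin_scE[of T fps_X] by (simp add: scE_X)

lemma fps_head_tail: "x = fps_const (fps_nth x 0) + fps_X * fps_shift 1 x" for x :: "'a::ring_1 fps"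
  by (rule fps_ext) (case_tac n, auto)

text \<open>Linearity over power series in h already implies continuity: from T x = T x_0 + h T x'
  the coefficients of T x vanish one order after the other.\<close>

lemma lin_eq_zero:
  assumes T: "lin T" and w: "\<And>w. T (wrd w) = 0"
  shows "T x = 0"
proof -
  have const: "T (fps_const p) = 0" for p
  proof (rule additive_poly_mapping_eq[where g = "\<lambda>_. 0"])
    show "Modules.additive (\<lambda>p. T (fps_const p))"
      using T by (auto simp: Modules.additive_def lin_add simp flip: fps_const_add)
    show "T (fps_const (Poly_Mapping.single w c)) = 0" for w c
    proof -
      have "fps_const (Poly_Mapping.single w c) = scE (fps_const c) * wrd w"
        by (simp add: scE_def wrd_def fps_map_const rhom_zero[OF rhom_cst] cst_mult_single)
      then show ?thesis by (simp add: lin_scE[OF T] w)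
    qed
  qed (simp add: Modules.additive_def)
  have "fps_nth (T x) l = 0" if "l < m" for l m x
    using that
  proof (induction m arbitrary: l x)
    case (Suc m)
    have "T x = fps_X * T (fps_shift 1 x)"
      by (subst fps_head_tail[of x]) (simp add: lin_add[OF T] const lin_X[OF T])
    then show ?case using Suc by (cases l) auto
  qed simp
  then show ?thesis by (auto simp: fps_eq_iff)
qed

lemma lin_eqI:
  assumes "lin T" "lin T'" "\<And>w. T (wrd w) = T' (wrd w)"
  shows "T x = T' x"
proof -
  have "lin (\<lambda>x. T x - T' x)"
    using assms by (auto intro!: linI simp: lin_add lin_scE right_diff_distrib)
  from lin_eq_zero[OF this, of x] assms(3) show ?thesis by simp
qed

definition lext0 :: "('g \<Rightarrow> ('g::monoid_add \<Rightarrow>\<^sub>0 'k::comm_ring_1) fps) \<Rightarrow> ('g \<Rightarrow>\<^sub>0 'k) \<Rightarrow> ('g \<Rightarrow>\<^sub>0 'k) fps" where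
  "lext0 f p = (\<Sum>w\<in>Poly_Mapping.keys p. fps_const (cst (Poly_Mapping.lookup p w)) * f w)"

text \<open>The values on words are themselves series in h, so extending coefficient by coefficient
  yields a series of series; its two variables h are then identified.\<close>

definition lext :: "('g \<Rightarrow> ('g::monoid_add \<Rightarrow>\<^sub>0 'k::comm_ring_1) fps) \<Rightarrow> ('g \<Rightarrow>\<^sub>0 'k) fps \<Rightarrow> ('g \<Rightarrow>\<^sub>0 'k) fps" where
  "lext f x = fps_diag (fps_map (lext0 f) x)"

lemma lext0_superset:
  "finite S \<Longrightarrow> Poly_Mapping.keys p \<subseteq> S \<Longrightarrow> lext0 f p = (\<Sum>w\<in>S. fps_const (cst (Poly_Mapping.lookup p w)) * f w)"
  unfolding lext0_def by (rule sum.mono_neutral_left) (auto simp: in_keys_iff rhom_zero[OF rhom_cst])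

lemma additive_lext0: "Modules.additive (lext0 (f :: 'g::monoid_add \<Rightarrow> ('g \<Rightarrow>\<^sub>0 'k::comm_ring_1) fps))"
  unfolding Modules.additive_def
proof (intro allI)
  fix x y :: "'g \<Rightarrow>\<^sub>0 'k"
  let ?S = "Poly_Mapping.keys x \<union> Poly_Mapping.keys y"
  have "lext0 f (x + y) = (\<Sum>w\<in>?S. fps_const (cst (Poly_Mapping.lookup (x + y) w)) * f w)"
    by (rule lext0_superset) (auto simp: keys_add[THEN subsetD] dest: keys_add[THEN subsetD])
  also have "\<dots> = lext0 f x + lext0 f y"
    by (simp add: lext0_superset[of ?S x] lext0_superset[of ?S y] lookup_add rhom_add[OF rhom_cst]
        fps_const_add[symmetric] distrib_right sum.distrib del: fps_const_add)
  finally show "lext0 f (x + y) = lext0 f x + lext0 f y" .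
qed

lemma lext0_single: "lext0 f (Poly_Mapping.single w c) = fps_const (cst c) * f w"
  by (subst lext0_superset[of "{w}"]) auto

lemma lext0_cst: "lext0 f (cst c * p) = fps_const (cst c) * lext0 f p"
  by (rule additive_poly_mapping_eq[where p = p])
     (auto simp: Modules.additive_def distrib_left additive.add[OF additive_lext0] cst_mult_single lext0_single
        rhom_mult[OF rhom_cst] mult.assoc[symmetric])

lemma fps_diag_const: "fps_diag (fps_const z) = z"
proof -
  have "(\<Sum>i\<le>m. fps_nth (fps_nth (fps_const z) (m - i)) i) = (\<Sum>i\<le>m. if i = m then fps_nth z i else 0)" for m
    by (rule sum.cong) auto
  then show ?thesis by (simp add: fps_diag_def fps_eq_iff)
qed

lemma fps_diag_map_const: "fps_diag (fps_map fps_const z) = z"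
proof -
  have "(\<Sum>i\<le>m. fps_nth (fps_const (fps_nth z (m - i))) i) = (\<Sum>i\<le>m. if i = 0 then fps_nth z m else 0)" for m
    by (rule sum.cong) auto
  then show ?thesis by (simp add: fps_diag_def fps_eq_iff)
qed

lemma lin_lext: "lin (lext f)"
proof (rule linI)
  show "lext f (x + y) = lext f x + lext f y" for x y
    by (simp add: lext_def additive.add[OF additive_fps_map[OF additive_lext0]] rhom_add[OF rhom_fps_diag])
  fix s x
  have "fps_map (lext0 f) (scE s * x) = fps_map fps_const (scE s) * fps_map (lext0 f) x"
    by (simp add: fps_eq_iff fps_mult_nth additive.sum[OF additive_lext0] scE_def lext0_cst)
  then show "lext f (scE s * x) = scE s * lext f x"
    by (simp add: lext_def rhom_mult[OF rhom_fps_diag] fps_diag_map_const)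
qed

lemma lext_wrd: "lext f (wrd w) = f w"
  by (simp add: lext_def wrd_def fps_map_const additive.zero[OF additive_lext0] lext0_single fps_diag_const rhom_one[OF rhom_cst])

lemma fps_map_diag: "Modules.additive \<theta> \<Longrightarrow> fps_map \<theta> (fps_diag z) = fps_diag (fps_map (fps_map \<theta>) z)"
  by (simp add: fps_diag_def fps_eq_iff additive.sum)

text \<open>Here \<open>\<phi>\<close> enlarges the coefficient ring and \<open>\<theta>\<close>
  extracts a coefficient. An operator whose values on words come from the smaller ring commutes with
  the extraction.\<close>

lemma lext_proj:
  fixes \<phi> :: "'k::comm_ring_1 \<Rightarrow> 'l::comm_ring_1"
  assumes \<theta>: "Modules.additive \<theta>" and \<phi>: "Modules.additive \<phi>" and proj: "\<And>a b. \<theta> (\<phi> a * b) = a * \<theta> b"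
  shows "fps_map (Poly_Mapping.map \<theta>) (lext (\<lambda>w. fps_map (Poly_Mapping.map \<phi>) (f w)) x) = lext f (fps_map (Poly_Mapping.map \<theta>) x)"
proof -
  note add = additive.add[OF additive_fps_map[OF additive_pmap[OF \<theta>]]] additive.add[OF additive_pmap[OF \<theta>]] additive.add[OF additive_lext0]
  have "fps_map (Poly_Mapping.map \<theta>) (lext0 (\<lambda>w. fps_map (Poly_Mapping.map \<phi>) (f w)) p) = lext0 f (Poly_Mapping.map \<theta> p)" for p
  proof (rule additive_poly_mapping_eq[where p = p])
    fix w c
    show "fps_map (Poly_Mapping.map \<theta>) (lext0 (\<lambda>w. fps_map (Poly_Mapping.map \<phi>) (f w)) (Poly_Mapping.single w c)) =
        lext0 f (Poly_Mapping.map \<theta> (Poly_Mapping.single w c))"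
      by (simp add: lext0_single pmap_single additive.zero[OF \<theta>] fps_eq_iff pmap_proj[OF assms] cst_def)
  qed (auto simp: Modules.additive_def add)
  then show ?thesis
    by (simp add: lext_def fps_map_diag additive_pmap[OF \<theta>] fps_map_comp)
qed

abbreviation ucf :: "int \<Rightarrow> ('g \<Rightarrow>\<^sub>0 'k::comm_ring_1 fls) fps \<Rightarrow> ('g \<Rightarrow>\<^sub>0 'k) fps" where
  "ucf r \<equiv> fps_map (Poly_Mapping.map (\<lambda>f. fls_nth f r))"

abbreviation cemb :: "('g \<Rightarrow>\<^sub>0 'k::comm_ring_1) fps \<Rightarrow> ('g \<Rightarrow>\<^sub>0 'k fls) fps" where
  "cemb \<equiv> fps_map (Poly_Mapping.map fls_const)"

lemma ucoeff_iota: "ucoeff r (fps_map iota z) = ucf r z"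
  by (simp add: fps_eq_iff nth_iota)

lemma additive_ucf: "Modules.additive (ucf r)"
  by (intro additive_fps_map additive_pmap additive_fls_nth)

lemma rhom_cemb: "rhom (cemb :: ('g::monoid_add \<Rightarrow>\<^sub>0 'k::comm_ring_1) fps \<Rightarrow> _)"
  by (intro rhom_fps_map rhom_pmap rhom_fls_const)

lemma fls_nth_const_mult: "fls_nth (fls_const a * f) r = a * fls_nth f r" "fls_nth (f * fls_const a) r = fls_nth f r * a"
  for a :: "'a::ring_1"
proof -
  have "fls_nth (fls_const a * f) r = (\<Sum>i=0..r - min r (fls_subdegree f). fls_nth (fls_const a) i * fls_nth f (r - i))"
    by (rule nth_fls_mult) auto
  also have "\<dots> = (\<Sum>i=0..r - min r (fls_subdegree f). if i = 0 then a * fls_nth f r else 0)"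
    by (rule sum.cong) auto
  finally show "fls_nth (fls_const a * f) r = a * fls_nth f r" by simp
  have "fls_nth (f * fls_const a) r = (\<Sum>i=min r (fls_subdegree f)..r - 0. fls_nth f i * fls_nth (fls_const a) (r - i))"
    by (rule nth_fls_mult) auto
  also have "\<dots> = (\<Sum>i=min r (fls_subdegree f)..r - 0. if i = r then fls_nth f r * a else 0)"
    by (rule sum.cong) auto
  finally show "fls_nth (f * fls_const a) r = fls_nth f r * a" by simp
qed

lemma ucf_cemb_mult:
  "ucf r (cemb x * z) = x * ucf r z" "ucf r (z * cemb x) = ucf r z * x"
  by (simp_all add: fps_eq_iff fps_mult_nth additive.sum[OF additive_pmap[OF additive_fls_nth]]
      pmap_proj[OF additive_fls_nth rhom_additive[OF rhom_fls_const] fls_nth_const_mult(1)])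

lemma ucf_cemb: "ucf r (cemb x) = (if r = 0 then x else 0)"
proof -
  have "Poly_Mapping.map (\<lambda>f. fls_nth f r) (Poly_Mapping.map fls_const p) = (if r = 0 then p else 0)" for p :: "'a \<Rightarrow>\<^sub>0 'b"
    by (rule poly_mapping_eqI) (auto simp: lookup_pmap)
  then show ?thesis by (auto simp: fps_eq_iff)
qed

lemma ucf_scE: "ucf b (scE s) = scE (ucoeff b s)"
  by (simp add: fps_eq_iff scE_def cst_def pmap_single)

lemma fsums_scE_mult: "fsums (\<lambda>b. scE (ucoeff b s) * ucf (r - b) z) (ucf r (scE s * z))"
  using fsums_ucoeff_mult[where x = "fps_map iota (scE s)" and y = "fps_map iota z" and r = r]
  by (simp add: ucoeff_iota ucf_scE flip: rhom_mult[OF rhom_fps_map[OF rhom_iota]])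

lemma fsums_scE_mult2:
  "fsums (\<lambda>(p, q). scE (ucoeff p (ucoeff q s)) * ucf (r - p) (ucf (t - q) z)) (ucf r (ucf t (scE s * z)))"
proof -
  have 1: "ucoeff p (ucoeff q (fps_map (fls_map iota) (fps_map iota z))) = ucf p (ucf q z)" for p q and z :: "('g::monoid_add \<Rightarrow>\<^sub>0 'b::comm_ring_1 fls fls) fps"
    by (simp add: fps_eq_iff nth_fls_map rhom_zero[OF rhom_iota] nth_iota)
  show ?thesis
    using fsums_ucoeff_mult2[where x = "fps_map (fls_map iota) (fps_map iota (scE s))" and y = "fps_map (fls_map iota) (fps_map iota z)" and r = r and s = t]
    by (simp add: 1 ucf_scE flip: rhom_mult[OF rhom_fps_map[OF rhom_iota]] rhom_mult[OF rhom_fps_map[OF rhom_fls_map[OF rhom_iota]]])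
qed

text \<open>This is what makes Laurent-valued operators composable: the coefficients of z and those
  of T on constants are convolved. On a single word it is the Cauchy product of Laurent series, and
  each order of z is a finite combination of words.\<close>

lemma fsums_lin_ucf:
  fixes T :: "('g::monoid_add \<Rightarrow>\<^sub>0 'k::comm_ring_1 fls) fps \<Rightarrow> _"
  assumes T: "lin T"
  shows "fsums (\<lambda>b. ucf (r - b) (T (cemb (ucf b z)))) (ucf r (T z))"
proof -
  define f where "f w = T (wrd w)" for w
  have Tf: "T x = lext f x" for x
    by (rule lin_eqI[OF T lin_lext]) (simp add: f_def lext_wrd)
  let ?n = "\<lambda>b. Poly_Mapping.map (\<lambda>f::'k fls. fls_nth f b) :: ('g \<Rightarrow>\<^sub>0 _) \<Rightarrow> _"
  let ?c = "Poly_Mapping.map fls_const :: ('g \<Rightarrow>\<^sub>0 'k) \<Rightarrow> _"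
  have single: "fin_sum (\<lambda>b. ?n (r - b) (fps_nth (lext0 f (?c (?n b (Poly_Mapping.single w c)))) j)) (?n r (fps_nth (lext0 f (Poly_Mapping.single w c)) j))" for w c j
  proof -
    have 1: "?n (r - b) (fps_nth (lext0 f (?c (?n b (Poly_Mapping.single w c)))) j) = fls_nth (iota (cst c)) b * fls_nth (iota (fps_nth (f w) j)) (r - b)" for b
    proof -
      have "?n (r - b) (?c (cst (fls_nth c b)) * fps_nth (f w) j) = cst (fls_nth c b) * ?n (r - b) (fps_nth (f w) j)"
        by (rule pmap_proj[OF additive_fls_nth rhom_additive[OF rhom_fls_const] fls_nth_const_mult(1)])
      then show ?thesis
        by (simp add: pmap_single lext0_single iota_cst nth_iota cst_def)
    qed
    have 2: "?n r (fps_nth (lext0 f (Poly_Mapping.single w c)) j) = fls_nth (iota (cst c) * iota (fps_nth (f w) j)) r"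
      by (simp add: lext0_single nth_iota flip: rhom_mult[OF rhom_iota])
    show ?thesis unfolding 1 2 by (rule fin_sum_fls_mult)
  qed
  note add = additive.sum[OF additive_pmap[OF additive_fls_nth]] additive.sum[OF additive_lext0]
     additive.sum[OF additive_pmap[OF rhom_additive[OF rhom_fls_const]]]
  have fa: "fin_sum (\<lambda>b. ?n (r - b) (fps_nth (lext0 f (?c (?n b p))) j)) (?n r (fps_nth (lext0 f p) j))" for p j
    by (subst (1 2) poly_mapping_decomp[of p]) (simp only: add fps_sum_nth, rule fin_sum_sum, rule single)
  show ?thesis
    unfolding fsums_def Tf
    by (auto simp: lext_def fps_diag_def add intro!: fin_sum_sum fa)
qed

subsection \<open>Operators on tensor legs\<close>

text \<open>Vectors in tensor powers of \<open>\<complex>\<^sup>N\<close> are functions of a multi-index with infinitely many legs, so that the operators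
  do not depend on the number of tensor factors.\<close>

definition l2 :: "nat \<Rightarrow> nat \<Rightarrow> ('e::ring_1 endo, 'n::finite) mat2 \<Rightarrow> ((nat \<Rightarrow> 'n) \<Rightarrow> 'e) endo" where
  "l2 r s A = Endo (\<lambda>\<psi> x. \<Sum>p\<in>UNIV. ap (A $ (x r, x s) $ p) (\<psi> (x(r := fst p, s := snd p))))"

definition l1 :: "nat \<Rightarrow> 'e::ring_1 endo ^ 'n::finite ^ 'n \<Rightarrow> ((nat \<Rightarrow> 'n) \<Rightarrow> 'e) endo" where
  "l1 r A = Endo (\<lambda>\<psi> x. \<Sum>a\<in>UNIV. ap (A $ x r $ a) (\<psi> (x(r := a))))"

definition zs :: "'e::ring_1 endo \<Rightarrow> ((nat \<Rightarrow> 'n) \<Rightarrow> 'e) endo" where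
  "zs c = Endo (\<lambda>\<psi> x. ap c (\<psi> x))"

text \<open>The matrix unit with entry 1 at \<open>(c, a)\<close>, on leg \<open>k\<close>.\<close>

definition eu :: "nat \<Rightarrow> 'n \<Rightarrow> 'n \<Rightarrow> ((nat \<Rightarrow> 'n) \<Rightarrow> 'e::ring_1) endo" where
  "eu k c a = Endo (\<lambda>\<psi> x. if x k = c then \<psi> (x(k := a)) else 0)"

definition t1 :: "'a::zero ^ 'n::finite ^ 'n \<Rightarrow> ('a, 'n) mat2" where
  "t1 A = (\<chi> x y. if snd x = snd y then A $ fst x $ fst y else 0)"

definition t2 :: "'a::zero ^ 'n::finite ^ 'n \<Rightarrow> ('a, 'n) mat2" where
  "t2 A = (\<chi> x y. if fst x = fst y then A $ snd x $ snd y else 0)"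

lemma ap_l2: "ap (l2 r s A) \<psi> x = (\<Sum>p\<in>UNIV. ap (A $ (x r, x s) $ p) (\<psi> (x(r := fst p, s := snd p))))"
  unfolding l2_def by (subst ap_Endo) (auto simp: Modules.additive_def fun_eq_iff sum.distrib)

lemma ap_l1: "ap (l1 r A) \<psi> x = (\<Sum>a\<in>UNIV. ap (A $ x r $ a) (\<psi> (x(r := a))))"
  unfolding l1_def by (subst ap_Endo) (auto simp: Modules.additive_def fun_eq_iff sum.distrib)

lemma ap_zs: "ap (zs c) \<psi> x = ap c (\<psi> x)"
  unfolding zs_def by (subst ap_Endo) (auto simp: Modules.additive_def fun_eq_iff)

lemma ap_eu: "ap (eu k c a) \<psi> x = (if x k = c then \<psi> (x(k := a)) else 0)"
  unfolding eu_def by (subst ap_Endo) (auto simp: Modules.additive_def fun_eq_iff)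

lemma op_eqI: "(\<And>\<psi> x. ap f \<psi> x = ap g \<psi> x) \<Longrightarrow> f = g" for f g :: "('x \<Rightarrow> 'e::ring_1) endo"
  by (rule endo_eqI) auto

lemma sum_pairs: "(\<Sum>p\<in>(UNIV :: ('a::finite \<times> 'b::finite) set). f p) = (\<Sum>a\<in>UNIV. \<Sum>b\<in>UNIV. f (a, b))"
  by (simp add: sum.cartesian_product UNIV_Times_UNIV[symmetric] del: UNIV_Times_UNIV)

lemma sum_fun_apply: "(sum f S) x = (\<Sum>i\<in>S. f i x)"
  by (induction S rule: infinite_finite_induct) auto

lemma sum_rot: "(\<Sum>a\<in>A. \<Sum>b\<in>B. \<Sum>c\<in>C. f a b c) = (\<Sum>c\<in>C. \<Sum>a\<in>A. \<Sum>b\<in>B. f a b c)"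
proof -
  have "(\<Sum>a\<in>A. \<Sum>b\<in>B. \<Sum>c\<in>C. f a b c) = (\<Sum>a\<in>A. \<Sum>c\<in>C. \<Sum>b\<in>B. f a b c)"
    by (intro sum.cong refl) (rule sum.swap)
  also have "\<dots> = (\<Sum>c\<in>C. \<Sum>a\<in>A. \<Sum>b\<in>B. f a b c)" by (rule sum.swap)
  finally show ?thesis .
qed

lemma ap_commute: "f * g = g * f \<Longrightarrow> ap f (ap g x) = ap g (ap f x)"
  by (metis ap_simps(6))

lemma rhom_zs: "rhom zs"
  by (rule rhomI; rule op_eqI) (auto simp: ap_zs)

lemma l2_mult: "r \<noteq> s \<Longrightarrow> l2 r s A * l2 r s B = l2 r s (A ** B)"
proof (rule op_eqI)
  assume rs: "r \<noteq> s"
  fix \<psi> and x :: "nat \<Rightarrow> 'a"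
  have upd: "x(r := a, s := b, r := c, s := d) = x(r := c, s := d)" for a b c d
    using rs by (auto simp: fun_eq_iff)
  have "ap (l2 r s A * l2 r s B) \<psi> x =
      (\<Sum>p\<in>UNIV. \<Sum>q\<in>UNIV. ap (A $ (x r, x s) $ p) (ap (B $ p $ q) (\<psi> (x(r := fst q, s := snd q)))))"
    using rs by (simp add: ap_l2 ap_arg_sum upd)
  also have "\<dots> = ap (l2 r s (A ** B)) \<psi> x"
    by (subst sum.swap) (simp add: ap_l2 nth_matrix_mult ap_sum)
  finally show "ap (l2 r s A * l2 r s B) \<psi> x = ap (l2 r s (A ** B)) \<psi> x" .
qed

lemma l2_diff: "l2 r s (A - B) = l2 r s A - l2 r s B"
  by (rule op_eqI) (simp add: ap_l2 sum_subtractf)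

lemma l2_zs: "l2 r s (map_matrix (\<lambda>a. c * a) A) = zs c * l2 r s A"
  by (rule op_eqI) (simp add: ap_l2 ap_zs ap_arg_sum)

lemma l2_one: "l2 r s (mat 1 :: ('e::ring_1 endo, 'n::finite) mat2) = 1"
proof (rule op_eqI)
  fix \<psi> :: "(nat \<Rightarrow> 'n) \<Rightarrow> 'e" and x
  have "ap (l2 r s (mat 1)) \<psi> x = (\<Sum>p\<in>UNIV. if p = (x r, x s) then \<psi> (x(r := fst p, s := snd p)) else 0)"
    unfolding ap_l2 by (rule sum.cong) (auto simp: mat_def)
  then show "ap (l2 r s (mat 1)) \<psi> x = ap 1 \<psi> x" by simp
qed

lemma l2_t1: "r \<noteq> s \<Longrightarrow> l2 r s (t1 A) = l1 r A"
proof (rule op_eqI)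
  fix \<psi> x
  assume rs: "r \<noteq> s"
  have "ap (l2 r s (t1 A)) \<psi> x = (\<Sum>a\<in>UNIV. \<Sum>b\<in>UNIV. if b = x s then ap (A $ x r $ a) (\<psi> (x(r := a, s := b))) else 0)"
    unfolding ap_l2 sum_pairs by (intro sum.cong) (auto simp: t1_def)
  also have "\<dots> = ap (l1 r A) \<psi> x"
    using rs by (simp add: ap_l1 fun_upd_twist[of r s])
  finally show "ap (l2 r s (t1 A)) \<psi> x = ap (l1 r A) \<psi> x" .
qed

lemma nth_flip: "flip A $ x $ y = A $ prod.swap x $ prod.swap y"
proof -
  have "(Pm ** A) $ x $ y = A $ prod.swap x $ y" for x y
    by (simp add: nth_matrix_mult Pm_def if_distrib[of "\<lambda>t. t * _"] cong: if_cong)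
  moreover have "(B ** Pm) $ x $ y = B $ x $ prod.swap y" for x y and B :: "('a, 'b) mat2"
  proof -
    have "(B ** Pm) $ x $ y = (\<Sum>k\<in>UNIV. if k = prod.swap y then B $ x $ k else 0)"
      unfolding nth_matrix_mult by (rule sum.cong) (auto simp: Pm_def)
    then show ?thesis by simp
  qed
  ultimately show ?thesis by (simp add: flip_def)
qed

lemma nth_mult_Pm: "(B ** Pm) $ x $ y = B $ x $ prod.swap y"
proof -
  have "(B ** Pm) $ x $ y = (\<Sum>k\<in>UNIV. if k = prod.swap y then B $ x $ k else 0)"
    unfolding nth_matrix_mult by (rule sum.cong) (auto simp: Pm_def)
  then show ?thesis by simp
qed

lemma nth_Pm_mult: "(Pm ** A) $ x $ y = A $ prod.swap x $ y"
  by (simp add: nth_matrix_mult Pm_def if_distrib[of "\<lambda>t. t * _"] cong: if_cong)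

lemma Pm_Pm: "Pm ** Pm = mat 1"
  by (simp add: vec_eq_iff nth_Pm_mult) (auto simp: Pm_def mat_def)

lemma sum_swap_UNIV: "(\<Sum>p\<in>UNIV. f (prod.swap p)) = (\<Sum>p\<in>(UNIV :: ('a::finite \<times> 'b::finite) set). f p)"
  by (rule sum.reindex_bij_witness[where i = prod.swap and j = prod.swap]) auto

lemma l2_flip: "r \<noteq> s \<Longrightarrow> l2 s r (flip A) = l2 r s A"
proof (rule op_eqI)
  fix \<psi> x
  assume rs: "r \<noteq> s"
  have "ap (l2 s r (flip A)) \<psi> x = (\<Sum>p\<in>UNIV. ap (A $ (x r, x s) $ prod.swap p) (\<psi> (x(r := snd p, s := fst p))))"
    using rs by (simp add: ap_l2 nth_flip fun_upd_twist[of r s])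
  also have "\<dots> = ap (l2 r s A) \<psi> x"
    unfolding ap_l2 by (subst sum_swap_UNIV[symmetric]) simp
  finally show "ap (l2 s r (flip A)) \<psi> x = ap (l2 r s A) \<psi> x" .
qed

lemma flip_t1: "flip (t1 A) = t2 A"
  by (auto simp: vec_eq_iff nth_flip t1_def t2_def)

lemma flip_flip: "flip (flip A) = A"
  by (simp add: vec_eq_iff nth_flip)

lemma l2_t2: "r \<noteq> s \<Longrightarrow> l2 r s (t2 A) = l1 s A"
  using l2_flip[of s r "t1 A"] by (simp add: flip_t1 l2_t1)

lemma l2_l2_commute:
  assumes legs: "r \<noteq> t" "r \<noteq> u" "s \<noteq> t" "s \<noteq> u"
    and comm: "\<And>x y x' y'. A $ x $ y * B $ x' $ y' = B $ x' $ y' * A $ x $ y"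
  shows "l2 r s A * l2 t u B = l2 t u B * l2 r s A"
proof (rule op_eqI)
  fix \<psi> and x :: "nat \<Rightarrow> 'a"
  have upd: "x(r := a, s := b, t := c, u := d) = x(t := c, u := d, r := a, s := b)" for a b c d
    using legs by (auto simp: fun_eq_iff)
  have "ap (l2 r s A * l2 t u B) \<psi> x = (\<Sum>p\<in>UNIV. \<Sum>q\<in>UNIV. ap (A $ (x r, x s) $ p) (ap (B $ (x t, x u) $ q)
       (\<psi> (x(t := fst q, u := snd q, r := fst p, s := snd p)))))"
    using legs by (simp add: ap_l2 ap_arg_sum upd)
  also have "\<dots> = (\<Sum>q\<in>UNIV. \<Sum>p\<in>UNIV. ap (B $ (x t, x u) $ q) (ap (A $ (x r, x s) $ p)
       (\<psi> (x(t := fst q, u := snd q, r := fst p, s := snd p)))))"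
    by (subst sum.swap) (simp add: ap_commute[OF comm])
  also have "\<dots> = ap (l2 t u B * l2 r s A) \<psi> x"
    using legs by (simp add: ap_l2 ap_arg_sum)
  finally show "ap (l2 r s A * l2 t u B) \<psi> x = ap (l2 t u B * l2 r s A) \<psi> x" .
qed

lemma ex_fresh_leg: "\<exists>v::nat. v \<noteq> r \<and> v \<noteq> s \<and> v \<noteq> t"
  by (rule exI[of _ "Suc (r + s + t)"]) auto

lemma l1_l2_commute:
  assumes legs: "r \<noteq> t" "r \<noteq> u"
    and comm: "\<And>x y x' y'. A $ x $ y * B $ x' $ y' = B $ x' $ y' * A $ x $ y"
  shows "l1 r A * l2 t u B = l2 t u B * l1 r A"
proof -
  \<comment> \<open>A one-leg operator is a two-leg operator that is trivial on a fresh leg.\<close>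
  obtain v where v: "v \<noteq> r" "v \<noteq> t" "v \<noteq> u" using ex_fresh_leg by metis
  have "l2 r v (t1 A) * l2 t u B = l2 t u B * l2 r v (t1 A)"
    by (rule l2_l2_commute) (use legs v comm in \<open>auto simp: t1_def\<close>)
  then show ?thesis using v by (simp add: l2_t1)
qed

lemma zs_l2_commute:
  assumes "\<And>x y. c * A $ x $ y = A $ x $ y * c"
  shows "zs c * l2 r s A = l2 r s A * zs c"
  by (rule op_eqI) (simp add: ap_l2 ap_zs ap_arg_sum ap_commute[OF assms])

lemma zs_l1_commute:
  assumes "\<And>x y. c * A $ x $ y = A $ x $ y * c"
  shows "zs c * l1 r A = l1 r A * zs c"
  by (rule op_eqI) (simp add: ap_l1 ap_zs ap_arg_sum ap_commute[OF assms])

lemma eu_l2_commute: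
  assumes "k \<noteq> r" "k \<noteq> s"
  shows "eu k a b * l2 r s A = l2 r s A * eu k a b"
  using assms by (intro op_eqI) (simp add: ap_eu ap_l2 fun_upd_twist[of k])

lemma eu_l1_commute:
  assumes "k \<noteq> r"
  shows "eu k a b * l1 r A = l1 r A * eu k a b"
  using assms by (intro op_eqI) (simp add: ap_eu ap_l1 fun_upd_twist[of k])

lemma ap_l2_Pm: "i \<noteq> j \<Longrightarrow> ap (l2 i j Pm) \<psi> x = \<psi> (x \<circ> Transposition.transpose i j)"
proof -
  assume ij: "i \<noteq> j"
  have "ap (l2 i j Pm) \<psi> x = (\<Sum>p\<in>UNIV. if p = prod.swap (x i, x j) then \<psi> (x(i := fst p, j := snd p)) else 0)"
    unfolding ap_l2 by (rule sum.cong) (auto simp: Pm_def)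
  also have "\<dots> = \<psi> (x(i := x j, j := x i))" by simp
  also have "x(i := x j, j := x i) = x \<circ> Transposition.transpose i j"
    using ij by (auto simp: fun_eq_iff Transposition.transpose_def)
  finally show ?thesis .
qed

lemma Pm_conj:
  assumes "i \<noteq> j"
  shows "l2 i j Pm * l2 k l A = l2 (Transposition.transpose i j k) (Transposition.transpose i j l) A * l2 i j Pm"
proof (rule op_eqI)
  fix \<psi> and x :: "nat \<Rightarrow> 'a"
  have "(x \<circ> Transposition.transpose i j)(k := a, l := b) = x(Transposition.transpose i j k := a, Transposition.transpose i j l := b) \<circ> Transposition.transpose i j" for a b
    by (auto simp: fun_eq_iff Transposition.transpose_def)
  then show "ap (l2 i j Pm * l2 k l A) \<psi> x = ap (l2 (Transposition.transpose i j k) (Transposition.transpose i j l) A * l2 i j Pm) \<psi> x"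
    using assms by (simp add: ap_l2_Pm ap_l2[where A = A])
qed

subsection \<open>Baxterization\<close>

text \<open>The Yang--Baxter equation for the Baxterized Hecke generators x and y, in braid form. A
  and C are the differences of consecutive spectral parameters; z is the last of the three
  parameters in the first identity and the first of them in the second. Expanding leaves terms that
  match by the braid and Hecke relations.\<close>

lemma baxter_identity:
  fixes x y A C k z :: "'a::ring_1"
  assumes braid: "x * (y * x) = y * (x * y)" and hx: "x * x = k * x + 1" and hy: "y * y = k * y + 1"
    and c: "x * A = A * x" "x * C = C * x" "x * k = k * x" "x * z = z * x"
       "y * A = A * y" "y * C = C * y" "y * k = k * y" "y * z = z * y"
       "C * A = A * C" "k * A = A * k" "z * A = A * z" "k * C = C * k" "z * C = C * z" "z * k = k * z"
  shows "(A * y + (z + C) * k) * ((A + C) * x + z * k) * (C * y + z * k) =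
         (C * x + z * k) * ((A + C) * y + z * k) * (A * x + (z + C) * k)"
    and "(A * y + z * k) * ((A + C) * x + z * k) * (C * y + (z + A) * k) =
         (C * x + (z + A) * k) * ((A + C) * y + z * k) * (A * x + z * k)"
proof -
  have c': "x * (A * t) = A * (x * t)" "x * (C * t) = C * (x * t)" "x * (k * t) = k * (x * t)" "x * (z * t) = z * (x * t)"
       "y * (A * t) = A * (y * t)" "y * (C * t) = C * (y * t)" "y * (k * t) = k * (y * t)" "y * (z * t) = z * (y * t)"
       "C * (A * t) = A * (C * t)" "k * (A * t) = A * (k * t)" "z * (A * t) = A * (z * t)" "k * (C * t) = C * (k * t)" "z * (C * t) = C * (z * t)" "z * (k * t) = k * (z * t)" for t
    by (simp_all add: mult.assoc[symmetric] c)
  show "(A * y + (z + C) * k) * ((A + C) * x + z * k) * (C * y + z * k) =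
         (C * x + z * k) * ((A + C) * y + z * k) * (A * x + (z + C) * k)"
    by (simp add: distrib_left distrib_right mult.assoc c c' hx hy braid add_ac)
  show "(A * y + z * k) * ((A + C) * x + z * k) * (C * y + (z + A) * k) =
         (C * x + (z + A) * k) * ((A + C) * y + z * k) * (A * x + z * k)"
    by (simp add: distrib_left distrib_right mult.assoc c c' hx hy braid add_ac)
qed

section \<open>The Hecke relation and the inverse of RP\<close>

definition kappa :: "complex fps" where "kappa = fps_exp 1 - fps_exp (- 1)"

text \<open>The inverse of R, because the Hecke relation reads R^2 = kappa R + 1. Consequently
  \<open>PRi\<close> is the inverse of RP.\<close>

definition Rinv :: "(complex fps, 'n::finite) mat2 \<Rightarrow> (complex fps, 'n) mat2" where
  "Rinv R = R - mat kappa"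

definition PRi :: "(complex fps, 'n::finite) mat2 \<Rightarrow> (complex fps, 'n) mat2" where
  "PRi R = Pm ** Rinv R"

lemma mat_mult: "(mat c ** A) $ x $ y = c * A $ x $ y" "(A ** mat c) $ x $ y = A $ x $ y * c"
proof -
  have "(mat c ** A) $ x $ y = (\<Sum>k\<in>UNIV. if k = x then c * A $ k $ y else 0)"
    unfolding nth_matrix_mult by (rule sum.cong) (auto simp: mat_def)
  then show "(mat c ** A) $ x $ y = c * A $ x $ y" by simp
  have "(A ** mat c) $ x $ y = (\<Sum>k\<in>UNIV. if k = y then A $ x $ k * c else 0)"
    unfolding nth_matrix_mult by (rule sum.cong) (auto simp: mat_def)
  then show "(A ** mat c) $ x $ y = A $ x $ y * c" by simp
qed

lemma matrix_mult_diff: "A ** (B - C) = A ** B - A ** C" "(A - B) ** C = A ** C - B ** C"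
  for A B C :: "'a::ring_1 ^ 'n::finite ^ 'n"
  by (simp_all add: vec_eq_iff nth_matrix_mult right_diff_distrib left_diff_distrib sum_subtractf)

lemma hecke_square:
  assumes "hecke_symmetry R"
  shows "(R ** R) $ x $ y = kappa * R $ x $ y + mat 1 $ x $ y"
proof -
  have e: "fps_exp (1::complex) * fps_exp (- 1) = 1"
    by (simp flip: fps_exp_add_mult)
  have "((R - mat (fps_exp 1)) ** (R + mat (fps_exp (- 1)))) $ x $ y = 0"
    using assms by (simp add: hecke_symmetry_def)
  then have "(R ** R) $ x $ y + R $ x $ y * fps_exp (- 1) - fps_exp 1 * R $ x $ y - mat (fps_exp 1) $ x $ y * fps_exp (-1) = 0"
    by (simp add: matrix_mult_diff matrix_add_ldistrib mat_mult algebra_simps)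
  moreover have "mat (fps_exp (1::complex)) $ x $ y * fps_exp (-1) = mat 1 $ x $ y"
    by (simp add: mat_def e)
  ultimately show ?thesis by (simp add: kappa_def algebra_simps)
qed

lemma hecke_inverse:
  assumes "hecke_symmetry R"
  shows "Rinv R ** R = mat 1" "R ** Rinv R = mat 1"
  by (simp_all add: vec_eq_iff Rinv_def matrix_mult_diff mat_mult hecke_square[OF assms] mult.commute)

lemma PRi_RP:
  assumes "hecke_symmetry R"
  shows "PRi R ** RP R = mat 1" "RP R ** PRi R = mat 1"
proof -
  have "PRi R ** RP R = Pm ** (Rinv R ** R) ** Pm" by (simp add: PRi_def RP_def matrix_mul_assoc)
  then show "PRi R ** RP R = mat 1" by (simp add: hecke_inverse[OF assms] matrix_mul_rid Pm_Pm)
  have "RP R ** PRi R = R ** (Pm ** Pm) ** Rinv R" by (simp add: PRi_def RP_def matrix_mul_assoc)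
  then show "RP R ** PRi R = mat 1" by (simp add: hecke_inverse[OF assms] matrix_mul_rid Pm_Pm)
qed

lemma flip_RP: "flip (RP R) = Pm ** R"
  by (simp add: vec_eq_iff nth_flip RP_def nth_mult_Pm nth_Pm_mult)

lemma map_matrix_Pm: "rhom \<phi> \<Longrightarrow> map_matrix \<phi> Pm = Pm"
  by (auto simp: vec_eq_iff Pm_def rhom_one rhom_zero)

lemma map_matrix_flip: "map_matrix \<phi> (flip A) = flip (map_matrix \<phi> A)"
  by (simp add: vec_eq_iff nth_flip)

definition trip :: "'n list \<Rightarrow> 'n \<times> 'n \<times> 'n" where
  "trip K = (K ! 0, K ! 1, K ! 2)"

lemma sum_length_3: "(\<Sum>K | length K = 3. f K) = (\<Sum>a\<in>UNIV. \<Sum>b\<in>UNIV. \<Sum>c\<in>(UNIV :: 'n::finite set). f [a, b, c])"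
proof -
  have "(\<Sum>K | length K = 3. f K) = (\<Sum>t\<in>UNIV. f (case t of (a, b, c) \<Rightarrow> [a, b, c]))"
    by (rule sum.reindex_bij_witness[where i = "\<lambda>(a, b, c). [a, b, c]" and j = trip])
       (auto simp: trip_def numeral_3_eq_3 length_Suc_conv)
  then show ?thesis by (simp add: sum_pairs)
qed

lemma leg_3:
  "leg 0 1 A [x, y, z] [a, b, c] = (if z = c then A $ (x, y) $ (a, b) else 0)"
  "leg 1 2 A [x, y, z] [a, b, c] = (if x = a then A $ (y, z) $ (b, c) else 0)"
  by (auto simp: leg_def less_Suc_eq numeral_2_eq_2)

text \<open>Carries a tensor with factors numbered 0, 1, 2 to three arbitrary legs, so that the
  braid relation in \<open>hecke_symmetry\<close> becomes available on all of them.\<close>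

definition l3 :: "(complex fps \<Rightarrow> 'e::ring_1 endo) \<Rightarrow> nat \<Rightarrow> nat \<Rightarrow> nat \<Rightarrow> (complex fps, 'n::finite) tens \<Rightarrow> ((nat \<Rightarrow> 'n) \<Rightarrow> 'e) endo" where
  "l3 \<eta> i j k T = Endo (\<lambda>\<psi> x. \<Sum>a\<in>UNIV. \<Sum>b\<in>UNIV. \<Sum>c\<in>UNIV. ap (\<eta> (T [x i, x j, x k] [a, b, c])) (\<psi> (x(i := a, j := b, k := c))))"

lemma ap_l3: "ap (l3 \<eta> i j k T) \<psi> x = (\<Sum>a\<in>UNIV. \<Sum>b\<in>UNIV. \<Sum>c\<in>UNIV. ap (\<eta> (T [x i, x j, x k] [a, b, c])) (\<psi> (x(i := a, j := b, k := c))))"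
  unfolding l3_def by (subst ap_Endo) (auto simp: Modules.additive_def fun_eq_iff sum.distrib)

lemma l3_mult:
  assumes \<eta>: "rhom \<eta>" and d: "i \<noteq> j" "i \<noteq> k" "j \<noteq> k"
  shows "l3 \<eta> i j k (tmul 3 S T) = l3 \<eta> i j k S * l3 \<eta> i j k T"
proof (rule op_eqI)
  fix \<psi> and x :: "nat \<Rightarrow> 'b"
  have upd: "x(i := a, j := b, k := c, i := a', j := b', k := c') = x(i := a', j := b', k := c')" for a b c a' b' c'
    using d by (auto simp: fun_eq_iff)
  let ?g = "\<lambda>a b c a' b' c'. ap (\<eta> (S [x i, x j, x k] [a, b, c])) (ap (\<eta> (T [a, b, c] [a', b', c'])) (\<psi> (x(i := a', j := b', k := c'))))"
  have "ap (l3 \<eta> i j k S * l3 \<eta> i j k T) \<psi> x = (\<Sum>a\<in>UNIV. \<Sum>b\<in>UNIV. \<Sum>c\<in>UNIV. \<Sum>a'\<in>UNIV. \<Sum>b'\<in>UNIV. \<Sum>c'\<in>UNIV. ?g a b c a' b' c')"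
    using d by (simp add: ap_l3 ap_arg_sum upd)
  also have "\<dots> = (\<Sum>(a, b, c)\<in>UNIV. \<Sum>(a', b', c')\<in>UNIV. ?g a b c a' b' c')"
    by (simp add: sum_pairs)
  also have "\<dots> = (\<Sum>(a', b', c')\<in>UNIV. \<Sum>(a, b, c)\<in>UNIV. ?g a b c a' b' c')"
    by (simp only: case_prod_unfold) (rule sum.swap)
  also have "\<dots> = ap (l3 \<eta> i j k (tmul 3 S T)) \<psi> x"
    by (simp add: sum_pairs ap_l3 tmul_def sum_length_3 rhom_sum[OF \<eta>] rhom_mult[OF \<eta>] ap_sum)
  finally show "ap (l3 \<eta> i j k (tmul 3 S T)) \<psi> x = ap (l3 \<eta> i j k S * l3 \<eta> i j k T) \<psi> x" by simp
qed

lemma l3_leg: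
  assumes \<eta>: "rhom \<eta>" and d: "i \<noteq> j" "i \<noteq> k" "j \<noteq> k"
  shows "l3 \<eta> i j k (leg 0 1 A) = l2 i j (map_matrix \<eta> A)" "l3 \<eta> i j k (leg 1 2 A) = l2 j k (map_matrix \<eta> A)"
proof (rule_tac [!] op_eqI)
  fix \<psi> x
  have "ap (l3 \<eta> i j k (leg 0 1 A)) \<psi> x = (\<Sum>a\<in>UNIV. \<Sum>b\<in>UNIV. \<Sum>c\<in>UNIV. if c = x k then ap (\<eta> (A $ (x i, x j) $ (a, b))) (\<psi> (x(i := a, j := b, k := c))) else 0)"
    unfolding ap_l3 leg_3 by (intro sum.cong refl) (auto simp: rhom_zero[OF \<eta>])
  also have "\<dots> = ap (l2 i j (map_matrix \<eta> A)) \<psi> x"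
    using d by (simp add: ap_l2 sum_pairs fun_upd_twist[of _ k] fun_upd_idem)
  finally show "ap (l3 \<eta> i j k (leg 0 1 A)) \<psi> x = ap (l2 i j (map_matrix \<eta> A)) \<psi> x" .
  have "ap (l3 \<eta> i j k (leg 1 2 A)) \<psi> x = (\<Sum>a\<in>UNIV. if a = x i then \<Sum>b\<in>UNIV. \<Sum>c\<in>UNIV. ap (\<eta> (A $ (x j, x k) $ (b, c))) (\<psi> (x(i := a, j := b, k := c))) else 0)"
    unfolding ap_l3 leg_3 by (intro sum.cong refl) (auto simp: rhom_zero[OF \<eta>])
  also have "\<dots> = ap (l2 j k (map_matrix \<eta> A)) \<psi> x"
    using d by (simp add: ap_l2 sum_pairs)
  finally show "ap (l3 \<eta> i j k (leg 1 2 A)) \<psi> x = ap (l2 j k (map_matrix \<eta> A)) \<psi> x" .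
qed

section \<open>Yang--Baxter equations on arbitrary legs\<close>

locale hecke_legs =
  fixes R :: "(complex fps, 'n::finite) mat2" and \<eta> :: "complex fps \<Rightarrow> 'e::ring_1 endo"
  assumes hecke: "hecke_symmetry R" and \<eta>: "rhom \<eta>"
begin

abbreviation Rop :: "nat \<Rightarrow> nat \<Rightarrow> ((nat \<Rightarrow> 'n) \<Rightarrow> 'e) endo" where "Rop i j \<equiv> l2 i j (map_matrix \<eta> R)"
abbreviation Pop :: "nat \<Rightarrow> nat \<Rightarrow> ((nat \<Rightarrow> 'n) \<Rightarrow> 'e) endo" where "Pop i j \<equiv> l2 i j Pm"
definition S :: "nat \<Rightarrow> nat \<Rightarrow> ((nat \<Rightarrow> 'n) \<Rightarrow> 'e) endo" where "S i j = l2 i j (map_matrix \<eta> (RP R))"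
definition Si :: "nat \<Rightarrow> nat \<Rightarrow> ((nat \<Rightarrow> 'n) \<Rightarrow> 'e) endo" where "Si i j = l2 i j (map_matrix \<eta> (PRi R))"

text \<open>z PR - w PR^{-1} on the legs i, j: \<open>S j i\<close> is PR there and
  \<open>Si i j\<close> is PR^{-1}. For z = e^{2u/a} and w = e^{2v/a} this is R_ij(u - v) up to a
  scalar.\<close>

definition D :: "nat \<Rightarrow> nat \<Rightarrow> 'e endo \<Rightarrow> 'e endo \<Rightarrow> ((nat \<Rightarrow> 'n) \<Rightarrow> 'e) endo" where
  "D i j z w = zs z * S j i - zs w * Si i j"

text \<open>Commuting with the coefficients of R is all that is asked. The spectral parameters will
  be multiplications by series in some v_k, which need not be in the image of
  \<open>\<eta>\<close>.\<close>

definition scalar :: "'e endo \<Rightarrow> bool" where "scalar z \<longleftrightarrow> (\<forall>c. z * \<eta> c = \<eta> c * z)"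

lemma scalar_eta: "scalar (\<eta> c)"
  by (simp add: scalar_def rhom_mult[OF \<eta>, symmetric] mult.commute)

lemma scalar_l2: "scalar z \<Longrightarrow> zs z * l2 i j (map_matrix \<eta> A) = l2 i j (map_matrix \<eta> A) * zs z"
  by (rule zs_l2_commute) (simp add: scalar_def)

lemma scalar_Pop: "zs z * Pop i j = Pop i j * zs z"
  by (rule zs_l2_commute) (simp add: Pm_def)

lemma S_Rop: "i \<noteq> j \<Longrightarrow> S i j = Rop i j * Pop i j"
  by (simp add: S_def RP_def map_matrix_mult[OF \<eta>] map_matrix_Pm[OF \<eta>] l2_mult)

lemma braid:
  assumes "i \<noteq> j" "i \<noteq> k" "j \<noteq> k"
  shows "Rop i j * (Rop j k * Rop i j) = Rop j k * (Rop i j * Rop j k)"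
proof -
  let ?l = "l3 \<eta> i j k" and ?L = "leg 0 1 R" and ?M = "leg 1 2 R"
  have "?l (tmul 3 (tmul 3 ?L ?M) ?L) = ?l (tmul 3 (tmul 3 ?M ?L) ?M)"
    by (rule op_eqI) (use hecke in \<open>simp add: ap_l3 hecke_symmetry_def\<close>)
  then show ?thesis
    unfolding l3_mult[OF \<eta> assms] l3_leg[OF \<eta> assms] by (simp only: mult.assoc)
qed

lemma hecke_op: "i \<noteq> j \<Longrightarrow> Rop i j * Rop i j = zs (\<eta> kappa) * Rop i j + 1"
proof (rule op_eqI)
  assume ij: "i \<noteq> j"
  fix \<psi> :: "(nat \<Rightarrow> 'n) \<Rightarrow> 'e" and x
  have "Rop i j * Rop i j = l2 i j (map_matrix \<eta> (R ** R))"
    by (simp add: l2_mult[OF ij] map_matrix_mult[OF \<eta>])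
  moreover have "ap (l2 i j (map_matrix \<eta> (R ** R))) \<psi> x = ap (zs (\<eta> kappa)) (ap (Rop i j) \<psi>) x + ap (l2 i j (map_matrix \<eta> (mat 1))) \<psi> x"
    by (simp add: ap_l2 ap_zs hecke_square[OF hecke] rhom_add[OF \<eta>] rhom_mult[OF \<eta>] ap_arg_sum sum.distrib)
  ultimately show "ap (Rop i j * Rop i j) \<psi> x = ap (zs (\<eta> kappa) * Rop i j + 1) \<psi> x"
    by (simp add: map_matrix_one[OF \<eta>] l2_one)
qed

lemma Pop_swap: "i \<noteq> j \<Longrightarrow> Pop j i = Pop i j"
proof -
  assume "i \<noteq> j"
  have "flip Pm = (Pm :: ('e endo, 'n) mat2)" by (simp add: flip_def Pm_Pm matrix_mul_lid)
  with l2_flip[OF \<open>i \<noteq> j\<close>, of "Pm :: ('e endo, 'n) mat2"] show ?thesis by simp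
qed

lemma Pop_braid:
  assumes "i \<noteq> j" "i \<noteq> k" "j \<noteq> k"
  shows "Pop i j * (Pop i k * Pop j k) = Pop j k * (Pop i k * Pop i j)"
proof -
  have 1: "Pop i j * Pop i k = Pop j k * Pop i j" "Pop i j * Pop j k = Pop i k * Pop i j"
    using Pm_conj[OF assms(1), of i k Pm] Pm_conj[OF assms(1), of j k Pm] assms by (simp_all add: Transposition.transpose_def)
  have "Pop i j * (Pop i k * Pop j k) = Pop i j * Pop i k * Pop j k" by (simp only: mult.assoc)
  also have "\<dots> = Pop j k * (Pop i j * Pop j k)" by (simp only: 1(1) mult.assoc)
  finally show ?thesis by (simp only: 1(2))
qed

text \<open>\<open>BX\<close> is the \<open>R\<close>-matrix in braid form; the permutations are moved to the left of every product of \<open>D\<close>'s.\<close>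

definition BX :: "nat \<Rightarrow> nat \<Rightarrow> 'e endo \<Rightarrow> 'e endo \<Rightarrow> ((nat \<Rightarrow> 'n) \<Rightarrow> 'e) endo" where
  "BX i j z w = zs (z - w) * Rop i j + zs w * zs (\<eta> kappa)"

lemma S_flip: "i \<noteq> j \<Longrightarrow> S j i = Pop i j * Rop i j"
  using Pm_conj[of i j j i "map_matrix \<eta> R"] Pm_conj[of i j i j "map_matrix \<eta> R"]
  by (simp add: S_Rop Pop_swap Transposition.transpose_def)

lemma Si_Rop: "i \<noteq> j \<Longrightarrow> Si i j = Pop i j * (Rop i j - zs (\<eta> kappa))"
proof -
  assume ij: "i \<noteq> j"
  have "l2 i j (map_matrix \<eta> (mat kappa :: (complex fps, 'n) mat2)) = zs (\<eta> kappa)"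
  proof -
    have "map_matrix \<eta> (mat kappa :: (complex fps, 'n) mat2) = map_matrix (\<lambda>a. \<eta> kappa * a) (mat 1 :: ('e endo, 'n) mat2)"
      by (auto simp: vec_eq_iff mat_def rhom_zero[OF \<eta>])
    then show ?thesis by (simp add: l2_zs l2_one)
  qed
  then show ?thesis
    using ij by (simp add: Si_def PRi_def Rinv_def map_matrix_mult[OF \<eta>] map_matrix_Pm[OF \<eta>] map_matrix_diff[OF \<eta>] l2_mult[symmetric] l2_diff)
qed

lemma D_X:
  assumes ij: "i \<noteq> j" and "scalar z" "scalar w"
  shows "D i j z w = Pop i j * BX i j z w"
  unfolding D_def BX_def S_flip[OF ij] Si_Rop[OF ij]
  by (simp add: scalar_Pop distrib_left right_diff_distrib left_diff_distrib rhom_diff[OF rhom_zs] mult.assoc[symmetric])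

lemma Pop_X:
  assumes "i \<noteq> j"
  shows "BX k l z w * Pop i j = Pop i j * BX (Transposition.transpose i j k) (Transposition.transpose i j l) z w"
proof -
  have conj: "Rop k l * Pop i j = Pop i j * Rop (Transposition.transpose i j k) (Transposition.transpose i j l)"
    using Pm_conj[OF assms, of "Transposition.transpose i j k" "Transposition.transpose i j l" "map_matrix \<eta> R"] by simp
  have z: "zs z * (Pop i j * t) = Pop i j * (zs z * t)" for z t
    by (simp only: mult.assoc[symmetric] scalar_Pop)
  show ?thesis
    by (simp only: BX_def distrib_left distrib_right mult.assoc conj scalar_Pop z)
qed

lemma X_YB:
  assumes d: "i \<noteq> j" "i \<noteq> k" "j \<noteq> k"
    and s: "scalar a" "scalar b" "scalar c" and comm: "a * b = b * a" "a * c = c * a" "b * c = c * b"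
  shows "BX j k a b * BX i j a c * BX j k b c = BX i j b c * BX j k a c * BX i j a b"
    and "BX j k b a * BX i j c a * BX j k c b = BX i j c b * BX j k c a * BX i j b a"
proof -
  let ?z = "zs :: 'e endo \<Rightarrow> ((nat \<Rightarrow> 'n) \<Rightarrow> 'e) endo" and ?k = "zs (\<eta> kappa) :: ((nat \<Rightarrow> 'n) \<Rightarrow> 'e) endo"
  have zc: "?z z * ?z w = ?z w * ?z z" if "z * w = w * z" for z w
    using that by (metis rhom_mult[OF rhom_zs])
  have zR: "Rop p q * ?z z = ?z z * Rop p q" if "scalar z" for z p q
    by (rule scalar_l2[OF that, symmetric])
  have ck: "?z z * ?k = ?k * ?z z" if "scalar z" for z
    by (rule zc) (use that in \<open>simp add: scalar_def\<close>)
  note zd = rhom_diff[OF rhom_zs]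
  have cd: "p * (q - r) = (q - r) * p" if "p * q = q * p" "p * r = r * p" for p q r :: "((nat \<Rightarrow> 'n) \<Rightarrow> 'e) endo"
    using that by (simp add: left_diff_distrib right_diff_distrib)
  have cd': "(q - r) * p = p * (q - r)" if "q * p = p * q" "r * p = p * r" for p q r :: "((nat \<Rightarrow> 'n) \<Rightarrow> 'e) endo"
    using that by (simp add: left_diff_distrib right_diff_distrib)
  have ab: "?z a * ?z b = ?z b * ?z a" and ac: "?z a * ?z c = ?z c * ?z a" and bc: "?z b * ?z c = ?z c * ?z b"
    using comm by (auto intro: zc)
  note base = braid[OF d] hecke_op[OF d(1)] hecke_op[OF d(3)] ab ac bc zR[OF s(1)] zR[OF s(2)] zR[OF s(3)] zR[OF scalar_eta]
    ck[OF s(1)] ck[OF s(2)] ck[OF s(3)]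
  \<comment> \<open>Writing a - c as (a - b) + (b - c), and b as c + (b - c), expresses both sides
    through the three commuting scalars of \<open>baxter_identity\<close>.\<close>
  have e1: "BX j k a b * BX i j a c * BX j k b c =
     ((?z a - ?z b) * Rop j k + (?z c + (?z b - ?z c)) * ?k) * (((?z a - ?z b) + (?z b - ?z c)) * Rop i j + ?z c * ?k) * ((?z b - ?z c) * Rop j k + ?z c * ?k)"
    and e2: "BX i j b c * BX j k a c * BX i j a b =
     ((?z b - ?z c) * Rop i j + ?z c * ?k) * (((?z a - ?z b) + (?z b - ?z c)) * Rop j k + ?z c * ?k) * ((?z a - ?z b) * Rop i j + (?z c + (?z b - ?z c)) * ?k)"
    by (simp_all add: BX_def zd)
  show "BX j k a b * BX i j a c * BX j k b c = BX i j b c * BX j k a c * BX i j a b"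
    unfolding e1 e2
    by (rule baxter_identity(1))
       ((intro cd cd')?; rule base base[symmetric] refl)+
  have e3: "BX j k b a * BX i j c a * BX j k c b =
     ((?z b - ?z a) * Rop j k + ?z a * ?k) * (((?z b - ?z a) + (?z c - ?z b)) * Rop i j + ?z a * ?k) * ((?z c - ?z b) * Rop j k + (?z a + (?z b - ?z a)) * ?k)"
    and e4: "BX i j c b * BX j k c a * BX i j b a =
     ((?z c - ?z b) * Rop i j + (?z a + (?z b - ?z a)) * ?k) * (((?z b - ?z a) + (?z c - ?z b)) * Rop j k + ?z a * ?k) * ((?z b - ?z a) * Rop i j + ?z a * ?k)"
    by (simp_all add: BX_def zd)
  show "BX j k b a * BX i j c a * BX j k c b = BX i j c b * BX j k c a * BX i j b a"
    unfolding e3 e4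
    by (rule baxter_identity(2))
       ((intro cd cd')?; rule base base[symmetric] refl)+
qed

lemma DDD_X:
  assumes d: "i \<noteq> j" "i \<noteq> k" "j \<noteq> k"
    and s: "scalar a" "scalar b" "scalar c" "scalar a'" "scalar b'" "scalar c'"
  shows "D i j a a' * D i k b b' * D j k c c' = Pop i j * (Pop i k * Pop j k) * (BX j k a a' * BX i j b b' * BX j k c c')"
    and "D j k c c' * D i k b b' * D i j a a' = Pop j k * (Pop i k * Pop i j) * (BX i j c c' * BX j k b b' * BX i j a a')"
proof -
  have p: "BX i j z w * Pop i k = Pop i k * BX k j z w" "BX k j z w * Pop j k = Pop j k * BX j k z w"
    "BX i k z w * Pop j k = Pop j k * BX i j z w" "BX j k z w * Pop i k = Pop i k * BX j i z w"
    "BX j i z w * Pop i j = Pop i j * BX i j z w" "BX i k z w * Pop i j = Pop i j * BX j k z w" for z w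
    using d by (simp_all add: Pop_X Transposition.transpose_def)
  have p': "BX i j z w * (Pop i k * t) = Pop i k * (BX k j z w * t)" "BX k j z w * (Pop j k * t) = Pop j k * (BX j k z w * t)"
    "BX i k z w * (Pop j k * t) = Pop j k * (BX i j z w * t)" "BX j k z w * (Pop i k * t) = Pop i k * (BX j i z w * t)"
    "BX j i z w * (Pop i j * t) = Pop i j * (BX i j z w * t)" "BX i k z w * (Pop i j * t) = Pop i j * (BX j k z w * t)" for z w t
    by (simp_all add: mult.assoc[symmetric] p)
  show "D i j a a' * D i k b b' * D j k c c' = Pop i j * (Pop i k * Pop j k) * (BX j k a a' * BX i j b b' * BX j k c c')"
    "D j k c c' * D i k b b' * D i j a a' = Pop j k * (Pop i k * Pop i j) * (BX i j c c' * BX j k b b' * BX i j a a')"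
    using d s by (simp_all add: D_X mult.assoc p')
qed

text \<open>In the second form the first parameter of each factor belongs to the second of its legs;
  this is the arrangement in R_k0(u - v_k), with L^- on leg 0.\<close>

lemma D_YB:
  assumes d: "i \<noteq> j" "i \<noteq> k" "j \<noteq> k"
    and s: "scalar a" "scalar b" "scalar c" and comm: "a * b = b * a" "a * c = c * a" "b * c = c * b"
  shows "D i j a b * D i k a c * D j k b c = D j k b c * D i k a c * D i j a b"
    and "D i j b a * D i k c a * D j k c b = D j k c b * D i k c a * D i j b a"
  using X_YB[OF assms] by (simp_all add: DDD_X d s Pop_braid[OF d])

text \<open>The constant case: with parameters 1 and 0, \<open>D\<close> becomes \<open>S\<close>
  with its legs exchanged, and \<open>BX\<close> becomes the braid generator itself.\<close>

lemma S_YB: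
  assumes d: "i \<noteq> j" "i \<noteq> k" "j \<noteq> k"
  shows "S i j * (S i k * S j k) = S j k * (S i k * S i j)"
proof -
  have s: "scalar (1::'e endo)" "scalar (0::'e endo)" by (simp_all add: scalar_def)
  have "D i j 1 0 * D i k 1 0 * D j k 1 0 = D j k 1 0 * D i k 1 0 * D i j 1 0" if "i \<noteq> j" "i \<noteq> k" "j \<noteq> k" for i j k
  proof -
    have "BX j k 1 0 * BX i j 1 0 * BX j k 1 0 = BX i j 1 0 * BX j k 1 0 * BX i j 1 0"
      using braid[OF that] by (simp add: BX_def rhom_zero[OF rhom_zs] rhom_one[OF rhom_zs] mult.assoc)
    then show ?thesis using that s by (simp add: DDD_X Pop_braid[OF that])
  qed
  from this[OF d(3)[symmetric] d(2)[symmetric] d(1)[symmetric]] show ?thesis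
    by (simp add: D_def rhom_zero[OF rhom_zs] rhom_one[OF rhom_zs] mult.assoc)
qed

lemma S_Si: "i \<noteq> j \<Longrightarrow> S i j * Si i j = 1" "i \<noteq> j \<Longrightarrow> Si i j * S i j = 1"
  by (simp_all add: S_def Si_def l2_mult map_matrix_mult[OF \<eta>, symmetric] PRi_RP[OF hecke] map_matrix_one[OF \<eta>] l2_one)

lemma Si_move:
  assumes d: "i \<noteq> j" and c: "S i j * A = B * S i j"
  shows "Si i j * B = A * Si i j"
proof -
  have "Si i j * B = Si i j * (B * S i j) * Si i j" by (simp add: mult.assoc S_Si[OF d])
  also have "\<dots> = (Si i j * S i j) * A * Si i j" by (simp only: c[symmetric] mult.assoc)
  finally show ?thesis by (simp add: S_Si[OF d])
qed

lemma scalar_S: "scalar z \<Longrightarrow> zs z * S i j = S i j * zs z" "scalar z \<Longrightarrow> zs z * Si i j = Si i j * zs z"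
  by (simp_all add: S_def Si_def scalar_l2)

text \<open>\<open>D i j\<close> is a combination of \<open>S j i\<close> and the inverse of
  \<open>S i j\<close>. The first exchanges with the pair by the constant Yang--Baxter equation, the
  second after that equation is moved across the inverse.\<close>

lemma D_SS:
  assumes d: "i \<noteq> j" "i \<noteq> k" "j \<noteq> k" and s: "scalar z" "scalar w"
  shows "D i j z w * (S j k * S i k) = S i k * S j k * D i j z w"
    and "D j k z w * (S i j * S i k) = S i k * S i j * D j k z w"
proof -
  have z: "S p q * (zs z * t) = zs z * (S p q * t)" "S p q * (zs w * t) = zs w * (S p q * t)" for p q t
    using scalar_S[OF s(1), of p q] scalar_S[OF s(2), of p q] by (simp_all add: mult.assoc[symmetric])
  have Si1: "Si i j * (S j k * S i k) = S i k * (S j k * Si i j)"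
    using Si_move[OF d(1), of "S i k * S j k" "S j k * S i k"] S_YB[OF d] by (simp only: mult.assoc)
  have S1: "S j i * (S j k * S i k) = S i k * (S j k * S j i)"
    by (rule S_YB) (use d in auto)
  show "D i j z w * (S j k * S i k) = S i k * S j k * D i j z w"
    by (simp only: D_def left_diff_distrib right_diff_distrib mult.assoc Si1 S1 z)
  have Si2: "Si j k * (S i j * S i k) = S i k * (S i j * Si j k)"
    using Si_move[OF d(3), of "S i k * S i j" "S i j * S i k"] S_YB[OF d] by (simp only: mult.assoc)
  have S2: "S k j * (S i j * S i k) = S i k * (S i j * S k j)"
    by (rule S_YB[symmetric]) (use d in auto)
  show "D j k z w * (S i j * S i k) = S i k * S i j * D j k z w"
    by (simp only: D_def left_diff_distrib right_diff_distrib mult.assoc Si2 S2 z)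
qed

text \<open>Both sides are equal to z S_ji S_ij - w. It is the relation between two operators L^-
  evaluated on the unit.\<close>

lemma D_S:
  assumes d: "i \<noteq> j" and s: "scalar z" "scalar w"
  shows "D i j z w * S i j = S j i * D j i z w"
proof -
  have z: "S p q * (zs z * t) = zs z * (S p q * t)" "S p q * (zs w * t) = zs w * (S p q * t)" for p q t
    using scalar_S[OF s(1), of p q] scalar_S[OF s(2), of p q] by (simp_all add: mult.assoc[symmetric])
  show ?thesis
    by (simp only: D_def left_diff_distrib right_diff_distrib mult.assoc z S_Si(2)[OF d] S_Si(1)[OF d[symmetric]])
qed

end

section \<open>Skew-invertibility and the cancellation of RP\<close>

lemma tr2_nth: "tr2 A B $ x $ y = (\<Sum>k\<in>UNIV. \<Sum>l\<in>UNIV. A $ (fst x, k) $ (fst y, l) * B $ (l, snd x) $ (k, snd y))"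
proof -
  have "tmul 3 (leg 0 1 A) (leg 1 2 B) [fst x, k, snd x] [fst y, k, snd y] =
      (\<Sum>l\<in>UNIV. A $ (fst x, k) $ (fst y, l) * B $ (l, snd x) $ (k, snd y))" for k
  proof -
    have "tmul 3 (leg 0 1 A) (leg 1 2 B) [fst x, k, snd x] [fst y, k, snd y] =
       (\<Sum>a\<in>UNIV. \<Sum>l\<in>UNIV. \<Sum>c\<in>UNIV. if a = fst y \<and> c = snd x then A $ (fst x, k) $ (fst y, l) * B $ (l, snd x) $ (k, snd y) else 0)"
      unfolding tmul_def sum_length_3 leg_3 by (intro sum.cong refl) auto
    also have "\<dots> = (\<Sum>a\<in>UNIV. if a = fst y then \<Sum>l\<in>UNIV. A $ (fst x, k) $ (fst y, l) * B $ (l, snd x) $ (k, snd y) else 0)"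
      by (intro sum.cong refl) (auto simp: if_distrib cong: if_cong)
    finally show ?thesis by simp
  qed
  then show ?thesis by (simp add: tr2_def)
qed

text \<open>\<open>Q m c a j\<close> inverts \<open>RP\<close> with respect to its first and fourth indices.\<close>

lemma skew_inverse:
  assumes "skew_invertible R"
  obtains Q :: "'n::finite \<Rightarrow> 'n \<Rightarrow> 'n \<Rightarrow> 'n \<Rightarrow> complex fps" where
    "\<And>m c m' c'. (\<Sum>a\<in>UNIV. \<Sum>j\<in>UNIV. Q m c a j * RP R $ (m', a) $ (j, c')) = (if m = m' \<and> c = c' then 1 else 0)"
    "\<And>a j a' j'. (\<Sum>m\<in>UNIV. \<Sum>c\<in>UNIV. RP R $ (m, a) $ (j, c) * Q m c a' j') = (if a = a' \<and> j = j' then 1 else 0)"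
proof -
  obtain \<Psi> where 1: "tr2 R \<Psi> = Pm" and 2: "tr2 \<Psi> R = Pm"
    using assms by (auto simp: skew_invertible_def)
  show ?thesis
  \<comment> \<open>Multiplication by P exchanges the column indices of R; after that the two
    partial traces are exactly the two inverse conditions for this rearrangement of
    \<open>\<Psi>\<close>.\<close>
  proof (rule that[of "\<lambda>m c a j. \<Psi> $ (j, c) $ (a, m)"])
    fix m c m' c'
    have "(\<Sum>a\<in>UNIV. \<Sum>j\<in>UNIV. \<Psi> $ (j, c) $ (a, m) * RP R $ (m', a) $ (j, c')) = tr2 R \<Psi> $ (m', c) $ (c', m)"
      by (simp add: tr2_nth RP_def nth_mult_Pm mult.commute)
    then show "(\<Sum>a\<in>UNIV. \<Sum>j\<in>UNIV. \<Psi> $ (j, c) $ (a, m) * RP R $ (m', a) $ (j, c')) = (if m = m' \<and> c = c' then 1 else 0)"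
      by (auto simp: 1 Pm_def)
  next
    fix a j a' j'
    have "(\<Sum>m\<in>UNIV. \<Sum>c\<in>UNIV. RP R $ (m, a) $ (j, c) * \<Psi> $ (j', c) $ (a', m)) = tr2 \<Psi> R $ (j', a) $ (a', j)"
      by (subst sum.swap) (simp add: tr2_nth RP_def nth_mult_Pm mult.commute)
    then show "(\<Sum>m\<in>UNIV. \<Sum>c\<in>UNIV. RP R $ (m, a) $ (j, c) * \<Psi> $ (j', c) $ (a', m)) = (if a = a' \<and> j = j' then 1 else 0)"
      by (auto simp: 2 Pm_def)
  qed
qed

locale skew_legs = hecke_legs R \<eta> for R :: "(complex fps, 'n::finite) mat2" and \<eta> :: "complex fps \<Rightarrow> 'e::ring_1 endo" +
  fixes Q :: "'n \<Rightarrow> 'n \<Rightarrow> 'n \<Rightarrow> 'n \<Rightarrow> complex fps"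
  assumes Q1: "\<And>m c m' c'. (\<Sum>a\<in>UNIV. \<Sum>j\<in>UNIV. Q m c a j * RP R $ (m', a) $ (j, c')) = (if m = m' \<and> c = c' then 1 else 0)"
    and Q2: "\<And>a j a' j'. (\<Sum>m\<in>UNIV. \<Sum>c\<in>UNIV. RP R $ (m, a) $ (j, c) * Q m c a' j') = (if a = a' \<and> j = j' then 1 else 0)"
begin

text \<open>Matrix units transport the index pair inverted by \<open>Q\<close>: this is what lets \<open>RP\<close> be cancelled between two operators.\<close>

lemma skew_identity:
  assumes "r \<noteq> k"
  shows "(\<Sum>m\<in>UNIV. \<Sum>c\<in>UNIV. \<Sum>a\<in>UNIV. \<Sum>j\<in>UNIV. zs (\<eta> (Q m c a j)) * eu k c a * S r k * eu r j m) = 1"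
proof (rule op_eqI)
  fix \<psi> :: "(nat \<Rightarrow> 'n) \<Rightarrow> 'e" and x
  let ?e = "\<lambda>m c'. \<psi> (x(r := m, k := c'))"
  have S: "ap (S r k) (ap (eu r j m) \<psi>) (x(k := a)) = (\<Sum>c'\<in>UNIV. ap (\<eta> (RP R $ (x r, a) $ (j, c'))) (?e m c'))" for a j m
  proof -
    have "ap (S r k) (ap (eu r j m) \<psi>) (x(k := a)) =
       (\<Sum>j'\<in>UNIV. if j' = j then \<Sum>c'\<in>UNIV. ap (\<eta> (RP R $ (x r, a) $ (j, c'))) (?e m c') else 0)"
      unfolding S_def ap_l2 sum_pairs using assms
      by (intro sum.cong refl) (auto simp: ap_eu fun_upd_twist[of r k])
    then show ?thesis by simp
  qed
  have "ap (\<Sum>m\<in>UNIV. \<Sum>c\<in>UNIV. \<Sum>a\<in>UNIV. \<Sum>j\<in>UNIV. zs (\<eta> (Q m c a j)) * eu k c a * S r k * eu r j m) \<psi> x =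
     (\<Sum>m\<in>UNIV. \<Sum>c\<in>UNIV. if c = x k then \<Sum>a\<in>UNIV. \<Sum>j\<in>UNIV. \<Sum>c'\<in>UNIV. ap (\<eta> (Q m c a j * RP R $ (x r, a) $ (j, c'))) (?e m c') else 0)"
    unfolding ap_sum sum_fun_apply
    by (intro sum.cong refl) (auto simp: ap_zs ap_eu S ap_arg_sum rhom_mult[OF \<eta>])
  also have "\<dots> = (\<Sum>m\<in>UNIV. \<Sum>a\<in>UNIV. \<Sum>j\<in>UNIV. \<Sum>c'\<in>UNIV. ap (\<eta> (Q m (x k) a j * RP R $ (x r, a) $ (j, c'))) (?e m c'))"
    by simp
  also have "\<dots> = (\<Sum>m\<in>UNIV. \<Sum>c'\<in>UNIV. ap (\<eta> (\<Sum>a\<in>UNIV. \<Sum>j\<in>UNIV. Q m (x k) a j * RP R $ (x r, a) $ (j, c'))) (?e m c'))"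
    unfolding rhom_sum[OF \<eta>] ap_sum
    by (rule sum.cong[OF refl]) (rule sum_rot)
  also have "\<dots> = (\<Sum>m\<in>UNIV. if m = x r then ?e m (x k) else 0)"
    unfolding Q1
  proof (intro sum.cong refl)
    fix m
    have "(\<Sum>c'\<in>UNIV. ap (\<eta> (if m = x r \<and> x k = c' then 1 else 0)) (?e m c')) = (\<Sum>c'\<in>UNIV. if c' = x k then (if m = x r then ?e m (x k) else 0) else 0)"
      by (intro sum.cong refl) (auto simp: rhom_one[OF \<eta>] rhom_zero[OF \<eta>])
    then show "(\<Sum>c'\<in>UNIV. ap (\<eta> (if m = x r \<and> x k = c' then 1 else 0)) (?e m c')) = (if m = x r then ?e m (x k) else 0)" by simp
  qed
  finally show "ap (\<Sum>m\<in>UNIV. \<Sum>c\<in>UNIV. \<Sum>a\<in>UNIV. \<Sum>j\<in>UNIV. zs (\<eta> (Q m c a j)) * eu k c a * S r k * eu r j m) \<psi> x = ap 1 \<psi> x"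
    by simp
qed

text \<open>The resolution of the identity in \<open>skew_identity\<close> is inserted between T and
  U. Units on leg k then leave to the left through T, units on leg r to the right through U, and
  what stays in the middle is the product with \<open>S r k\<close>.\<close>

lemma skew_cancel:
  assumes rk: "r \<noteq> k" and T: "\<And>c a. eu k c a * T = T * eu k c a" "\<And>s. T * zs (\<eta> s) = zs (\<eta> s) * T"
    and U: "\<And>c a. eu r c a * U = U * eu r c a"
  shows "T * U = (\<Sum>m\<in>UNIV. \<Sum>c\<in>UNIV. \<Sum>a\<in>UNIV. \<Sum>j\<in>UNIV. zs (\<eta> (Q m c a j)) * eu k c a * (T * S r k * U) * eu r j m)"
proof -
  have "T * (zs (\<eta> q) * eu k c a * S r k * eu r j m) * U = zs (\<eta> q) * eu k c a * (T * S r k * U) * eu r j m" for q c a j m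
  proof -
    have "T * (zs (\<eta> q) * eu k c a * S r k * eu r j m) * U = (T * zs (\<eta> q)) * eu k c a * S r k * (eu r j m * U)"
      by (simp only: mult.assoc)
    also have "\<dots> = zs (\<eta> q) * (T * eu k c a) * S r k * (U * eu r j m)"
      by (simp only: T(2) U mult.assoc)
    also have "\<dots> = zs (\<eta> q) * eu k c a * (T * S r k * U) * eu r j m"
      by (simp only: T(1)[symmetric] mult.assoc)
    finally show ?thesis .
  qed
  then have "(\<Sum>m\<in>UNIV. \<Sum>c\<in>UNIV. \<Sum>a\<in>UNIV. \<Sum>j\<in>UNIV. zs (\<eta> (Q m c a j)) * eu k c a * (T * S r k * U) * eu r j m)
     = T * (\<Sum>m\<in>UNIV. \<Sum>c\<in>UNIV. \<Sum>a\<in>UNIV. \<Sum>j\<in>UNIV. zs (\<eta> (Q m c a j)) * eu k c a * S r k * eu r j m) * U"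
    by (simp only: sum_distrib_left sum_distrib_right)
  then show ?thesis by (simp add: skew_identity[OF rk])
qed

end

subsection \<open>The operators \<open>L\<^sup>-\<close> on the free algebra\<close>

type_synonym ('k, 'n) fa = "('n \<times> 'n \<times> nat) free_monoid \<Rightarrow>\<^sub>0 'k"

text \<open>The coefficients of l^+_ij(v), over any base ring, so that the same formulas serve
  constants, series in u and series in u and v.\<close>

definition lam :: "'n \<Rightarrow> 'n \<Rightarrow> nat \<Rightarrow> ('k::comm_ring_1, 'n) fa fps" where
  "lam i j e = fps_const ((if i = j \<and> e = 0 then 1 else 0) - Poly_Mapping.single (Word [(i, j, e)]) 1)"

definition LPm :: "('k::comm_ring_1, 'n::finite) fa fps fps ^ 'n ^ 'n" where
  "LPm = (\<chi> i j. Abs_fps (lam i j))"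

definition vsc :: "'k::comm_ring_1 fps fps \<Rightarrow> ('k, 'n) fa fps fps" where
  "vsc = fps_map scE"

lemma rhom_vsc: "rhom vsc"
  unfolding vsc_def by (rule rhom_fps_map[OF rhom_scE])

text \<open>\<open>R\<^sub>0\<^sub>1(u-v+hc/2)\<^sup>-\<^sup>1 L\<^sub>1\<^sup>+(v) (RP)\<^sub>1\<^sub>0 X\<^sub>0 R\<^sub>1\<^sub>0(u-v-hc/2)\<close> for a matrix \<open>X\<close> over the algebra.\<close>

definition Wmat :: "('k::comm_ring_1 fps, 'n::finite) mat2 \<Rightarrow> ('k fps fps, 'n) mat2 \<Rightarrow> ('k fps fps, 'n) mat2 \<Rightarrow>
    ('k, 'n) fa fps ^ 'n ^ 'n \<Rightarrow> (('k, 'n) fa fps fps, 'n) mat2" where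
  "Wmat S RI RM Xm = map_matrix vsc RI ** t2 LPm ** map_matrix vsc (map_matrix fps_const (flip S))
     ** t1 (map_matrix fps_const Xm) ** map_matrix vsc RM"

definition Lrel :: "('k::comm_ring_1 fps, 'n::finite) mat2 \<Rightarrow> ('k fps fps, 'n) mat2 \<Rightarrow> ('k fps fps, 'n) mat2 \<Rightarrow>
    ('n \<Rightarrow> 'n \<Rightarrow> ('k, 'n) fa fps \<Rightarrow> ('k, 'n) fa fps) \<Rightarrow> ('k, 'n) fa fps \<Rightarrow> bool" where
  "Lrel S RI RM L y \<longleftrightarrow> (\<forall>i a j b e. (\<Sum>k\<in>UNIV. \<Sum>c\<in>UNIV. scE (S $ (k, a) $ (j, c)) * L i k (lam c b e * y)) =
     fps_nth (Wmat S RI RM (\<chi> i k. L i k y) $ (i, a) $ (j, b)) e)"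

lemma matrix_central_mult:
  fixes A B :: "'a::ring_1 ^ 'n::finite ^ 'n"
  assumes "\<And>x. c * x = x * c"
  shows "A ** map_matrix ((*) c) B = map_matrix ((*) c) (A ** B)" "map_matrix ((*) c) A ** B = map_matrix ((*) c) (A ** B)"
proof -
  have "x * (c * y) = c * (x * y)" for x y :: 'a by (metis assms mult.assoc)
  then show "A ** map_matrix ((*) c) B = map_matrix ((*) c) (A ** B)" "map_matrix ((*) c) A ** B = map_matrix ((*) c) (A ** B)"
    by (simp_all add: vec_eq_iff nth_matrix_mult sum_distrib_left mult.assoc)
qed

lemma fps_const_scE_central: "fps_const (scE s) * x = x * fps_const (scE s)"
  by (simp add: fps_eq_iff scE_central)

lemma matrix_add_mult: "A ** (B + C) = A ** B + A ** C" "(A + B) ** C = A ** C + B ** C"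
  for A B C :: "'a::ring_1 ^ 'n::finite ^ 'n"
  by (simp_all add: vec_eq_iff nth_matrix_mult distrib_left distrib_right sum.distrib)

lemma lin_Wmat:
  assumes "\<And>i j. lin (L i j)"
  shows "lin (\<lambda>y. fps_nth (Wmat S RI RM (\<chi> i k. L i k y) $ p $ q) e)"
proof (rule linI)
  fix x y
  have "t1 (map_matrix fps_const (\<chi> i k. L i k (x + y))) = t1 (map_matrix fps_const (\<chi> i k. L i k x)) + t1 (map_matrix fps_const (\<chi> i k. L i k y))"
    by (simp add: vec_eq_iff t1_def lin_add[OF assms])
  then show "fps_nth (Wmat S RI RM (\<chi> i k. L i k (x + y)) $ p $ q) e =
      fps_nth (Wmat S RI RM (\<chi> i k. L i k x) $ p $ q) e + fps_nth (Wmat S RI RM (\<chi> i k. L i k y) $ p $ q) e"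
    by (simp add: Wmat_def matrix_add_mult)
next
  fix s x
  have "t1 (map_matrix fps_const (\<chi> i k. L i k (scE s * x))) = map_matrix ((*) (fps_const (scE s))) (t1 (map_matrix fps_const (\<chi> i k. L i k x)))"
    by (simp add: vec_eq_iff t1_def lin_scE[OF assms])
  then show "fps_nth (Wmat S RI RM (\<chi> i k. L i k (scE s * x)) $ p $ q) e = scE s * fps_nth (Wmat S RI RM (\<chi> i k. L i k x) $ p $ q) e"
    by (simp add: Wmat_def matrix_central_mult[OF fps_const_scE_central])
qed

lemma lin_comp: "lin T \<Longrightarrow> lin U \<Longrightarrow> lin (\<lambda>x. T (U x))"
  by (auto intro!: linI simp: lin_add lin_scE)

lemma lin_mult_left: "lin (\<lambda>x. a * x)"
proof (rule linI)
  show "a * (scE s * x) = scE s * (a * x)" for s x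
    by (metis mult.assoc scE_central)
qed (simp add: distrib_left)

lemma lin_sumI: "(\<And>i. i \<in> S \<Longrightarrow> lin (T i)) \<Longrightarrow> lin (\<lambda>x. \<Sum>i\<in>S. T i x)"
  by (rule linI) (simp_all add: lin_add lin_scE sum.distrib sum_distrib_left)

lemma lin_id: "lin (\<lambda>x. x)" and lin_zero_fun: "lin (\<lambda>x. 0)"
  by (auto intro!: linI)

lemma lin_diffI: "lin T \<Longrightarrow> lin U \<Longrightarrow> lin (\<lambda>x. T x - U x)"
  by (rule linI) (simp_all add: lin_add lin_scE right_diff_distrib)

lemma Lrel_words:
  assumes L: "\<And>i j. lin (L i j)" and w: "\<And>w. Lrel S RI RM L (wrd w)"
  shows "Lrel S RI RM L y"
  unfolding Lrel_def
proof (intro allI)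
  fix i a j b e
  show "(\<Sum>k\<in>UNIV. \<Sum>c\<in>UNIV. scE (S $ (k, a) $ (j, c)) * L i k (lam c b e * y)) =
     fps_nth (Wmat S RI RM (\<chi> i k. L i k y) $ (i, a) $ (j, b)) e"
  proof (rule lin_eqI[where x = y])
    show "lin (\<lambda>y. \<Sum>k\<in>UNIV. \<Sum>c\<in>UNIV. scE (S $ (k, a) $ (j, c)) * L i k (lam c b e * y))"
      by (intro lin_sumI lin_comp[OF lin_mult_left] lin_comp[OF L lin_mult_left])
  qed (use lin_Wmat[OF L] w in \<open>auto simp: Lrel_def\<close>)
qed

text \<open>The recursion \<open>Lrel\<close> solved for its unknown by means of Q. A letter is a
  Kronecker delta minus a coefficient \<open>lam\<close>, which explains the difference of two
  terms.\<close>

fun Lword :: "('n::finite \<Rightarrow> 'n \<Rightarrow> 'n \<Rightarrow> 'n \<Rightarrow> 'k::comm_ring_1 fps) \<Rightarrow> ('k fps, 'n) mat2 \<Rightarrow> ('k fps fps, 'n) mat2 \<Rightarrow> ('k fps fps, 'n) mat2 \<Rightarrow>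
    ('n \<times> 'n \<times> nat) list \<Rightarrow> ('k, 'n) fa fps ^ 'n ^ 'n" where
  "Lword Q S RI RM [] = mat 1"
| "Lword Q S RI RM ((c, b, e) # w) = (let Xm = Lword Q S RI RM w in
     (if c = b \<and> e = 0 then Xm else 0) -
     (\<chi> i k. \<Sum>a\<in>UNIV. \<Sum>j\<in>UNIV. scE (Q k c a j) * fps_nth (Wmat S RI RM Xm $ (i, a) $ (j, b)) e))"

definition Lmap :: "('n::finite \<Rightarrow> 'n \<Rightarrow> 'n \<Rightarrow> 'n \<Rightarrow> 'k::comm_ring_1 fps) \<Rightarrow> ('k fps, 'n) mat2 \<Rightarrow> ('k fps fps, 'n) mat2 \<Rightarrow> ('k fps fps, 'n) mat2 \<Rightarrow>
    'n \<Rightarrow> 'n \<Rightarrow> ('k, 'n) fa fps \<Rightarrow> ('k, 'n) fa fps" where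
  "Lmap Q S RI RM i k = lext (\<lambda>w. Lword Q S RI RM (letters w) $ i $ k)"

lemma lin_Lmap: "lin (Lmap Q S RI RM i k)"
  unfolding Lmap_def by (rule lin_lext)

lemma wrd_zero: "wrd 0 = 1"
  by (simp add: wrd_def)

lemma Lmap_one: "Lmap Q S RI RM i k 1 = (if i = k then 1 else 0)"
proof -
  have "Lmap Q S RI RM i k (wrd 0) = (if i = k then 1 else 0)"
    unfolding Lmap_def lext_wrd by (simp add: zero_free_monoid_def mat_def)
  then show ?thesis by (simp add: wrd_zero)
qed

lemma lam_wrd: "lam c b e * wrd w = (if c = b \<and> e = 0 then wrd w else 0) - wrd (Word ((c, b, e) # letters w))"
  by (simp add: lam_def wrd_def left_diff_distrib mult_single plus_free_monoid_def)

lemma Lmap_lam_wrd: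
  "Lmap Q S RI RM i k (lam c b e * wrd w) =
     (\<Sum>a\<in>UNIV. \<Sum>j\<in>UNIV. scE (Q k c a j) * fps_nth (Wmat S RI RM (\<chi> i k. Lmap Q S RI RM i k (wrd w)) $ (i, a) $ (j, b)) e)"
proof -
  have "(\<chi> i k. Lmap Q S RI RM i k (wrd w)) = Lword Q S RI RM (letters w)"
    by (simp add: vec_eq_iff Lmap_def lext_wrd)
  moreover have "Lmap Q S RI RM i k (lam c b e * wrd w) = (if c = b \<and> e = 0 then Lword Q S RI RM (letters w) $ i $ k else 0) - Lword Q S RI RM ((c, b, e) # letters w) $ i $ k"
    unfolding lam_wrd lin_diff[OF lin_Lmap] by (simp add: lin_zero[OF lin_Lmap]) (simp add: Lmap_def lext_wrd)
  ultimately show ?thesis by (simp add: Let_def)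
qed

lemma scE_delta: "scE (if P then 1 else 0) * t = (if P then t else 0)"
  by (simp add: rhom_one[OF rhom_scE] rhom_zero[OF rhom_scE])

lemma Lrel_Lmap:
  assumes Q2: "\<And>a j a' j'. (\<Sum>m\<in>UNIV. \<Sum>c\<in>UNIV. S $ (m, a) $ (j, c) * Q m c a' j') = (if a = a' \<and> j = j' then 1 else 0)"
  shows "Lrel S RI RM (Lmap Q S RI RM) y"
proof (rule Lrel_words[OF lin_Lmap])
  fix w
  show "Lrel S RI RM (Lmap Q S RI RM) (wrd w)"
    unfolding Lrel_def
  proof (intro allI)
    fix i a j b e
    let ?W = "\<lambda>a j. fps_nth (Wmat S RI RM (\<chi> i k. Lmap Q S RI RM i k (wrd w)) $ (i, a) $ (j, b)) e"
    have "(\<Sum>k\<in>UNIV. \<Sum>c\<in>UNIV. scE (S $ (k, a) $ (j, c)) * Lmap Q S RI RM i k (lam c b e * wrd w)) =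
       (\<Sum>(k, c)\<in>UNIV. \<Sum>(a', j')\<in>UNIV. scE (S $ (k, a) $ (j, c) * Q k c a' j') * ?W a' j')"
      by (simp add: Lmap_lam_wrd sum_distrib_left sum_pairs rhom_mult[OF rhom_scE] mult.assoc)
    also have "\<dots> = (\<Sum>(a', j')\<in>UNIV. \<Sum>(k, c)\<in>UNIV. scE (S $ (k, a) $ (j, c) * Q k c a' j') * ?W a' j')"
      by (simp only: case_prod_unfold) (rule sum.swap)
    also have "\<dots> = (\<Sum>(a', j')\<in>UNIV. scE (\<Sum>m\<in>UNIV. \<Sum>c\<in>UNIV. S $ (m, a) $ (j, c) * Q m c a' j') * ?W a' j')"
      by (simp add: sum_pairs sum_distrib_right rhom_sum[OF rhom_scE])
    also have "\<dots> = (\<Sum>p\<in>UNIV. if p = (a, j) then ?W a j else 0)"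
      unfolding Q2 scE_delta by (rule sum.cong) (auto split: if_splits)
    finally show "(\<Sum>k\<in>UNIV. \<Sum>c\<in>UNIV. scE (S $ (k, a) $ (j, c)) * Lmap Q S RI RM i k (lam c b e * wrd w)) = ?W a j"
      by simp
  qed
qed

section \<open>Base change\<close>

definition emap :: "('k::comm_ring_1 \<Rightarrow> 'l::comm_ring_1) \<Rightarrow> ('k, 'n) fa fps \<Rightarrow> ('l, 'n) fa fps" where
  "emap \<phi> = fps_map (Poly_Mapping.map \<phi>)"

lemma rhom_emap: "rhom \<phi> \<Longrightarrow> rhom (emap \<phi>)"
  unfolding emap_def by (intro rhom_fps_map rhom_pmap)

lemma emap_scE: "rhom \<phi> \<Longrightarrow> emap \<phi> (scE s) = scE (fps_map \<phi> s)"
  by (simp add: emap_def scE_def fps_eq_iff cst_def pmap_single rhom_zero)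

lemma emap_lam: "rhom \<phi> \<Longrightarrow> emap \<phi> (lam i j e) = lam i j e"
  by (simp add: emap_def lam_def fps_map_const rhom_zero[OF rhom_pmap] rhom_diff[OF rhom_pmap] rhom_one[OF rhom_pmap] pmap_single rhom_zero rhom_one)

lemma map_matrix_t1: "rhom \<phi> \<Longrightarrow> map_matrix \<phi> (t1 A) = t1 (map_matrix \<phi> A)"
  and map_matrix_t2: "rhom \<phi> \<Longrightarrow> map_matrix \<phi> (t2 A) = t2 (map_matrix \<phi> A)"
  by (simp_all add: vec_eq_iff t1_def t2_def rhom_zero)

lemma map_Wmat:
  assumes \<phi>: "rhom \<phi>"
  shows "map_matrix (fps_map (emap \<phi>)) (Wmat S RI RM Xm) =
    Wmat (map_matrix (fps_map \<phi>) S) (map_matrix (fps_map (fps_map \<phi>)) RI) (map_matrix (fps_map (fps_map \<phi>)) RM) (map_matrix (emap \<phi>) Xm)"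
proof -
  note e = rhom_emap[OF \<phi>] and f = rhom_fps_map[OF rhom_emap[OF \<phi>]]
  have 1: "map_matrix (fps_map (emap \<phi>)) (map_matrix vsc A) = map_matrix vsc (map_matrix (fps_map (fps_map \<phi>)) A)" for A
    by (simp add: vec_eq_iff vsc_def fps_eq_iff emap_scE[OF \<phi>])
  have 2: "map_matrix (fps_map (emap \<phi>)) LPm = LPm"
    by (simp add: vec_eq_iff LPm_def fps_eq_iff emap_lam[OF \<phi>])
  have 3: "map_matrix (fps_map (emap \<phi>)) (map_matrix fps_const Xm) = map_matrix fps_const (map_matrix (emap \<phi>) Xm)"
    by (simp add: vec_eq_iff fps_map_const rhom_zero[OF e])
  have 4: "map_matrix (fps_map (fps_map \<phi>)) (map_matrix fps_const (flip S)) = map_matrix fps_const (flip (map_matrix (fps_map \<phi>) S))"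
    by (simp add: vec_eq_iff nth_flip fps_map_const rhom_zero[OF rhom_fps_map[OF \<phi>]])
  show ?thesis
    unfolding Wmat_def map_matrix_mult[OF f] map_matrix_t1[OF f] map_matrix_t2[OF f] 1 2 3 4 ..
qed

text \<open>The same operator over a larger ring: the values on words are carried over and extended
  linearly. This lets L^-(u) and L^-(v) act on one module over series in both variables.\<close>

definition Lbase :: "('k::comm_ring_1 \<Rightarrow> 'l::comm_ring_1) \<Rightarrow> ('n \<Rightarrow> 'n \<Rightarrow> ('k, 'n) fa fps \<Rightarrow> ('k, 'n) fa fps) \<Rightarrow>
    'n \<Rightarrow> 'n \<Rightarrow> ('l, 'n) fa fps \<Rightarrow> ('l, 'n) fa fps" where
  "Lbase \<phi> L i k = lext (\<lambda>w. emap \<phi> (L i k (wrd w)))"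

lemma lin_Lbase: "lin (Lbase \<phi> L i k)"
  unfolding Lbase_def by (rule lin_lext)

lemma Lrel_Lbase:
  assumes \<phi>: "rhom \<phi>" and L: "\<And>i j. lin (L i j)" and rel: "\<And>y. Lrel S RI RM L y"
  shows "Lrel (map_matrix (fps_map \<phi>) S) (map_matrix (fps_map (fps_map \<phi>)) RI) (map_matrix (fps_map (fps_map \<phi>)) RM) (Lbase \<phi> L) y"
proof (rule Lrel_words[OF lin_Lbase])
  fix w
  have wrd: "Lbase \<phi> L i k (wrd w) = emap \<phi> (L i k (wrd w))" for i k w
    by (simp add: Lbase_def lext_wrd)
  have lam: "Lbase \<phi> L i k (lam c b e * wrd w) = emap \<phi> (L i k (lam c b e * wrd w))" for i k c b e
    by (simp add: lam_wrd lin_diff[OF lin_Lbase] lin_diff[OF L] wrd lin_zero[OF lin_Lbase] lin_zero[OF L] rhom_diff[OF rhom_emap[OF \<phi>]] rhom_zero[OF rhom_emap[OF \<phi>]])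
  have Xm: "(\<chi> i k. Lbase \<phi> L i k (wrd w)) = map_matrix (emap \<phi>) (\<chi> i k. L i k (wrd w))"
    by (simp add: vec_eq_iff wrd)
  show "Lrel (map_matrix (fps_map \<phi>) S) (map_matrix (fps_map (fps_map \<phi>)) RI) (map_matrix (fps_map (fps_map \<phi>)) RM) (Lbase \<phi> L) (wrd w)"
    unfolding Lrel_def Xm map_Wmat[OF \<phi>, symmetric]
  proof (intro allI)
    fix i a j b e
    have "emap \<phi> (\<Sum>k\<in>UNIV. \<Sum>c\<in>UNIV. scE (S $ (k, a) $ (j, c)) * L i k (lam c b e * wrd w)) =
       emap \<phi> (fps_nth (Wmat S RI RM (\<chi> i k. L i k (wrd w)) $ (i, a) $ (j, b)) e)"
      using rel[of "wrd w"] unfolding Lrel_def by simp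
    then show "(\<Sum>k\<in>UNIV. \<Sum>c\<in>UNIV. scE (map_matrix (fps_map \<phi>) S $ (k, a) $ (j, c)) * Lbase \<phi> L i k (lam c b e * wrd w)) =
       fps_nth (map_matrix (fps_map (emap \<phi>)) (Wmat S RI RM (\<chi> i k. L i k (wrd w))) $ (i, a) $ (j, b)) e"
      by (simp add: rhom_sum[OF rhom_emap[OF \<phi>]] rhom_mult[OF rhom_emap[OF \<phi>]] emap_scE[OF \<phi>] lam)
  qed
qed

subsection \<open>Operators on series in the variables \<open>v\<^sub>1, v\<^sub>2, \<dots>\<close>\<close>

text \<open>A function of type \<open>(nat \<Rightarrow> nat) \<Rightarrow> 'e\<close> is the family of coefficients of a series in the \<open>v\<^sub>k\<close>; a series in one variable
  acts on it by multiplication in \<open>v\<^sub>k\<close>.\<close>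

definition act :: "nat \<Rightarrow> 'e::ring_1 endo fps \<Rightarrow> ((nat \<Rightarrow> nat) \<Rightarrow> 'e) endo" where
  "act k f = Endo (\<lambda>\<phi> e. \<Sum>q\<le>e k. ap (fps_nth f q) (\<phi> (e(k := e k - q))))"

lemma ap_act: "ap (act k f) \<phi> e = (\<Sum>q\<le>e k. ap (fps_nth f q) (\<phi> (e(k := e k - q))))"
  unfolding act_def by (subst ap_Endo) (auto simp: Modules.additive_def fun_eq_iff sum.distrib)

lemma ap_act_const: "ap (act k (fps_const T)) \<phi> e = ap T (\<phi> e)"
proof -
  have "ap (act k (fps_const T)) \<phi> e = (\<Sum>q\<le>e k. if q = 0 then ap T (\<phi> e) else 0)"
    unfolding ap_act by (rule sum.cong) auto
  then show ?thesis by simp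
qed

lemma act_const_indep: "act k (fps_const T) = act j (fps_const T)"
  by (rule op_eqI) (simp add: ap_act_const)

lemma rhom_act: "rhom (act k :: 'e::ring_1 endo fps \<Rightarrow> _)"
proof (rule rhomI)
  show "act k (f + g) = act k f + act k g" for f g :: "'e endo fps"
    by (rule op_eqI) (simp add: ap_act sum.distrib)
  show "act k (1 :: 'e endo fps) = 1"
    using ap_act_const[of k 1] by (intro op_eqI) simp
  show "act k (f * g) = act k f * act k g" for f g :: "'e endo fps"
  proof (rule op_eqI)
    fix \<phi> and e :: "nat \<Rightarrow> nat"
    let ?n = "e k"
    let ?t = "\<lambda>q q'. ap (fps_nth f q) (ap (fps_nth g q') (\<phi> (e(k := ?n - q - q'))))"
    have "ap (act k f * act k g) \<phi> e = (\<Sum>q\<le>?n. \<Sum>q'\<le>?n - q. ?t q q')"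
      by (simp add: ap_act ap_arg_sum)
    also have "\<dots> = (\<Sum>(q, q')\<in>Sigma {..?n} (\<lambda>q. {..?n - q}). ?t q q')" by (rule sum.Sigma) auto
    also have "\<dots> = (\<Sum>(t, q)\<in>Sigma {..?n} (\<lambda>t. {0..t}). ?t q (t - q))"
      by (rule sum.reindex_bij_witness[where i = "\<lambda>(t, q). (q, t - q)" and j = "\<lambda>(q, q'). (q + q', q)"]) auto
    also have "\<dots> = (\<Sum>t\<le>?n. \<Sum>q=0..t. ?t q (t - q))" by (rule sum.Sigma[symmetric]) auto
    also have "\<dots> = ap (act k (f * g)) \<phi> e"
      by (simp add: ap_act fps_mult_nth ap_sum)
    finally show "ap (act k (f * g)) \<phi> e = ap (act k f * act k g) \<phi> e" ..
  qed
qed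

lemma act_commute:
  assumes "\<And>q q'. fps_nth f q * fps_nth g q' = fps_nth g q' * fps_nth f q"
  shows "act k f * act j g = act j g * act k f"
proof (cases "k = j")
  case True
  have "(\<Sum>i=0..n. fps_nth f i * fps_nth g (n - i)) = (\<Sum>i=0..n. fps_nth g i * fps_nth f (n - i))" for n
    by (rule sum.reindex_bij_witness[where i = "\<lambda>i. n - i" and j = "\<lambda>i. n - i"]) (auto simp: assms)
  then have "f * g = g * f"
    by (simp add: fps_eq_iff fps_mult_nth)
  then show ?thesis using True by (simp flip: rhom_mult[OF rhom_act])
next
  case False
  show ?thesis
  proof (rule op_eqI)
    fix \<phi> and e :: "nat \<Rightarrow> nat"
    have upd: "e(k := a, j := b) = e(j := b, k := a)" for a b using False by (rule fun_upd_twist)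
    have "ap (act k f * act j g) \<phi> e = (\<Sum>q\<le>e k. \<Sum>q'\<le>e j. ap (fps_nth f q) (ap (fps_nth g q') (\<phi> (e(j := e j - q', k := e k - q)))))"
      using False by (simp add: ap_act ap_arg_sum upd)
    also have "\<dots> = (\<Sum>q'\<le>e j. \<Sum>q\<le>e k. ap (fps_nth g q') (ap (fps_nth f q) (\<phi> (e(j := e j - q', k := e k - q)))))"
      by (subst sum.swap) (simp add: ap_commute[OF assms])
    also have "\<dots> = ap (act j g * act k f) \<phi> e"
      using False by (simp add: ap_act ap_arg_sum)
    finally show "ap (act k f * act j g) \<phi> e = ap (act j g * act k f) \<phi> e" .
  qed
qed

definition msc :: "'k::comm_ring_1 fps fps \<Rightarrow> ('k, 'n) fa fps endo fps" where
  "msc = fps_map (\<lambda>s. mulL (scE s))"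

lemma rhom_msc: "rhom msc"
  unfolding msc_def by (rule rhom_fps_map[OF rhom_comp[OF rhom_mulL rhom_scE]])

definition vact :: "nat \<Rightarrow> 'k::comm_ring_1 fps fps \<Rightarrow> ((nat \<Rightarrow> nat) \<Rightarrow> ('k, 'n) fa fps) endo" where
  "vact k s = act k (msc s)"

lemma rhom_vact: "rhom (vact k)"
  unfolding vact_def by (rule rhom_comp[OF rhom_act rhom_msc])

lemma vact_const_indep: "vact k (fps_const s) = vact j (fps_const s)"
  unfolding vact_def msc_def
  by (simp add: fps_map_const rhom_zero[OF rhom_comp[OF rhom_mulL rhom_scE]]) (rule act_const_indep)

definition LpM :: "('k::comm_ring_1, 'n::finite) fa fps endo fps ^ 'n ^ 'n" where
  "LpM = map_matrix (fps_map mulL) LPm"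

definition LmM :: "('n::finite \<Rightarrow> 'n \<Rightarrow> ('k::comm_ring_1, 'n) fa fps \<Rightarrow> ('k, 'n) fa fps) \<Rightarrow> ('k, 'n) fa fps endo fps ^ 'n ^ 'n" where
  "LmM L = (\<chi> i k. fps_const (Endo (L i k)))"

lemma ap_Endo_lin: "lin T \<Longrightarrow> ap (Endo T) = T"
  by (rule ap_Endo) (rule lin_additive)

text \<open>The recursion for all y turns into one identity of matrices over the ring of operators.
  On the operator side the scalars of RM are applied before L, in \<open>Wmat\<close> they multiply
  the value L y; linearity of L and centrality of scalars identify the two.\<close>

lemma Lrel_matrix:
  fixes L :: "'n::finite \<Rightarrow> 'n \<Rightarrow> ('k::comm_ring_1, 'n) fa fps \<Rightarrow> ('k, 'n) fa fps"
  assumes L: "\<And>i j. lin (L i j)" and rel: "\<And>y. Lrel S RI RM L y"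
  shows "t1 (LmM L) ** map_matrix msc (map_matrix fps_const S) ** t2 LpM =
    map_matrix msc RI ** t2 LpM ** map_matrix msc (map_matrix fps_const (flip S)) ** t1 (LmM L) ** map_matrix msc RM"
proof -
  let ?ev = "\<lambda>y. fps_map (\<lambda>T. ap T y)"
  let ?A = "map_matrix vsc RI ** t2 LPm ** map_matrix vsc (map_matrix fps_const (flip S))"
  have ev_sum: "?ev y (sum f I) = (\<Sum>i\<in>I. ?ev y (f i))" for y I and f :: "_ \<Rightarrow> ('k, 'n) fa fps endo fps"
    by (simp add: fps_eq_iff fps_sum_nth ap_sum)
  have mm: "map_matrix msc C = map_matrix (fps_map mulL) (map_matrix vsc C)" for C :: "('k fps fps, 'n) mat2"
    by (simp add: vec_eq_iff msc_def vsc_def fps_map_comp)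
  have ml: "rhom (fps_map mulL :: ('k, 'n) fa fps fps \<Rightarrow> _)" by (rule rhom_fps_map[OF rhom_mulL])
  have A: "map_matrix msc RI ** t2 LpM ** map_matrix msc (map_matrix fps_const (flip S)) = map_matrix (fps_map mulL) ?A"
    unfolding map_matrix_mult[OF ml] mm map_matrix_t2[OF ml] LpM_def ..
  have "?ev y ((t1 (LmM L) ** map_matrix msc (map_matrix fps_const S) ** t2 LpM) $ (i, a) $ (j, b)) =
        ?ev y ((map_matrix (fps_map mulL) ?A ** t1 (LmM L) ** map_matrix msc RM) $ (i, a) $ (j, b))" for y i a j b
  proof -
    have lhs: "fps_nth (?ev y ((t1 (LmM L) ** map_matrix msc (map_matrix fps_const S) ** t2 LpM) $ (i, a) $ (j, b))) e =
        (\<Sum>k\<in>UNIV. \<Sum>c\<in>UNIV. scE (S $ (k, a) $ (j, c)) * L i k (lam c b e * y))" for e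
    proof -
      have 1: "(t1 (LmM L) ** map_matrix msc (map_matrix fps_const S)) $ (i, a) $ s =
          (\<Sum>k\<in>UNIV. LmM L $ i $ k * fps_const (mulL (scE (S $ (k, a) $ s))))" for s
      proof -
        have "(t1 (LmM L) ** map_matrix msc (map_matrix fps_const S)) $ (i, a) $ s =
           (\<Sum>k\<in>UNIV. \<Sum>a'\<in>UNIV. if a' = a then LmM L $ i $ k * fps_const (mulL (scE (S $ (k, a) $ s))) else 0)"
          unfolding nth_matrix_mult sum_pairs
          by (intro sum.cong refl) (auto simp: t1_def msc_def fps_map_const rhom_zero[OF rhom_comp[OF rhom_mulL rhom_scE]])
        then show ?thesis by simp
      qed
      have "(t1 (LmM L) ** map_matrix msc (map_matrix fps_const S) ** t2 LpM) $ (i, a) $ (j, b) =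
         (\<Sum>j'\<in>UNIV. if j' = j then (\<Sum>c\<in>UNIV. (\<Sum>k\<in>UNIV. LmM L $ i $ k * fps_const (mulL (scE (S $ (k, a) $ (j, c))))) * LpM $ c $ b) else 0)"
        unfolding nth_matrix_mult[of _ "t2 LpM"] sum_pairs 1 by (intro sum.cong refl) (auto simp: t2_def)
      then have "(t1 (LmM L) ** map_matrix msc (map_matrix fps_const S) ** t2 LpM) $ (i, a) $ (j, b) =
         (\<Sum>k\<in>UNIV. \<Sum>c\<in>UNIV. LmM L $ i $ k * (fps_const (mulL (scE (S $ (k, a) $ (j, c)))) * LpM $ c $ b))"
        by (simp add: sum_distrib_right mult.assoc) (rule sum.swap)
      then show ?thesis
        by (simp add: fps_sum_nth ap_sum LmM_def LpM_def LPm_def ap_Endo_lin[OF L] lin_scE[OF L])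
    qed
    have "?ev y ((map_matrix (fps_map mulL) ?A ** t1 (LmM L) ** map_matrix msc RM) $ (i, a) $ (j, b)) =
        Wmat S RI RM (\<chi> i k. L i k y) $ (i, a) $ (j, b)"
    proof -
      have trm: "?ev y (fps_map mulL f * t1 (LmM L) $ r $ s * msc m) = f * t1 (map_matrix fps_const (\<chi> i k. L i k y)) $ r $ s * vsc m" for f r s m
      proof (cases "snd r = snd s")
        case True
        let ?T = "L (fst r) (fst s)"
        have comm: "a * ?T (scE m * y) = a * ?T y * scE m" for a m
          unfolding lin_scE[OF L] by (simp only: scE_central mult.assoc)
        have "fps_nth (?ev y (fps_map mulL f * fps_const (Endo ?T) * msc m)) n = fps_nth (f * fps_const (?T y) * vsc m) n" for n
        proof -
          have "fps_nth (?ev y (fps_map mulL f * fps_const (Endo ?T) * msc m)) n = (\<Sum>i=0..n. fps_nth f i * ?T (scE (fps_nth m (n - i)) * y))"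
            unfolding nth_fps_map fps_mult_nth[of "_ * fps_const _"] fps_mult_right_const_nth
            by (simp add: ap_sum msc_def ap_Endo_lin[OF L])
          also have "\<dots> = fps_nth (f * fps_const (?T y) * vsc m) n"
            unfolding fps_mult_nth[of "_ * fps_const _"] fps_mult_right_const_nth comm by (simp add: vsc_def)
          finally show ?thesis .
        qed
        then show ?thesis using True
          by (simp add: t1_def LmM_def fps_ext del: nth_fps_map)
      qed (simp add: t1_def fps_eq_iff)
      show ?thesis
        unfolding Wmat_def nth_matrix_mult[of _ "map_matrix msc RM"] nth_matrix_mult[of _ "map_matrix vsc RM"]
          nth_matrix_mult[of _ "t1 (LmM L)"] nth_matrix_mult[of _ "t1 (map_matrix fps_const _)"]
        by (simp add: sum_distrib_right ev_sum trm)
    qed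
    then show ?thesis
      using rel[of y] by (simp add: fps_eq_iff lhs Lrel_def del: nth_fps_map) 
  qed
  then have "ap (fps_nth ((t1 (LmM L) ** map_matrix msc (map_matrix fps_const S) ** t2 LpM) $ (i, a) $ (j, b)) e) y =
     ap (fps_nth ((map_matrix (fps_map mulL) ?A ** t1 (LmM L) ** map_matrix msc RM) $ (i, a) $ (j, b)) e) y" for y i a j b e
    by (simp add: fps_eq_iff)
  then have "t1 (LmM L) ** map_matrix msc (map_matrix fps_const S) ** t2 LpM = map_matrix (fps_map mulL) ?A ** t1 (LmM L) ** map_matrix msc RM"
    by (auto simp: vec_eq_iff fps_eq_iff intro: endo_eqI)
  then show ?thesis by (simp only: A)
qed

subsection \<open>Exchange relations\<close>

lemma prod_list_commute:
  fixes a :: "'a::monoid_mult"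
  shows "(\<And>x. x \<in> set xs \<Longrightarrow> a * x = x * a) \<Longrightarrow> a * prod_list xs = prod_list xs * a"
proof (induction xs)
  case (Cons x xs)
  have IH: "a * prod_list xs = prod_list xs * a" by (rule Cons.IH) (rule Cons.prems, simp)
  have x: "a * x = x * a" by (rule Cons.prems) simp
  have "a * prod_list (x # xs) = (a * x) * prod_list xs" by (simp only: prod_list.Cons mult.assoc)
  also have "\<dots> = x * (a * prod_list xs)" by (simp only: x mult.assoc)
  finally show ?case by (simp only: IH prod_list.Cons mult.assoc)
qed simp

lemma mult_tail: "a * b = c * d \<Longrightarrow> a * (b * t) = c * (d * t)" for a b c d t :: "'a::monoid_mult"
  by (simp only: mult.assoc[symmetric])

lemma mulL_scE_commute: "mulL (scE s) * mulL a = mulL a * mulL (scE s)"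
  by (simp only: rhom_mult[OF rhom_mulL, symmetric] scE_central[of s a])

lemma vact_commute: "vact k a * vact j b = vact j b * vact k a"
  unfolding vact_def by (rule act_commute, unfold msc_def nth_fps_map, rule mulL_scE_commute)

text \<open>\<open>cm\<close> embeds C[[h]] in the series over the base ring and \<open>Zv\<close>
  plays the role of e^{2v/a}. The locale is interpreted over constants, over series in u, and over
  series in u and v.\<close>

locale Lcalc =
  fixes R :: "(complex fps, 'n::finite) mat2" and cm :: "complex fps \<Rightarrow> 'k::comm_ring_1 fps" and Zv :: "'k fps fps"
    and Q :: "'n \<Rightarrow> 'n \<Rightarrow> 'n \<Rightarrow> 'n \<Rightarrow> complex fps"
  assumes hecke_R: "hecke_symmetry R" and cm: "rhom cm"
    and Q_left: "\<And>m c m' c'. (\<Sum>a\<in>UNIV. \<Sum>j\<in>UNIV. Q m c a j * RP R $ (m', a) $ (j, c')) = (if m = m' \<and> c = c' then 1 else 0)"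
    and Q_right: "\<And>a j a' j'. (\<Sum>m\<in>UNIV. \<Sum>c\<in>UNIV. RP R $ (m, a) $ (j, c) * Q m c a' j') = (if a = a' \<and> j = j' then 1 else 0)"
begin

definition eta :: "complex fps \<Rightarrow> ((nat \<Rightarrow> nat) \<Rightarrow> ('k, 'n) fa fps) endo" where
  "eta c = vact 0 (fps_const (cm c))"

lemma vact_eta: "vact k (fps_const (cm c)) = eta c"
  unfolding eta_def by (rule vact_const_indep)

lemma rhom_eta: "rhom eta"
  unfolding eta_def[abs_def] by (rule rhom_comp[OF rhom_vact], rule rhom_comp[OF rhom_fps_const], rule cm)

sublocale skew_legs R eta Q
  by (rule skew_legs.intro, rule hecke_legs.intro, rule hecke_R, rule rhom_eta, rule skew_legs_axioms.intro, rule Q_left, rule Q_right)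

definition Sc :: "('k fps, 'n) mat2" where "Sc = map_matrix cm (RP R)"

definition Dm :: "'k fps fps \<Rightarrow> 'k fps fps \<Rightarrow> ('k fps fps, 'n) mat2" where
  "Dm z w = (\<chi> x y. z * fps_const (cm (flip (RP R) $ x $ y)) - w * fps_const (cm (PRi R $ x $ y)))"

text \<open>In the application \<open>zp\<close> and \<open>zm\<close> are e^{2(u + hc/2)/a} and
  e^{2(u - hc/2)/a}. The scalars \<open>\<sigma>\<close> stay anonymous: they are central and occur
  equally on both sides of the exchange relations.\<close>

definition Lgood where
  "Lgood L zp zm RI RM \<longleftrightarrow> (\<forall>i k. lin (L i k)) \<and> (\<forall>y. Lrel Sc RI RM L y) \<and> (\<forall>i j. L i j 1 = (if i = j then 1 else 0)) \<and>
     (\<exists>\<sigma>. map_matrix ((*) \<sigma>) (Dm (fps_const zp) Zv) ** RI = mat 1 \<and> RI ** map_matrix ((*) \<sigma>) (Dm (fps_const zp) Zv) = mat 1) \<and>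
     (\<exists>\<sigma>. RM = flip (map_matrix ((*) \<sigma>) (Dm (fps_const zm) Zv)))"

abbreviation va :: "nat \<Rightarrow> 'k fps fps \<Rightarrow> ((nat \<Rightarrow> nat) \<Rightarrow> ('k, 'n) fa fps) endo" where "va \<equiv> vact"

abbreviation vl :: "nat \<Rightarrow> nat \<Rightarrow> nat \<Rightarrow> ('k fps fps, 'n) mat2 \<Rightarrow> ((nat \<Rightarrow> 'n) \<Rightarrow> (nat \<Rightarrow> nat) \<Rightarrow> ('k, 'n) fa fps) endo" where
  "vl k r s A \<equiv> l2 r s (map_matrix (vact k) A)"

definition Lm :: "nat \<Rightarrow> ('n \<Rightarrow> 'n \<Rightarrow> ('k, 'n) fa fps \<Rightarrow> ('k, 'n) fa fps) \<Rightarrow> ((nat \<Rightarrow> 'n) \<Rightarrow> (nat \<Rightarrow> nat) \<Rightarrow> ('k, 'n) fa fps) endo" where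
  "Lm r L = l1 r (map_matrix (act 0) (LmM L))"

definition Lp :: "nat \<Rightarrow> ((nat \<Rightarrow> 'n) \<Rightarrow> (nat \<Rightarrow> nat) \<Rightarrow> ('k, 'n) fa fps) endo" where
  "Lp k = l1 k (map_matrix (act k) LpM)"

abbreviation Zk :: "nat \<Rightarrow> ((nat \<Rightarrow> nat) \<Rightarrow> ('k, 'n) fa fps) endo" where "Zk k \<equiv> vact k Zv"
abbreviation zc :: "'k fps \<Rightarrow> ((nat \<Rightarrow> nat) \<Rightarrow> ('k, 'n) fa fps) endo" where "zc z \<equiv> vact 0 (fps_const z)"

lemma zc_indep: "va k (fps_const z) = zc z"
  by (rule vact_const_indep)

lemma scalar_vact: "scalar (vact k s)"
  unfolding scalar_def eta_def by (simp add: vact_commute)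

lemma S_vl: "r \<noteq> s \<Longrightarrow> vl k r s (map_matrix fps_const Sc) = S r s"
  by (simp add: S_def Sc_def map_matrix_comp vact_eta)

lemma S_flip_vl: "r \<noteq> s \<Longrightarrow> vl k r s (map_matrix fps_const (flip Sc)) = S s r"
proof -
  assume rs: "r \<noteq> s"
  have "map_matrix (vact k) (map_matrix fps_const (flip Sc)) = flip (map_matrix eta (RP R))"
    by (simp add: vec_eq_iff nth_flip Sc_def vact_eta)
  then show ?thesis using rs by (simp add: S_def l2_flip)
qed

lemma D_Dm:
  assumes rs: "r \<noteq> s"
  shows "vl k r s (Dm z w) = D r s (vact k z) (vact k w)"
proof -
  have "map_matrix (vact k) (Dm z w) = map_matrix ((*) (vact k z)) (flip (map_matrix eta (RP R))) - map_matrix ((*) (vact k w)) (map_matrix eta (PRi R))"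
    by (simp add: vec_eq_iff nth_flip Dm_def rhom_diff[OF rhom_vact] rhom_mult[OF rhom_vact] vact_eta)
  then show ?thesis
    using rs by (simp add: l2_diff l2_zs D_def S_def Si_def l2_flip)
qed

lemma vl_scale: "vl k r s (map_matrix ((*) \<sigma>) A) = zs (vact k \<sigma>) * vl k r s A"
proof -
  have "map_matrix (va k) (map_matrix ((*) \<sigma>) A) = map_matrix ((*) (va k \<sigma>)) (map_matrix (va k) A)"
    by (simp add: vec_eq_iff rhom_mult[OF rhom_vact])
  then show ?thesis by (simp add: l2_zs)
qed

lemma vl_mult: "r \<noteq> s \<Longrightarrow> vl k r s A * vl k r s B = vl k r s (A ** B)"
  by (simp add: l2_mult map_matrix_mult[OF rhom_vact])

lemma op_rel:
  assumes rk: "r \<noteq> k" and L: "Lgood L zp zm RI RM"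
  shows "Lm r L * S r k * Lp k = vl k r k RI * Lp k * S k r * Lm r L * vl k r k RM"
proof -
  have Lrel: "t1 (LmM L) ** map_matrix msc (map_matrix fps_const Sc) ** t2 LpM =
    map_matrix msc RI ** t2 LpM ** map_matrix msc (map_matrix fps_const (flip Sc)) ** t1 (LmM L) ** map_matrix msc RM"
    by (rule Lrel_matrix) (use L in \<open>auto simp: Lgood_def\<close>)
  have m: "map_matrix (act k) (map_matrix msc A) = map_matrix (vact k) A" for A :: "('k fps fps, 'n) mat2"
    by (simp add: vec_eq_iff vact_def)
  have c: "map_matrix (act k) (LmM L) = map_matrix (act 0) (LmM L)"
    using act_const_indep by (auto simp: vec_eq_iff LmM_def)
  have "l2 r k (map_matrix (act k) (t1 (LmM L) ** map_matrix msc (map_matrix fps_const Sc) ** t2 LpM)) = Lm r L * S r k * Lp k"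
    unfolding map_matrix_mult[OF rhom_act] map_matrix_t1[OF rhom_act] map_matrix_t2[OF rhom_act] m c
    using rk by (simp add: l2_mult[symmetric] l2_t1 l2_t2 S_vl Lm_def Lp_def)
  moreover have "l2 r k (map_matrix (act k) (map_matrix msc RI ** t2 LpM ** map_matrix msc (map_matrix fps_const (flip Sc)) ** t1 (LmM L) ** map_matrix msc RM)) =
      vl k r k RI * Lp k * S k r * Lm r L * vl k r k RM"
    unfolding map_matrix_mult[OF rhom_act] map_matrix_t1[OF rhom_act] map_matrix_t2[OF rhom_act] m c
    using rk by (simp add: l2_mult[symmetric] l2_t1 l2_t2 S_flip_vl Lm_def Lp_def)
  ultimately show ?thesis by (simp add: Lrel)
qed

text \<open>The legs are different, and the entries of L are linear over the scalars that occur in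
  A; this linearity is where operators on the algebra and coefficients of R meet.\<close>

lemma Lm_vl:
  assumes "r \<noteq> s" "r \<noteq> t" and L: "\<And>i k. lin (L i k)"
  shows "Lm r L * vl k s t A = vl k s t A * Lm r L"
  unfolding Lm_def
proof (rule l1_l2_commute)
  fix x y x' y'
  have "Endo (L x y) * mulL (scE s) = mulL (scE s) * Endo (L x y)" for s
    by (rule endo_eqI) (simp add: ap_Endo_lin[OF L] lin_scE[OF L])
  then show "map_matrix (act 0) (LmM L) $ x $ y * map_matrix (vact k) A $ x' $ y' = map_matrix (vact k) A $ x' $ y' * map_matrix (act 0) (LmM L) $ x $ y"
    unfolding nth_map_matrix vact_def by (intro act_commute) (auto simp: LmM_def msc_def)
qed (use assms in auto)

lemma Lp_vl:
  assumes "j \<noteq> s" "j \<noteq> t"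
  shows "Lp j * vl k s t A = vl k s t A * Lp j"
  unfolding Lp_def
proof (rule l1_l2_commute)
  fix x y x' y'
  show "map_matrix (act j) LpM $ x $ y * map_matrix (vact k) A $ x' $ y' = map_matrix (vact k) A $ x' $ y' * map_matrix (act j) LpM $ x $ y"
    unfolding nth_map_matrix vact_def by (rule act_commute) (simp add: LpM_def msc_def mulL_scE_commute)
qed (use assms in auto)

lemma Lm_S: "r \<noteq> s \<Longrightarrow> r \<noteq> t \<Longrightarrow> s \<noteq> t \<Longrightarrow> (\<And>i k. lin (L i k)) \<Longrightarrow> Lm r L * S s t = S s t * Lm r L"
  using Lm_vl[of r s t L 0 "map_matrix fps_const Sc"] by (simp add: S_vl)

lemma Lp_S: "j \<noteq> s \<Longrightarrow> j \<noteq> t \<Longrightarrow> s \<noteq> t \<Longrightarrow> Lp j * S s t = S s t * Lp j"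
  using Lp_vl[of j s t 0 "map_matrix fps_const Sc"] by (simp add: S_vl)

lemma vl_vl:
  "r \<noteq> t \<Longrightarrow> r \<noteq> u \<Longrightarrow> s \<noteq> t \<Longrightarrow> s \<noteq> u \<Longrightarrow> vl k r s A * vl j t u B = vl j t u B * vl k r s A"
  by (rule l2_l2_commute) (simp_all add: vact_commute)

lemma vl_S: "r \<noteq> t \<Longrightarrow> r \<noteq> u \<Longrightarrow> s \<noteq> t \<Longrightarrow> s \<noteq> u \<Longrightarrow> t \<noteq> u \<Longrightarrow> vl k r s A * S t u = S t u * vl k r s A"
  using vl_vl[of r t u s k A 0 "map_matrix fps_const Sc"] by (simp add: S_vl)

lemma S_S: "r \<noteq> t \<Longrightarrow> r \<noteq> u \<Longrightarrow> s \<noteq> t \<Longrightarrow> s \<noteq> u \<Longrightarrow> r \<noteq> s \<Longrightarrow> t \<noteq> u \<Longrightarrow> S r s * S t u = S t u * S r s"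
  using vl_S[of r t u s 0 "map_matrix fps_const Sc"] by (simp add: S_vl)

lemma zs_vl: "zs (vact k a) * vl j r s A = vl j r s A * zs (vact k a)"
  by (rule zs_l2_commute) (simp add: vact_commute)

lemma zs_S: "zs (vact k a) * S r s = S r s * zs (vact k a)" "zs (vact k a) * D r s (vact i z) (vact j w) = D r s (vact i z) (vact j w) * zs (vact k a)"
proof -
  have 1: "zs (vact k a) * S r s = S r s * zs (vact k a)" "zs (vact k a) * Si r s = Si r s * zs (vact k a)" for r s
    using scalar_S[OF scalar_vact] by auto
  have 2: "zs (vact k a) * zs (vact j b) = zs (vact j b) * zs (vact k a)" for j b
    by (simp add: vact_commute flip: rhom_mult[OF rhom_zs])
  show "zs (vact k a) * S r s = S r s * zs (vact k a)" by (rule 1)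
  show "zs (vact k a) * D r s (vact i z) (vact j w) = D r s (vact i z) (vact j w) * zs (vact k a)"
    unfolding D_def left_diff_distrib right_diff_distrib
    by (simp add: mult.assoc 1[symmetric]) (simp add: mult.assoc[symmetric] 2)
qed

lemma zs_Lp: "zs (vact k a) * Lp j = Lp j * zs (vact k a)"
  unfolding Lp_def
proof (rule zs_l1_commute)
  show "vact k a * map_matrix (act j) LpM $ x $ y = map_matrix (act j) LpM $ x $ y * vact k a" for x y
    unfolding nth_map_matrix vact_def by (rule act_commute) (simp add: LpM_def msc_def mulL_scE_commute)
qed

lemma RM_form:
  assumes "Lgood L zp zm RI RM" "r \<noteq> k"
  obtains \<sigma> where "vl k r k RM = zs (vact k \<sigma>) * D k r (zc zm) (Zk k)"
proof -
  obtain \<sigma> where "RM = flip (map_matrix ((*) \<sigma>) (Dm (fps_const zm) Zv))"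
    using assms(1) by (auto simp: Lgood_def)
  then have "vl k r k RM = vl k k r (map_matrix ((*) \<sigma>) (Dm (fps_const zm) Zv))"
    using assms(2) by (simp add: map_matrix_flip l2_flip)
  also have "\<dots> = zs (vact k \<sigma>) * D k r (zc zm) (Zk k)"
    using assms(2) by (simp add: vl_scale D_Dm zc_indep[of k])
  finally show ?thesis by (rule that)
qed

lemma RI_form:
  assumes "Lgood L zp zm RI RM" "r \<noteq> k"
  obtains \<sigma> where "zs (vact k \<sigma>) * D r k (zc zp) (Zk k) * vl k r k RI = 1" "vl k r k RI * (zs (vact k \<sigma>) * D r k (zc zp) (Zk k)) = 1"
proof -
  obtain \<sigma> where \<sigma>: "map_matrix ((*) \<sigma>) (Dm (fps_const zp) Zv) ** RI = mat 1" "RI ** map_matrix ((*) \<sigma>) (Dm (fps_const zp) Zv) = mat 1"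
    using assms(1) by (auto simp: Lgood_def)
  have "vl k r k (map_matrix ((*) \<sigma>) (Dm (fps_const zp) Zv)) = zs (vact k \<sigma>) * D r k (zc zp) (Zk k)"
    using assms(2) by (simp add: vl_scale D_Dm zc_indep[of k])
  then show ?thesis
    using that[of \<sigma>] vl_mult[OF assms(2), of k "map_matrix ((*) \<sigma>) (Dm (fps_const zp) Zv)" RI]
      vl_mult[OF assms(2), of k RI "map_matrix ((*) \<sigma>) (Dm (fps_const zp) Zv)"] \<sigma>
    by (simp add: map_matrix_one[OF rhom_vact] l2_one)
qed

lemma inverse_move:
  fixes p :: "'z::monoid_mult"
  assumes "p * q = 1" "q * p = 1" "p * A = B * p"
  shows "A * q = q * B"
proof -
  have "A * q = (q * p) * A * q" by (simp add: assms)
  also have "\<dots> = q * (p * A) * q" by (simp only: mult.assoc)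
  also have "\<dots> = q * B * (p * q)" by (simp only: assms(3) mult.assoc)
  finally show ?thesis by (simp add: assms)
qed

lemma RM_SS:
  assumes L: "Lgood L zp zm RI RM" and d: "r \<noteq> k" "r \<noteq> j" "k \<noteq> j"
  shows "vl k r k RM * (S r j * S k j) = S k j * (S r j * vl k r k RM)"
proof -
  obtain \<sigma> where RM: "vl k r k RM = zs (vact k \<sigma>) * D k r (zc zm) (Zk k)" using RM_form[OF L d(1)] .
  have z: "S p q * (zs (vact k \<sigma>) * t) = zs (vact k \<sigma>) * (S p q * t)" for p q t
    by (rule mult_tail) (rule zs_S(1)[symmetric])
  have D: "D k r (zc zm) (Zk k) * (S r j * S k j) = S k j * (S r j * D k r (zc zm) (Zk k))"
    using D_SS(1)[of k r j "zc zm" "Zk k"] d scalar_vact by (simp add: mult.assoc)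
  show ?thesis unfolding RM by (simp only: mult.assoc D z)
qed

lemma SS_RI:
  assumes L: "Lgood L zp zm RI RM" and d: "r \<noteq> k" "r \<noteq> j" "k \<noteq> j"
  shows "S k r * (S k j * vl j r j RI) = vl j r j RI * (S k j * S k r)"
proof -
  obtain \<sigma> where RI: "zs (vact j \<sigma>) * D r j (zc zp) (Zk j) * vl j r j RI = 1" "vl j r j RI * (zs (vact j \<sigma>) * D r j (zc zp) (Zk j)) = 1"
    using RI_form[OF L d(2)] .
  have z: "S p q * (zs (vact j \<sigma>) * t) = zs (vact j \<sigma>) * (S p q * t)" for p q t
    by (rule mult_tail) (rule zs_S(1)[symmetric])
  have D: "D r j (zc zp) (Zk j) * (S k r * S k j) = S k j * (S k r * D r j (zc zp) (Zk j))"
    using D_SS(2)[of k r j "zc zp" "Zk j"] d scalar_vact by (simp add: mult.assoc)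
  have "zs (vact j \<sigma>) * D r j (zc zp) (Zk j) * (S k r * S k j) = S k j * S k r * (zs (vact j \<sigma>) * D r j (zc zp) (Zk j))"
    by (simp only: mult.assoc D z)
  from inverse_move[OF RI this] show ?thesis by (simp only: mult.assoc)
qed

section \<open>L^- moved through products of L^+\<close>

abbreviation SP :: "nat \<Rightarrow> nat list \<Rightarrow> ((nat \<Rightarrow> 'n) \<Rightarrow> (nat \<Rightarrow> nat) \<Rightarrow> ('k, 'n) fa fps) endo" where
  "SP r ks \<equiv> prod_list (map (S r) ks)"

text \<open>L^+_[n](v) for an arbitrary list of labels. The defining relation of the algebra
  compares the lists 1, 2 and 2, 1.\<close>

fun LL :: "nat list \<Rightarrow> ((nat \<Rightarrow> 'n) \<Rightarrow> (nat \<Rightarrow> nat) \<Rightarrow> ('k, 'n) fa fps) endo" where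
  "LL [] = 1"
| "LL (k # ks) = Lp k * SP k ks * LL ks"

lemma vl_LL:
  "distinct ks \<Longrightarrow> r \<notin> set ks \<Longrightarrow> s \<notin> set ks \<Longrightarrow> vl k r s A * LL ks = LL ks * vl k r s A"
proof (induction ks)
  case (Cons j js)
  have 1: "vl k r s A * SP j js = SP j js * vl k r s A"
    by (rule prod_list_commute) (use Cons.prems in \<open>auto intro!: vl_S\<close>)
  have 2: "vl k r s A * Lp j = Lp j * vl k r s A"
    using Cons.prems by (intro Lp_vl[symmetric]) auto
  have 3: "vl k r s A * LL js = LL js * vl k r s A" using Cons by auto
  show ?case
    by (simp only: LL.simps mult.assoc) (simp only: 3 1[THEN mult_tail] 2[THEN mult_tail])
qed simp

lemma S_LL: "distinct ks \<Longrightarrow> r \<notin> set ks \<Longrightarrow> s \<notin> set ks \<Longrightarrow> r \<noteq> s \<Longrightarrow> S r s * LL ks = LL ks * S r s"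
  using vl_LL[of ks r s 0 "map_matrix fps_const Sc"] by (simp add: S_vl)

lemma RM_SP:
  assumes L: "Lgood L zp zm RI RM"
  shows "r \<noteq> k \<Longrightarrow> distinct js \<Longrightarrow> r \<notin> set js \<Longrightarrow> k \<notin> set js \<Longrightarrow>
    vl k r k RM * (SP r js * SP k js) = SP k js * (SP r js * vl k r k RM)"
proof (induction js)
  case (Cons j js)
  have c1: "SP r js * S k j = S k j * SP r js" "S r j * SP k js = SP k js * S r j"
    using Cons.prems by (auto intro!: prod_list_commute prod_list_commute[symmetric] S_S)
  have c2: "vl k r k RM * (S r j * S k j) = S k j * (S r j * vl k r k RM)"
    using Cons.prems by (intro RM_SS[OF L]) auto
  have IH: "vl k r k RM * (SP r js * SP k js) = SP k js * (SP r js * vl k r k RM)"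
    using Cons by auto
  have "vl k r k RM * (SP r (j # js) * SP k (j # js)) = vl k r k RM * (S r j * S k j) * (SP r js * SP k js)"
    by (simp add: mult.assoc) (simp only: c1(1)[THEN mult_tail])
  also have "\<dots> = S k j * (S r j * (vl k r k RM * (SP r js * SP k js)))" by (simp only: c2 mult.assoc)
  also have "\<dots> = S k j * (SP k js * (S r j * (SP r js * vl k r k RM)))" by (simp only: IH c1(2)[THEN mult_tail])
  finally show ?case by (simp add: mult.assoc)
qed simp

lemma SP_RI:
  assumes L: "Lgood L zp zm RI RM"
  shows "r \<noteq> k \<Longrightarrow> distinct js \<Longrightarrow> r \<notin> set js \<Longrightarrow> k \<notin> set js \<Longrightarrow>
    S k r * (SP k js * prod_list (map (\<lambda>j. vl j r j RI) js)) = prod_list (map (\<lambda>j. vl j r j RI) js) * (SP k js * S k r)"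
proof (induction js)
  case (Cons j js)
  let ?P = "prod_list (map (\<lambda>j. vl j r j RI) js)"
  have c1: "SP k js * vl j r j RI = vl j r j RI * SP k js" "S k j * ?P = ?P * S k j"
    using Cons.prems by (auto intro!: prod_list_commute prod_list_commute[symmetric] vl_S vl_S[symmetric])
  have c2: "S k r * (S k j * vl j r j RI) = vl j r j RI * (S k j * S k r)"
    using Cons.prems by (intro SS_RI[OF L]) auto
  have IH: "S k r * (SP k js * ?P) = ?P * (SP k js * S k r)" using Cons by auto
  have "S k r * (SP k (j # js) * prod_list (map (\<lambda>j. vl j r j RI) (j # js))) = S k r * (S k j * vl j r j RI) * (SP k js * ?P)"
    by (simp add: mult.assoc) (simp only: c1(1)[THEN mult_tail])
  also have "\<dots> = vl j r j RI * (S k j * (S k r * (SP k js * ?P)))" by (simp only: c2 mult.assoc)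
  also have "\<dots> = vl j r j RI * (?P * (S k j * (SP k js * S k r)))" by (simp only: IH c1(2)[THEN mult_tail])
  finally show ?case by (simp add: mult.assoc)
qed simp

text \<open>Induction on the list: \<open>op_rel\<close> moves L^- past the first label. Before the
  induction hypothesis applies, the factor RM left behind has to cross both rows of RP factors, by
  \<open>RM_SP\<close>; afterwards RP_k0 has to cross the new inverse factors, by
  \<open>SP_RI\<close>. L^- stays in the product on the right, where it later acts on
  scalars.\<close>

theorem Lm_LL:
  assumes L: "Lgood L zp zm RI RM"
  shows "distinct ks \<Longrightarrow> r \<notin> set ks \<Longrightarrow>
    Lm r L * (SP r ks * LL ks) = prod_list (map (\<lambda>k. vl k r k RI) ks) *
      (LL ks * (prod_list (map (\<lambda>k. S k r) ks) * (Lm r L * prod_list (map (\<lambda>k. vl k r k RM) (rev ks)))))"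
proof (induction ks)
  case (Cons k ks)
  then have d: "r \<noteq> k" "distinct ks" "r \<notin> set ks" "k \<notin> set ks" by auto
  have lin: "lin (L i j)" for i j using L by (auto simp: Lgood_def)
  let ?RI = "prod_list (map (\<lambda>k. vl k r k RI) ks)" and ?RM = "prod_list (map (\<lambda>k. vl k r k RM) (rev ks))"
    and ?T = "prod_list (map (\<lambda>k. S k r) ks)" and ?A = "vl k r k RI" and ?B = "vl k r k RM"
  have a: "SP r ks * Lp k = Lp k * SP r ks"
    by (rule prod_list_commute[symmetric]) (use d in \<open>auto intro!: Lp_S\<close>)
  have b: "?B * LL ks = LL ks * ?B" using d by (intro vl_LL)
  have c: "Lm r L * SP k ks = SP k ks * Lm r L"
    by (rule prod_list_commute) (use d lin in \<open>auto intro!: Lm_S\<close>)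
  have e: "S k r * LL ks = LL ks * S k r" using d by (intro S_LL) auto
  have f: "Lp k * ?RI = ?RI * Lp k"
    by (rule prod_list_commute) (use d in \<open>auto intro!: Lp_vl\<close>)
  have op: "Lm r L * (S r k * Lp k) = ?A * (Lp k * (S k r * (Lm r L * ?B)))"
    using op_rel[OF d(1) L] by (simp only: mult.assoc)
  have IH: "Lm r L * (SP r ks * LL ks) = ?RI * (LL ks * (?T * (Lm r L * ?RM)))"
    using Cons.IH d by simp
  have "Lm r L * (SP r (k # ks) * LL (k # ks)) = (Lm r L * (S r k * Lp k)) * (SP r ks * (SP k ks * LL ks))"
    by (simp add: mult.assoc) (simp only: a[THEN mult_tail])
  also have "\<dots> = ?A * (Lp k * (S k r * (Lm r L * (?B * (SP r ks * SP k ks) * LL ks))))"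
    by (simp only: op mult.assoc)
  also have "\<dots> = ?A * (Lp k * (S k r * (Lm r L * (SP k ks * (SP r ks * (?B * LL ks))))))"
    by (simp only: RM_SP[OF L d] mult.assoc)
  also have "\<dots> = ?A * (Lp k * (S k r * (SP k ks * (Lm r L * (SP r ks * LL ks) * ?B))))"
    by (simp only: b c[THEN mult_tail] mult.assoc)
  also have "\<dots> = ?A * (Lp k * (S k r * (SP k ks * ?RI) * (LL ks * (?T * (Lm r L * (?RM * ?B))))))"
    by (simp only: IH mult.assoc)
  also have "\<dots> = ?A * (?RI * (Lp k * (SP k ks * (S k r * LL ks * (?T * (Lm r L * (?RM * ?B)))))))"
    by (simp only: SP_RI[OF L d] mult.assoc f[THEN mult_tail])
  also have "\<dots> = ?A * (?RI * (Lp k * (SP k ks * (LL ks * (S k r * (?T * (Lm r L * (?RM * ?B))))))))"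
    by (simp only: e mult.assoc)
  finally show ?case by (simp add: mult.assoc)
qed simp

text \<open>The defining relation of the algebra, with the scalar factors and the pole of \<open>R(v\<^sub>1 - v\<^sub>2)\<close> cleared.\<close>

definition Rel :: "((nat \<Rightarrow> 'n) \<Rightarrow> (nat \<Rightarrow> nat) \<Rightarrow> ('k, 'n) fa fps) endo" where
  "Rel = D 1 2 (Zk 1) (Zk 2) * (Lp 1 * (S 1 2 * Lp 2)) - Lp 2 * (S 2 1 * (Lp 1 * D 2 1 (Zk 1) (Zk 2)))"

lemma Lm_D: "r \<noteq> s \<Longrightarrow> r \<noteq> t \<Longrightarrow> s \<noteq> t \<Longrightarrow> (\<And>i k. lin (L i k)) \<Longrightarrow>
   Lm r L * D s t (vact i z) (vact j w) = D s t (vact i z) (vact j w) * Lm r L"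
proof -
  assume d: "r \<noteq> s" "r \<noteq> t" "s \<noteq> t" and L: "\<And>i k. lin (L i k)"
  have Si: "Si s t = vl 0 s t (map_matrix (\<lambda>c. fps_const (cm c)) (PRi R))"
    by (simp add: Si_def map_matrix_comp vact_eta)
  have z: "Lm r L * zs (vact k a) = zs (vact k a) * Lm r L" for k a
  proof -
    have "zs (vact k a) = vl k s t (map_matrix ((*) a) (mat 1))"
      by (simp only: vl_scale map_matrix_one[OF rhom_vact] l2_one mult_1_right)
    then show ?thesis using Lm_vl[OF d(1,2) L] by simp
  qed
  have 1: "Lm r L * S t s = S t s * Lm r L" "Lm r L * Si s t = Si s t * Lm r L"
    using d L unfolding Si by (auto intro: Lm_S Lm_vl)
  show ?thesis
    unfolding D_def left_diff_distrib right_diff_distrib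
    by (simp only: mult.assoc z[THEN mult_tail] 1)
qed

text \<open>The Yang--Baxter equation on the legs 0, 1, 2 with the two factors on leg 0 brought to
  the other side as inverses; their scalar factors are central and cancel.\<close>

lemma D_RI_RI:
  assumes L: "Lgood L zp zm RI RM"
  shows "D 1 2 (Zk 1) (Zk 2) * (vl 1 0 1 RI * vl 2 0 2 RI) = vl 2 0 2 RI * (vl 1 0 1 RI * D 1 2 (Zk 1) (Zk 2))"
proof -
  let ?D = "D 1 2 (Zk 1) (Zk 2)"
  have n: "(0::nat) \<noteq> 1" "(0::nat) \<noteq> 2" by auto
  obtain \<sigma> where A: "zs (vact 1 \<sigma>) * D 0 1 (zc zp) (Zk 1) * vl 1 0 1 RI = 1" "vl 1 0 1 RI * (zs (vact 1 \<sigma>) * D 0 1 (zc zp) (Zk 1)) = 1"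
    using RI_form[OF L n(1)] .
  obtain \<tau> where B: "zs (vact 2 \<tau>) * D 0 2 (zc zp) (Zk 2) * vl 2 0 2 RI = 1" "vl 2 0 2 RI * (zs (vact 2 \<tau>) * D 0 2 (zc zp) (Zk 2)) = 1"
    using RI_form[OF L n(2)] .
  let ?A = "zs (vact 1 \<sigma>) * D 0 1 (zc zp) (Zk 1)" and ?B = "zs (vact 2 \<tau>) * D 0 2 (zc zp) (Zk 2)"
  have yb: "D 0 1 (zc zp) (Zk 1) * (D 0 2 (zc zp) (Zk 2) * ?D) = ?D * (D 0 2 (zc zp) (Zk 2) * D 0 1 (zc zp) (Zk 1))"
    using D_YB(1)[of 0 1 2 "zc zp" "Zk 1" "Zk 2"] by (simp add: scalar_vact vact_commute mult.assoc)
  have z: "D r s (vact i z) (vact j w) * (zs (vact k a) * t) = zs (vact k a) * (D r s (vact i z) (vact j w) * t)" for r s i z j w k a t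
    by (rule mult_tail) (rule zs_S(2)[symmetric])
  have z': "zs (vact 2 \<tau>) * (zs (vact 1 \<sigma>) * t) = zs (vact 1 \<sigma>) * (zs (vact 2 \<tau>) * t)" for t :: "((nat \<Rightarrow> 'n) \<Rightarrow> (nat \<Rightarrow> nat) \<Rightarrow> ('k, 'n) fa fps) endo"
    by (rule mult_tail) (simp add: vact_commute flip: rhom_mult[OF rhom_zs])
  have "?A * (?B * ?D) = ?D * (?B * ?A)"
    by (simp only: mult.assoc z yb z')
  then have "(?A * ?B) * ?D = ?D * (?B * ?A)" by (simp only: mult.assoc)
  moreover have "(?B * ?A) * (vl 1 0 1 RI * vl 2 0 2 RI) = 1"
  proof -
    have "(?B * ?A) * (vl 1 0 1 RI * vl 2 0 2 RI) = ?B * ((?A * vl 1 0 1 RI) * vl 2 0 2 RI)" by (simp only: mult.assoc)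
    then show ?thesis by (simp only: A B mult_1_left)
  qed
  moreover have "(vl 2 0 2 RI * vl 1 0 1 RI) * (?A * ?B) = 1"
  proof -
    have "(vl 2 0 2 RI * vl 1 0 1 RI) * (?A * ?B) = vl 2 0 2 RI * ((vl 1 0 1 RI * ?A) * ?B)" by (simp only: mult.assoc)
    then show ?thesis by (simp only: A B mult_1_left)
  qed
  ultimately have "?D * (vl 1 0 1 RI * vl 2 0 2 RI) = (vl 2 0 2 RI * vl 1 0 1 RI) * ?D"
    by (metis (no_types) mult.assoc mult_1_left mult_1_right)
  then show ?thesis by (simp only: mult.assoc)
qed

lemma RM_RM_D:
  assumes L: "Lgood L zp zm RI RM"
  shows "vl 1 0 1 RM * (vl 2 0 2 RM * D 2 1 (Zk 1) (Zk 2)) = D 2 1 (Zk 1) (Zk 2) * (vl 2 0 2 RM * vl 1 0 1 RM)"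
proof -
  let ?D = "D 2 1 (Zk 1) (Zk 2)"
  have n: "(0::nat) \<noteq> 1" "(0::nat) \<noteq> 2" by auto
  obtain \<sigma> where A: "vl 1 0 1 RM = zs (vact 1 \<sigma>) * D 1 0 (zc zm) (Zk 1)" using RM_form[OF L n(1)] .
  obtain \<tau> where B: "vl 2 0 2 RM = zs (vact 2 \<tau>) * D 2 0 (zc zm) (Zk 2)" using RM_form[OF L n(2)] .
  have yb: "D 1 0 (zc zm) (Zk 1) * (D 2 0 (zc zm) (Zk 2) * ?D) = ?D * (D 2 0 (zc zm) (Zk 2) * D 1 0 (zc zm) (Zk 1))"
    using D_YB(2)[of 2 1 0 "Zk 2" "Zk 1" "zc zm"] by (simp add: scalar_vact vact_commute mult.assoc)
  have z: "D r s (vact i z) (vact j w) * (zs (vact k a) * t) = zs (vact k a) * (D r s (vact i z) (vact j w) * t)" for r s i z j w k a t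
    by (rule mult_tail) (rule zs_S(2)[symmetric])
  have z': "zs (vact 2 \<tau>) * (zs (vact 1 \<sigma>) * t) = zs (vact 1 \<sigma>) * (zs (vact 2 \<tau>) * t)" for t :: "((nat \<Rightarrow> 'n) \<Rightarrow> (nat \<Rightarrow> nat) \<Rightarrow> ('k, 'n) fa fps) endo"
    by (rule mult_tail) (simp add: vact_commute flip: rhom_mult[OF rhom_zs])
  show ?thesis unfolding A B by (simp only: mult.assoc z yb z')
qed

text \<open>The two terms of \<open>Rel\<close> contain L^+ for the lists 1, 2 and 2, 1, and
  \<open>Lm_LL\<close> treats each of them. The exchange relations of D with RP, with the inverses
  and with the factors RM bring the outer factors of both terms to the same order, so
  \<open>Rel\<close> itself reappears in the middle.\<close>

theorem Lm_Rel:
  assumes L: "Lgood L zp zm RI RM"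
  shows "Lm 0 L * (S 0 2 * (S 0 1 * Rel)) =
    vl 2 0 2 RI * (vl 1 0 1 RI * (Rel * (S 1 0 * (S 2 0 * (Lm 0 L * (vl 2 0 2 RM * vl 1 0 1 RM))))))"
proof -
  have lin: "lin (L i j)" for i j using L by (auto simp: Lgood_def)
  let ?D = "D 1 2 (Zk 1) (Zk 2)" and ?D' = "D 2 1 (Zk 1) (Zk 2)"
  have 12: "Lm 0 L * (S 0 1 * (S 0 2 * (Lp 1 * (S 1 2 * Lp 2)))) =
     vl 1 0 1 RI * (vl 2 0 2 RI * (Lp 1 * (S 1 2 * (Lp 2 * (S 1 0 * (S 2 0 * (Lm 0 L * (vl 2 0 2 RM * vl 1 0 1 RM))))))))"
    using Lm_LL[OF L, of "[1, 2]" 0] by (simp add: mult.assoc)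
  have 21: "Lm 0 L * (S 0 2 * (S 0 1 * (Lp 2 * (S 2 1 * Lp 1)))) =
     vl 2 0 2 RI * (vl 1 0 1 RI * (Lp 2 * (S 2 1 * (Lp 1 * (S 2 0 * (S 1 0 * (Lm 0 L * (vl 1 0 1 RM * vl 2 0 2 RM))))))))"
    using Lm_LL[OF L, of "[2, 1]" 0] by (simp add: mult.assoc)
  have DS: "S 0 2 * (S 0 1 * ?D) = ?D * (S 0 1 * S 0 2)"
    using D_SS(2)[of 0 1 2 "Zk 1" "Zk 2"] by (simp add: scalar_vact mult.assoc)
  have DS': "S 2 0 * (S 1 0 * ?D') = ?D' * (S 1 0 * S 2 0)"
    using D_SS(1)[of 2 1 0 "Zk 1" "Zk 2"] by (simp add: scalar_vact mult.assoc)
  have LD: "Lm 0 L * D 1 2 (Zk 1) (Zk 2) = D 1 2 (Zk 1) (Zk 2) * Lm 0 L" "Lm 0 L * D 2 1 (Zk 1) (Zk 2) = D 2 1 (Zk 1) (Zk 2) * Lm 0 L"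
    using lin by (auto intro!: Lm_D)
  have t1: "Lm 0 L * (S 0 2 * (S 0 1 * (?D * (Lp 1 * (S 1 2 * Lp 2))))) =
      vl 2 0 2 RI * (vl 1 0 1 RI * (?D * (Lp 1 * (S 1 2 * (Lp 2 * (S 1 0 * (S 2 0 * (Lm 0 L * (vl 2 0 2 RM * vl 1 0 1 RM)))))))))"
  proof -
    have "Lm 0 L * (S 0 2 * (S 0 1 * (?D * (Lp 1 * (S 1 2 * Lp 2))))) = Lm 0 L * ((S 0 2 * (S 0 1 * ?D)) * (Lp 1 * (S 1 2 * Lp 2)))"
      by (simp only: mult.assoc)
    also have "\<dots> = ?D * (Lm 0 L * (S 0 1 * (S 0 2 * (Lp 1 * (S 1 2 * Lp 2)))))"
      by (simp only: DS mult.assoc LD(1)[THEN mult_tail])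
    also have "\<dots> = (?D * (vl 1 0 1 RI * vl 2 0 2 RI)) * (Lp 1 * (S 1 2 * (Lp 2 * (S 1 0 * (S 2 0 * (Lm 0 L * (vl 2 0 2 RM * vl 1 0 1 RM)))))))"
      by (simp only: 12 mult.assoc)
    finally show ?thesis by (simp only: D_RI_RI[OF L] mult.assoc)
  qed
  have t2: "Lm 0 L * (S 0 2 * (S 0 1 * (Lp 2 * (S 2 1 * (Lp 1 * ?D'))))) =
      vl 2 0 2 RI * (vl 1 0 1 RI * (Lp 2 * (S 2 1 * (Lp 1 * (?D' * (S 1 0 * (S 2 0 * (Lm 0 L * (vl 2 0 2 RM * vl 1 0 1 RM)))))))))"
  proof -
    have "Lm 0 L * (S 0 2 * (S 0 1 * (Lp 2 * (S 2 1 * (Lp 1 * ?D'))))) = (Lm 0 L * (S 0 2 * (S 0 1 * (Lp 2 * (S 2 1 * Lp 1))))) * ?D'"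
      by (simp only: mult.assoc)
    also have "\<dots> = vl 2 0 2 RI * (vl 1 0 1 RI * (Lp 2 * (S 2 1 * (Lp 1 * (S 2 0 * (S 1 0 * (Lm 0 L * (vl 1 0 1 RM * (vl 2 0 2 RM * ?D')))))))))"
      by (simp only: 21 mult.assoc)
    also have "\<dots> = vl 2 0 2 RI * (vl 1 0 1 RI * (Lp 2 * (S 2 1 * (Lp 1 * ((S 2 0 * (S 1 0 * ?D')) * (Lm 0 L * (vl 2 0 2 RM * vl 1 0 1 RM)))))))"
      by (simp only: RM_RM_D[OF L] LD(2)[THEN mult_tail] mult.assoc)
    finally show ?thesis by (simp only: DS' mult.assoc)
  qed
  show ?thesis
    unfolding Rel_def right_diff_distrib left_diff_distrib by (simp only: t1 t2 mult.assoc)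
qed

end

subsection \<open>Density and stability of the ideal\<close>

lemma fps_trunc_sum: "l < m \<Longrightarrow> fps_nth (\<Sum>i<m. fps_X ^ i * fps_const (fps_nth x i)) l = fps_nth x l"
  for x :: "'a::ring_1 fps"
proof -
  assume "l < m"
  have "fps_nth (\<Sum>i<m. fps_X ^ i * fps_const (fps_nth x i)) l = (\<Sum>i<m. if i = l then fps_nth x i else 0)"
    unfolding fps_sum_nth by (rule sum.cong) (auto simp: fps_X_power_mult_nth)
  with \<open>l < m\<close> show ?thesis by simp
qed

lemma scE_X_power: "scE (fps_X ^ m) = fps_X ^ m"
  by (induction m) (simp_all add: rhom_one[OF rhom_scE] rhom_mult[OF rhom_scE] scE_X)

lemma span_closed:
  fixes x :: "('g::monoid_add \<Rightarrow>\<^sub>0 'k::comm_ring_1) fps"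
  assumes zero: "0 \<in> G" and add: "\<And>x y. x \<in> G \<Longrightarrow> y \<in> G \<Longrightarrow> x + y \<in> G" and sc: "\<And>s x. x \<in> G \<Longrightarrow> scE s * x \<in> G"
    and wrd: "\<And>w. wrd w \<in> G" and closed: "\<And>x. (\<And>m. \<exists>y\<in>G. \<forall>l<m. fps_nth y l = fps_nth x l) \<Longrightarrow> x \<in> G"
  shows "x \<in> G"
proof (rule closed)
  fix m
  have sum': "sum f I \<in> G" if "\<And>i. i \<in> I \<Longrightarrow> f i \<in> G" for f and I :: "'g set"
    using that by (induction I rule: infinite_finite_induct) (auto intro: zero add)
  have sum'': "sum f I \<in> G" if "\<And>i. i \<in> I \<Longrightarrow> f i \<in> G" for f and I :: "nat set"
    using that by (induction I rule: infinite_finite_induct) (auto intro: zero add)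
  have const: "fps_const p \<in> G" for p
  proof -
    have "fps_const p = (\<Sum>w\<in>Poly_Mapping.keys p. scE (fps_const (Poly_Mapping.lookup p w)) * wrd w)"
    proof -
      have "scE (fps_const c) * wrd w = fps_const (Poly_Mapping.single w c)" for c :: 'k and w :: 'g
        by (simp add: scE_def wrd_def fps_map_const rhom_zero[OF rhom_cst] cst_mult_single)
      then show ?thesis
        by (simp only: rhom_sum[OF rhom_fps_const, symmetric] poly_mapping_decomp[symmetric])
    qed
    then show ?thesis by (simp add: sum' sc wrd)
  qed
  show "\<exists>y\<in>G. \<forall>l<m. fps_nth y l = fps_nth x l"
  proof (rule bexI)
    show "(\<Sum>i<m. fps_X ^ i * fps_const (fps_nth x i)) \<in> G"
      by (rule sum'') (metis const sc scE_X_power)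
  qed (simp add: fps_trunc_sum)
qed

text \<open>The extension of J to Laurent coefficients. Describing it by coefficients makes it
  closed and saturated at once, which the ideal generated by J over the larger ring need not
  be.\<close>

definition JE :: "('g::monoid_add \<Rightarrow>\<^sub>0 'k::comm_ring_1) fps set \<Rightarrow> ('g \<Rightarrow>\<^sub>0 'k fls) fps set" where
  "JE J = {z. \<forall>r. ucf r z \<in> J}"

lemma ucf_X: "ucf r (fps_X * z) = fps_X * ucf r z"
proof -
  have "fps_X = cemb (fps_X :: ('g::monoid_add \<Rightarrow>\<^sub>0 'b::comm_ring_1) fps)"
    by (simp add: fps_eq_iff rhom_one[OF rhom_pmap[OF rhom_fls_const]] rhom_zero[OF rhom_pmap[OF rhom_fls_const]])
  then show ?thesis by (metis ucf_cemb_mult(1))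
qed

lemma hideal_JE:
  fixes J :: "('g::monoid_add \<Rightarrow>\<^sub>0 'k::comm_ring_1) fps set"
  assumes J: "hideal J"
  shows "hideal (JE J)"
  unfolding hideal_def
proof (intro conjI ballI allI impI)
  show "0 \<in> JE J" by (simp add: JE_def additive.zero[OF additive_ucf] hideal_zero[OF J])
  show "x + y \<in> JE J" if "x \<in> JE J" "y \<in> JE J" for x y
    using that by (simp add: JE_def additive.add[OF additive_ucf] hideal_add[OF J])
  have fs: "fsums (\<lambda>b. ucf b x * ucf (r - b) y) (ucf r (x * y))" for x y :: "('g \<Rightarrow>\<^sub>0 'k fls) fps" and r
    using fsums_ucoeff_mult[where x = "fps_map iota x" and y = "fps_map iota y" and r = r]
    by (simp add: ucoeff_iota flip: rhom_mult[OF rhom_fps_map[OF rhom_iota]])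
  show "x * y \<in> JE J" if "x \<in> JE J" for x y
    using that unfolding JE_def by (auto intro!: hideal_fsums[OF J fs] hideal_mult_right[OF J])
  show "y * x \<in> JE J" if "x \<in> JE J" for x y
    using that unfolding JE_def by (auto intro!: hideal_fsums[OF J fs] hideal_mult_left[OF J])
  show "x \<in> JE J" if x: "\<forall>m. \<exists>y\<in>JE J. \<forall>l<m. fps_nth y l = fps_nth x l" for x
    unfolding JE_def
  proof (intro CollectI allI hideal_closed[OF J])
    fix r m
    obtain y where "y \<in> JE J" "\<forall>l<m. fps_nth y l = fps_nth x l" using x by blast
    then show "\<exists>y\<in>J. \<forall>l<m. fps_nth y l = fps_nth (ucf r x) l"
      by (intro bexI[of _ "ucf r y"]) (auto simp: JE_def)
  qed
  show "x \<in> JE J" if "fps_X * x \<in> JE J" for x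
    using that hideal_saturated[OF J] by (auto simp: JE_def ucf_X)
qed

lemma cemb_JE: "hideal J \<Longrightarrow> cemb x \<in> JE J \<longleftrightarrow> x \<in> J"
  by (auto simp: JE_def ucf_cemb hideal_zero split: if_splits)

lemma lin_approx:
  assumes T: "lin T" and eq: "\<forall>l<m. fps_nth x l = fps_nth y l"
  shows "\<forall>l<m. fps_nth (T x) l = fps_nth (T y) l"
proof -
  have "x - y = fps_X ^ m * fps_shift m (x - y)"
  proof (rule fps_ext)
    show "fps_nth (x - y) n = fps_nth (fps_X ^ m * fps_shift m (x - y)) n" for n
      using eq by (auto simp: fps_X_power_mult_nth)
  qed
  then have "T x - T y = fps_X ^ m * T (fps_shift m (x - y))"
    by (metis lin_diff[OF T] lin_scE[OF T] scE_X_power)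
  then have "fps_nth (T x - T y) l = 0" if "l < m" for l
    using that by (simp add: fps_X_power_mult_nth)
  then show ?thesis by simp
qed

lemma JE_approx:
  assumes J: "hideal J" and T: "lin T" and x: "\<And>m. \<exists>y. T y \<in> J \<and> (\<forall>l<m. fps_nth y l = fps_nth x l)"
  shows "T x \<in> J"
proof (rule hideal_closed[OF J])
  fix m
  obtain y where "T y \<in> J" "\<forall>l<m. fps_nth y l = fps_nth x l" using x by blast
  then show "\<exists>y\<in>J. \<forall>l<m. fps_nth y l = fps_nth (T x) l" using lin_approx[OF T, of m y x] by blast
qed

lemma matrix_mult_in_ideal:
  assumes J: "hideal J" and Xm: "\<And>p q e. fps_nth (Xm $ p $ q) e \<in> J"
  shows "fps_nth ((A ** Xm ** B) $ p $ q) e \<in> J"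
  unfolding nth_matrix_mult sum_distrib_right fps_sum_nth fps_mult_nth[of "_ * _"] fps_mult_nth
  by (intro hideal_sum[OF J] hideal_mult_right[OF J] hideal_mult_left[OF J] Xm)

lemma Wmat_in_ideal:
  assumes J: "hideal J" and Xm: "\<And>i j. Xm $ i $ j \<in> J"
  shows "fps_nth (Wmat S RI RM Xm $ p $ q) e \<in> J"
  unfolding Wmat_def
  by (rule matrix_mult_in_ideal[OF J]) (auto simp: t1_def Xm hideal_zero[OF J])

subsection \<open>The defining relations in two variables\<close>

text \<open>Series in v_1 and v_2 over the algebra, acting by left multiplication; the outer
  variable is v_2.\<close>

definition act12 :: "'e::ring_1 fps fps \<Rightarrow> ((nat \<Rightarrow> nat) \<Rightarrow> 'e) endo" where
  "act12 f = Endo (\<lambda>\<phi> e. \<Sum>q\<le>e 2. \<Sum>k\<le>e 1. fps_nth (fps_nth f q) k * \<phi> (e(1 := e 1 - k, 2 := e 2 - q)))"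

lemma ap_act12: "ap (act12 f) \<phi> e = (\<Sum>q\<le>e 2. \<Sum>k\<le>e 1. fps_nth (fps_nth f q) k * \<phi> (e(1 := e 1 - k, 2 := e 2 - q)))"
  unfolding act12_def by (subst ap_Endo) (auto simp: Modules.additive_def fun_eq_iff sum.distrib distrib_left)

lemma ap_act_mulL: "ap (act k (fps_map mulL g)) \<phi> e = (\<Sum>q\<le>e k. fps_nth g q * \<phi> (e(k := e k - q)))"
  by (simp add: ap_act)

lemma act12_act1: "ap (act12 f) \<phi> e = (\<Sum>q\<le>e 2. ap (act 1 (fps_map mulL (fps_nth f q))) \<phi> (e(2 := e 2 - q)))"
proof -
  have "e(1 := a, 2 := b) = e(2 := b, 1 := a)" for a b :: nat by (rule fun_upd_twist) simp
  then show ?thesis by (simp add: ap_act12 ap_act)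
qed

lemma act12_const: "act12 (fps_const g) = act 1 (fps_map mulL g)"
proof (rule op_eqI)
  fix \<phi> and e :: "nat \<Rightarrow> nat"
  have "ap (act12 (fps_const g)) \<phi> e = (\<Sum>q\<le>e 2. if q = 0 then ap (act 1 (fps_map mulL g)) \<phi> e else 0)"
    unfolding act12_act1 by (rule sum.cong) (auto simp: ap_act)
  then show "ap (act12 (fps_const g)) \<phi> e = ap (act 1 (fps_map mulL g)) \<phi> e" by simp
qed

lemma act12_map_const: "act12 (fps_map fps_const g) = act 2 (fps_map mulL g)"
proof (rule op_eqI)
  fix \<phi> and e :: "nat \<Rightarrow> nat"
  have "(\<Sum>k\<le>e 1. fps_nth (fps_nth (fps_map fps_const g) q) k * \<phi> (e(1 := e 1 - k, 2 := e 2 - q))) =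
     (\<Sum>k\<le>e 1. if k = 0 then fps_nth g q * \<phi> (e(2 := e 2 - q)) else 0)" for q
    by (rule sum.cong) auto
  then show "ap (act12 (fps_map fps_const g)) \<phi> e = ap (act 2 (fps_map mulL g)) \<phi> e"
    by (simp add: ap_act12 ap_act)
qed

lemma rhom_act12: "rhom (act12 :: 'e::ring_1 fps fps \<Rightarrow> _)"
proof (rule rhomI)
  show "act12 (f + g) = act12 f + act12 g" for f g :: "'e fps fps"
    by (rule op_eqI) (simp add: ap_act12 sum.distrib distrib_right)
  show "act12 (1 :: 'e fps fps) = 1"
    using act12_const[of "1 :: 'e fps"] by (simp add: rhom_one[OF rhom_act] rhom_one[OF rhom_fps_map[OF rhom_mulL]])
  show "act12 (f * g) = act12 f * act12 g" for f g :: "'e fps fps"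
  proof (rule op_eqI)
    fix \<phi> and e :: "nat \<Rightarrow> nat"
    let ?b = "\<lambda>h :: 'e fps. act 1 (fps_map mulL h)"
    let ?n = "e 2"
    have b: "rhom ?b" by (rule rhom_comp[OF rhom_act rhom_fps_map[OF rhom_mulL]])
    have twist: "e'(1 := a, 2 := c) = e'(2 := c, 1 := a)" for a c :: nat and e' :: "nat \<Rightarrow> nat" by (rule fun_upd_twist) simp
    have inner: "ap (?b h) (ap (act12 g) \<phi>) e' = (\<Sum>q'\<le>e' 2. ap (?b h) (ap (?b (fps_nth g q')) \<phi>) (e'(2 := e' 2 - q')))" for h e'
    proof -
      have "ap (?b h) (ap (act12 g) \<phi>) e' = (\<Sum>k\<le>e' 1. \<Sum>q'\<le>e' 2. fps_nth h k * ap (?b (fps_nth g q')) \<phi> (e'(2 := e' 2 - q', 1 := e' 1 - k)))"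
        by (simp add: ap_act_mulL act12_act1 sum_distrib_left twist)
      also have "\<dots> = (\<Sum>q'\<le>e' 2. ap (?b h) (ap (?b (fps_nth g q')) \<phi>) (e'(2 := e' 2 - q')))"
        by (subst sum.swap) (simp add: ap_act_mulL[where k = 1 and g = h] del: One_nat_def)
      finally show ?thesis .
    qed
    let ?t = "\<lambda>q q'. ap (?b (fps_nth f q * fps_nth g q')) \<phi> (e(2 := ?n - q - q'))"
    have "ap (act12 f * act12 g) \<phi> e = (\<Sum>q\<le>?n. \<Sum>q'\<le>?n - q. ?t q q')"
      by (simp add: act12_act1[of f] inner rhom_mult[OF b] del: One_nat_def)
    also have "\<dots> = (\<Sum>(q, q')\<in>Sigma {..?n} (\<lambda>q. {..?n - q}). ?t q q')" by (rule sum.Sigma) auto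
    also have "\<dots> = (\<Sum>(t, q)\<in>Sigma {..?n} (\<lambda>t. {0..t}). ?t q (t - q))"
      by (rule sum.reindex_bij_witness[where i = "\<lambda>(t, q). (q, t - q)" and j = "\<lambda>(q, q'). (q + q', q)"]) auto
    also have "\<dots> = (\<Sum>t\<le>?n. \<Sum>q=0..t. ?t q (t - q))" by (rule sum.Sigma[symmetric]) auto
    also have "\<dots> = ap (act12 (f * g)) \<phi> e"
      by (simp add: act12_act1 fps_mult_nth rhom_sum[OF b] ap_sum sum_fun_apply del: One_nat_def)
    finally show "ap (act12 (f * g)) \<phi> e = ap (act12 f * act12 g) \<phi> e" ..
  qed
qed

lemma sum_delta2: "(\<Sum>p\<in>UNIV. \<Sum>b\<le>q. if p = y then (if b = q then t else 0) else 0) = t"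
  for y :: "'z::finite" and q :: nat and t :: "'t::comm_monoid_add"
proof -
  have "(\<Sum>b\<le>q. if p = y then (if b = q then t else 0) else 0) = (if p = y then t else 0)" for p
    by (cases "p = y") simp_all
  then show ?thesis by simp
qed

lemma sum_delta3: "(\<Sum>p\<in>UNIV. \<Sum>b\<le>q. \<Sum>a\<le>m. if p = y then (if b = q then (if a = m then t else 0) else 0) else 0) = t"
  for y :: "'z::finite" and q m :: nat and t :: "'t::comm_monoid_add"
proof -
  have "(\<Sum>a\<le>m. if p = y then (if b = q then (if a = m then t else 0) else 0) else 0) = (if p = y then (if b = q then t else 0) else 0)" for p b
    by (cases "p = y"; cases "b = q") simp_all
  then show ?thesis by (simp add: sum_delta2)
qed

text \<open>A basis vector in degree 0 of all v_k. Applying an operator to it reads off a column of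
  its matrix.\<close>

definition dl :: "'x \<Rightarrow> 'e::zero \<Rightarrow> 'x \<Rightarrow> (nat \<Rightarrow> nat) \<Rightarrow> 'e" where
  "dl x0 z = (\<lambda>x e. if x = x0 \<and> e = (\<lambda>_. 0) then z else 0)"

context Lcalc
begin

abbreviation cc :: "complex fps \<Rightarrow> ('k, 'n) fa fps fps fps" where "cc c \<equiv> fps_const (fps_const (scE (cm c)))"

definition DT :: "(('k, 'n) fa fps fps fps, 'n) mat2" where
  "DT = (\<chi> x y. fps_const (vsc Zv) * cc (flip (RP R) $ x $ y) - fps_map fps_const (vsc Zv) * cc (PRi R $ x $ y))"

text \<open>The entries of this matrix are the relations as elements of the algebra, while
  \<open>Rel\<close> is the operator by which they act from the left on the legs 1 and 2.\<close>

definition RelT :: "(('k, 'n) fa fps fps fps, 'n) mat2" where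
  "RelT = DT ** t1 (map_matrix fps_const LPm) ** map_matrix cc (RP R) ** t2 (map_matrix (fps_map fps_const) LPm)
     - t2 (map_matrix (fps_map fps_const) LPm) ** map_matrix cc (flip (RP R)) ** t1 (map_matrix fps_const LPm) ** flip DT"

lemma act12_cc: "act12 (cc c) = eta c"
proof -
  have "act12 (cc c) = vact 1 (fps_const (cm c))"
    by (simp add: act12_const vact_def msc_def fps_map_const rhom_zero[OF rhom_mulL] rhom_zero[OF rhom_comp[OF rhom_mulL rhom_scE]])
  then show ?thesis by (simp add: vact_eta)
qed

lemma act12_Z: "act12 (fps_const (vsc Zv)) = Zk 1" "act12 (fps_map fps_const (vsc Zv)) = Zk 2"
  unfolding act12_const act12_map_const by (simp_all add: vact_def vsc_def msc_def fps_map_comp)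

lemma DT_l2: "r \<noteq> s \<Longrightarrow> l2 r s (map_matrix act12 DT) = D r s (Zk 1) (Zk 2)"
proof -
  assume rs: "r \<noteq> s"
  have "map_matrix act12 DT = map_matrix ((*) (Zk 1)) (flip (map_matrix eta (RP R))) - map_matrix ((*) (Zk 2)) (map_matrix eta (PRi R))"
    by (simp add: vec_eq_iff nth_flip DT_def rhom_diff[OF rhom_act12] rhom_mult[OF rhom_act12] act12_cc act12_Z del: fps_const_mult One_nat_def)
  then show ?thesis using rs by (simp add: l2_diff l2_zs D_def S_def Si_def l2_flip)
qed

lemma Rel_RelT: "Rel = l2 1 2 (map_matrix act12 RelT)"
proof -
  have n: "(1::nat) \<noteq> 2" "(2::nat) \<noteq> 1" by auto
  have L1: "map_matrix act12 (map_matrix fps_const LPm) = map_matrix (act 1) LpM"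
    and L2: "map_matrix act12 (map_matrix (fps_map fps_const) LPm) = map_matrix (act 2) LpM"
    by (simp_all add: vec_eq_iff act12_const act12_map_const LpM_def)
  have e: "map_matrix act12 (map_matrix cc A) = map_matrix eta A" for A :: "(complex fps, 'n) mat2"
    by (simp add: vec_eq_iff act12_cc)
  have f: "l2 1 2 (map_matrix eta (flip (RP R))) = S 2 1"
    using l2_flip[OF n(2), of "map_matrix eta (RP R)"] by (simp add: S_def map_matrix_flip)
  have g: "l2 1 2 (map_matrix act12 (flip DT)) = D 2 1 (Zk 1) (Zk 2)"
    unfolding map_matrix_flip l2_flip[OF n(2)] by (rule DT_l2[OF n(2)])
  show ?thesis
    unfolding RelT_def map_matrix_diff[OF rhom_act12] map_matrix_mult[OF rhom_act12] l2_diff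
      map_matrix_t1[OF rhom_act12] map_matrix_t2[OF rhom_act12] L1 L2 e
    using n by (simp add: l2_mult[symmetric] l2_t1 l2_t2 DT_l2 g f Rel_def Lp_def mult.assoc del: One_nat_def) (simp add: S_def)
qed

lemma ap_Lm: "(\<And>i k. lin (L i k)) \<Longrightarrow> ap (Lm r L) \<psi> x e = (\<Sum>k\<in>UNIV. L (x r) k (\<psi> (x(r := k)) e))"
  by (simp add: Lm_def ap_l1 LmM_def ap_act_const ap_Endo_lin sum_fun_apply)

lemma ap_Lp: "ap (Lp k) \<psi> x e = (\<Sum>a\<in>UNIV. \<Sum>q\<le>e k. lam (x k) a q * \<psi> (x(k := a)) (e(k := e k - q)))"
  by (simp add: Lp_def ap_l1 LpM_def LPm_def ap_act sum_fun_apply)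

lemma ap_vl: "ap (vl k r s A) \<psi> x e = (\<Sum>p\<in>UNIV. \<Sum>q\<le>e k. scE (fps_nth (A $ (x r, x s) $ p) q) * \<psi> (x(r := fst p, s := snd p)) (e(k := e k - q)))"
  by (simp add: ap_l2 vact_def msc_def ap_act sum_fun_apply)

definition valued :: "('k, 'n) fa fps set \<Rightarrow> ((nat \<Rightarrow> 'n) \<Rightarrow> (nat \<Rightarrow> nat) \<Rightarrow> ('k, 'n) fa fps) \<Rightarrow> bool" where
  "valued G \<psi> \<longleftrightarrow> (\<forall>x e. \<psi> x e \<in> G)"

definition submod :: "('k, 'n) fa fps set \<Rightarrow> bool" where
  "submod G \<longleftrightarrow> 0 \<in> G \<and> (\<forall>x\<in>G. \<forall>y\<in>G. x + y \<in> G) \<and> (\<forall>s. \<forall>x\<in>G. scE s * x \<in> G)"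

lemma submod_sum: "submod G \<Longrightarrow> (\<And>i. i \<in> I \<Longrightarrow> f i \<in> G) \<Longrightarrow> sum f I \<in> G"
  by (induction I rule: infinite_finite_induct) (auto simp: submod_def)

lemma submod_hideal: "hideal J \<Longrightarrow> submod J"
  by (simp add: submod_def hideal_zero hideal_add hideal_mult_left)

lemma valued_vl: "submod G \<Longrightarrow> valued G \<psi> \<Longrightarrow> valued G (ap (vl k r s A) \<psi>)"
  unfolding valued_def ap_vl by (intro allI submod_sum) (auto simp: submod_def)

lemma valued_eu: "submod G \<Longrightarrow> valued G \<psi> \<Longrightarrow> valued G (ap (eu k c a) \<psi>)"
  by (auto simp: valued_def ap_eu submod_def)

lemma ap_zs_eta: "ap (zs (eta s)) \<psi> x e = scE (cm s) * \<psi> x e"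
  by (simp add: ap_zs eta_def vact_def msc_def fps_map_const rhom_zero[OF rhom_comp[OF rhom_mulL rhom_scE]] ap_act_const)

lemma valued_zs: "submod G \<Longrightarrow> valued G \<psi> \<Longrightarrow> valued G (ap (zs (eta s)) \<psi>)"
  unfolding valued_def ap_zs_eta by (auto simp: submod_def)

text \<open>By \<open>skew_cancel\<close> the product without \<open>S r k\<close> is made of matrix
  units, scalars and the product with \<open>S r k\<close>, and all of these keep the values in a
  submodule.\<close>

lemma skew_valued:
  assumes G: "submod G" and rk: "r \<noteq> k" and T: "\<And>c a. eu k c a * T = T * eu k c a" "\<And>s. T * zs (eta s) = zs (eta s) * T"
    and U: "\<And>c a. eu r c a * U = U * eu r c a"
    and v: "\<And>j m. valued G (ap (T * S r k * U) (ap (eu r j m) \<psi>))"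
  shows "valued G (ap (T * U) \<psi>)"
proof -
  have "valued G (ap (zs (eta (Q m c a j)) * eu k c a * (T * S r k * U) * eu r j m) \<psi>)" for m c a j
  proof -
    have "ap (zs (eta (Q m c a j)) * eu k c a * (T * S r k * U) * eu r j m) \<psi> = ap (zs (eta (Q m c a j))) (ap (eu k c a) (ap (T * S r k * U) (ap (eu r j m) \<psi>)))"
      by simp
    then show ?thesis using valued_zs[OF G valued_eu[OF G v]] by simp
  qed
  then show ?thesis
    unfolding skew_cancel[OF rk T U] ap_sum valued_def sum_fun_apply
    by (intro allI submod_sum[OF G]) auto
qed

lemma eu_S: "k \<noteq> r \<Longrightarrow> k \<noteq> s \<Longrightarrow> eu k a b * S r s = S r s * eu k a b"
  unfolding S_def by (rule eu_l2_commute)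

lemma eu_Lp: "k \<noteq> r \<Longrightarrow> eu k a b * Lp r = Lp r * eu k a b"
  unfolding Lp_def by (rule eu_l1_commute)

lemma eu_Lm: "k \<noteq> r \<Longrightarrow> eu k a b * Lm r L = Lm r L * eu k a b"
  unfolding Lm_def by (rule eu_l1_commute)

lemma zs_eta_Lm: "(\<And>i k. lin (L i k)) \<Longrightarrow> Lm r L * zs (eta s) = zs (eta s) * Lm r L"
  by (rule op_eqI, rule ext) (simp add: ap_Lm ap_zs_eta lin_scE sum_distrib_left)

lemma zs_eta_S: "S r t * zs (eta s) = zs (eta s) * S r t"
  by (rule scalar_S(1)[OF scalar_eta, symmetric])

lemma zs_eta_Lp: "Lp r * zs (eta s) = zs (eta s) * Lp r"
  unfolding eta_def by (rule zs_Lp[symmetric])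

text \<open>In \<open>Lm_Rel\<close> the operator \<open>Rel\<close> stands to the right of scalar
  matrices, so the values lie in J. The factors \<open>S 0 1\<close> and \<open>S 0 2\<close>
  between L^- and \<open>Rel\<close> are cancelled one at a time, and a basis vector isolates a
  single relation.\<close>

lemma L_RelT:
  assumes L: "Lgood L zp zm RI RM" and J: "hideal J"
    and rel: "\<And>x y q m. fps_nth (fps_nth (RelT $ x $ y) q) m \<in> J"
  shows "L i k (fps_nth (fps_nth (RelT $ x $ y) q) m * z) \<in> J"
proof -
  have lin: "lin (L i j)" for i j using L by (auto simp: Lgood_def)
  have G: "submod J" by (rule submod_hideal[OF J])
  have vRel: "valued J (ap Rel \<psi>)" for \<psi>
    unfolding valued_def Rel_RelT ap_l2 sum_fun_apply nth_map_matrix ap_act12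
    by (intro allI hideal_sum[OF J] hideal_mult_right[OF J] rel)
  have euRel: "eu 0 c a * Rel = Rel * eu 0 c a" for c a
    unfolding Rel_RelT by (rule eu_l2_commute) auto
  have 1: "valued J (ap (Lm 0 L * S 0 2 * S 0 1 * Rel) \<psi>)" for \<psi>
  proof -
    have "Lm 0 L * S 0 2 * S 0 1 * Rel = vl 2 0 2 RI * vl 1 0 1 RI * Rel * (S 1 0 * (S 2 0 * (Lm 0 L * (vl 2 0 2 RM * vl 1 0 1 RM))))"
      using Lm_Rel[OF L] by (simp only: mult.assoc)
    then show ?thesis by (simp add: valued_vl[OF G] vRel)
  qed
  have 2: "valued J (ap (Lm 0 L * S 0 2 * Rel) \<psi>)" for \<psi>
  proof (rule skew_valued[OF G, where r = 0 and k = 1])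
    show "eu 1 c a * (Lm 0 L * S 0 2) = Lm 0 L * S 0 2 * eu 1 c a" for c a
      using eu_Lm[of 1 0 c a L, THEN mult_tail] eu_S[of 1 0 2 c a] by (simp add: mult.assoc)
    show "Lm 0 L * S 0 2 * zs (eta s) = zs (eta s) * (Lm 0 L * S 0 2)" for s
      using zs_eta_Lm[OF lin, where r = 0 and s = s, THEN mult_tail] zs_eta_S[of 0 2 s] by (simp only: mult.assoc)
  qed (use euRel 1 in auto)
  have 3: "valued J (ap (Lm 0 L * Rel) \<psi>)" for \<psi>
  proof (rule skew_valued[OF G, where r = 0 and k = 2])
    show "eu 2 c a * Lm 0 L = Lm 0 L * eu 2 c a" for c a by (rule eu_Lm) simp
  qed (use euRel 2 zs_eta_Lm[OF lin] in auto)
  \<comment> \<open>The column indices k and y sit on the legs 0, 1, 2 of x0, the row indices i and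
    x on those of x1, and e selects degree m in v_1 and q in v_2; a single summand survives.\<close>
  define x0 where "x0 = (\<lambda>n::nat. if n = 0 then k else if n = 1 then fst y else snd y)"
  define x1 where "x1 = x0(0 := i, 1 := fst x, 2 := snd x)"
  define e where "e = (\<lambda>n::nat. if n = 1 then m else if n = 2 then q else 0)"
  have "ap Rel (dl x0 z) (x1(0 := k')) e = (if k' = k then fps_nth (fps_nth (RelT $ x $ y) q) m * z else 0)" for k'
  proof -
    have upd: "x1(0 := k', 1 := fst p, 2 := snd p) = x0 \<longleftrightarrow> k' = k \<and> p = y" for p
    proof
      assume *: "x1(0 := k', 1 := fst p, 2 := snd p) = x0"
      from fun_cong[OF *, of 0] fun_cong[OF *, of 1] fun_cong[OF *, of 2]
      show "k' = k \<and> p = y" by (simp add: x0_def x1_def prod_eq_iff)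
    qed (auto simp: x0_def x1_def fun_eq_iff)
    have updz: "e(1 := m - a, 2 := q - b) = (\<lambda>_. 0) \<longleftrightarrow> m - a = 0 \<and> q - b = 0" for a b
    proof
      assume *: "e(1 := m - a, 2 := q - b) = (\<lambda>_. 0)"
      from fun_cong[OF *, of 1] fun_cong[OF *, of 2] show "m - a = 0 \<and> q - b = 0" by simp
    qed (auto simp: e_def fun_eq_iff)
    have ev: "e 1 = m" "e 2 = q" "(x1(0 := k')) 1 = fst x" "(x1(0 := k')) 2 = snd x"
      by (simp_all add: e_def x1_def)
    have "ap Rel (dl x0 z) (x1(0 := k')) e = (\<Sum>p\<in>UNIV. \<Sum>b\<le>q. \<Sum>a\<le>m. if p = y then (if b = q then (if a = m then (if k' = k then fps_nth (fps_nth (RelT $ x $ y) q) m * z else 0) else 0) else 0) else 0)"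
      unfolding Rel_RelT ap_l2 sum_fun_apply nth_map_matrix ap_act12
    proof (intro sum.cong)
      show "{..e 2} = {..q}" "{..e 1} = {..m}" by (simp_all add: e_def)
      fix p b a assume "b \<in> {..q}" "a \<in> {..m}"
      then show "fps_nth (fps_nth (RelT $ ((x1(0 := k')) 1, (x1(0 := k')) 2) $ p) b) a * dl x0 z (x1(0 := k', 1 := fst p, 2 := snd p)) (e(1 := e 1 - a, 2 := e 2 - b)) =
          (if p = y then (if b = q then (if a = m then (if k' = k then fps_nth (fps_nth (RelT $ x $ y) q) m * z else 0) else 0) else 0) else 0)"
        by (simp only: dl_def ev upd updz) auto
    qed simp_all
    then show ?thesis by (simp only: sum_delta3)
  qed
  then have "ap (Lm 0 L * Rel) (dl x0 z) x1 e = (\<Sum>k'\<in>UNIV. if k' = k then L i k (fps_nth (fps_nth (RelT $ x $ y) q) m * z) else 0)"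
    unfolding ap_simps ap_Lm[OF lin] by (intro sum.cong refl) (auto simp: x1_def lin_zero[OF lin])
  then have "ap (Lm 0 L * Rel) (dl x0 z) x1 e = L i k (fps_nth (fps_nth (RelT $ x $ y) q) m * z)" by simp
  then show ?thesis
    using 3[of "dl x0 z", unfolded valued_def, rule_format, of x1 e] by (simp only:)
qed

text \<open>Existence of L used that Q inverts RP on one side; inverting on the other side shows
  that every good L obeys the solved recursion.\<close>

lemma L_lam_solved:
  assumes L: "Lgood L zp zm RI RM"
  shows "L i k (lam c b e * y) = (\<Sum>a\<in>UNIV. \<Sum>j\<in>UNIV. scE (cm (Q k c a j)) * fps_nth (Wmat Sc RI RM (\<chi> i k. L i k y) $ (i, a) $ (j, b)) e)"
proof -
  have rel: "Lrel Sc RI RM L y" using L by (auto simp: Lgood_def)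
  let ?t = "\<lambda>m c'. L i m (lam c' b e * y)"
  have W: "fps_nth (Wmat Sc RI RM (\<chi> i k. L i k y) $ (i, a) $ (j, b)) e = (\<Sum>m\<in>UNIV. \<Sum>c'\<in>UNIV. scE (cm (RP R $ (m, a) $ (j, c'))) * ?t m c')" for a j
    using rel unfolding Lrel_def by (simp add: Sc_def)
  have "(\<Sum>a\<in>UNIV. \<Sum>j\<in>UNIV. scE (cm (Q k c a j)) * fps_nth (Wmat Sc RI RM (\<chi> i k. L i k y) $ (i, a) $ (j, b)) e) =
     (\<Sum>(a, j)\<in>UNIV. \<Sum>(m, c')\<in>UNIV. scE (cm (Q k c a j * RP R $ (m, a) $ (j, c'))) * ?t m c')"
    unfolding W by (simp add: sum_pairs sum_distrib_left rhom_mult[OF cm] rhom_mult[OF rhom_scE] mult.assoc)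
  also have "\<dots> = (\<Sum>(m, c')\<in>UNIV. \<Sum>(a, j)\<in>UNIV. scE (cm (Q k c a j * RP R $ (m, a) $ (j, c'))) * ?t m c')"
    by (simp only: case_prod_unfold) (rule sum.swap)
  also have "\<dots> = (\<Sum>(m, c')\<in>UNIV. scE (cm (\<Sum>a\<in>UNIV. \<Sum>j\<in>UNIV. Q k c a j * RP R $ (m, a) $ (j, c'))) * ?t m c')"
    by (simp add: sum_pairs sum_distrib_right rhom_sum[OF rhom_scE] rhom_sum[OF cm])
  also have "\<dots> = (\<Sum>p\<in>UNIV. if p = (k, c) then ?t k c else 0)"
    unfolding Q_left by (rule sum.cong) (auto simp: rhom_one[OF cm] rhom_zero[OF cm] rhom_one[OF rhom_scE] rhom_zero[OF rhom_scE] split: if_splits)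
  finally show ?thesis by simp
qed

section \<open>The relation between L^-(u) and L^-(v)\<close>

lemma zc_mult: "zc (a * b) = zc a * zc b"
  by (simp add: rhom_mult[OF rhom_vact, symmetric])

text \<open>\<open>D\<close> is homogeneous of degree one in its parameters, so a unit by which both
  of them are shifted comes out as a scalar.\<close>

lemma D_scale: "D r s (zc (\<epsilon> * z)) (zc (\<epsilon> * w)) = zs (zc \<epsilon>) * D r s (zc z) (zc w)"
  by (simp only: D_def zc_mult rhom_mult[OF rhom_zs] right_diff_distrib mult.assoc)

lemma zc_unit: "\<epsilon> * \<epsilon>' = 1 \<Longrightarrow> zs (zc \<epsilon>') * (zs (zc \<epsilon>) * t) = t"
  by (simp add: mult.assoc[symmetric] rhom_mult[OF rhom_zs, symmetric] zc_mult[symmetric] mult.commute[of \<epsilon>'] rhom_one[OF rhom_vact] rhom_one[OF rhom_zs])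

definition RLLop where
  "RLLop Lu Lv zu zv = D 0 1 (zc zu) (zc zv) * (Lm 0 Lu * (S 0 1 * Lm 1 Lv)) - Lm 1 Lv * (S 1 0 * (Lm 0 Lu * D 1 0 (zc zu) (zc zv)))"

text \<open>The inverses involve the shifted parameters, D on the legs 0 and 1 the unshifted ones.
  The unit \<open>\<epsilon>\<close> is put in for the Yang--Baxter equation and taken out again by
  homogeneity.\<close>

lemma D_RI_RI':
  assumes Lu: "Lgood Lu (\<epsilon> * zu) zmu RIu RMu" and Lv: "Lgood Lv (\<epsilon> * zv) zmv RIv RMv" and unit: "\<epsilon> * \<epsilon>' = 1"
  shows "D 0 1 (zc zu) (zc zv) * (vl 2 1 2 RIv * vl 2 0 2 RIu) = vl 2 0 2 RIu * (vl 2 1 2 RIv * D 0 1 (zc zu) (zc zv))"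
proof -
  let ?D = "D 0 1 (zc (\<epsilon> * zu)) (zc (\<epsilon> * zv))"
  have n: "(0::nat) \<noteq> 2" "(1::nat) \<noteq> 2" by auto
  obtain \<sigma> where A: "zs (vact 2 \<sigma>) * D 0 2 (zc (\<epsilon> * zu)) (Zk 2) * vl 2 0 2 RIu = 1" "vl 2 0 2 RIu * (zs (vact 2 \<sigma>) * D 0 2 (zc (\<epsilon> * zu)) (Zk 2)) = 1"
    using RI_form[OF Lu n(1)] .
  obtain \<tau> where B: "zs (vact 2 \<tau>) * D 1 2 (zc (\<epsilon> * zv)) (Zk 2) * vl 2 1 2 RIv = 1" "vl 2 1 2 RIv * (zs (vact 2 \<tau>) * D 1 2 (zc (\<epsilon> * zv)) (Zk 2)) = 1"
    using RI_form[OF Lv n(2)] .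
  let ?A = "zs (vact 2 \<sigma>) * D 0 2 (zc (\<epsilon> * zu)) (Zk 2)" and ?B = "zs (vact 2 \<tau>) * D 1 2 (zc (\<epsilon> * zv)) (Zk 2)"
  have yb: "?D * (D 0 2 (zc (\<epsilon> * zu)) (Zk 2) * D 1 2 (zc (\<epsilon> * zv)) (Zk 2)) = D 1 2 (zc (\<epsilon> * zv)) (Zk 2) * (D 0 2 (zc (\<epsilon> * zu)) (Zk 2) * ?D)"
    using D_YB(1)[of 0 1 2 "zc (\<epsilon> * zu)" "zc (\<epsilon> * zv)" "Zk 2"] by (simp add: scalar_vact vact_commute mult.assoc)
  have z: "D r s (vact i z) (vact j w) * (zs (vact k a) * t) = zs (vact k a) * (D r s (vact i z) (vact j w) * t)" for r s i z j w k a t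
    by (rule mult_tail) (rule zs_S(2)[symmetric])
  have z': "zs (vact 2 \<tau>) * (zs (vact 2 \<sigma>) * t) = zs (vact 2 \<sigma>) * (zs (vact 2 \<tau>) * t)" for t :: "((nat \<Rightarrow> 'n) \<Rightarrow> (nat \<Rightarrow> nat) \<Rightarrow> ('k, 'n) fa fps) endo"
    by (rule mult_tail) (simp add: vact_commute flip: rhom_mult[OF rhom_zs])
  have 1: "?D * (?A * ?B) = (?B * ?A) * ?D"
    by (simp only: mult.assoc z yb z')
  have 2: "(?A * ?B) * (vl 2 1 2 RIv * vl 2 0 2 RIu) = 1"
  proof -
    have "(?A * ?B) * (vl 2 1 2 RIv * vl 2 0 2 RIu) = ?A * ((?B * vl 2 1 2 RIv) * vl 2 0 2 RIu)" by (simp only: mult.assoc)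
    then show ?thesis by (simp only: A B mult_1_left)
  qed
  have 3: "(vl 2 0 2 RIu * vl 2 1 2 RIv) * (?B * ?A) = 1"
  proof -
    have "(vl 2 0 2 RIu * vl 2 1 2 RIv) * (?B * ?A) = vl 2 0 2 RIu * ((vl 2 1 2 RIv * ?B) * ?A)" by (simp only: mult.assoc)
    then show ?thesis by (simp only: A B mult_1_left)
  qed
  let ?V = "vl 2 1 2 RIv * vl 2 0 2 RIu" and ?U = "vl 2 0 2 RIu * vl 2 1 2 RIv"
  have "?D * ?V = (?U * (?B * ?A)) * ?D * ?V" by (simp only: 3 mult_1_left)
  also have "\<dots> = ?U * ((?B * ?A) * ?D) * ?V" by (simp only: mult.assoc)
  also have "\<dots> = ?U * (?D * (?A * ?B)) * ?V" by (simp only: 1)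
  also have "\<dots> = ?U * ?D * ((?A * ?B) * ?V)" by (simp only: mult.assoc)
  also have "\<dots> = ?U * ?D" by (simp only: 2 mult_1_right)
  finally have "zs (zc \<epsilon>) * (D 0 1 (zc zu) (zc zv) * ?V) = ?U * (zs (zc \<epsilon>) * D 0 1 (zc zu) (zc zv))"
    by (simp only: D_scale mult.assoc)
  also have "\<dots> = zs (zc \<epsilon>) * (?U * D 0 1 (zc zu) (zc zv))"
    by (simp only: mult.assoc zs_vl[THEN mult_tail])
  finally have "zs (zc \<epsilon>') * (zs (zc \<epsilon>) * (D 0 1 (zc zu) (zc zv) * ?V)) = zs (zc \<epsilon>') * (zs (zc \<epsilon>) * (?U * D 0 1 (zc zu) (zc zv)))" by simp
  then show ?thesis by (simp only: zc_unit[OF unit] mult.assoc)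
qed

lemma RM_RM_D':
  assumes Lu: "Lgood Lu zpu (\<epsilon> * zu) RIu RMu" and Lv: "Lgood Lv zpv (\<epsilon> * zv) RIv RMv" and unit: "\<epsilon> * \<epsilon>' = 1"
  shows "vl 2 1 2 RMv * (vl 2 0 2 RMu * D 1 0 (zc zu) (zc zv)) = D 1 0 (zc zu) (zc zv) * (vl 2 0 2 RMu * vl 2 1 2 RMv)"
proof -
  let ?D = "D 1 0 (zc (\<epsilon> * zu)) (zc (\<epsilon> * zv))"
  have n: "(0::nat) \<noteq> 2" "(1::nat) \<noteq> 2" by auto
  obtain \<sigma> where A: "vl 2 0 2 RMu = zs (vact 2 \<sigma>) * D 2 0 (zc (\<epsilon> * zu)) (Zk 2)" using RM_form[OF Lu n(1)] .
  obtain \<tau> where B: "vl 2 1 2 RMv = zs (vact 2 \<tau>) * D 2 1 (zc (\<epsilon> * zv)) (Zk 2)" using RM_form[OF Lv n(2)] .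
  have yb: "D 2 1 (zc (\<epsilon> * zv)) (Zk 2) * (D 2 0 (zc (\<epsilon> * zu)) (Zk 2) * ?D) = ?D * (D 2 0 (zc (\<epsilon> * zu)) (Zk 2) * D 2 1 (zc (\<epsilon> * zv)) (Zk 2))"
    using D_YB(2)[of 2 1 0 "Zk 2" "zc (\<epsilon> * zv)" "zc (\<epsilon> * zu)"] by (simp add: scalar_vact vact_commute mult.assoc)
  have z: "D r s (vact i z) (vact j w) * (zs (vact k a) * t) = zs (vact k a) * (D r s (vact i z) (vact j w) * t)" for r s i z j w k a t
    by (rule mult_tail) (rule zs_S(2)[symmetric])
  have z': "zs (vact 2 \<tau>) * (zs (vact 2 \<sigma>) * t) = zs (vact 2 \<sigma>) * (zs (vact 2 \<tau>) * t)" for t :: "((nat \<Rightarrow> 'n) \<Rightarrow> (nat \<Rightarrow> nat) \<Rightarrow> ('k, 'n) fa fps) endo"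
    by (rule mult_tail) (simp add: vact_commute flip: rhom_mult[OF rhom_zs])
  have "vl 2 1 2 RMv * (vl 2 0 2 RMu * ?D) = ?D * (vl 2 0 2 RMu * vl 2 1 2 RMv)"
    unfolding A B by (simp only: mult.assoc z yb z')
  then have "zs (zc \<epsilon>) * (vl 2 1 2 RMv * (vl 2 0 2 RMu * D 1 0 (zc zu) (zc zv))) = zs (zc \<epsilon>) * (D 1 0 (zc zu) (zc zv) * (vl 2 0 2 RMu * vl 2 1 2 RMv))"
    by (simp only: D_scale mult.assoc zs_vl[THEN mult_tail])
  then have "zs (zc \<epsilon>') * (zs (zc \<epsilon>) * (vl 2 1 2 RMv * (vl 2 0 2 RMu * D 1 0 (zc zu) (zc zv)))) = zs (zc \<epsilon>') * (zs (zc \<epsilon>) * (D 1 0 (zc zu) (zc zv) * (vl 2 0 2 RMu * vl 2 1 2 RMv)))"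
    by simp
  then show ?thesis by (simp only: zc_unit[OF unit])
qed

text \<open>In the first term L^-(v) passes L^+ before L^-(u) does, in the second term after it. The
  Yang--Baxter equation brings the resulting outer factors to the same order, so the difference of
  the two terms obeys one linear exchange rule.\<close>

theorem RLLop_exchange:
  assumes Lu: "Lgood Lu (\<epsilon> * zu) (\<delta> * zu) RIu RMu" and Lv: "Lgood Lv (\<epsilon> * zv) (\<delta> * zv) RIv RMv"
    and unit: "\<epsilon> * \<epsilon>' = 1" "\<delta> * \<delta>' = 1"
  shows "RLLop Lu Lv zu zv * (S 0 2 * (S 1 2 * Lp 2)) =
    vl 2 0 2 RIu * (vl 2 1 2 RIv * (Lp 2 * (S 2 1 * (S 2 0 * (RLLop Lu Lv zu zv * (vl 2 0 2 RMu * vl 2 1 2 RMv))))))"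
proof -
  have linu: "lin (Lu i j)" and linv: "lin (Lv i j)" for i j using Lu Lv by (auto simp: Lgood_def)
  let ?D = "D 0 1 (zc zu) (zc zv)" and ?D' = "D 1 0 (zc zu) (zc zv)"
  let ?U = "Lm 0 Lu" and ?V = "Lm 1 Lv" and ?I = "vl 2 0 2 RIu" and ?K = "vl 2 1 2 RIv" and ?M = "vl 2 0 2 RMu" and ?N = "vl 2 1 2 RMv"
  have opu: "?U * (S 0 2 * Lp 2) = ?I * (Lp 2 * (S 2 0 * (?U * ?M)))"
    using op_rel[OF _ Lu, of 0 2] by (simp add: mult.assoc)
  have opv: "?V * (S 1 2 * Lp 2) = ?K * (Lp 2 * (S 2 1 * (?V * ?N)))"
    using op_rel[OF _ Lv, of 1 2] by (simp add: mult.assoc del: One_nat_def)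
  have c1: "?V * S 0 2 = S 0 2 * ?V" "?U * S 1 2 = S 1 2 * ?U" "?U * S 2 1 = S 2 1 * ?U" "?V * S 2 0 = S 2 0 * ?V"
    using linu linv by (auto intro!: Lm_S)
  have c2: "?U * ?K = ?K * ?U" "?V * ?I = ?I * ?V" "?U * ?N = ?N * ?U" "?V * ?M = ?M * ?V"
    using linu linv by (auto intro!: Lm_vl)
  have c3: "S 0 1 * Lp 2 = Lp 2 * S 0 1" "S 1 0 * Lp 2 = Lp 2 * S 1 0"
    by (auto intro!: Lp_S[symmetric])
  have c4: "?D * Lp 2 = Lp 2 * ?D" "?D' * Lp 2 = Lp 2 * ?D'"
  proof -
    have "D r s (zc zu) (zc zv) = vl 0 r s (Dm (fps_const zu) (fps_const zv))" if "r \<noteq> s" for r s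
      using that by (simp add: D_Dm)
    then show "?D * Lp 2 = Lp 2 * ?D" "?D' * Lp 2 = Lp 2 * ?D'" by (simp_all add: Lp_vl)
  qed
  have s1: "S 0 1 * (S 0 2 * ?K) = ?K * (S 0 2 * S 0 1)" by (rule SS_RI[OF Lv]) auto
  have s2: "S 1 0 * (S 1 2 * ?I) = ?I * (S 1 2 * S 1 0)" by (rule SS_RI[OF Lu]) auto
  have m1: "?M * (S 0 1 * S 2 1) = S 2 1 * (S 0 1 * ?M)" by (rule RM_SS[OF Lu]) auto
  have m2: "?N * (S 1 0 * S 2 0) = S 2 0 * (S 1 0 * ?N)" by (rule RM_SS[OF Lv]) auto
  have d1: "?D * (S 2 0 * S 2 1) = S 2 1 * (S 2 0 * ?D)"
    using D_SS(2)[of 2 0 1 "zc zu" "zc zv"] by (simp add: scalar_vact mult.assoc del: One_nat_def)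
  have d2: "?D' * (S 0 2 * S 1 2) = S 1 2 * (S 0 2 * ?D')"
    using D_SS(1)[of 1 0 2 "zc zu" "zc zv"] by (simp add: scalar_vact mult.assoc del: One_nat_def)
  have t1: "?D * (?U * (S 0 1 * (?V * (S 0 2 * (S 1 2 * Lp 2))))) = ?I * (?K * (Lp 2 * (S 2 1 * (S 2 0 * (?D * (?U * (S 0 1 * (?V * (?M * ?N)))))))))"
  proof -
    have "?D * (?U * (S 0 1 * (?V * (S 0 2 * (S 1 2 * Lp 2))))) = ?D * (?U * (S 0 1 * (S 0 2 * (?V * (S 1 2 * Lp 2)))))"
      by (simp only: c1(1)[THEN mult_tail])
    also have "\<dots> = ?D * (?U * ((S 0 1 * (S 0 2 * ?K)) * (Lp 2 * (S 2 1 * (?V * ?N)))))"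
      by (simp only: opv mult.assoc)
    also have "\<dots> = ?D * (?K * (?U * (S 0 2 * (Lp 2 * (S 0 1 * (S 2 1 * (?V * ?N)))))))"
      by (simp only: s1 mult.assoc c2(1)[THEN mult_tail] c3(1)[THEN mult_tail])
    also have "\<dots> = ?D * (?K * ((?U * (S 0 2 * Lp 2)) * (S 0 1 * (S 2 1 * (?V * ?N)))))"
      by (simp only: mult.assoc)
    also have "\<dots> = ?D * (?K * (?I * (Lp 2 * (S 2 0 * (?U * ((?M * (S 0 1 * S 2 1)) * (?V * ?N)))))))"
      by (simp only: opu mult.assoc)
    also have "\<dots> = (?D * (?K * ?I)) * (Lp 2 * (S 2 0 * (?U * (S 2 1 * (S 0 1 * (?M * (?V * ?N)))))))"
      by (simp only: m1 mult.assoc)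
    also have "\<dots> = ?I * (?K * (?D * (Lp 2 * (S 2 0 * (S 2 1 * (?U * (S 0 1 * (?V * (?M * ?N)))))))))"
      by (simp only: D_RI_RI'[OF Lu Lv unit(1)] mult.assoc c1(3)[THEN mult_tail] c2(4)[symmetric, THEN mult_tail])
    also have "\<dots> = ?I * (?K * (Lp 2 * ((?D * (S 2 0 * S 2 1)) * (?U * (S 0 1 * (?V * (?M * ?N)))))))"
      by (simp only: c4(1)[THEN mult_tail] mult.assoc)
    finally show ?thesis by (simp only: d1 mult.assoc)
  qed
  have t2: "?V * (S 1 0 * (?U * (?D' * (S 0 2 * (S 1 2 * Lp 2))))) = ?I * (?K * (Lp 2 * (S 2 1 * (S 2 0 * (?V * (S 1 0 * (?U * (?D' * (?M * ?N)))))))))"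
  proof -
    have "?V * (S 1 0 * (?U * (?D' * (S 0 2 * (S 1 2 * Lp 2))))) = ?V * (S 1 0 * (?U * ((?D' * (S 0 2 * S 1 2)) * Lp 2)))"
      by (simp only: mult.assoc)
    also have "\<dots> = ?V * (S 1 0 * (S 1 2 * ((?U * (S 0 2 * Lp 2)) * ?D')))"
      by (simp only: d2 mult.assoc c4(2) c1(2)[THEN mult_tail])
    also have "\<dots> = ?V * ((S 1 0 * (S 1 2 * ?I)) * (Lp 2 * (S 2 0 * (?U * (?M * ?D')))))"
      by (simp only: opu mult.assoc)
    also have "\<dots> = ?I * ((?V * (S 1 2 * Lp 2)) * (S 1 0 * (S 2 0 * (?U * (?M * ?D')))))"
      by (simp only: s2 mult.assoc c2(2)[THEN mult_tail] c3(2)[THEN mult_tail])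
    also have "\<dots> = ?I * (?K * (Lp 2 * (S 2 1 * (?V * ((?N * (S 1 0 * S 2 0)) * (?U * (?M * ?D')))))))"
      by (simp only: opv mult.assoc)
    also have "\<dots> = ?I * (?K * (Lp 2 * (S 2 1 * (S 2 0 * (?V * (S 1 0 * (?U * (?N * (?M * ?D')))))))))"
      by (simp only: m2 mult.assoc c1(4)[THEN mult_tail] c2(3)[symmetric, THEN mult_tail])
    finally show ?thesis by (simp only: RM_RM_D'[OF Lu Lv unit(2)] mult.assoc)
  qed
  show ?thesis
    unfolding RLLop_def left_diff_distrib right_diff_distrib by (simp only: mult.assoc t1 t2)
qed

definition Dk :: "'k fps \<Rightarrow> 'k fps \<Rightarrow> ('k fps, 'n) mat2" where
  "Dk z w = (\<chi> x y. z * cm (flip (RP R) $ x $ y) - w * cm (PRi R $ x $ y))"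

abbreviation me :: "'k fps \<Rightarrow> ('k, 'n) fa fps endo" where "me s \<equiv> mulL (scE s)"

abbreviation ELm :: "('n \<Rightarrow> 'n \<Rightarrow> ('k, 'n) fa fps \<Rightarrow> ('k, 'n) fa fps) \<Rightarrow> ('k, 'n) fa fps endo ^ 'n ^ 'n" where
  "ELm L \<equiv> (\<chi> i k. Endo (L i k))"

text \<open>The operator \<open>RLLop\<close> acts on the legs 0 and 1 by a matrix of operators on
  the algebra that involves no v_k, so its vanishing can be tested entry by entry on words.\<close>

definition RLLmat where
  "RLLmat Lu Lv zu zv = map_matrix me (Dk zu zv) ** t1 (ELm Lu) ** map_matrix me Sc ** t2 (ELm Lv)
     - t2 (ELm Lv) ** map_matrix me (flip Sc) ** t1 (ELm Lu) ** map_matrix me (flip (Dk zu zv))"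

lemma RLLop_RLLmat: "RLLop Lu Lv zu zv = l2 0 1 (map_matrix (\<lambda>T. act 0 (fps_const T)) (RLLmat Lu Lv zu zv))"
proof -
  let ?a = "\<lambda>T :: ('k, 'n) fa fps endo. act 0 (fps_const T)"
  have a: "rhom ?a" by (rule rhom_comp[OF rhom_act rhom_fps_const])
  have n: "(0::nat) \<noteq> 1" "(1::nat) \<noteq> 0" by auto
  have me: "?a (me s) = zc s" for s
    by (simp add: vact_def msc_def fps_map_const rhom_zero[OF rhom_comp[OF rhom_mulL rhom_scE]])
  have Sm: "map_matrix ?a (map_matrix me Sc) = map_matrix eta (RP R)"
    by (simp add: vec_eq_iff me Sc_def vact_eta)
  have Sf: "l2 0 1 (map_matrix ?a (map_matrix me (flip Sc))) = S 1 0"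
  proof -
    have "map_matrix ?a (map_matrix me (flip Sc)) = flip (map_matrix eta (RP R))"
      by (simp add: vec_eq_iff me Sc_def vact_eta nth_flip)
    then show ?thesis using l2_flip[OF n(2)] by (simp add: S_def)
  qed
  have Dm: "l2 r s (map_matrix ?a (map_matrix me (Dk zu zv))) = D r s (zc zu) (zc zv)" if "r \<noteq> s" for r s
  proof -
    have "map_matrix ?a (map_matrix me (Dk zu zv)) = map_matrix (vact 0) (Dm (fps_const zu) (fps_const zv))"
      by (simp add: vec_eq_iff me Dk_def Dm_def)
    then show ?thesis using that by (simp add: D_Dm)
  qed
  have Df: "l2 0 1 (map_matrix ?a (map_matrix me (flip (Dk zu zv)))) = D 1 0 (zc zu) (zc zv)"
    unfolding map_matrix_flip l2_flip[OF n(2)] by (rule Dm[OF n(2)])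
  have E: "map_matrix ?a (ELm L) = map_matrix (act 0) (LmM L)" for L
    by (simp add: vec_eq_iff LmM_def)
  show ?thesis
    unfolding RLLmat_def map_matrix_diff[OF a] map_matrix_mult[OF a] map_matrix_t1[OF a] map_matrix_t2[OF a] l2_diff E
    using n by (simp add: l2_mult[symmetric] l2_t1 l2_t2 Dm Df Sf RLLop_def Lm_def mult.assoc del: One_nat_def) (simp add: Sm S_def)
qed

lemma lin_RLLmat:
  assumes "\<And>i j. lin (Lu i j)" "\<And>i j. lin (Lv i j)"
  shows "lin (ap (RLLmat Lu Lv zu zv $ p $ q))"
proof (rule linI)
  fix s y
  have m: "me s * me t = me t * me s" for t by (rule mulL_scE_commute)
  have E: "me s * Endo (L i j) = Endo (L i j) * me s" if "\<And>i j. lin (L i j)" for L :: "'n \<Rightarrow> 'n \<Rightarrow> ('k, 'n) fa fps \<Rightarrow> ('k, 'n) fa fps" and i j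
    by (rule endo_eqI) (simp add: ap_Endo_lin[OF that] lin_scE[OF that])
  have mult: "(\<And>p q. me s * (A ** B) $ p $ q = (A ** B) $ p $ q * me s)"
    if A: "\<And>p q. me s * A $ p $ q = A $ p $ q * me s" and B: "\<And>p q. me s * B $ p $ q = B $ p $ q * me s" for A B :: "(('k, 'n) fa fps endo, 'n) mat2"
  proof -
    have "me s * (A $ p $ k * B $ k $ q) = A $ p $ k * B $ k $ q * me s" for p k q
      by (simp only: mult.assoc[symmetric] A) (simp only: mult.assoc B)
    then show "me s * (A ** B) $ p $ q = (A ** B) $ p $ q * me s" for p q
      by (simp add: nth_matrix_mult sum_distrib_left sum_distrib_right)
  qed
  have c: "me s * RLLmat Lu Lv zu zv $ p $ q = RLLmat Lu Lv zu zv $ p $ q * me s"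
    unfolding RLLmat_def vector_minus_component left_diff_distrib right_diff_distrib
    by (intro arg_cong2[where f = "(-)"] mult) (auto simp: m t1_def t2_def E[of Lu, OF assms(1)] E[of Lv, OF assms(2)])
  have "ap (me s * RLLmat Lu Lv zu zv $ p $ q) y = ap (RLLmat Lu Lv zu zv $ p $ q * me s) y" by (simp only: c)
  then show "ap (RLLmat Lu Lv zu zv $ p $ q) (scE s * y) = scE s * ap (RLLmat Lu Lv zu zv $ p $ q) y" by simp
qed simp

text \<open>Let G be the common kernel of the entries. The exchange rule and two cancellations of RP
  show that G is stable under left multiplication by every \<open>lam\<close>; as it contains 1, it
  contains all words.\<close>

theorem RLLmat_zero:
  assumes Lu: "Lgood Lu (\<epsilon> * zu) (\<delta> * zu) RIu RMu" and Lv: "Lgood Lv (\<epsilon> * zv) (\<delta> * zv) RIv RMv"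
    and unit: "\<epsilon> * \<epsilon>' = 1" "\<delta> * \<delta>' = 1"
  shows "RLLmat Lu Lv zu zv = 0"
proof -
  have linu: "\<And>i j. lin (Lu i j)" and linv: "\<And>i j. lin (Lv i j)" using Lu Lv by (auto simp: Lgood_def)
  define n where "n p q = ap (RLLmat Lu Lv zu zv $ p $ q)" for p q
  have linn: "lin (n p q)" for p q unfolding n_def by (rule lin_RLLmat[OF linu linv])
  let ?N = "RLLop Lu Lv zu zv"
  define G where "G = {y. \<forall>p q. n p q y = 0}"
  have G: "submod G"
    by (auto simp: submod_def G_def lin_zero[OF linn] lin_add[OF linn] lin_scE[OF linn])
  have N: "ap ?N \<psi> x e = (\<Sum>p\<in>UNIV. n (x 0, x 1) p (\<psi> (x(0 := fst p, 1 := snd p)) e))" for \<psi> x e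
    by (simp add: RLLop_RLLmat ap_l2 sum_fun_apply ap_act_const n_def)
  have NG: "ap ?N \<psi> = 0" if "valued G \<psi>" for \<psi>
  proof (intro ext)
    fix x e
    have "n p q (\<psi> y e') = 0" for p q y e' using that unfolding valued_def G_def by blast
    then show "ap ?N \<psi> x e = 0 x e" by (simp add: N)
  qed
  have zero: "submod {0}" by (auto simp: submod_def)
  have v0: "valued {0} \<psi> \<longleftrightarrow> \<psi> = 0" for \<psi> :: "(nat \<Rightarrow> 'n) \<Rightarrow> (nat \<Rightarrow> nat) \<Rightarrow> ('k, 'n) fa fps"
    by (auto simp: valued_def fun_eq_iff)
  have euN: "eu 2 c a * ?N = ?N * eu 2 c a" for c a
    unfolding RLLop_RLLmat by (rule eu_l2_commute) auto
  have zN: "?N * zs (eta s) = zs (eta s) * ?N" for s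
    by (rule op_eqI, rule ext) (simp add: N ap_zs_eta lin_scE[OF linn] sum_distrib_left)
  \<comment> \<open>After the exchange \<open>RLLop\<close> is applied to scalar matrices acting on
    the vector, and these keep the values in its kernel G.\<close>
  have 1: "ap (?N * S 0 2 * (S 1 2 * Lp 2)) \<psi> = 0" if "valued G \<psi>" for \<psi>
  proof -
    have "?N * S 0 2 * (S 1 2 * Lp 2) = (vl 2 0 2 RIu * (vl 2 1 2 RIv * (Lp 2 * (S 2 1 * S 2 0)))) * (?N * (vl 2 0 2 RMu * vl 2 1 2 RMv))"
      using RLLop_exchange[OF Lu Lv unit] by (simp only: mult.assoc)
    moreover have "ap (?N * (vl 2 0 2 RMu * vl 2 1 2 RMv)) \<psi> = 0"
      using NG[OF valued_vl[OF G valued_vl[OF G that]]] by simp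
    ultimately show ?thesis by simp
  qed
  have 2: "ap (?N * (S 1 2 * Lp 2)) \<psi> = 0" if "valued G \<psi>" for \<psi>
  proof -
    have "valued {0} (ap (?N * (S 1 2 * Lp 2)) \<psi>)"
    proof (rule skew_valued[OF zero, where r = 0 and k = 2])
      show "eu 0 c a * (S 1 2 * Lp 2) = S 1 2 * Lp 2 * eu 0 c a" for c a
        using eu_S[of 0 1 2 c a, THEN mult_tail] eu_Lp[of 0 2 c a] by (simp add: mult.assoc del: One_nat_def)
      show "valued {0} (ap (?N * S 0 2 * (S 1 2 * Lp 2)) (ap (eu 0 j m) \<psi>))" for j m
        unfolding v0 by (rule 1) (rule valued_eu[OF G that])
    qed (use euN zN in auto)
    then show ?thesis by (simp only: v0)
  qed
  have 3: "ap (?N * Lp 2) \<psi> = 0" if "valued G \<psi>" for \<psi>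
  proof -
    have "valued {0} (ap (?N * Lp 2) \<psi>)"
    proof (rule skew_valued[OF zero, where r = 1 and k = 2])
      show "eu 1 c a * Lp 2 = Lp 2 * eu 1 c a" for c a by (rule eu_Lp) simp
      show "valued {0} (ap (?N * S 1 2 * Lp 2) (ap (eu 1 j m) \<psi>))" for j m
        unfolding v0 mult.assoc by (rule 2) (rule valued_eu[OF G that])
    qed (use euN zN in auto)
    then show ?thesis by (simp only: v0)
  qed
  have lam: "lam c b f * y \<in> G" if y: "y \<in> G" for c b f y
    unfolding G_def
  proof (intro CollectI allI)
    fix p q
    \<comment> \<open>The column indices q and b sit on the legs of x0, the row indices p and c on
      those of x1; in degree f of v_2 only one summand is nonzero.\<close>
    define x0 where "x0 = (\<lambda>m::nat. if m = 0 then fst q else if m = 1 then snd q else b)"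
    define x1 where "x1 = x0(0 := fst p, 1 := snd p, 2 := c)"
    define e where "e = (\<lambda>m::nat. if m = 2 then f else 0)"
    have "ap (Lp 2) (dl x0 y) (x1(0 := fst r, 1 := snd r)) e = (if r = q then lam c b f * y else 0)" for r
    proof -
      have upd: "x1(0 := fst r, 1 := snd r, 2 := a) = x0 \<longleftrightarrow> r = q \<and> a = b" for a
      proof
        assume *: "x1(0 := fst r, 1 := snd r, 2 := a) = x0"
        from fun_cong[OF *, of 0] fun_cong[OF *, of 1] fun_cong[OF *, of 2]
        show "r = q \<and> a = b" by (simp add: x0_def x1_def prod_eq_iff)
      qed (auto simp: x0_def x1_def fun_eq_iff)
      have updz: "e(2 := f - d) = (\<lambda>_. 0) \<longleftrightarrow> f - d = 0" for d
      proof
        assume *: "e(2 := f - d) = (\<lambda>_. 0)"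
        from fun_cong[OF *, of 2] show "f - d = 0" by simp
      qed (auto simp: e_def fun_eq_iff)
      have ev: "e 2 = f" "(x1(0 := fst r, 1 := snd r)) 2 = c"
        by (simp_all add: e_def x1_def)
      have "ap (Lp 2) (dl x0 y) (x1(0 := fst r, 1 := snd r)) e = (\<Sum>a\<in>UNIV. \<Sum>d\<le>f. if a = b then (if d = f then (if r = q then lam c b f * y else 0) else 0) else 0)"
        unfolding ap_Lp
      proof (intro sum.cong)
        show "{..e 2} = {..f}" by (simp add: e_def)
        fix a d assume "d \<in> {..f}"
        then show "lam ((x1(0 := fst r, 1 := snd r)) 2) a d * dl x0 y (x1(0 := fst r, 1 := snd r, 2 := a)) (e(2 := e 2 - d)) =
           (if a = b then (if d = f then (if r = q then lam c b f * y else 0) else 0) else 0)"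
          by (simp only: dl_def ev upd updz) auto
      qed simp_all
      then show ?thesis by (simp only: sum_delta2)
    qed
    then have "ap (?N * Lp 2) (dl x0 y) x1 e = (\<Sum>r\<in>UNIV. if r = q then n p q (lam c b f * y) else 0)"
      unfolding ap_simps N by (intro sum.cong refl) (auto simp: x1_def lin_zero[OF linn])
    then have "ap (?N * Lp 2) (dl x0 y) x1 e = n p q (lam c b f * y)" by simp
    moreover have "valued G (dl x0 y)" using y G by (auto simp: valued_def dl_def submod_def)
    ultimately show "n p q (lam c b f * y) = 0" using 3[of "dl x0 y"] by simp
  qed
  \<comment> \<open>On vectors with scalar values both operators L^- act as the identity, and what
    remains of the difference vanishes by \<open>D_S\<close>.\<close>
  have one: "1 \<in> G"
  proof -
    let ?c = "\<lambda>\<psi> :: (nat \<Rightarrow> 'n) \<Rightarrow> (nat \<Rightarrow> nat) \<Rightarrow> ('k, 'n) fa fps. \<forall>x e. \<exists>s. \<psi> x e = scE s"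
    have Lm1: "ap (Lm r L) \<psi> = \<psi>" if c: "?c \<psi>" and that: "\<And>i j. lin (L i j)" "\<And>i j. L i j 1 = (if i = j then 1 else 0)" for L r \<psi>
    proof (intro ext)
      fix x e
      have "L i j (scE s) = (if i = j then scE s else 0)" for i j s
        using lin_scE[OF that(1), of i j s 1] that(2) by simp
      moreover obtain g where g: "\<And>x e. \<psi> x e = scE (g x e)" using c by metis
      ultimately show "ap (Lm r L) \<psi> x e = \<psi> x e"
        unfolding ap_Lm[OF that(1)] g by simp
    qed
    have cv: "?c (ap (vl k r s A) \<psi>)" if c: "?c \<psi>" for k r s A \<psi>
    proof (intro allI)
      fix x e
      obtain g where g: "\<And>x e. \<psi> x e = scE (g x e)" using c by metis
      show "\<exists>t. ap (vl k r s A) \<psi> x e = scE t"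
        unfolding ap_vl g rhom_mult[OF rhom_scE, symmetric] rhom_sum[OF rhom_scE, symmetric] by blast
    qed
    have oneu: "Lu i j 1 = (if i = j then 1 else 0)" and onev: "Lv i j 1 = (if i = j then 1 else 0)" for i j
      using Lu Lv by (auto simp: Lgood_def)
    have cS: "?c (ap (S r s) \<psi>)" if "?c \<psi>" "r \<noteq> s" for r s \<psi>
      using cv[OF that(1), where k = 0 and r = r and s = s and A = "map_matrix fps_const Sc"] S_vl[OF that(2), of 0] by simp
    have cD: "?c (ap (D r s (zc zu) (zc zv)) \<psi>)" if "?c \<psi>" "r \<noteq> s" for r s \<psi>
      using cv[OF that(1), where k = 0 and r = r and s = s and A = "Dm (fps_const zu) (fps_const zv)"] D_Dm[OF that(2), of 0] by simp
    have "ap ?N \<psi> = 0" if c: "?c \<psi>" for \<psi>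
    proof -
      have n01: "(0::nat) \<noteq> 1" "(1::nat) \<noteq> 0" by auto
      have "ap ?N \<psi> = ap (D 0 1 (zc zu) (zc zv) * S 0 1) \<psi> - ap (S 1 0 * D 1 0 (zc zu) (zc zv)) \<psi>"
        unfolding RLLop_def ap_simps Lm1[OF c linv onev] Lm1[OF cS[OF c n01(1)] linu oneu]
          Lm1[OF cD[OF c n01(2)] linu oneu] Lm1[OF cS[OF cD[OF c n01(2)] n01(2)] linv onev] ..
      then show ?thesis by (simp only: D_S[OF n01(1) scalar_vact scalar_vact] diff_self)
    qed
    moreover have "?c (dl x0 1)" for x0
    proof (intro allI)
      fix x e
      show "\<exists>s. dl x0 1 x e = scE s"
        by (cases "x = x0 \<and> e = (\<lambda>_. 0)") (auto simp: dl_def rhom_one[OF rhom_scE] rhom_zero[OF rhom_scE] intro: exI[of _ 1] exI[of _ 0])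
    qed
    ultimately have N0: "ap ?N (dl x0 1) = 0" for x0 by blast
    have "n p q 1 = 0" for p q
    proof -
      define x0 where "x0 = (\<lambda>m::nat. if m = 0 then fst q else snd q)"
      define x1 where "x1 = x0(0 := fst p, 1 := snd p)"
      have upd: "x1(0 := fst r, 1 := snd r) = x0 \<longleftrightarrow> r = q" for r
      proof
        assume *: "x1(0 := fst r, 1 := snd r) = x0"
        from fun_cong[OF *, of 0] fun_cong[OF *, of 1] show "r = q" by (simp add: x0_def x1_def prod_eq_iff)
      qed (auto simp: x0_def x1_def fun_eq_iff)
      have "ap ?N (dl x0 1) x1 (\<lambda>_. 0) = (\<Sum>r\<in>UNIV. if r = q then n p q 1 else 0)"
        unfolding N dl_def upd by (intro sum.cong refl) (auto simp: x1_def lin_zero[OF linn])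
      then show ?thesis using N0 by (simp add: zero_fun_apply)
    qed
    then show ?thesis by (simp add: G_def)
  qed
  have "wrd (Word w) \<in> G" for w
  proof (induction w)
    case Nil
    have "wrd (Word []) = (1 :: ('k,'n) fa fps)" by (simp add: wrd_zero flip: zero_free_monoid_def)
    then show ?case using one by simp
  next
    case (Cons l w)
    obtain c b f where l: "l = (c, b, f)" by (cases l)
    have "(wrd (Word (l # w)) :: ('k,'n) fa fps) = (if c = b \<and> f = 0 then wrd (Word w) else 0) + scE (- 1) * (lam c b f * wrd (Word w))"
      by (simp add: lam_wrd l rhom_minus[OF rhom_scE] rhom_one[OF rhom_scE])
    then show ?case using Cons lam[OF Cons] G by (auto simp: submod_def)
  qed
  then have w: "n p q (wrd w) = 0" for p q w
  proof (cases w)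
    case (Word x)
    then show ?thesis using \<open>wrd (Word x) \<in> G\<close> unfolding G_def by blast
  qed
  have "n p q y = 0" for p q y by (rule lin_eq_zero[OF linn w])
  then show ?thesis
    by (auto simp: vec_eq_iff n_def intro!: endo_eqI)
qed

end

text \<open>The hypothesis \<open>gen\<close> covers right multiples only; left multipliers are split into letters, to which \<open>rec\<close> applies.\<close>

lemma L_preserves_ideal:
  fixes L :: "'n::finite \<Rightarrow> 'n \<Rightarrow> ('k::comm_ring_1 fls, 'n) fa fps \<Rightarrow> ('k fls, 'n) fa fps"
  assumes J: "hideal J" and lin: "\<And>i k. lin (L i k)"
    and rec: "\<And>y i k c b e. (\<And>i k. L i k y \<in> JE J) \<Longrightarrow> L i k (lam c b e * y) \<in> JE J"
    and gen: "\<And>\<rho> i k z. \<rho> \<in> \<Gamma> \<Longrightarrow> L i k (cemb \<rho> * z) \<in> JE J"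
    and least: "\<And>I. hideal I \<Longrightarrow> \<Gamma> \<subseteq> I \<Longrightarrow> J \<subseteq> I"
    and x: "x \<in> J"
  shows "L i k (cemb x) \<in> JE J"
proof -
  have JE: "hideal (JE J)" by (rule hideal_JE[OF J])
  \<comment> \<open>Left and right multipliers are built into I, which makes it a two-sided ideal by
    construction.\<close>
  define I where "I = {x. \<forall>y z i k. L i k (cemb y * cemb x * z) \<in> JE J}"
  have cm: "cemb (a * b) = cemb a * cemb b" "cemb (a + b) = cemb a + cemb b" for a b :: "('k, 'n) fa fps"
    by (rule rhom_mult[OF rhom_cemb], rule rhom_add[OF rhom_cemb])
  have X: "cemb fps_X = (fps_X :: ('k fls, 'n) fa fps)"
    by (simp add: fps_eq_iff rhom_one[OF rhom_pmap[OF rhom_fls_const]] rhom_zero[OF rhom_pmap[OF rhom_fls_const]])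
  have Xc: "a * (fps_X * b) = fps_X * (a * b)" for a b :: "('k fls, 'n) fa fps"
    by (rule lin_X[OF lin_mult_left])
  have linyz: "lin (\<lambda>x. L i k (a * x * z))" for i k a z
  proof -
    have "lin (\<lambda>x. a * x * z)"
    proof (rule linI)
      show "a * (scE s * x) * z = scE s * (a * x * z)" for s x
        by (simp only: lin_scE[OF lin_mult_left] mult.assoc)
    qed (simp add: distrib_left distrib_right)
    from lin_comp[OF lin this] show ?thesis .
  qed
  have "hideal I"
    unfolding hideal_def
  proof (intro conjI ballI allI impI)
    show "0 \<in> I" by (simp add: I_def rhom_zero[OF rhom_cemb] lin_zero[OF lin] hideal_zero[OF JE])
    show "a + b \<in> I" if "a \<in> I" "b \<in> I" for a b
      using that by (simp add: I_def cm distrib_left distrib_right lin_add[OF lin] hideal_add[OF JE])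
    show "a * b \<in> I" "b * a \<in> I" if "a \<in> I" for a b
    proof -
      have *: "L i k (cemb y * cemb a * z) \<in> JE J" for y z i k using that by (auto simp: I_def)
      have "cemb y * cemb (a * b) * z = cemb y * cemb a * (cemb b * z)"
        "cemb y * cemb (b * a) * z = cemb (y * b) * cemb a * z" for y z
        by (simp_all only: cm mult.assoc)
      then show "a * b \<in> I" "b * a \<in> I"
        unfolding I_def by (auto simp only: * mem_Collect_eq)
    qed
    show "a \<in> I" if a: "\<forall>m. \<exists>y\<in>I. \<forall>l<m. fps_nth y l = fps_nth a l" for a
      unfolding I_def
    proof (intro CollectI allI)
      fix y z i k
      show "L i k (cemb y * cemb a * z) \<in> JE J"
      proof (rule JE_approx[OF JE linyz])
        fix m
        obtain b where "b \<in> I" "\<forall>l<m. fps_nth b l = fps_nth a l" using a by blast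
        then show "\<exists>b. L i k (cemb y * b * z) \<in> JE J \<and> (\<forall>l<m. fps_nth b l = fps_nth (cemb a) l)"
          by (intro exI[of _ "cemb b"]) (auto simp: I_def)
      qed
    qed
    show "a \<in> I" if "fps_X * a \<in> I" for a
    proof -
      have "fps_X * L i k (cemb y * cemb a * z) \<in> JE J" for y z i k
      proof -
        have "L i k (cemb y * cemb (fps_X * a) * z) \<in> JE J" using that unfolding I_def by blast
        moreover have "cemb y * cemb (fps_X * a) * z = fps_X * (cemb y * cemb a * z)"
          unfolding cm X mult.assoc by (rule Xc)
        ultimately show ?thesis by (simp only: lin_X[OF lin])
      qed
      then show ?thesis using hideal_saturated[OF JE] by (auto simp: I_def)
    qed
  qed
  moreover have "\<Gamma> \<subseteq> I"
  proof
    fix \<rho> assume \<rho>: "\<rho> \<in> \<Gamma>"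
    \<comment> \<open>For a fixed relation the admissible left multipliers form a closed submodule,
      and \<open>rec\<close> allows one more letter on the left; hence they are everything.\<close>
    define G where "G = {y :: ('k fls, 'n) fa fps. \<forall>z i k. L i k (y * (cemb \<rho> * z)) \<in> JE J}"
    have "y \<in> G" for y
    proof (rule span_closed)
      show "0 \<in> G" by (simp add: G_def lin_zero[OF lin] hideal_zero[OF JE])
      show "a + b \<in> G" if "a \<in> G" "b \<in> G" for a b
        using that by (simp add: G_def distrib_right lin_add[OF lin] hideal_add[OF JE])
      show "scE s * a \<in> G" if "a \<in> G" for s a
        using that by (simp add: G_def mult.assoc lin_scE[OF lin] hideal_mult_left[OF JE])
      show "a \<in> G" if a: "\<And>m. \<exists>y\<in>G. \<forall>l<m. fps_nth y l = fps_nth a l" for a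
        unfolding G_def
      proof (intro CollectI allI)
        fix z i k
        have l: "lin (\<lambda>y. L i k (y * (cemb \<rho> * z)))" using linyz[of i k 1 "cemb \<rho> * z"] by simp
        show "L i k (a * (cemb \<rho> * z)) \<in> JE J"
        proof (rule JE_approx[OF JE l])
          fix m
          obtain y where "y \<in> G" "\<forall>l<m. fps_nth y l = fps_nth a l" using a by blast
          then show "\<exists>y. L i k (y * (cemb \<rho> * z)) \<in> JE J \<and> (\<forall>l<m. fps_nth y l = fps_nth a l)"
            by (intro exI[of _ y]) (simp add: G_def)
        qed
      qed
      have "wrd (Word w) \<in> G" for w
      proof (induction w)
        case Nil
        have "wrd (Word []) = (1 :: ('k fls, 'n) fa fps)" by (simp add: wrd_zero flip: zero_free_monoid_def)
        then show ?case using gen[OF \<rho>] by (simp add: G_def)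
      next
        case (Cons l w)
        obtain c b f where l: "l = (c, b, f)" by (cases l)
        have "wrd (Word (l # w)) = (if c = b \<and> f = 0 then wrd (Word w) else 0) - (lam c b f * wrd (Word w) :: ('k fls, 'n) fa fps)"
          by (simp add: lam_wrd l)
        then have eq: "L i k (wrd (Word (l # w)) * t) = (if c = b \<and> f = 0 then L i k (wrd (Word w) * t) else 0) - L i k (lam c b f * (wrd (Word w) * t))" for i k t
          by (simp add: left_diff_distrib lin_diff[OF lin] mult.assoc lin_zero[OF lin])
        have w: "L i k (wrd (Word w) * (cemb \<rho> * z)) \<in> JE J" for i k z
          using Cons unfolding G_def by blast
        have w': "L i k (lam c b f * (wrd (Word w) * (cemb \<rho> * z))) \<in> JE J" for i k z
          by (rule rec) (rule w)
        have "L i k (wrd (Word (l # w)) * (cemb \<rho> * z)) \<in> JE J" for i k z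
          by (subst eq, rule hideal_diff[OF JE _ w']) (simp add: w hideal_zero[OF JE])
        then show ?case unfolding G_def by blast
      qed
      then show "wrd w \<in> G" for w by (cases w) simp
    qed
    then have "L i k (y * (cemb \<rho> * z)) \<in> JE J" for y z i k unfolding G_def by blast
    then show "\<rho> \<in> I" unfolding I_def by (auto simp only: mem_Collect_eq mult.assoc)
  qed
  ultimately have "x \<in> I" using least x by blast
  then have "L i k (cemb 1 * cemb x * 1) \<in> JE J" unfolding I_def by blast
  then show ?thesis by (simp add: rhom_one[OF rhom_cemb])
qed

subsection \<open>Series in \<open>v\<^sub>1, \<dots>, v\<^sub>n\<close> as operators\<close>

text \<open>Lists of indices become functions on all legs; beyond the list a fixed default keeps
  equal lists and equal functions in correspondence once the length is known.\<close>

definition ix :: "'n list \<Rightarrow> nat \<Rightarrow> 'n" where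
  "ix I = (\<lambda>k. if k < length I then I ! k else undefined)"

text \<open>Shifted by one: leg 0 carries L^- and has no variable, so the exponent of v_k is at
  position k - 1 of the list. All other variables have degree 0.\<close>

definition ex :: "nat list \<Rightarrow> nat \<Rightarrow> nat" where
  "ex e = (\<lambda>k. if 1 \<le> k \<and> k \<le> length e then e ! (k - 1) else 0)"

abbreviation exps :: "nat \<Rightarrow> nat list \<Rightarrow> nat list set" where
  "exps n e \<equiv> {d. length d = n \<and> (\<forall>k<n. d ! k \<le> e ! k)}"

lemma finite_exps: "finite (exps n e)"
proof -
  obtain B where B: "\<forall>i<n. e ! i \<le> B"
    using finite_nat_set_iff_bounded_le[of "(!) e ` {..<n}"] by auto
  have "exps n e \<subseteq> {d. set d \<subseteq> {..B} \<and> length d = n}"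
    using B order_trans by (fastforce simp: in_set_conv_nth)
  then show ?thesis by (rule finite_subset) (simp add: finite_lists_length_eq)
qed

lemma finite_indices: "finite {K :: 'n::finite list. length K = m}"
  using finite_lists_length_eq[of "UNIV :: 'n set" m] by simp

lemma vmul_eq: "vmul n S T e I J = (\<Sum>d\<in>exps n e. \<Sum>K | length K = Suc n. S d I K * T (map2 (-) e d) K J)"
  by (simp add: vmul_def tmul_def)

lemma vmul_cong:
  assumes "length e = n" "length I = Suc n"
    "\<And>d K. length d = n \<Longrightarrow> length K = Suc n \<Longrightarrow> S d I K = S' d I K"
    "\<And>d K. length d = n \<Longrightarrow> length K = Suc n \<Longrightarrow> T d K J = T' d K J"
  shows "vmul n S T e I J = vmul n S' T' e I J"
  unfolding vmul_eq using assms by (intro sum.cong refl) auto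

lemma vmul_assoc:
  fixes S T U :: "('a::ring_1, 'n::finite) vtens" and e :: "nat list"
  assumes e: "length e = n"
  shows "vmul n (vmul n S T) U e I J = vmul n S (vmul n T U) e I J"
proof -
  let ?K = "{K :: 'n list. length K = Suc n}"
  let ?t = "\<lambda>c d' d'' K K'. S c I K * T d' K K' * U d'' K' J"
  have "vmul n (vmul n S T) U e I J = (\<Sum>d\<in>exps n e. \<Sum>K'\<in>?K. \<Sum>c\<in>exps n d. \<Sum>K\<in>?K. ?t c (map2 (-) d c) (map2 (-) e d) K K')"
    by (simp add: vmul_eq sum_distrib_right)
  also have "\<dots> = (\<Sum>d\<in>exps n e. \<Sum>c\<in>exps n d. \<Sum>K'\<in>?K. \<Sum>K\<in>?K. ?t c (map2 (-) d c) (map2 (-) e d) K K')"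
    by (rule sum.cong[OF refl], rule sum.swap)
  also have "\<dots> = (\<Sum>(d, c)\<in>Sigma (exps n e) (exps n). \<Sum>K'\<in>?K. \<Sum>K\<in>?K. ?t c (map2 (-) d c) (map2 (-) e d) K K')"
    by (rule sum.Sigma) (auto simp: finite_exps)
  \<comment> \<open>c is the degree taken by S and d' the one taken by T; on the left d = c + d' is
    their sum.\<close>
  also have "\<dots> = (\<Sum>(c, d')\<in>Sigma (exps n e) (\<lambda>c. exps n (map2 (-) e c)). \<Sum>K'\<in>?K. \<Sum>K\<in>?K. ?t c d' (map2 (-) (map2 (-) e c) d') K K')"
  proof (rule sum.reindex_bij_witness[where i = "\<lambda>(c, d'). (map2 (+) c d', c)" and j = "\<lambda>(d, c). (c, map2 (-) d c)"])
    fix a :: "nat list \<times> nat list" assume a: "a \<in> Sigma (exps n e) (exps n)"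
    obtain d c where dc: "a = (d, c)" by (cases a)
    have l: "length d = n" "length c = n" and le: "\<And>k. k < n \<Longrightarrow> d ! k \<le> e ! k" "\<And>k. k < n \<Longrightarrow> c ! k \<le> d ! k"
      using a dc by auto
    have 1: "map2 (+) c (map2 (-) d c) = d" using l le by (auto intro!: nth_equalityI)
    have 2: "map2 (-) (map2 (-) e c) (map2 (-) d c) = map2 (-) e d" using l le e by (auto intro!: nth_equalityI)
    show "(case case a of (d, c) \<Rightarrow> (c, map2 (-) d c) of (c, d') \<Rightarrow> (map2 (+) c d', c)) = a" by (simp add: dc 1)
    show "(case a of (d, c) \<Rightarrow> (c, map2 (-) d c)) \<in> Sigma (exps n e) (\<lambda>c. exps n (map2 (-) e c))"
      using l le e by (auto simp: dc intro: order_trans diff_le_mono)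
    show "(case case a of (d, c) \<Rightarrow> (c, map2 (-) d c) of (c, d') \<Rightarrow> \<Sum>K'\<in>?K. \<Sum>K\<in>?K. ?t c d' (map2 (-) (map2 (-) e c) d') K K') =
       (case a of (d, c) \<Rightarrow> \<Sum>K'\<in>?K. \<Sum>K\<in>?K. ?t c (map2 (-) d c) (map2 (-) e d) K K')"
      by (simp add: dc 2)
  next
    fix b :: "nat list \<times> nat list" assume b: "b \<in> Sigma (exps n e) (\<lambda>c. exps n (map2 (-) e c))"
    obtain c d' where cd: "b = (c, d')" by (cases b)
    have l: "length c = n" "length d' = n" and le: "\<And>k. k < n \<Longrightarrow> c ! k \<le> e ! k" "\<And>k. k < n \<Longrightarrow> d' ! k \<le> e ! k - c ! k"
      using b cd e by auto
    have 1: "map2 (-) (map2 (+) c d') c = d'" using l by (auto intro!: nth_equalityI)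
    show "(case case b of (c, d') \<Rightarrow> (map2 (+) c d', c) of (d, c) \<Rightarrow> (c, map2 (-) d c)) = b" by (simp add: cd 1)
    have "c ! k + d' ! k \<le> e ! k" if "k < n" for k using le[OF that] by simp
    then show "(case b of (c, d') \<Rightarrow> (map2 (+) c d', c)) \<in> Sigma (exps n e) (exps n)"
      using l le by (auto simp: cd)
  qed
  also have "\<dots> = (\<Sum>c\<in>exps n e. \<Sum>d'\<in>exps n (map2 (-) e c). \<Sum>K'\<in>?K. \<Sum>K\<in>?K. ?t c d' (map2 (-) (map2 (-) e c) d') K K')"
    by (rule sum.Sigma[symmetric]) (auto simp: finite_exps)
  also have "\<dots> = (\<Sum>c\<in>exps n e. \<Sum>K\<in>?K. \<Sum>d'\<in>exps n (map2 (-) e c). \<Sum>K'\<in>?K. ?t c d' (map2 (-) (map2 (-) e c) d') K K')"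
    by (rule sum.cong[OF refl], rule sum_rot)
  also have "\<dots> = vmul n S (vmul n T U) e I J"
    by (simp add: vmul_eq sum_distrib_left mult.assoc)
  finally show ?thesis .
qed

lemma vmul_vone:
  fixes U :: "('a::ring_1, 'n::finite) vtens"
  assumes e: "length e = n" and I: "length I = Suc n"
  shows "vmul n (vone n) U e I J = U e I J"
proof -
  have r: "map2 (-) e (replicate n 0) = e" using e by (auto intro!: nth_equalityI)
  have "vmul n (vone n) U e I J = (\<Sum>d\<in>exps n e. \<Sum>K | length K = Suc n. if d = replicate n 0 then (if K = I then U e I J else 0) else 0)"
    unfolding vmul_eq by (intro sum.cong refl) (auto simp: vone_def r)
  also have "\<dots> = (\<Sum>d\<in>exps n e. if d = replicate n 0 then U e I J else 0)"
    using I by (intro sum.cong refl) (auto simp: sum.delta[OF finite_indices])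
  also have "\<dots> = U e I J"
    by (subst sum.delta[OF finite_exps]) auto
  finally show ?thesis .
qed

lemma vprod_hom:
  assumes h: "rhom h"
  shows "h (vprod n Ss e I J) = vprod n (map (\<lambda>S e I J. h (S e I J)) Ss) e I J"
proof (induction Ss arbitrary: e I)
  case Nil
  show ?case by (simp add: vprod_def vone_def rhom_one[OF h] rhom_zero[OF h])
next
  case (Cons S Ss)
  then show ?case by (simp add: vprod_def vmul_eq rhom_sum[OF h] rhom_mult[OF h])
qed

section \<open>Coefficient families as columns of operators\<close>

definition lop :: "nat \<Rightarrow> nat \<Rightarrow> nat \<Rightarrow> ('a::ring_1 fps, 'n::finite) mat2 \<Rightarrow> ((nat \<Rightarrow> 'n) \<Rightarrow> (nat \<Rightarrow> nat) \<Rightarrow> 'a) endo" where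
  "lop k r s A = l2 r s (map_matrix (\<lambda>f. act k (fps_map mulL f)) A)"

lemma ap_lop: "ap (lop k r s A) \<psi> x e = (\<Sum>p\<in>UNIV. \<Sum>q\<le>e k. fps_nth (A $ (x r, x s) $ p) q * \<psi> (x(r := fst p, s := snd p)) (e(k := e k - q)))"
  by (simp add: lop_def ap_l2 ap_act sum_fun_apply)

text \<open>Only the column with index J is represented, by a vector. Products are folded from the
  right, so each further factor acts on such a vector by its operator.\<close>

definition rep :: "nat \<Rightarrow> 'n list \<Rightarrow> ('a, 'n) vtens \<Rightarrow> ((nat \<Rightarrow> 'n) \<Rightarrow> (nat \<Rightarrow> nat) \<Rightarrow> 'a) \<Rightarrow> bool" where
  "rep n J T \<psi> \<longleftrightarrow> (\<forall>e I. length e = n \<longrightarrow> length I = Suc n \<longrightarrow> T e I J = \<psi> (ix I) (ex e))"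

definition repop :: "nat \<Rightarrow> ('a::ring_1, 'n::finite) vtens \<Rightarrow> ((nat \<Rightarrow> 'n) \<Rightarrow> (nat \<Rightarrow> nat) \<Rightarrow> 'a) endo \<Rightarrow> bool" where
  "repop n S Op \<longleftrightarrow> (\<forall>T \<psi> J. rep n J T \<psi> \<longrightarrow> rep n J (vmul n S T) (ap Op \<psi>))"

lemma repop_cong:
  fixes S :: "('a::ring_1, 'n::finite) vtens"
  assumes "repop n S Op" "\<And>d I K. length d = n \<Longrightarrow> length I = Suc n \<Longrightarrow> length K = Suc n \<Longrightarrow> S' d I K = S d I K"
  shows "repop n S' Op"
  unfolding repop_def rep_def
proof (intro allI impI)
  fix T :: "('a, 'n) vtens" and \<psi> J and e :: "nat list" and I :: "'n list"
  assume r: "\<forall>e I. length e = n \<longrightarrow> length I = Suc n \<longrightarrow> T e I J = \<psi> (ix I) (ex e)" and l: "length e = n" "length I = Suc n"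
  have "vmul n S' T e I J = vmul n S T e I J"
    by (rule vmul_cong) (use assms(2) l in auto)
  then show "vmul n S' T e I J = ap Op \<psi> (ix I) (ex e)"
    using assms(1) r l unfolding repop_def rep_def by simp
qed

lemma repop_vleg:
  fixes A :: "('a::ring_1 fps, 'n::finite) mat2"
  assumes k: "1 \<le> k" "k \<le> n" and rs: "r \<le> n" "s \<le> n" "r \<noteq> s"
  shows "repop n (vleg n k r s A) (lop k r s A)"
  unfolding repop_def rep_def
proof (intro allI impI)
  fix T :: "('a, 'n) vtens" and \<psi> J and e :: "nat list" and I :: "'n list"
  assume r: "\<forall>e I. length e = n \<longrightarrow> length I = Suc n \<longrightarrow> T e I J = \<psi> (ix I) (ex e)" and l: "length e = n" "length I = Suc n"
  \<comment> \<open>These parametrize the nonzero summands: \<open>dq q\<close> is the exponent list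
    with q at the position k - 1 of v_k, and \<open>Kp p\<close> alters I at r and s only.\<close>
  define dq where "dq q = (replicate n 0)[k - 1 := q]" for q :: nat
  define Kp where "Kp p = I[r := fst p, s := snd p]" for p :: "'n \<times> 'n"
  have dq: "length (dq q) = n" "dq q ! (k - 1) = q" "\<And>j. j < n \<Longrightarrow> Suc j \<noteq> k \<Longrightarrow> dq q ! j = 0" for q
    using k by (auto simp: dq_def nth_list_update)
  have Kp: "length (Kp p) = Suc n" "Kp p ! r = fst p" "Kp p ! s = snd p" "\<And>j. j \<noteq> r \<Longrightarrow> j \<noteq> s \<Longrightarrow> Kp p ! j = I ! j" for p
    using rs l by (auto simp: Kp_def nth_list_update)
  let ?t = "\<lambda>d K. vleg n k r s A d I K * T (map2 (-) e d) K J"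
  have sub: "dq ` {..e ! (k - 1)} \<subseteq> exps n e"
    using k by (auto simp: dq_def nth_list_update)
  have zero_d: "vleg n k r s A d I K = 0" if "d \<in> exps n e - dq ` {..e ! (k - 1)}" for d K
  proof -
    have "\<not> (\<forall>j<n. Suc j \<noteq> k \<longrightarrow> d ! j = 0)"
    proof
      assume *: "\<forall>j<n. Suc j \<noteq> k \<longrightarrow> d ! j = 0"
      have "d = dq (d ! (k - 1))"
      proof (rule nth_equalityI)
        show "length d = length (dq (d ! (k - 1)))" using that dq by simp
        show "d ! i = dq (d ! (k - 1)) ! i" if "i < length d" for i
        proof (cases "Suc i = k")
          case True
          then show ?thesis using dq(2)[of "d ! (k - 1)"] by auto
        next
          case False
          then show ?thesis using * that dq \<open>d \<in> exps n e - dq ` {..e ! (k - 1)}\<close> by auto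
        qed
      qed
      moreover have "d ! (k - 1) \<le> e ! (k - 1)" using that k by auto
      ultimately show False using that by blast
    qed
    then show ?thesis unfolding vleg_def by (rule if_not_P)
  qed
  have zero_K: "vleg n k r s A d I K = 0" if "K \<in> {K. length K = Suc n} - range Kp" for d K
  proof -
    have "\<not> (\<forall>j<length I. j \<noteq> r \<and> j \<noteq> s \<longrightarrow> I ! j = K ! j)"
    proof
      assume *: "\<forall>j<length I. j \<noteq> r \<and> j \<noteq> s \<longrightarrow> I ! j = K ! j"
      have "K = Kp (K ! r, K ! s)"
      proof (rule nth_equalityI)
        show "length K = length (Kp (K ! r, K ! s))" using that Kp by simp
        show "K ! i = Kp (K ! r, K ! s) ! i" if "i < length K" for i
          using * that \<open>K \<in> _ - _\<close> l by (cases "i = r"; cases "i = s") (auto simp: Kp(2-4))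
      qed
      then show False using that by blast
    qed
    then show ?thesis unfolding vleg_def leg_def by (simp only: if_False if_cancel)
  qed
  have inj_d: "inj_on dq {..e ! (k - 1)}" using dq(2) by (metis inj_onI)
  have inj_K: "inj Kp" using Kp(2,3) by (metis injI prod_eq_iff)
  have val: "?t (dq q) (Kp p) = fps_nth (A $ (ix I r, ix I s) $ p) q * \<psi> ((ix I)(r := fst p, s := snd p)) ((ex e)(k := ex e k - q))" if "q \<le> e ! (k - 1)" for q p
  proof -
    have "vleg n k r s A (dq q) I (Kp p) = fps_nth (A $ (ix I r, ix I s) $ p) q"
      using dq Kp rs l by (simp add: vleg_def leg_def ix_def)
    moreover have "T (map2 (-) e (dq q)) (Kp p) J = \<psi> (ix (Kp p)) (ex (map2 (-) e (dq q)))"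
      using r l dq Kp by simp
    moreover have "ix (Kp p) = (ix I)(r := fst p, s := snd p)"
      using rs l Kp by (auto simp: ix_def fun_eq_iff)
    moreover have "ex (map2 (-) e (dq q)) = (ex e)(k := ex e k - q)"
    proof
      fix j
      show "ex (map2 (-) e (dq q)) j = ((ex e)(k := ex e k - q)) j"
        using l dq(1) dq(2)[of q] dq(3)[of "j - 1" q] k by (auto simp: ex_def)
    qed
    ultimately show ?thesis by simp
  qed
  have "vmul n (vleg n k r s A) T e I J = (\<Sum>d\<in>exps n e. \<Sum>K | length K = Suc n. ?t d K)" by (rule vmul_eq)
  also have "\<dots> = (\<Sum>d\<in>dq ` {..e ! (k - 1)}. \<Sum>K | length K = Suc n. ?t d K)"
    by (rule sum.mono_neutral_right[OF finite_exps sub]) (use zero_d in simp)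
  also have "\<dots> = (\<Sum>q\<le>e ! (k - 1). \<Sum>K | length K = Suc n. ?t (dq q) K)"
    by (subst sum.reindex[OF inj_d]) simp
  also have "\<dots> = (\<Sum>q\<le>e ! (k - 1). \<Sum>K\<in>range Kp. ?t (dq q) K)"
    by (intro sum.cong[OF refl] sum.mono_neutral_right[OF finite_indices]) (use Kp zero_K in auto)
  also have "\<dots> = (\<Sum>q\<le>e ! (k - 1). \<Sum>p\<in>UNIV. ?t (dq q) (Kp p))"
    by (subst sum.reindex[OF inj_K]) simp
  also have "\<dots> = (\<Sum>q\<le>e ! (k - 1). \<Sum>p\<in>UNIV. fps_nth (A $ (ix I r, ix I s) $ p) q * \<psi> ((ix I)(r := fst p, s := snd p)) ((ex e)(k := ex e k - q)))"
    by (intro sum.cong[OF refl] val) simp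
  also have "\<dots> = ap (lop k r s A) \<psi> (ix I) (ex e)"
  proof -
    have "ex e k = e ! (k - 1)" using k l by (simp add: ex_def)
    then show ?thesis unfolding ap_lop by (subst sum.swap) simp
  qed
  finally show "vmul n (vleg n k r s A) T e I J = ap (lop k r s A) \<psi> (ix I) (ex e)" .
qed

text \<open>A constant matrix is a series of degree 0 in v_k, whichever k is chosen, so this reduces
  to the case of one variable.\<close>

lemma repop_vconst:
  fixes A :: "('a::ring_1, 'n::finite) mat2"
  assumes "1 \<le> k" "k \<le> n" "r \<le> n" "s \<le> n" "r \<noteq> s"
  shows "repop n (vconst n (leg r s A)) (lop k r s (map_matrix fps_const A))"
proof (rule repop_cong[OF repop_vleg[OF assms]])
  fix d :: "nat list" and I K :: "'n list"
  assume d: "length d = n"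
  have m: "map_matrix (\<lambda>F. fps_nth F (d ! (k - 1))) (map_matrix fps_const A) = (if d ! (k - 1) = 0 then A else 0)"
    by (simp add: vec_eq_iff)
  have "d = replicate n 0 \<longleftrightarrow> (\<forall>j<n. d ! j = 0)" using d unfolding list_eq_iff_nth_eq by simp
  also have "\<dots> \<longleftrightarrow> (\<forall>j<n. Suc j \<noteq> k \<longrightarrow> d ! j = 0) \<and> d ! (k - 1) = 0"
  proof (intro iffI conjI allI impI)
    fix j assume *: "(\<forall>j<n. Suc j \<noteq> k \<longrightarrow> d ! j = 0) \<and> d ! (k - 1) = 0" "j < n"
    then show "d ! j = 0" by (cases "Suc j = k") auto
  qed (use assms(1,2) in auto)
  finally show "vconst n (leg r s A) d I K = vleg n k r s (map_matrix fps_const A) d I K"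
    by (auto simp: vconst_def vleg_def m leg_def)
qed

lemma repop_vmul:
  fixes S T :: "('a::ring_1, 'n::finite) vtens"
  shows "repop n S A \<Longrightarrow> repop n T B \<Longrightarrow> repop n (vmul n S T) (A * B)"
  unfolding repop_def
proof (intro allI impI)
  fix U :: "('a, 'n) vtens" and \<psi> J
  assume S: "\<forall>T \<psi> J. rep n J T \<psi> \<longrightarrow> rep n J (vmul n S T) (ap A \<psi>)" and T: "\<forall>U \<psi> J. rep n J U \<psi> \<longrightarrow> rep n J (vmul n T U) (ap B \<psi>)"
    and U: "rep n J U \<psi>"
  then have "rep n J (vmul n S (vmul n T U)) (ap A (ap B \<psi>))" by blast
  then show "rep n J (vmul n (vmul n S T) U) (ap (A * B) \<psi>)"
    by (simp add: rep_def vmul_assoc)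
qed

lemma repop_vone: "repop n (vone n) 1"
  by (simp add: repop_def rep_def vmul_vone)

lemma repop_vprod: "list_all2 (repop n) Ss Os \<Longrightarrow> repop n (vprod n Ss) (prod_list Os)"
  by (induction rule: list_all2_induct) (simp_all add: vprod_def repop_vone repop_vmul)

lemma rep_vone:
  fixes J :: "'n list"
  shows "length J = Suc n \<Longrightarrow> rep n J (vone n) (dl (ix J) 1)"
  unfolding rep_def
proof (intro allI impI)
  fix e :: "nat list" and I :: "'n list" assume l: "length J = Suc n" "length e = n" "length I = Suc n"
  have "e = replicate n 0 \<longleftrightarrow> ex e = (\<lambda>_. 0)"
  proof
    assume "e = replicate n 0"
    then show "ex e = (\<lambda>_. 0)" by (auto simp: ex_def fun_eq_iff nth_replicate)
  next
    assume *: "ex e = (\<lambda>_. 0)"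
    show "e = replicate n 0"
    proof (rule nth_equalityI)
      show "e ! i = replicate n 0 ! i" if "i < length e" for i
        using fun_cong[OF *, of "Suc i"] that l by (simp add: ex_def)
    qed (use l in simp)
  qed
  moreover have "I = J \<longleftrightarrow> ix I = ix J"
  proof
    assume *: "ix I = ix J"
    show "I = J"
    proof (rule nth_equalityI)
      show "I ! i = J ! i" if "i < length I" for i
        using fun_cong[OF *, of i] that l by (simp add: ix_def)
    qed (use l in simp)
  qed simp
  ultimately show "vone n e I J = dl (ix J) 1 (ix I) (ex e)"
    by (auto simp: vone_def dl_def)
qed

lemma rep_vprod: "list_all2 (repop n) Ss Os \<Longrightarrow> length J = Suc n \<Longrightarrow> rep n J (vprod n Ss) (ap (prod_list Os) (dl (ix J) 1))"
proof (induction rule: list_all2_induct)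
  case Nil
  then show ?case by (simp add: vprod_def rep_vone)
next
  case (Cons S Ss O' Os)
  then show ?case by (simp add: vprod_def repop_def)
qed

section \<open>The formula for L^- on products of n factors\<close>

definition gL :: "nat \<Rightarrow> nat \<Rightarrow> (('k::comm_ring_1, 'n) fa fps, 'n) vtens" where
  "gL n k e I J =
     (if (\<forall>j<n. Suc j \<noteq> k \<longrightarrow> e ! j = 0) \<and> (\<forall>j\<le>n. j \<noteq> k \<longrightarrow> I ! j = J ! j)
      then lam (I ! k) (J ! k) (e ! (k - 1)) else 0)"

context Lcalc
begin

definition Sv :: "nat \<Rightarrow> nat \<Rightarrow> nat \<Rightarrow> (('k, 'n) fa fps, 'n) vtens" where
  "Sv n i k = vconst n (leg i k (map_matrix (\<lambda>s. scE (cm s)) (RP R)))"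

definition gLb :: "nat \<Rightarrow> (('k, 'n) fa fps, 'n) vtens" where
  "gLb n = vprod n (concat (map (\<lambda>i. gL n i # map (Sv n i) [Suc i..<Suc n]) [1..<Suc n]))"

lemma lop_S: "r \<noteq> s \<Longrightarrow> lop k r s (map_matrix fps_const (map_matrix (\<lambda>s. scE (cm s)) (RP R))) = S r s"
proof -
  have "act k (fps_map mulL (fps_const (scE (cm c)))) = eta c" for c
    using vact_eta[of k c] by (simp add: vact_def msc_def fps_map_const rhom_zero[OF rhom_mulL] rhom_zero[OF rhom_comp[OF rhom_mulL rhom_scE]])
  then show ?thesis by (simp add: lop_def S_def map_matrix_comp)
qed

lemma lop_vl: "lop k r s (map_matrix vsc A) = vl k r s A"
proof -
  have "map_matrix (\<lambda>f. act k (fps_map mulL f)) (map_matrix vsc A) = map_matrix (va k) A"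
    by (simp add: vec_eq_iff vact_def msc_def vsc_def fps_map_comp)
  then show ?thesis by (simp add: lop_def)
qed

text \<open>L^+_k occupies a single leg; leg 0 serves as the idle second leg of a two-leg
  operator.\<close>

lemma lop_Lp: "k \<noteq> 0 \<Longrightarrow> lop k k 0 (t1 LPm) = Lp k"
proof -
  have "rhom (\<lambda>f :: ('k, 'n) fa fps fps. act k (fps_map mulL f))"
    by (rule rhom_comp[OF rhom_act rhom_fps_map[OF rhom_mulL]])
  moreover assume "k \<noteq> 0"
  ultimately show ?thesis
    by (simp add: lop_def map_matrix_t1 l2_t1 Lp_def LpM_def map_matrix_comp)
qed

lemma repop_S: "1 \<le> n \<Longrightarrow> r \<le> n \<Longrightarrow> s \<le> n \<Longrightarrow> r \<noteq> s \<Longrightarrow> repop n (Sv n r s) (S r s)"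
  unfolding Sv_def by (subst lop_S[of r s 1, symmetric]) (auto intro!: repop_vconst)

lemma repop_Lp: "1 \<le> k \<Longrightarrow> k \<le> n \<Longrightarrow> repop n (gL n k) (Lp k)"
proof -
  assume k: "1 \<le> k" "k \<le> n"
  have "repop n (gL n k) (lop k k 0 (t1 LPm :: (('k, 'n) fa fps fps, 'n) mat2))"
  proof (rule repop_cong[OF repop_vleg])
    fix d :: "nat list" and I K :: "'n list"
    assume l: "length I = Suc n"
    show "(gL n k d I K :: ('k, 'n) fa fps) = vleg n k k 0 (t1 LPm) d I K"
    proof (cases "(\<forall>j\<le>n. j \<noteq> k \<longrightarrow> I ! j = K ! j)")
      case True
      moreover from this have "I ! 0 = K ! 0" using k by auto
      ultimately show ?thesis using l by (auto simp: gL_def vleg_def leg_def t1_def LPm_def)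
    next
      case False
      then obtain j where "j < length I" "j \<noteq> k" "I ! j \<noteq> K ! j" using l by (metis less_Suc_eq_le)
      then have "\<not> ((\<forall>j<length I. j \<noteq> k \<and> j \<noteq> 0 \<longrightarrow> I ! j = K ! j) \<and> I ! 0 = K ! 0)"
        by (cases "j = 0") auto
      then show ?thesis using False by (auto simp: gL_def vleg_def leg_def t1_def)
    qed
  qed (use k in auto)
  then show ?thesis using k by (simp add: lop_Lp)
qed

lemma LL_upt: "LL [i..<Suc n] = prod_list (concat (map (\<lambda>i. Lp i # map (S i) [Suc i..<Suc n]) [i..<Suc n]))"
proof (induction "Suc n - i" arbitrary: i)
  case 0
  then show ?case by simp
next
  case (Suc m)
  then have i: "i < Suc n" and "m = Suc n - Suc i" by auto
  then have "LL [Suc i..<Suc n] = prod_list (concat (map (\<lambda>i. Lp i # map (S i) [Suc i..<Suc n]) [Suc i..<Suc n]))"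
    using Suc(1) by blast
  then show ?case using upt_conv_Cons[OF i] by (simp add: mult.assoc del: upt_Suc)
qed

lemma repop_gLb: "1 \<le> n \<Longrightarrow> repop n (gLb n) (LL [1..<Suc n])"
  unfolding gLb_def LL_upt
proof (rule repop_vprod)
  assume n: "1 \<le> n"
  have "list_all2 (repop n) (gL n i # map (Sv n i) [Suc i..<Suc n]) (Lp i # map (S i) [Suc i..<Suc n])" if "i \<in> set [1..<Suc n]" for i
    using that n by (auto simp: list_all2_map1 list_all2_map2 list_all2_same simp del: upt_Suc intro!: repop_Lp repop_S)
  then show "list_all2 (repop n) (concat (map (\<lambda>i. gL n i # map (Sv n i) [Suc i..<Suc n]) [1..<Suc n]))
      (concat (map (\<lambda>i. Lp i # map (S i) [Suc i..<Suc n]) [1..<Suc n]))"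
    by (intro concat_transfer[unfolded rel_fun_def, rule_format]) (auto simp: list_all2_map1 list_all2_map2 list_all2_same simp del: upt_Suc)
qed

lemma rep_Lminus_arg:
  assumes "1 \<le> n" "length J = Suc n"
  shows "rep n J (vprod n (map (Sv n 0) [1..<Suc n] @ [gLb n])) (ap (SP 0 [1..<Suc n] * LL [1..<Suc n]) (dl (ix J) 1))"
proof -
  have "list_all2 (repop n) (map (Sv n 0) [1..<Suc n] @ [gLb n]) (map (S 0) [1..<Suc n] @ [LL [1..<Suc n]])"
    using assms by (intro list_all2_appendI) (auto simp: list_all2_map1 list_all2_map2 list_all2_same repop_gLb simp del: upt_Suc One_nat_def intro!: repop_S)
  from rep_vprod[OF this assms(2)] show ?thesis by (simp del: upt_Suc)
qed

lemma rep_Lminus_value: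
  assumes "1 \<le> n" "length J = Suc n"
  shows "rep n J (vprod n (map (\<lambda>k. vleg n k 0 k (map_matrix vsc RI)) [1..<Suc n] @ [gLb n] @ map (\<lambda>k. Sv n k 0) [1..<Suc n]
        @ map (\<lambda>k. vleg n k k 0 (map_matrix vsc (flip RM))) (rev [1..<Suc n])))
     (ap (prod_list (map (\<lambda>k. vl k 0 k RI) [1..<Suc n]) * (LL [1..<Suc n] *
        (prod_list (map (\<lambda>k. S k 0) [1..<Suc n]) * prod_list (map (\<lambda>k. vl k 0 k RM) (rev [1..<Suc n]))))) (dl (ix J) 1))"
proof -
  have RM: "repop n (vleg n k k 0 (map_matrix vsc (flip RM))) (vl k 0 k RM)" if "1 \<le> k" "k \<le> n" for k
  proof -
    have "lop k k 0 (map_matrix vsc (flip RM)) = vl k 0 k RM"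
      using that unfolding lop_vl by (simp add: map_matrix_flip l2_flip)
    from this[symmetric] show ?thesis using that by (simp add: repop_vleg)
  qed
  have RI: "repop n (vleg n k 0 k (map_matrix vsc RI)) (vl k 0 k RI)" if "1 \<le> k" "k \<le> n" for k
    using that unfolding lop_vl[symmetric] by (simp add: repop_vleg)
  have "list_all2 (repop n) (map (\<lambda>k. vleg n k 0 k (map_matrix vsc RI)) [1..<Suc n] @ [gLb n] @ map (\<lambda>k. Sv n k 0) [1..<Suc n]
        @ map (\<lambda>k. vleg n k k 0 (map_matrix vsc (flip RM))) (rev [1..<Suc n]))
     (map (\<lambda>k. vl k 0 k RI) [1..<Suc n] @ [LL [1..<Suc n]] @ map (\<lambda>k. S k 0) [1..<Suc n] @ map (\<lambda>k. vl k 0 k RM) (rev [1..<Suc n]))"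
    using assms by (intro list_all2_appendI) (auto simp: list_all2_map1 list_all2_map2 list_all2_same repop_gLb RI RM simp del: upt_Suc One_nat_def intro!: repop_S)
  from rep_vprod[OF this assms(2)] show ?thesis by (simp del: upt_Suc add: mult.assoc)
qed

lemma Lm_scalar_valued:
  assumes lin: "\<And>i j. lin (L i j)" and one: "\<And>i j. L i j 1 = (if i = j then 1 else 0)" and c: "\<And>x e. \<exists>s. \<psi> x e = scE s"
  shows "ap (Lm r L) \<psi> = \<psi>"
proof (intro ext)
  fix x e
  have "L i j (scE s) = (if i = j then scE s else 0)" for i j s
    using lin_scE[OF lin, of i j s 1] one by simp
  moreover obtain g where g: "\<And>x e. \<psi> x e = scE (g x e)" using c by metis
  ultimately show "ap (Lm r L) \<psi> x e = \<psi> x e"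
    unfolding ap_Lm[OF lin] g by simp
qed

lemma scalar_valued_vl:
  assumes c: "\<And>x e. \<exists>t. \<psi> x e = scE t"
  shows "\<exists>t. ap (vl k r s A) \<psi> x e = scE t"
proof -
  obtain g where g: "\<And>x e. \<psi> x e = scE (g x e)" using c by metis
  show ?thesis
    unfolding ap_vl g rhom_mult[OF rhom_scE, symmetric] rhom_sum[OF rhom_scE, symmetric] by blast
qed

lemma scalar_valued_dl: "\<exists>t. dl x0 1 x e = scE t"
  by (cases "x = x0 \<and> e = (\<lambda>_. 0)") (auto simp: dl_def intro: exI[of _ 1] exI[of _ 0] simp: rhom_one[OF rhom_scE] rhom_zero[OF rhom_scE])

text \<open>\<open>Lm_LL\<close> is applied to the column J of the identity. The factors RM produce
  a vector with scalar values, on which L^- acts as the identity because L^- 1 = 1; this is how L^-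
  disappears from the right side.\<close>

theorem L_formula:
  assumes L: "Lgood L zp zm RI RM" and n: "1 \<le> n" and len: "length e = n" "length I = n" "length J = Suc n"
  shows "(\<Sum>k0\<in>UNIV. L i0 k0 (vprod n (map (Sv n 0) [1..<Suc n] @ [gLb n]) e (k0 # I) J)) =
    vprod n (map (\<lambda>k. vleg n k 0 k (map_matrix vsc RI)) [1..<Suc n] @ [gLb n] @ map (\<lambda>k. Sv n k 0) [1..<Suc n]
        @ map (\<lambda>k. vleg n k k 0 (map_matrix vsc (flip RM))) (rev [1..<Suc n])) e (i0 # I) J"
proof -
  have lin: "lin (L i j)" and one: "L i j 1 = (if i = j then 1 else 0)" for i j using L by (auto simp: Lgood_def)
  define ks where "ks = [1..<Suc n]"
  define d where "d = (dl (ix J) 1 :: (nat \<Rightarrow> 'n) \<Rightarrow> (nat \<Rightarrow> nat) \<Rightarrow> ('k, 'n) fa fps)"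
  define arg where "arg = vprod n (map (Sv n 0) ks @ [gLb n])"
  define val where "val = vprod n (map (\<lambda>k. vleg n k 0 k (map_matrix vsc RI)) ks @ [gLb n] @ map (\<lambda>k. Sv n k 0) ks
        @ map (\<lambda>k. vleg n k k 0 (map_matrix vsc (flip RM))) (rev ks))"
  define A where "A = prod_list (map (\<lambda>k. vl k 0 k RI) ks)"
  define T where "T = prod_list (map (\<lambda>k. S k 0) ks)"
  define M where "M = prod_list (map (\<lambda>k. vl k 0 k RM) (rev ks))"
  have ix0: "ix (i0 # I) 0 = i0" by (simp add: ix_def)
  have ixk: "(ix (i0 # I))(0 := k0) = ix (k0 # I)" for k0
    by (auto simp: ix_def fun_eq_iff nth_Cons')
  have "\<exists>t. ap (prod_list (map (\<lambda>k. vl k 0 k RM) js)) d x f = scE t" for js x f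
  proof (induction js arbitrary: x f)
    case Nil
    show ?case by (simp add: scalar_valued_dl d_def)
  next
    case (Cons k js)
    show ?case using scalar_valued_vl[OF Cons] by simp
  qed
  then have c: "\<exists>t. ap M d x f = scE t" for x f unfolding M_def .
  have arg: "arg e (k0 # I) J = ap (SP 0 ks * LL ks) d (ix (k0 # I)) (ex e)" for k0
    using rep_Lminus_arg[OF n len(3), folded ks_def, folded d_def arg_def] len unfolding rep_def
    by (metis length_Cons)
  have val: "val e (i0 # I) J = ap (A * (LL ks * (T * M))) d (ix (i0 # I)) (ex e)"
    using rep_Lminus_value[OF n len(3), of RI RM, folded ks_def, folded d_def val_def A_def T_def M_def] len unfolding rep_def
    by (metis length_Cons)
  have "distinct ks" "0 \<notin> set ks" by (auto simp: ks_def)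
  from Lm_LL[OF L this] have LL: "Lm 0 L * (SP 0 ks * LL ks) = A * (LL ks * (T * (Lm 0 L * M)))"
    by (simp only: A_def T_def M_def)
  have "(\<Sum>k0\<in>UNIV. L i0 k0 (arg e (k0 # I) J)) = ap (Lm 0 L) (ap (SP 0 ks * LL ks) d) (ix (i0 # I)) (ex e)"
    by (simp only: ap_Lm[OF lin] arg ixk ix0)
  also have "\<dots> = ap (Lm 0 L * (SP 0 ks * LL ks)) d (ix (i0 # I)) (ex e)" by (simp only: ap_simps)
  also have "\<dots> = ap A (ap (LL ks) (ap T (ap (Lm 0 L) (ap M d)))) (ix (i0 # I)) (ex e)"
    unfolding LL by (simp only: ap_simps)
  also have "\<dots> = val e (i0 # I) J"
    unfolding val Lm_scalar_valued[OF lin one c] by (simp only: ap_simps)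
  finally show ?thesis by (simp only: arg_def val_def ks_def)
qed

end

subsection \<open>The concrete \<open>R\<close>-matrix\<close>

lemma rhom_neg_u: "rhom neg_u"
  unfolding neg_u_def
  by (intro rhom_fps_map rhomI) (simp_all add: fls_compose_fps_add fls_compose_fps_mult)

lemma neg_u_neg_u: "neg_u (neg_u x) = x"
proof -
  have "fls_compose_fps (fls_compose_fps F (- fps_X)) (- fps_X) = F" for F :: "complex fls"
  proof -
    have X: "- fps_X = fps_const (- 1) * (fps_X :: complex fps)" by (simp add: fps_eq_iff)
    have "(- 1 :: complex) powi n * (- 1) powi n = 1" for n
      by (simp add: power_int_mult_distrib[symmetric])
    then show ?thesis
      unfolding X by (intro fls_eqI) (simp add: fls_nth_fls_compose_fps_linear mult.assoc del: fps_const_neg)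
  qed
  then show ?thesis by (simp add: neg_u_def fps_eq_iff)
qed

lemma flip_mult: "flip (A ** B) = flip A ** flip B"
proof -
  have "Pm ** A ** Pm ** (Pm ** B ** Pm) = Pm ** A ** (Pm ** Pm) ** B ** Pm" by (simp only: matrix_mul_assoc)
  then show ?thesis by (simp add: flip_def Pm_Pm matrix_mul_assoc)
qed

lemma flip_one: "flip (mat 1) = mat 1"
  by (simp add: flip_def Pm_Pm)

lemma rhom_unit: "rhom \<phi> \<Longrightarrow> x dvd 1 \<Longrightarrow> \<phi> x dvd 1" for x :: "'a::comm_ring_1"
  by (metis dvd_def rhom_mult rhom_one)

lemma hv_swap_const: "hv_swap (fps_const g) = fps_map fls_const g"
  by (simp add: hv_swap_def fps_swap_def fps_eq_iff fls_eq_iff)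

locale Ydata =
  fixes R :: "(complex fps, 'n::finite) mat2" and M :: nat and a c :: complex and \<psi> :: "complex fps"
    and Ru :: "(complex fls fps, 'n) mat2" and Q :: "'n \<Rightarrow> 'n \<Rightarrow> 'n \<Rightarrow> 'n \<Rightarrow> complex fps"
  assumes hecke: "hecke_symmetry R" and a: "a \<noteq> 0" and Ru: "Ru = Rmat M a \<psi> R" and unitary: "unitary Ru"
    and Q_left: "\<And>m c m' c'. (\<Sum>a\<in>UNIV. \<Sum>j\<in>UNIV. Q m c a j * RP R $ (m', a) $ (j, c')) = (if m = m' \<and> c = c' then 1 else 0)"
    and Q_right: "\<And>a j a' j'. (\<Sum>m\<in>UNIV. \<Sum>c\<in>UNIV. RP R $ (m, a) $ (j, c) * Q m c a' j') = (if a = a' \<and> j = j' then 1 else 0)"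
begin

abbreviation cU :: "complex fps \<Rightarrow> complex fls fps" where "cU \<equiv> fps_map fls_const"
abbreviation cW :: "complex fps \<Rightarrow> complex fls fls fps" where "cW \<equiv> fps_map (\<lambda>z. fls_const (fls_const z))"
abbreviation Zc :: "complex fps fps" where "Zc \<equiv> fps_map fps_const (fps_exp (2 / a))"
abbreviation Zu :: "complex fls fps fps" where "Zu \<equiv> exp_v (2 / a)"
abbreviation Zw :: "complex fls fls fps fps" where "Zw \<equiv> fps_map (\<lambda>z. fps_const (fls_const (fls_const z))) (fps_exp (2 / a))"

lemma rhom_cU: "rhom cU" by (rule rhom_fps_map[OF rhom_fls_const])

lemma rhom_cW: "rhom cW" by (rule rhom_fps_map[OF rhom_comp[OF rhom_fls_const rhom_fls_const]])

sublocale C: Lcalc R "\<lambda>x. x" Zc Q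
  by unfold_locales (auto simp: hecke Q_left Q_right intro: rhomI)

sublocale U: Lcalc R cU Zu Q
  by unfold_locales (auto simp: hecke Q_left Q_right rhom_cU)

sublocale W: Lcalc R cW Zw Q
  by unfold_locales (auto simp: hecke Q_left Q_right rhom_cW)

abbreviation Eu :: "complex fls fps" where "Eu \<equiv> fps_const (exp_u (2 / a))"

definition tau :: "complex fls fps" where
  "tau = cU \<psi> * fser M a * fps_const (inverse (exp_u (2 / a) - 1))"

lemma PRi_nth: "PRi R $ x $ y = flip (RP R) $ x $ y - kappa * Pm $ x $ y"
  by (simp add: PRi_def Rinv_def matrix_mult_diff mat_mult flip_RP mult.commute)

text \<open>From PR^{-1} = PR - kappa P one gets (E - 1) PR + kappa P = E PR - PR^{-1} with E =
  e^{2u/a}; dividing by E - 1 gives the additive R-matrix.\<close>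

lemma Ru_nth: "Ru $ x $ y = tau * (Eu * cU (flip (RP R) $ x $ y) - cU (PRi R $ x $ y))"
proof -
  have "fls_nth (exp_u (2 / a) - 1) 1 = 2 / a" by (simp add: exp_u_def)
  then have ne: "exp_u (2 / a) - 1 \<noteq> 0" using a by auto
  then have one: "fps_const (inverse (exp_u (2 / a) - 1)) * (Eu - 1) = 1"
    unfolding fps_const_1_eq_1[symmetric] fps_const_sub fps_const_mult by simp
  have "\<alpha> * (E * p) = p + \<alpha> * p" if "\<alpha> * (E - 1) = 1" for \<alpha> E p :: "complex fls fps"
  proof -
    have "\<alpha> * (E * p) = \<alpha> * (E - 1) * p + \<alpha> * p" by (simp add: algebra_simps)
    then show ?thesis by (simp add: that)
  qed
  from this[OF one] have i: "fps_const (inverse (exp_u (2 / a) - 1)) * (Eu * p) = p + fps_const (inverse (exp_u (2 / a) - 1)) * p" for p .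
  have "cU (Pm $ x $ y) = Pm $ x $ y"
    by (simp add: Pm_def rhom_one[OF rhom_cU] rhom_zero[OF rhom_cU])
  then have P: "cU (PRi R $ x $ y) = cU (flip (RP R) $ x $ y) - cU kappa * Pm $ x $ y"
    by (simp add: PRi_nth rhom_diff[OF rhom_cU] rhom_mult[OF rhom_cU])
  show ?thesis
    unfolding Ru Rmat_def P tau_def kappa_def[symmetric] exp_u_def[symmetric] flip_RP[symmetric]
    by (simp add: right_diff_distrib mult.assoc i) (simp add: algebra_simps)
qed

text \<open>Every entry of R(u) carries the factor \<open>tau\<close>, and a diagonal entry of the
  unitarity relation is 1.\<close>

lemma tau_unit: "tau dvd 1"
proof -
  let ?x = "undefined :: 'n \<times> 'n"
  define N where "N = flip (map_matrix neg_u Ru)"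
  have "(Ru ** N) $ ?x $ ?x = 1" using unitary by (simp add: unitary_def N_def mat_def)
  then have "tau * (\<Sum>y\<in>UNIV. (Eu * cU (flip (RP R) $ ?x $ y) - cU (PRi R $ ?x $ y)) * N $ y $ ?x) = 1"
    by (simp add: nth_matrix_mult Ru_nth sum_distrib_left mult.assoc)
  from this[symmetric] show ?thesis by (rule dvdI)
qed

text \<open>Replacing u by -u and flipping the legs turns the right inverse into a left
  inverse.\<close>

lemma unitary': "flip (map_matrix neg_u Ru) ** Ru = mat 1"
proof -
  have "map_matrix neg_u (Ru ** flip (map_matrix neg_u Ru)) = mat 1"
    using unitary by (simp add: unitary_def map_matrix_one[OF rhom_neg_u])
  then have "map_matrix neg_u Ru ** flip Ru = mat 1"
    by (simp add: map_matrix_mult[OF rhom_neg_u] map_matrix_flip map_matrix_comp neg_u_neg_u)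
       (simp add: map_matrix_def)
  then have "flip (map_matrix neg_u Ru ** flip Ru) = flip (mat 1)" by simp
  then show ?thesis by (simp add: flip_mult flip_flip flip_one)
qed

text \<open>The shift of the argument is a ring homomorphism, so it carries the two-sided inverse
  R_21(-u) of R(u) along; \<open>matrix_inv\<close> then picks a genuine inverse.\<close>

lemma Rshift_inverse:
  "Rshift b Ru ** matrix_inv (Rshift b Ru) = mat 1" "matrix_inv (Rshift b Ru) ** Rshift b Ru = mat 1"
proof -
  let ?N = "map_matrix (shift_arg b) (flip (map_matrix neg_u Ru))"
  have "Rshift b Ru ** ?N = mat 1" "?N ** Rshift b Ru = mat 1"
    using unitary unitary' unfolding Rshift_def unitary_def
    by (simp_all add: map_matrix_mult[OF rhom_shift_arg, symmetric] map_matrix_one[OF rhom_shift_arg])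
  then have "Rshift b Ru ** matrix_inv (Rshift b Ru) = mat 1 \<and> matrix_inv (Rshift b Ru) ** Rshift b Ru = mat 1"
    unfolding matrix_inv_def by (intro someI) auto
  then show "Rshift b Ru ** matrix_inv (Rshift b Ru) = mat 1" "matrix_inv (Rshift b Ru) ** Rshift b Ru = mat 1" by auto
qed

text \<open>e^{2(u + bh)/a}, the first spectral parameter of R(u - v + bh).\<close>

definition ze :: "complex \<Rightarrow> complex fls fps" where "ze b = Eu * exp_h (2 / a * b)"
text \<open>The factor e^{-2v/a} is moved into the scalar, so that the parameters are e^{2(u +
  bh)/a} and e^{2v/a} instead of their quotient and 1.\<close>

definition sg :: "complex \<Rightarrow> complex fls fps fps" where "sg b = shift_arg b tau * exp_v (- (2 / a))"

lemma exp_v_inverse: "exp_v (- t) * exp_v t = 1"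
  by (simp add: exp_v_mult exp_v_0)

lemma sg_unit: "sg b dvd 1"
  unfolding sg_def using rhom_unit[OF rhom_shift_arg tau_unit] exp_v_inverse
  by (metis dvd_triv_left mult_dvd_mono mult_1)

lemma Rshift_nth:
  "Rshift b Ru $ x $ y = sg b * (fps_const (ze b) * fps_const (cU (flip (RP R) $ x $ y)) - Zu * fps_const (cU (PRi R $ x $ y)))"
proof -
  have "Rshift b Ru $ x $ y = shift_arg b tau * (shift_arg b Eu * fps_const (cU (flip (RP R) $ x $ y)) - fps_const (cU (PRi R $ x $ y)))"
    by (simp add: Rshift_def Ru_nth rhom_mult[OF rhom_shift_arg] rhom_diff[OF rhom_shift_arg] shift_arg_const)
  also have "shift_arg b Eu = fps_const (ze b) * exp_v (- (2 / a))"
    by (simp add: shift_arg_exp ze_def)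
  also have "fps_const (cU (PRi R $ x $ y)) = exp_v (- (2 / a)) * Zu * fps_const (cU (PRi R $ x $ y))"
    by (simp only: exp_v_inverse mult_1)
  finally show ?thesis by (simp add: sg_def algebra_simps)
qed

lemma Rshift_Dm: "Rshift b Ru = map_matrix ((*) (sg b)) (U.Dm (fps_const (ze b)) Zu)"
  by (simp add: vec_eq_iff Rshift_nth U.Dm_def)

abbreviation RI where "RI \<equiv> matrix_inv (Rshift (c / 2) Ru)"
abbreviation RM where "RM \<equiv> flip (Rshift (- (c / 2)) Ru)"

definition LE :: "'n \<Rightarrow> 'n \<Rightarrow> (complex fls, 'n) fa fps \<Rightarrow> (complex fls, 'n) fa fps" where
  "LE = Lmap (\<lambda>k c a j. cU (Q k c a j)) U.Sc RI RM"

lemma Lgood_LE: "U.Lgood LE (ze (c / 2)) (ze (- (c / 2))) RI RM"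
  unfolding U.Lgood_def
proof (intro conjI allI)
  show "lin (LE i k)" for i k by (simp add: LE_def lin_Lmap)
  show "Lrel U.Sc RI RM LE y" for y
    unfolding LE_def
  proof (rule Lrel_Lmap)
    fix a' j a'' j'
    show "(\<Sum>m\<in>UNIV. \<Sum>c\<in>UNIV. U.Sc $ (m, a') $ (j, c) * cU (Q m c a'' j')) = (if a' = a'' \<and> j = j' then 1 else 0)"
      using arg_cong[OF Q_right[of a' j a'' j'], of cU]
      by (simp add: U.Sc_def rhom_sum[OF rhom_cU] rhom_mult[OF rhom_cU] rhom_one[OF rhom_cU] rhom_zero[OF rhom_cU] split: if_splits)
  qed
  show "LE i j 1 = (if i = j then 1 else 0)" for i j by (simp add: LE_def Lmap_one)
  show "\<exists>\<sigma>. map_matrix ((*) \<sigma>) (U.Dm (fps_const (ze (c / 2))) Zu) ** RI = mat 1 \<and> RI ** map_matrix ((*) \<sigma>) (U.Dm (fps_const (ze (c / 2))) Zu) = mat 1"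
    using Rshift_inverse[of "c / 2"] unfolding Rshift_Dm[of "c / 2", symmetric] by (intro exI[of _ "sg (c / 2)"]) (simp add: Rshift_Dm[symmetric])
  show "\<exists>\<sigma>. RM = flip (map_matrix ((*) \<sigma>) (U.Dm (fps_const (ze (- (c / 2)))) Zu))"
    unfolding Rshift_Dm[of "- (c / 2)"] by blast
qed

lemma lin_LE: "lin (LE i j)" and LE_one: "LE i j 1 = (if i = j then 1 else 0)" and Lrel_LE: "Lrel U.Sc RI RM LE y"
  using Lgood_LE by (auto simp: U.Lgood_def)

subsection \<open>The relation ideal\<close>

lemma U_RelT: "U.RelT = map_matrix (fps_map (fps_map cemb)) C.RelT"
proof -
  let ?h = "fps_map (fps_map cemb) :: (complex, 'n) fa fps fps fps \<Rightarrow> (complex fls, 'n) fa fps fps fps"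
  have h1: "rhom (fps_map cemb :: (complex, 'n) fa fps fps \<Rightarrow> _)" by (rule rhom_fps_map[OF rhom_cemb])
  have h: "rhom ?h" by (rule rhom_fps_map[OF h1])
  have sc: "cemb (scE s) = (scE (cU s) :: (complex fls, 'n) fa fps)" for s
    by (simp only: emap_scE[OF rhom_fls_const, unfolded emap_def])
  have lam: "cemb (lam i j e) = (lam i j e :: (complex fls, 'n) fa fps)" for i j e
    by (simp only: emap_lam[OF rhom_fls_const, unfolded emap_def])
  have Z: "fps_map cemb (vsc Zc) = (vsc Zu :: (complex fls, 'n) fa fps fps)"
    by (simp add: vsc_def fps_map_comp sc exp_v_def fps_map_const)
  have LP: "map_matrix (fps_map cemb) LPm = (LPm :: (complex fls, 'n) fa fps fps ^ 'n ^ 'n)"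
    by (simp add: vec_eq_iff LPm_def fps_eq_iff lam[unfolded fps_eq_iff nth_fps_map])
  have LPf: "map_matrix (\<lambda>x. f (fps_map cemb x)) LPm = map_matrix f (LPm :: (complex fls, 'n) fa fps fps ^ 'n ^ 'n)"
    for f :: "_ \<Rightarrow> (complex fls, 'n) fa fps fps fps"
    by (simp only: map_matrix_comp[symmetric] LP)
  have cc: "?h (fps_const (fps_const (scE s))) = fps_const (fps_const (scE (cU s)))" for s
    by (simp add: fps_map_const rhom_zero[OF h1] rhom_zero[OF rhom_cemb] sc)
  have c1: "?h (fps_const g) = fps_const (fps_map cemb g)" for g
    by (simp add: fps_map_const rhom_zero[OF h1])
  have c2: "?h (fps_map fps_const g) = fps_map fps_const (fps_map cemb g)" for g
    by (simp add: fps_map_comp fps_map_const rhom_zero[OF rhom_cemb])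
  have DT: "map_matrix ?h C.DT = U.DT"
    by (simp add: vec_eq_iff C.DT_def U.DT_def rhom_diff[OF h] rhom_mult[OF h] cc c1[of "vsc Zc"] c2 Z del: fps_const_mult)
  have L1: "map_matrix ?h (t1 (map_matrix fps_const LPm)) = t1 (map_matrix fps_const LPm)"
    unfolding map_matrix_t1[OF h] map_matrix_comp c1 LPf ..
  have L2: "map_matrix ?h (t2 (map_matrix (fps_map fps_const) LPm)) = t2 (map_matrix (fps_map fps_const) LPm)"
    unfolding map_matrix_t2[OF h] map_matrix_comp c2 LPf ..
  have S: "map_matrix ?h (map_matrix (\<lambda>s. fps_const (fps_const (scE s))) A) = map_matrix (\<lambda>s. fps_const (fps_const (scE (cU s)))) A" for A :: "(complex fps, 'n) mat2"
    by (simp add: map_matrix_comp cc)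
  show ?thesis
    unfolding C.RelT_def map_matrix_diff[OF h] map_matrix_mult[OF h] DT L1 L2 S map_matrix_flip U.RelT_def ..
qed

abbreviation J :: "'n free_alg fps set" where "J \<equiv> rel_ideal R Ru"

definition rels :: "'n free_alg fps set" where
  "rels = {fps_nth (fps_nth (C.RelT $ x $ y) q) m | x y q m. True}"

definition Jt :: "'n free_alg fps set \<Rightarrow> 'n free_alg fls fps fps set" where
  "Jt I = {z. \<forall>q k. ucoeff k (fps_nth z q) \<in> I}"

text \<open>Each coefficient of the product is a convergent sum of multiples of coefficients of z,
  and the ideal is closed.\<close>

lemma Jt_mult:
  assumes I: "hideal I" and z: "z \<in> Jt I"
  shows "w * z \<in> Jt I"
  unfolding Jt_def
proof (intro CollectI allI)
  fix q k
  have "ucoeff k (x * fps_nth z i) \<in> I" for x i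
    by (rule hideal_fsums[OF I fsums_ucoeff_mult]) (use z I in \<open>auto simp: Jt_def intro: hideal_mult_left\<close>)
  then show "ucoeff k (fps_nth (w * z) q) \<in> I"
    unfolding fps_mult_nth additive.sum[OF additive_ucoeff] by (intro hideal_sum[OF I])
qed

lemma emb_cst: "emb = cst" by (simp add: fun_eq_iff emb_def cst_def)

lemma scal_scE: "scal = scE" by (simp add: scal_def scE_def emb_cst)

lemma rhom_scal_u: "rhom scal_u"
  unfolding scal_u_def emb_cst by (intro rhom_fps_map rhom_fls_map rhom_cst)

lemma fls_map_cst_central: "fls_map cst f * x = x * fls_map cst f" for x :: "('g::monoid_add \<Rightarrow>\<^sub>0 'k::comm_ring_1) fls"
proof (rule fls_eqI)
  fix n
  obtain B where B: "\<And>k. k < B \<Longrightarrow> fls_nth f k = 0" using fls_nth_bounded[of f] by blast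
  obtain B' where B': "\<And>k. k < B' \<Longrightarrow> fls_nth x k = 0" using fls_nth_bounded[of x] by blast
  have m: "fls_nth (fls_map cst f) k = cst (fls_nth f k)" for k by (rule nth_fls_map) (rule rhom_zero[OF rhom_cst])
  have l: "fls_nth (fls_map cst f * x) n = (\<Sum>i=B..n-B'. fls_nth (fls_map cst f) i * fls_nth x (n - i))"
    by (rule nth_fls_mult) (auto simp: m B B' rhom_zero[OF rhom_cst])
  have r: "fls_nth (x * fls_map cst f) n = (\<Sum>i=B'..n-B. fls_nth x i * fls_nth (fls_map cst f) (n - i))"
    by (rule nth_fls_mult) (auto simp: m B B' rhom_zero[OF rhom_cst])
  show "fls_nth (fls_map cst f * x) n = fls_nth (x * fls_map cst f) n"
    unfolding l r
    by (rule sum.reindex_bij_witness[of _ "\<lambda>i. n - i" "\<lambda>i. n - i"]) (auto simp: m cst_central)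
qed

lemma fps_central: "(\<And>m y. fps_nth s m * y = y * fps_nth s m) \<Longrightarrow> s * x = x * s" for s x :: "'a::ring_1 fps"
proof (rule fps_ext)
  fix n assume s: "\<And>m y. fps_nth s m * y = y * fps_nth s m"
  show "fps_nth (s * x) n = fps_nth (x * s) n"
    unfolding fps_mult_nth s by (rule sum.reindex_bij_witness[of _ "\<lambda>i. n - i" "\<lambda>i. n - i"]) auto
qed

lemma scal_u_central: "fps_map scal_u s * x = x * fps_map scal_u s"
  by (intro fps_central) (simp add: scal_u_def emb_cst fls_map_cst_central fps_central)

lemma lam_lplus: "lam i j e = fps_const (fps_nth (lplus i j) e)"
  by (simp add: lam_def lplus_def gen_def)

lemma hv_swap_map_const: "hv_swap (fps_map fps_const g) = fps_const (fps_to_fls g)"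
  by (auto simp: hv_swap_def fps_swap_def fps_eq_iff fls_eq_iff)

lemma fps_to_fls_map: "\<phi> 0 = 0 \<Longrightarrow> fps_to_fls (fps_map \<phi> g) = fls_map \<phi> (fps_to_fls g)"
  by (simp add: fls_eq_iff nth_fls_map)

text \<open>\<open>hv_swap\<close> turns the first power series variable into the Laurent variable
  u. The scalar factor is the same for R(u - v) and its flip and is central, so it comes out in
  front of both terms.\<close>

lemma defining_relation_RelT:
  "defining_relation R Ru = map_matrix ((*) (fps_map scal_u (sg 0))) (map_matrix (fps_map hv_swap) C.RelT)"
proof -
  let ?h = "fps_map hv_swap :: (complex, 'n) fa fps fps fps \<Rightarrow> 'n free_alg fls fps fps"
  have h: "rhom ?h" by (rule rhom_fps_map[OF rhom_hv_swap])
  have su: "rhom (fps_map scal_u :: complex fls fps fps \<Rightarrow> 'n free_alg fls fps fps)" by (rule rhom_fps_map[OF rhom_scal_u])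
  have z0: "cst 0 = 0" by (rule rhom_zero[OF rhom_cst])
  have lift: "fps_map fls_const (scE s) = (lift_u (scal s) :: 'n free_alg fls fps)" for s by (simp add: lift_u_def scal_scE)
  have scal_u_cU: "scal_u (cU s) = (lift_u (scal s) :: 'n free_alg fls fps)" for s
    by (simp add: scal_u_def lift_u_def scal_def fps_eq_iff fls_eq_iff nth_fls_map emb_cst z0)
  have c1: "?h (fps_const g) = fps_const (hv_swap g)" for g
    by (simp add: fps_map_const rhom_zero[OF rhom_hv_swap])
  have c2: "?h (fps_map fps_const g) = fps_map (fps_map fls_const) g" for g
    by (simp add: fps_map_comp hv_swap_const)
  have cc: "?h (fps_const (fps_const (scE s))) = fps_const (lift_u (scal s))" for s
    by (simp add: c1 hv_swap_const lift)
  have Z1: "hv_swap (vsc Zc) = (scal_u Eu :: 'n free_alg fls fps)"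
  proof -
    have "(vsc Zc :: (complex, 'n) fa fps fps) = fps_map fps_const (fps_map cst (fps_exp (2 / a)))"
      by (simp add: vsc_def fps_map_comp scE_def fps_map_const z0)
    then have "hv_swap (vsc Zc :: (complex, 'n) fa fps fps) = fps_const (fps_to_fls (fps_map cst (fps_exp (2 / a))))" by (simp only: hv_swap_map_const)
    also have "\<dots> = scal_u Eu"
      by (simp add: scal_u_def emb_cst fps_map_const exp_u_def fps_to_fls_map z0 rhom_zero[OF rhom_fls_map[OF rhom_cst]])
    finally show ?thesis .
  qed
  have Z2: "fps_map (fps_map fls_const) (vsc Zc) = (fps_map scal_u Zu :: 'n free_alg fls fps fps)"
    by (simp add: vsc_def exp_v_def fps_map_comp scE_def fps_map_const z0 scal_u_def emb_cst fps_eq_iff fls_eq_iff nth_fls_map)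
  have ze0: "ze 0 = Eu" by (simp add: ze_def exp_h_def fps_exp_0 rhom_one[OF rhom_cU])
  have DT: "map_matrix (fps_map scal_u) (Rshift 0 Ru) = map_matrix ((*) (fps_map scal_u (sg 0))) (map_matrix ?h C.DT)"
    by (simp add: vec_eq_iff Rshift_nth C.DT_def rhom_diff[OF su] rhom_mult[OF su] rhom_diff[OF h] rhom_mult[OF h] cc c1[of "vsc Zc"] c2 Z1 Z2 ze0
        fps_map_const rhom_zero[OF rhom_scal_u] scal_u_cU del: fps_const_mult)
  have hl: "hv_swap (Abs_fps (lam i j)) = fps_const (fps_to_fls (lplus i j))" for i j :: 'n
  proof -
    have "Abs_fps (lam i j) = fps_map fps_const (lplus i j)" by (simp add: fps_eq_iff lam_lplus)
    then show ?thesis by (simp add: hv_swap_map_const)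
  qed
  have L1: "map_matrix ?h (t1 (map_matrix fps_const LPm)) = L1_u"
    unfolding map_matrix_t1[OF h] map_matrix_comp c1 by (simp add: vec_eq_iff t1_def L1_u_def LPm_def hl)
  have L2: "map_matrix ?h (t2 (map_matrix (fps_map fps_const) LPm)) = L2_v"
    unfolding map_matrix_t2[OF h] map_matrix_comp c2
    by (simp add: vec_eq_iff t2_def L2_v_def LPm_def fps_eq_iff lam_lplus)
  have S: "map_matrix ?h (map_matrix (\<lambda>s. fps_const (fps_const (scE s))) A) = map_matrix (\<lambda>s. fps_const (lift_u (scal s))) A" for A :: "(complex fps, 'n) mat2"
    by (simp add: map_matrix_comp cc)
  have flip: "map_matrix (fps_map scal_u) (flip (Rshift 0 Ru)) = map_matrix ((*) (fps_map scal_u (sg 0))) (flip (map_matrix ?h C.DT))"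
    unfolding map_matrix_flip DT ..
  have d: "map_matrix ((*) s) (A - B) = map_matrix ((*) s) A - map_matrix ((*) s) B" for s and A B :: "('n free_alg fls fps fps, 'n) mat2"
    by (simp add: vec_eq_iff right_diff_distrib)
  show ?thesis
    unfolding defining_relation_def flip unfolding DT
    unfolding C.RelT_def map_matrix_diff[OF h] map_matrix_mult[OF h] L1 L2 S map_matrix_flip
    by (simp only: map_matrix_flip[symmetric] matrix_central_mult[OF scal_u_central] d)
qed

text \<open>The scalar \<open>sg 0\<close> is a unit. Multiplying by it or by its inverse mixes
  infinitely many coefficients, but the sums converge, so closed ideals do not distinguish the two
  families of relations.\<close>

lemma relations_iff:
  assumes I: "hideal I"
  shows "(\<forall>x y q k. ucoeff k (fps_nth (defining_relation R Ru $ x $ y) q) \<in> I) \<longleftrightarrow> rels \<subseteq> I"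
proof -
  define s :: "'n free_alg fls fps fps" where "s = fps_map scal_u (sg 0)"
  obtain t where "t * sg 0 = 1" using sg_unit[of 0] by (metis dvd_def mult.commute)
  then have "fps_map scal_u t * s = 1"
    using rhom_mult[OF rhom_fps_map[OF rhom_scal_u], of t "sg 0"] rhom_one[OF rhom_fps_map[OF rhom_scal_u]] unfolding s_def by metis
  then obtain s' where s: "s' * s = 1" by blast
  have "(\<forall>x y q k. ucoeff k (fps_nth (defining_relation R Ru $ x $ y) q) \<in> I) \<longleftrightarrow> (\<forall>x y. s * fps_map hv_swap (C.RelT $ x $ y) \<in> Jt I)"
    by (simp add: defining_relation_RelT Jt_def s_def)
  also have "\<dots> \<longleftrightarrow> (\<forall>x y. fps_map hv_swap (C.RelT $ x $ y) \<in> Jt I)"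
  proof (intro all_cong1 iffI)
    fix x y
    assume "s * fps_map hv_swap (C.RelT $ x $ y) \<in> Jt I"
    from Jt_mult[OF I this, of s'] show "fps_map hv_swap (C.RelT $ x $ y) \<in> Jt I"
      by (simp add: mult.assoc[symmetric] s)
  qed (rule Jt_mult[OF I])
  also have "\<dots> \<longleftrightarrow> rels \<subseteq> I"
  proof
    assume *: "\<forall>x y. fps_map hv_swap (C.RelT $ x $ y) \<in> Jt I"
    have "fps_nth (fps_nth (C.RelT $ x $ y) q) m \<in> I" for x y q m
      using *[rule_format, of x y] unfolding Jt_def
      by (auto simp: ucoeff_hv_swap dest!: spec[of _ q] spec[of _ "int m"])
    then show "rels \<subseteq> I" by (auto simp: rels_def)
  next
    assume "rels \<subseteq> I"
    then have "fps_nth (fps_nth (C.RelT $ x $ y) q) m \<in> I" for x y q m unfolding rels_def by blast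
    then show "\<forall>x y. fps_map hv_swap (C.RelT $ x $ y) \<in> Jt I"
      by (simp add: Jt_def ucoeff_hv_swap hideal_zero[OF I])
  qed
  finally show ?thesis .
qed

lemma J_eq: "J = \<Inter> {I. hideal I \<and> rels \<subseteq> I}"
  unfolding rel_ideal_def using relations_iff by (intro arg_cong[of _ _ Inter] Collect_cong) (metis hideal_iff)

lemma J_least: "hideal I \<Longrightarrow> rels \<subseteq> I \<Longrightarrow> J \<subseteq> I"
  unfolding J_eq by blast

lemma rels_J: "rels \<subseteq> J"
  unfolding J_eq by blast

lemma hideal_J: "hideal J"
  unfolding hideal_def
proof (intro conjI ballI allI impI)
  fix x assume x: "\<forall>m. \<exists>y\<in>J. \<forall>l<m. fps_nth y l = fps_nth x l"
  show "x \<in> J"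
    unfolding J_eq
  proof (intro InterI)
    fix I assume I: "I \<in> {I. hideal I \<and> rels \<subseteq> I}"
    then have "J \<subseteq> I" using J_least by blast
    then show "x \<in> I" using I x by (intro hideal_closed[of I]) blast+
  qed
qed (auto simp: J_eq intro: hideal_zero hideal_add hideal_mult_left hideal_mult_right dest: hideal_saturated)

lemma LE_J: "x \<in> J \<Longrightarrow> LE i k (cemb x) \<in> JE J"
proof (rule L_preserves_ideal[where \<Gamma> = rels and L = LE, OF hideal_J lin_LE])
  fix y i k c' b e assume y: "\<And>i k. LE i k y \<in> JE J"
  show "LE i k (lam c' b e * y) \<in> JE J"
    unfolding U.L_lam_solved[OF Lgood_LE]
    by (intro hideal_sum[OF hideal_JE[OF hideal_J]] hideal_mult_left[OF hideal_JE[OF hideal_J]] Wmat_in_ideal[OF hideal_JE[OF hideal_J]])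
       (simp add: y)
next
  fix \<rho> i k z assume "\<rho> \<in> rels"
  then obtain x y q m where \<rho>: "\<rho> = fps_nth (fps_nth (C.RelT $ x $ y) q) m" by (auto simp: rels_def)
  have "cemb \<rho> = fps_nth (fps_nth (U.RelT $ x $ y) q) m" by (simp add: U_RelT \<rho>)
  moreover have "fps_nth (fps_nth (U.RelT $ x $ y) q) m \<in> JE J" for x y q m
  proof -
    have "fps_nth (fps_nth (C.RelT $ x $ y) q) m \<in> J" using rels_J unfolding rels_def by blast
    then show ?thesis unfolding U_RelT by (simp add: cemb_JE[OF hideal_J])
  qed
  ultimately show "LE i k (cemb \<rho> * z) \<in> JE J"
    using U.L_RelT[OF Lgood_LE hideal_JE[OF hideal_J]] by simp
qed (use J_least in auto)

text \<open>An element of \<open>JE J\<close> need not be a finite combination of elements of J with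
  Laurent coefficients. Its image is reached as a convergent sum of images of its coefficients, and
  J is closed.\<close>

lemma JE_LE: "z \<in> JE J \<Longrightarrow> LE i k z \<in> JE J"
proof -
  assume z: "z \<in> JE J"
  have "ucf r (LE i k z) \<in> J" for r
  proof (rule hideal_fsums[OF hideal_J])
    show "fsums (\<lambda>b. ucf (r - b) (LE i k (cemb (ucf b z)))) (ucf r (LE i k z))" by (rule fsums_lin_ucf[OF lin_LE])
    have "ucf b z \<in> J" for b using z unfolding JE_def by blast
    from LE_J[OF this] show "ucf (r - b) (LE i k (cemb (ucf b z))) \<in> J" for b unfolding JE_def by blast
  qed
  then show ?thesis by (simp add: JE_def)
qed

end

subsection \<open>Inverting operators congruent to the identity modulo \<open>h\<close>\<close>

lemma lin_order:
  assumes T: "lin T" and T0: "\<And>x. fps_nth (T x) 0 = 0" and x: "\<forall>l<m. fps_nth x l = 0"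
  shows "\<forall>l<Suc m. fps_nth (T x) l = 0"
proof -
  have "x = scE (fps_X ^ m) * fps_shift m x"
    unfolding scE_X_power using x by (auto simp: fps_eq_iff fps_X_power_mult_nth)
  then have "T x = fps_X ^ m * T (fps_shift m x)"
    using lin_scE[OF T, of "fps_X ^ m" "fps_shift m x"] by (simp add: scE_X_power)
  then show ?thesis using T0 by (auto simp: fps_X_power_mult_nth less_Suc_eq)
qed

text \<open>1 - L raises the order in h, so its powers sum to an inverse. The partial sums preserve
  every ideal that L preserves, and closedness passes this to the limit, so that the inverse
  descends to the quotient.\<close>

lemma lin_matrix_inverse:
  fixes L :: "'n::finite \<Rightarrow> 'n \<Rightarrow> ('g::monoid_add \<Rightarrow>\<^sub>0 'k::comm_ring_1) fps \<Rightarrow> ('g \<Rightarrow>\<^sub>0 'k) fps"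
  assumes L: "\<And>i k. lin (L i k)" and L0: "\<And>i k x. fps_nth (L i k x) 0 = (if i = k then fps_nth x 0 else 0)"
  obtains K where "\<And>i k. lin (K i k)" "\<And>i j x. (\<Sum>k\<in>UNIV. L i k (K k j x)) = (if i = j then x else 0)"
    "\<And>i j x. (\<Sum>k\<in>UNIV. K i k (L k j x)) = (if i = j then x else 0)"
    "\<And>J i k x. hideal J \<Longrightarrow> (\<And>i k x. x \<in> J \<Longrightarrow> L i k x \<in> J) \<Longrightarrow> x \<in> J \<Longrightarrow> K i k x \<in> J"
proof -
  define I where "I i k x = (if i = k then x else 0)" for i k :: 'n and x :: "('g \<Rightarrow>\<^sub>0 'k) fps"
  define T where "T i k x = I i k x - L i k x" for i k x
  \<comment> \<open>\<open>P m\<close> is the m-th power of T = 1 - L, \<open>S M\<close> a partial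
    sum, and K its limit: the coefficient of h^l no longer changes once M > l.\<close>
  define P where "P = rec_nat I (\<lambda>m P i k x. \<Sum>j\<in>UNIV. T i j (P j k x))"
  have P0: "P 0 = I" and PS: "P (Suc m) i k x = (\<Sum>j\<in>UNIV. T i j (P m j k x))" for m i k x by (simp_all add: P_def)
  define S where "S M i k x = (\<Sum>m<M. P m i k x)" for M i k x
  define K where "K i k x = Abs_fps (\<lambda>l. fps_nth (S (Suc l) i k x) l)" for i k x
  have linId: "lin (I i k)" for i k unfolding I_def[abs_def] by (cases "i = k") (simp_all add: lin_id lin_zero_fun)
  have linT: "lin (T i k)" for i k unfolding T_def[abs_def] by (intro lin_diffI linId L)
  have linP: "lin (P m i k)" for m i k
    by (induction m arbitrary: i k) (auto simp: P0 linId PS[abs_def] intro!: lin_sumI lin_comp[OF linT])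
  have linS: "lin (S M i k)" for M i k unfolding S_def[abs_def] by (intro lin_sumI linP)
  have T0: "fps_nth (T i k x) 0 = 0" for i k x by (simp add: T_def I_def L0)
  have ord: "\<forall>l<m. fps_nth (P m i k x) l = 0" for m i k x
  proof (induction m arbitrary: i k)
    case (Suc m)
    show ?case unfolding PS fps_sum_nth using lin_order[OF linT T0 Suc] by (auto intro!: sum.neutral)
  qed simp
  have KS: "fps_nth (K i k x) l = fps_nth (S M i k x) l" if "l < M" for i k x l M
  proof -
    have "(\<Sum>m<M. fps_nth (P m i k x) l) = (\<Sum>m<Suc l. fps_nth (P m i k x) l)"
      by (rule sum.mono_neutral_right) (use that ord in auto)
    then show ?thesis by (simp add: K_def S_def fps_sum_nth del: sum.lessThan_Suc)
  qed
  \<comment> \<open>The recursion for powers adds a factor on the left; a factor on the right is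
    wanted for the left inverse.\<close>
  have PS': "P (Suc m) i k x = (\<Sum>j\<in>UNIV. P m i j (T j k x))" for m i k x
  proof (induction m arbitrary: i k x)
    case 0
    have "T i j (I j k x) = (if j = k then T i k x else 0)" "I i j (T j k x) = (if j = i then T i k x else 0)" for j
      using lin_zero[OF linT] by (auto simp: I_def)
    then show ?case by (simp only: PS P0) simp
  next
    case (Suc m)
    have "P (Suc (Suc m)) i k x = (\<Sum>j\<in>UNIV. \<Sum>j'\<in>UNIV. T i j (P m j j' (T j' k x)))"
      by (subst PS, subst Suc) (simp add: lin_sum[OF linT])
    also have "\<dots> = (\<Sum>j'\<in>UNIV. P (Suc m) i j' (T j' k x))"
      by (subst sum.swap) (simp add: PS)
    finally show ?case .
  qed
  have tel: "S M i j x - (\<Sum>m<M. P (Suc m) i j x) = I i j x - P M i j x" for M i j x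
    by (induction M) (simp_all add: S_def P0 algebra_simps)
  have LS: "(\<Sum>k\<in>UNIV. L i k (S M k j x)) = I i j x - P M i j x" for M i j x
  proof -
    have "L i k y = I i k y - T i k y" for k y by (simp add: T_def)
    then have "(\<Sum>k\<in>UNIV. L i k (S M k j x)) = (\<Sum>k\<in>UNIV. I i k (S M k j x)) - (\<Sum>k\<in>UNIV. T i k (S M k j x))"
      by (simp add: sum_subtractf)
    also have "(\<Sum>k\<in>UNIV. I i k (S M k j x)) = S M i j x" by (simp add: I_def)
    also have "(\<Sum>k\<in>UNIV. T i k (S M k j x)) = (\<Sum>m<M. P (Suc m) i j x)"
      unfolding S_def lin_sum[OF linT] PS by (rule sum.swap)
    finally show ?thesis by (simp only: tel)
  qed
  have SL: "(\<Sum>k\<in>UNIV. S M i k (L k j x)) = I i j x - P M i j x" for M i j x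
  proof -
    have "L k j x = I k j x - T k j x" for k by (simp add: T_def)
    then have "(\<Sum>k\<in>UNIV. S M i k (L k j x)) = (\<Sum>k\<in>UNIV. S M i k (I k j x)) - (\<Sum>k\<in>UNIV. S M i k (T k j x))"
      by (simp add: sum_subtractf lin_diff[OF linS])
    also have "(\<Sum>k\<in>UNIV. S M i k (I k j x)) = S M i j x"
    proof -
      have "S M i k (I k j x) = (if k = j then S M i j x else 0)" for k using lin_zero[OF linS] by (simp add: I_def)
      then show ?thesis by simp
    qed
    also have "(\<Sum>k\<in>UNIV. S M i k (T k j x)) = (\<Sum>m<M. P (Suc m) i j x)"
      unfolding S_def PS' by (rule sum.swap)
    finally show ?thesis by (simp only: tel)
  qed
  show ?thesis
  proof (rule that)
    show "lin (K i k)" for i k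
    proof (rule linI)
      show "K i k (x + y) = K i k x + K i k y" for x y
        by (rule fps_ext) (simp add: K_def lin_add[OF linS])
      show "K i k (scE s * x) = scE s * K i k x" for s x
      proof (rule fps_ext)
        fix l
        have "fps_nth (K i k (scE s * x)) l = fps_nth (scE s * S (Suc l) i k x) l"
          by (simp add: K_def lin_scE[OF linS])
        also have "\<dots> = fps_nth (scE s * K i k x) l"
          unfolding fps_mult_nth by (intro sum.cong refl arg_cong2[of _ _ _ _ "(*)"] KS[symmetric]) simp
        finally show "fps_nth (K i k (scE s * x)) l = fps_nth (scE s * K i k x) l" .
      qed
    qed
    show "(\<Sum>k\<in>UNIV. L i k (K k j x)) = (if i = j then x else 0)" for i j x
    proof (rule fps_ext)
      fix l
      have "fps_nth (L i k (K k j x)) l = fps_nth (L i k (S (Suc l) k j x)) l" for k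
        using lin_approx[OF L, of "Suc l" "K k j x" "S (Suc l) k j x"] KS by auto
      then have "fps_nth (\<Sum>k\<in>UNIV. L i k (K k j x)) l = fps_nth (\<Sum>k\<in>UNIV. L i k (S (Suc l) k j x)) l"
        by (simp add: fps_sum_nth)
      then show "fps_nth (\<Sum>k\<in>UNIV. L i k (K k j x)) l = fps_nth (if i = j then x else 0) l"
        unfolding LS using ord[of "Suc l" i j x] by (simp add: I_def)
    qed
    show "(\<Sum>k\<in>UNIV. K i k (L k j x)) = (if i = j then x else 0)" for i j x
    proof (rule fps_ext)
      fix l
      have "fps_nth (\<Sum>k\<in>UNIV. K i k (L k j x)) l = fps_nth (\<Sum>k\<in>UNIV. S (Suc l) i k (L k j x)) l"
        by (simp add: fps_sum_nth K_def)
      then show "fps_nth (\<Sum>k\<in>UNIV. K i k (L k j x)) l = fps_nth (if i = j then x else 0) l"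
        unfolding SL using ord[of "Suc l" i j x] by (simp add: I_def)
    qed
    show "K i k x \<in> J" if J: "hideal J" and LJ: "\<And>i k x. x \<in> J \<Longrightarrow> L i k x \<in> J" and x: "x \<in> J" for J i k x
    proof -
      have TJ: "T i k y \<in> J" if "y \<in> J" for i k y
        using LJ[OF that] that hideal_diff[OF J] hideal_zero[OF J] by (auto simp: T_def I_def)
      have "P m i k x \<in> J" for m i k
        by (induction m arbitrary: i k) (auto simp: P0 I_def PS x hideal_zero[OF J] intro!: hideal_sum[OF J] TJ)
      then have "S M i k x \<in> J" for M unfolding S_def by (intro hideal_sum[OF J])
      then show ?thesis using KS by (intro hideal_closed[OF J]) metis
    qed
  qed
qed

subsection \<open>Coefficient extraction\<close>

lemma additive_fls_map: "Modules.additive \<theta> \<Longrightarrow> Modules.additive (fls_map \<theta>)"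
  by (auto simp: Modules.additive_def fls_eq_iff nth_fls_map additive.zero[unfolded Modules.additive_def])

text \<open>In C((u))((v)) the outer variable is v. Its powers are extracted by \<open>ucf\<close>,
  those of the inner variable u by this map.\<close>

abbreviation icf :: "int \<Rightarrow> 'k::comm_ring_1 fls fls \<Rightarrow> 'k fls" where
  "icf p \<equiv> fls_map (\<lambda>g. fls_nth g p)"

lemma icf_proj: "icf p (fls_map fls_const x * y) = x * icf p y" for x :: "'k::comm_ring_1 fls"
proof (rule fls_eqI)
  fix n
  obtain B where B: "\<And>k. k < B \<Longrightarrow> fls_nth x k = 0" using fls_nth_bounded[of x] by blast
  obtain B' where B': "\<And>k. k < B' \<Longrightarrow> fls_nth y k = 0" using fls_nth_bounded[of y] by blast
  have "fls_nth (fls_map fls_const x * y) n = (\<Sum>i=B..n-B'. fls_const (fls_nth x i) * fls_nth y (n - i))"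
    by (subst nth_fls_mult[of B _ B']) (auto simp: nth_fls_map B B')
  moreover have "fls_nth (x * icf p y) n = (\<Sum>i=B..n-B'. fls_nth x i * fls_nth (fls_nth y (n - i)) p)"
    by (subst nth_fls_mult[of B _ B']) (auto simp: nth_fls_map B B')
  ultimately show "fls_nth (icf p (fls_map fls_const x * y)) n = fls_nth (x * icf p y) n"
    by (simp add: nth_fls_map additive.sum[OF additive_fls_nth] fls_nth_const_mult)
qed

lemma icf_zero: "icf p 0 = 0"
  by (simp add: fls_eq_iff nth_fls_map)

lemma lin_lext_eq: "lin T \<Longrightarrow> T = lext (\<lambda>w. T (wrd w))"
  by (rule ext, rule lin_eqI[OF _ lin_lext]) (simp_all add: lext_wrd)

text \<open>L^-(u), made constant in the outer variable v, lets v-coefficients pass through it.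
  \<open>Lbase_v\<close> is the counterpart for L^-(v) and the inner variable u.\<close>

lemma Lbase_u:
  assumes "\<And>i k. lin (L i k)"
  shows "ucf s (Lbase fls_const L i k y) = L i k (ucf s y)"
  unfolding Lbase_def emap_def
  by (subst lext_proj) (auto simp: additive_fls_nth rhom_additive[OF rhom_fls_const] fls_nth_const_mult lin_lext_eq[OF assms, symmetric])

lemma Lbase_v:
  assumes "\<And>i k. lin (L i k)"
  shows "emap (icf p) (Lbase (fls_map fls_const) L i k y) = L i k (emap (icf p) y)"
  unfolding Lbase_def emap_def
  by (subst lext_proj) (auto simp: additive_fls_map[OF additive_fls_nth] rhom_additive[OF rhom_fls_map[OF rhom_fls_const]] icf_proj lin_lext_eq[OF assms, symmetric])

lemma ucf_ucf: "ucf p (ucf s z) = ucf s (emap (icf p) z)"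
  by (rule fps_ext, rule poly_mapping_eqI) (simp add: emap_def lookup_pmap nth_fls_map icf_zero)

lemma ucf_eqI: "(\<And>r. ucf r y = ucf r z) \<Longrightarrow> y = z"
proof (rule fps_ext, rule poly_mapping_eqI, rule fls_eqI)
  fix n w k assume *: "\<And>r. ucf r y = ucf r z"
  have "Poly_Mapping.lookup (fps_nth (ucf k y) n) w = Poly_Mapping.lookup (fps_nth (ucf k z) n) w" by (simp only: *)
  then show "fls_nth (Poly_Mapping.lookup (fps_nth y n) w) k = fls_nth (Poly_Mapping.lookup (fps_nth z n) w) k"
    by (simp add: lookup_pmap)
qed

lemma icf_const: "icf p (fls_const g) = fls_const (fls_nth g p)"
  by (simp add: fls_eq_iff nth_fls_map)

lemma emap_icf_cemb: "emap (icf p) (cemb w) = cemb (ucf p w)"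
  by (rule fps_ext, rule poly_mapping_eqI) (simp add: emap_def lookup_pmap icf_const icf_zero)

lemma fsums_zero: "fsums (\<lambda>_. 0) 0"
  by (simp add: fsums_def fin_sum_zero)

text \<open>The convolution runs over all integers, the exponents of v in R(u - v) over natural
  numbers; the terms in between vanish.\<close>

lemma fsums_nat:
  fixes f :: "int \<Rightarrow> int \<Rightarrow> 'a::ab_group_add fps"
  assumes "fsums (\<lambda>(p, q). f p q) t" "\<And>p q. q < 0 \<Longrightarrow> f p q = 0"
  shows "fsums (\<lambda>(p, q). f p (int q)) t"
  unfolding fsums_def
proof
  fix l
  define g where "g = (\<lambda>(p :: int, q). (p, int q))"
  have g: "inj g" by (auto simp: g_def inj_def)
  obtain S where S: "finite S" "\<And>i. i \<notin> S \<Longrightarrow> fps_nth (case i of (p, q) \<Rightarrow> f p q) l = 0"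
    "(\<Sum>i\<in>S. fps_nth (case i of (p, q) \<Rightarrow> f p q) l) = fps_nth t l"
    using assms(1) unfolding fsums_def fin_sum_def by metis
  have "(\<Sum>i\<in>S. fps_nth (case i of (p, q) \<Rightarrow> f p q) l) = (\<Sum>i\<in>g ` (g -` S). fps_nth (case i of (p, q) \<Rightarrow> f p q) l)"
  proof (rule sum.mono_neutral_right[OF S(1)])
    show "\<forall>i\<in>S - g ` (g -` S). fps_nth (case i of (p, q) \<Rightarrow> f p q) l = 0"
    proof (clarify)
      fix p q assume *: "(p, q) \<in> S" "(p, q) \<notin> g ` (g -` S)"
      then have "q < 0"
      proof (rule_tac ccontr)
        assume "\<not> q < 0"
        then have "(p, q) = g (p, nat q)" by (simp add: g_def)
        then show False using * by (metis imageI vimageI)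
      qed
      then show "fps_nth (f p q) l = 0" using assms(2) by simp
    qed
  qed auto
  also have "\<dots> = (\<Sum>i\<in>g -` S. fps_nth (case i of (p, q) \<Rightarrow> f p (int q)) l)"
    by (subst sum.reindex[OF inj_on_subset[OF g]]) (auto simp: g_def case_prod_beta intro!: sum.cong)
  finally have s: "(\<Sum>i\<in>g -` S. fps_nth (case i of (p, q) \<Rightarrow> f p (int q)) l) = fps_nth t l" using S(3) by simp
  show "fin_sum (\<lambda>i. fps_nth (case i of (p, q) \<Rightarrow> f p (int q)) l) (fps_nth t l)"
  proof (rule fin_sumI[OF finite_vimageI[OF S(1) g] _ s])
    fix i assume "i \<notin> g -` S"
    then show "fps_nth (case i of (p, q) \<Rightarrow> f p (int q)) l = 0"
      using S(2)[of "g i"] by (simp add: g_def case_prod_beta)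
  qed
qed

lemma fsums_nested:
  fixes f :: "'p \<Rightarrow> 'q \<Rightarrow> 'a::ab_group_add fps"
  assumes "finite S" "\<And>p q. q \<notin> S \<Longrightarrow> f p q = 0" "\<And>q. q \<in> S \<Longrightarrow> fsums (\<lambda>p. f p q) (t q)"
  shows "fsums (\<lambda>(p, q). f p q) (\<Sum>q\<in>S. t q)"
  unfolding fsums_def fps_sum_nth
proof
  fix l
  have eq: "(\<lambda>i. fps_nth (case i of (p, q) \<Rightarrow> f p q) l) = (\<lambda>(p, q). fps_nth (f p q) l)" by auto
  show "fin_sum (\<lambda>i. fps_nth (case i of (p, q) \<Rightarrow> f p q) l) (\<Sum>q\<in>S. fps_nth (t q) l)"
    unfolding eq using assms(2,3) by (intro fin_sum_nested[OF assms(1)]) (simp_all add: fsums_def)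
qed

lemma ucoeff_mult_const: "ucoeff p (x * fps_map fls_const g) = ucoeff p x * g" "ucoeff p (fps_map fls_const g * x) = g * ucoeff p x"
  for x :: "'a::ring_1 fls fps"
  by (simp_all add: fps_eq_iff fps_mult_nth additive.sum[OF additive_fls_nth] fls_nth_const_mult)

lemma t1_mult: "(A ** t1 B) $ x $ y = (\<Sum>k\<in>UNIV. A $ x $ (k, snd y) * B $ k $ fst y)"
proof -
  have "(A ** t1 B) $ x $ y = (\<Sum>k\<in>UNIV. \<Sum>l\<in>UNIV. if l = snd y then A $ x $ (k, l) * B $ k $ fst y else 0)"
    by (simp add: nth_matrix_mult sum_pairs t1_def if_distrib cong: if_cong)
  then show ?thesis by simp
qed

lemma t2_mult: "(A ** t2 B) $ x $ y = (\<Sum>l\<in>UNIV. A $ x $ (fst y, l) * B $ l $ snd y)"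
proof -
  have "(A ** t2 B) $ x $ y = (\<Sum>k\<in>UNIV. \<Sum>l\<in>UNIV. if k = fst y then A $ x $ (k, l) * B $ l $ snd y else 0)"
    by (simp add: nth_matrix_mult sum_pairs t2_def if_distrib cong: if_cong)
  also have "\<dots> = (\<Sum>l\<in>UNIV. \<Sum>k\<in>UNIV. if k = fst y then A $ x $ (k, l) * B $ l $ snd y else 0)" by (rule sum.swap)
  finally show ?thesis by simp
qed

lemma mult_t2: "(t2 B ** A) $ x $ y = (\<Sum>l\<in>UNIV. B $ snd x $ l * A $ (fst x, l) $ y)"
proof -
  have "(t2 B ** A) $ x $ y = (\<Sum>k\<in>UNIV. \<Sum>l\<in>UNIV. if fst x = k then B $ snd x $ l * A $ (k, l) $ y else 0)"
    by (simp add: nth_matrix_mult sum_pairs t2_def if_distrib[of "\<lambda>t. t * _"] cong: if_cong)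
  also have "\<dots> = (\<Sum>l\<in>UNIV. \<Sum>k\<in>UNIV. if fst x = k then B $ snd x $ l * A $ (k, l) $ y else 0)" by (rule sum.swap)
  finally show ?thesis by simp
qed

lemma rll_entry_left: "(A ** t1 B ** C ** t2 D) $ (i1, i2) $ (j1, j2) =
   (\<Sum>k1\<in>UNIV. \<Sum>k2\<in>UNIV. \<Sum>l1\<in>UNIV. \<Sum>l2\<in>UNIV. A $ (i1, i2) $ (k1, k2) * B $ k1 $ l1 * C $ (l1, k2) $ (j1, l2) * D $ l2 $ j2)"
proof -
  have "(A ** t1 B ** C ** t2 D) $ (i1, i2) $ (j1, j2) =
     (\<Sum>l2\<in>UNIV. \<Sum>l1\<in>UNIV. \<Sum>k2\<in>UNIV. \<Sum>k1\<in>UNIV. A $ (i1, i2) $ (k1, k2) * B $ k1 $ l1 * C $ (l1, k2) $ (j1, l2) * D $ l2 $ j2)"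
    unfolding t2_mult nth_matrix_mult[of _ C] sum_pairs t1_mult by (simp add: sum_distrib_right)
  also have "\<dots> = (\<Sum>l2\<in>UNIV. \<Sum>k1\<in>UNIV. \<Sum>l1\<in>UNIV. \<Sum>k2\<in>UNIV. A $ (i1, i2) $ (k1, k2) * B $ k1 $ l1 * C $ (l1, k2) $ (j1, l2) * D $ l2 $ j2)"
    by (rule sum.cong[OF refl], rule sum_rot)
  also have "\<dots> = (\<Sum>k1\<in>UNIV. \<Sum>l2\<in>UNIV. \<Sum>l1\<in>UNIV. \<Sum>k2\<in>UNIV. A $ (i1, i2) $ (k1, k2) * B $ k1 $ l1 * C $ (l1, k2) $ (j1, l2) * D $ l2 $ j2)"
    by (rule sum.swap)
  also have "\<dots> = (\<Sum>k1\<in>UNIV. \<Sum>k2\<in>UNIV. \<Sum>l2\<in>UNIV. \<Sum>l1\<in>UNIV. A $ (i1, i2) $ (k1, k2) * B $ k1 $ l1 * C $ (l1, k2) $ (j1, l2) * D $ l2 $ j2)"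
    by (rule sum.cong[OF refl], rule sum_rot)
  also have "\<dots> = (\<Sum>k1\<in>UNIV. \<Sum>k2\<in>UNIV. \<Sum>l1\<in>UNIV. \<Sum>l2\<in>UNIV. A $ (i1, i2) $ (k1, k2) * B $ k1 $ l1 * C $ (l1, k2) $ (j1, l2) * D $ l2 $ j2)"
    by (rule sum.cong[OF refl], rule sum.cong[OF refl], rule sum.swap)
  finally show ?thesis .
qed

lemma rll_entry_right: "(t2 D ** C ** t1 B ** A) $ (i1, i2) $ (j1, j2) =
   (\<Sum>k1\<in>UNIV. \<Sum>k2\<in>UNIV. \<Sum>l1\<in>UNIV. \<Sum>l2\<in>UNIV. D $ i2 $ l2 * C $ (i1, l2) $ (l1, k2) * B $ l1 $ k1 * A $ (k1, k2) $ (j1, j2))"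
  unfolding nth_matrix_mult[of _ A] sum_pairs t1_mult mult_t2
  by (simp add: sum_distrib_right)

lemma fsums_finite_index4:
  fixes f :: "'k1::finite \<Rightarrow> 'k2::finite \<Rightarrow> 'k3::finite \<Rightarrow> 'k4::finite \<Rightarrow> 'i \<Rightarrow> 'a::ab_group_add fps"
  assumes "\<And>k1 k2 k3 k4. fsums (f k1 k2 k3 k4) (t k1 k2 k3 k4)"
  shows "fsums (\<lambda>(k1, k2, k3, k4, i). f k1 k2 k3 k4 i) (\<Sum>k1\<in>UNIV. \<Sum>k2\<in>UNIV. \<Sum>k3\<in>UNIV. \<Sum>k4\<in>UNIV. t k1 k2 k3 k4)"
proof -
  have 1: "fsums (\<lambda>(k4, i). f k1 k2 k3 k4 i) (\<Sum>k4\<in>UNIV. t k1 k2 k3 k4)" for k1 k2 k3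
    by (rule fsums_finite_index[OF assms])
  have 2: "fsums (\<lambda>(k3, k4, i). f k1 k2 k3 k4 i) (\<Sum>k3\<in>UNIV. \<Sum>k4\<in>UNIV. t k1 k2 k3 k4)" for k1 k2
    by (rule fsums_finite_index[OF 1])
  have 3: "fsums (\<lambda>(k2, k3, k4, i). f k1 k2 k3 k4 i) (\<Sum>k2\<in>UNIV. \<Sum>k3\<in>UNIV. \<Sum>k4\<in>UNIV. t k1 k2 k3 k4)" for k1
    by (rule fsums_finite_index[OF 2])
  show ?thesis by (rule fsums_finite_index[OF 3])
qed

lemma fsums_finite_index6:
  fixes f :: "'k1::finite \<Rightarrow> 'k2::finite \<Rightarrow> 'k3::finite \<Rightarrow> 'k4::finite \<Rightarrow> 'p \<Rightarrow> 'q \<Rightarrow> 'a::ab_group_add fps"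
  assumes "\<And>k1 k2 k3 k4. fsums (\<lambda>(p, q). f k1 k2 k3 k4 p q) (t k1 k2 k3 k4)"
  shows "fsums (\<lambda>(k1, k2, k3, k4, p, q). f k1 k2 k3 k4 p q) (\<Sum>k1\<in>UNIV. \<Sum>k2\<in>UNIV. \<Sum>k3\<in>UNIV. \<Sum>k4\<in>UNIV. t k1 k2 k3 k4)"
  by (rule fsums_finite_index4[where f = "\<lambda>k1 k2 k3 k4 (p, q). f k1 k2 k3 k4 p q", OF assms])

context Ydata
begin

subsection \<open>\<open>L\<^sup>-(u)\<close> modulo \<open>h\<close>\<close>

abbreviation m0 :: "'a::zero fps \<Rightarrow> 'a" where "m0 x \<equiv> fps_nth x 0"
abbreviation pv :: "complex fls fps fps \<Rightarrow> complex fls fps" where "pv \<equiv> fps_map m0"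
abbreviation pE :: "(complex fls, 'n) fa fps fps \<Rightarrow> (complex fls, 'n) fa fps" where "pE \<equiv> fps_map m0"
abbreviation pc :: "complex fps \<Rightarrow> complex fls fps" where "pc s \<equiv> fps_const (m0 (cU s))"
abbreviation vs :: "complex fls fps \<Rightarrow> (complex fls, 'n) fa fps" where "vs \<equiv> scE"

lemma rhom_pv: "rhom pv" by (rule rhom_fps_map[OF rhom_fps_nth_0])
lemma rhom_pE: "rhom pE" by (rule rhom_fps_map[OF rhom_fps_nth_0])
lemma rhom_pc: "rhom pc" by (rule rhom_comp[OF rhom_fps_const rhom_comp[OF rhom_fps_nth_0 rhom_cU]])

lemma pv_const: "pv (fps_const x) = fps_const (m0 x)" by (simp add: fps_map_const)

lemma pE_vsc: "pE (vsc f) = vs (pv f)"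
  by (simp add: vsc_def scE_def fps_eq_iff)

lemma m0_PRi: "m0 (flip (RP R) $ x $ y) = m0 (PRi R $ x $ y)"
  by (simp add: PRi_nth kappa_def)

text \<open>\<open>kappa\<close> vanishes at h = 0, so PR and PR^{-1} coincide there and R(u - v) is
  a scalar multiple of PR^{-1}.\<close>

lemma Rshift_mod_h:
  obtains \<theta> where "map_matrix pv (Rshift b Ru) = map_matrix ((*) \<theta>) (map_matrix pc (PRi R))"
proof
  show "map_matrix pv (Rshift b Ru) = map_matrix ((*) (pv (sg b) * (pv (fps_const (ze b)) - pv Zu))) (map_matrix pc (PRi R))"
    by (simp add: vec_eq_iff Rshift_nth rhom_mult[OF rhom_pv] rhom_diff[OF rhom_pv] pv_const m0_PRi algebra_simps del: fps_const_mult)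
qed

text \<open>At h = 0 the product of the flipped RP and RM is a scalar \<open>\<theta>\<close>, and
  \<open>\<theta>\<close> times RI is RP. The scalars cancel and RP L^+ y is left.\<close>

lemma Wmat_mod_h:
  assumes Xm: "\<And>i k. m0 (Xm $ i $ k) = (if i = k then y else 0)"
  shows "map_matrix pE (Wmat U.Sc RI RM Xm) = map_matrix vs (map_matrix pc (RP R)) ** t2 (map_matrix pE LPm) ** mat (fps_const y)"
proof -
  obtain \<theta> where \<theta>: "map_matrix pv (Rshift (c / 2) Ru) = map_matrix ((*) \<theta>) (map_matrix pc (PRi R))" by (rule Rshift_mod_h)
  define \<rho> where "\<rho> = map_matrix pv (Rshift (c / 2) Ru)"
  let ?S = "map_matrix pc (RP R)"
  have comm: "a * x = x * a" for a x :: "complex fls fps" by (rule mult.commute)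
  have inv: "\<rho> ** ?S = map_matrix ((*) \<theta>) (mat 1)" "?S ** \<rho> = map_matrix ((*) \<theta>) (mat 1)"
    unfolding \<rho>_def \<theta> matrix_central_mult[OF comm] map_matrix_mult[OF rhom_pc, symmetric] PRi_RP[OF hecke] map_matrix_one[OF rhom_pc] by (rule refl)+
  have RI: "map_matrix pv RI ** \<rho> = mat 1"
    unfolding \<rho>_def map_matrix_mult[OF rhom_pv, symmetric] Rshift_inverse map_matrix_one[OF rhom_pv] ..
  have RM: "map_matrix pv RM = flip \<rho>"
    unfolding \<rho>_def map_matrix_flip
    by (rule arg_cong[of _ _ flip]) (simp add: vec_eq_iff fps_eq_iff Rshift_def shift_arg_nth_0_indep[of "- (c / 2)" _ _ "c / 2"])
  have Y: "t1 (map_matrix pE (map_matrix fps_const Xm)) = mat (fps_const y)"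
    by (auto simp: vec_eq_iff t1_def mat_def Xm fps_map_const prod_eq_iff)
  have vs: "map_matrix vs A ** mat (fps_const y) = mat (fps_const y) ** map_matrix vs A" for A :: "(complex fls fps, 'n) mat2"
    by (simp add: vec_eq_iff mat_mult scE_central)
  have SD: "map_matrix vs (map_matrix pv (map_matrix fps_const (flip U.Sc))) ** map_matrix vs (map_matrix pv RM) = map_matrix ((*) (vs \<theta>)) (mat 1)"
  proof -
    have "map_matrix pv (map_matrix fps_const (flip U.Sc)) = flip ?S"
      by (simp add: map_matrix_comp pv_const U.Sc_def map_matrix_flip)
    then have "map_matrix pv (map_matrix fps_const (flip U.Sc)) ** map_matrix pv RM = flip (map_matrix ((*) \<theta>) (mat 1))"
      by (simp only: RM flip_mult[symmetric] inv)
    also have "\<dots> = map_matrix ((*) \<theta>) (mat 1)" by (simp only: map_matrix_flip[symmetric] flip_one)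
    finally have f: "map_matrix pv (map_matrix fps_const (flip U.Sc)) ** map_matrix pv RM = map_matrix ((*) \<theta>) (mat 1)" .
    show ?thesis
      unfolding map_matrix_mult[OF rhom_scE, symmetric] f
      by (auto simp: vec_eq_iff mat_def rhom_zero[OF rhom_scE])
  qed
  have RIS: "map_matrix ((*) (vs \<theta>)) (map_matrix vs (map_matrix pv RI)) = map_matrix vs ?S"
  proof -
    have "map_matrix ((*) \<theta>) (map_matrix pv RI) = map_matrix pv RI ** map_matrix ((*) \<theta>) (mat 1)"
      by (simp only: matrix_central_mult[OF comm] matrix_mul_rid)
    also have "\<dots> = map_matrix pv RI ** \<rho> ** ?S" unfolding inv[symmetric] by (rule matrix_mul_assoc)
    also have "\<dots> = ?S" by (simp only: RI matrix_mul_lid)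
    finally have f: "map_matrix ((*) \<theta>) (map_matrix pv RI) = ?S" .
    have "map_matrix ((*) (vs \<theta>)) (map_matrix vs A) = map_matrix vs (map_matrix ((*) \<theta>) A)" for A :: "(complex fls fps, 'n) mat2"
      by (simp add: vec_eq_iff rhom_mult[OF rhom_scE])
    then show ?thesis unfolding f[symmetric] .
  qed
  have cen: "vs \<theta> * x = x * vs \<theta>" for x by (rule scE_central)
  let ?A = "map_matrix vs (map_matrix pv RI)" and ?L = "t2 (map_matrix pE LPm)" and ?Y = "mat (fps_const y)"
    and ?B = "map_matrix vs (map_matrix pv (map_matrix fps_const (flip U.Sc)))" and ?D = "map_matrix vs (map_matrix pv RM)"
  have "map_matrix pE (Wmat U.Sc RI RM Xm) = ?A ** ?L ** ?B ** ?Y ** ?D"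
    unfolding Wmat_def map_matrix_mult[OF rhom_pE] map_matrix_t1[OF rhom_pE] map_matrix_t2[OF rhom_pE] Y
    by (simp only: map_matrix_comp pE_vsc)
  also have "\<dots> = ?A ** ?L ** (?B ** ?D) ** ?Y"
    unfolding matrix_mul_assoc[symmetric] vs[symmetric] ..
  also have "\<dots> = map_matrix ((*) (vs \<theta>)) ?A ** ?L ** ?Y"
    unfolding SD by (simp only: matrix_central_mult[OF cen] matrix_mul_rid)
  finally show ?thesis unfolding RIS .
qed

text \<open>Once \<open>Wmat\<close> is reduced to RP L^+ y, the solved recursion contracts Q with
  RP to Kronecker deltas.\<close>

lemma LE_lam_mod_h:
  assumes y: "\<And>i k. m0 (LE i k y) = (if i = k then m0 y else 0)"
  shows "m0 (LE i k (lam c' b e * y)) = (if i = k then m0 (lam c' b e * y) else 0)"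
proof -
  have W: "m0 (fps_nth (Wmat U.Sc RI RM (\<chi> i k. LE i k y) $ (i, a') $ (j, b)) e) =
      (\<Sum>d\<in>UNIV. cst (m0 (cU (RP R $ (i, a') $ (j, d)))) * (m0 (lam d b e) * m0 y))" for a' j
  proof -
    have "m0 (fps_nth (Wmat U.Sc RI RM (\<chi> i k. LE i k y) $ (i, a') $ (j, b)) e) =
        fps_nth (map_matrix pE (Wmat U.Sc RI RM (\<chi> i k. LE i k y)) $ (i, a') $ (j, b)) e" by simp
    also have "\<dots> = fps_nth ((map_matrix vs (map_matrix pc (RP R)) ** t2 (map_matrix pE LPm) ** mat (fps_const (m0 y))) $ (i, a') $ (j, b)) e"
      by (subst Wmat_mod_h) (simp_all add: y)
    also have "\<dots> = (\<Sum>d\<in>UNIV. cst (m0 (cU (RP R $ (i, a') $ (j, d)))) * (m0 (lam d b e) * m0 y))"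
      by (simp add: mat_mult t2_mult LPm_def scE_def fps_map_const rhom_zero[OF rhom_cst] fps_sum_nth sum_distrib_right mult.assoc)
    finally show ?thesis .
  qed
  have m: "m0 (scE (cU s) * x) = cst (m0 (cU s)) * m0 x" for s and x :: "(complex fls, 'n) fa fps" by (simp add: scE_def)
  have "m0 (LE i k (lam c' b e * y)) = (\<Sum>a'\<in>UNIV. \<Sum>j\<in>UNIV. \<Sum>d\<in>UNIV. cst (m0 (cU (Q k c' a' j))) * (cst (m0 (cU (RP R $ (i, a') $ (j, d)))) * (m0 (lam d b e) * m0 y)))"
    unfolding U.L_lam_solved[OF Lgood_LE] fps_sum_nth m W sum_distrib_left ..
  also have "\<dots> = (\<Sum>d\<in>UNIV. \<Sum>a'\<in>UNIV. \<Sum>j\<in>UNIV. cst (m0 (cU (Q k c' a' j))) * (cst (m0 (cU (RP R $ (i, a') $ (j, d)))) * (m0 (lam d b e) * m0 y)))"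
    by (rule sum_rot)
  also have "\<dots> = (\<Sum>d\<in>UNIV. cst (m0 (cU (\<Sum>a'\<in>UNIV. \<Sum>j\<in>UNIV. Q k c' a' j * RP R $ (i, a') $ (j, d)))) * (m0 (lam d b e) * m0 y))"
    by (simp add: rhom_sum[OF rhom_comp[OF rhom_cst rhom_comp[OF rhom_fps_nth_0 rhom_cU]]] rhom_mult[OF rhom_comp[OF rhom_cst rhom_comp[OF rhom_fps_nth_0 rhom_cU]]]
        sum_distrib_right mult.assoc del: nth_fps_map)
  also have "\<dots> = (\<Sum>d\<in>UNIV. if c' = d then (if i = k then m0 (lam c' b e) * m0 y else 0) else 0)"
    unfolding Q_left by (intro sum.cong refl) (auto simp: rhom_one[OF rhom_cst] rhom_zero[OF rhom_cst])
  also have "\<dots> = (if i = k then m0 (lam c' b e * y) else 0)" by simp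
  finally show ?thesis .
qed

lemma LE_mod_h: "m0 (LE i k x) = (if i = k then m0 x else 0)"
proof -
  define G where "G = {x. \<forall>i k. m0 (LE i k x) = (if i = k then m0 x else 0)}"
  have w: "wrd (Word w) \<in> G" for w
  proof (induction w)
    case Nil
    have "wrd (Word []) = (1 :: (complex fls, 'n) fa fps)" by (simp add: wrd_zero flip: zero_free_monoid_def)
    then show ?case by (simp add: G_def LE_one)
  next
    case (Cons l w)
    obtain d b f where l: "l = (d, b, f)" by (cases l)
    have eq: "(wrd (Word (l # w)) :: (complex fls, 'n) fa fps) = (if d = b \<and> f = 0 then wrd (Word w) else 0) - lam d b f * wrd (Word w)"
      by (simp add: lam_wrd l)
    have "m0 (LE i k (wrd (Word w))) = (if i = k then m0 (wrd (Word w)) else 0)" for i k using Cons unfolding G_def by blast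
    from this LE_lam_mod_h[OF this] show ?case
      unfolding G_def eq by (simp add: lin_diff[OF lin_LE] lin_zero[OF lin_LE])
  qed
  have "x \<in> G"
  proof (rule span_closed)
    show "0 \<in> G" by (simp add: G_def lin_zero[OF lin_LE])
    show "x + y \<in> G" if "x \<in> G" "y \<in> G" for x y using that unfolding G_def by (simp add: lin_add[OF lin_LE])
    show "scE s * x \<in> G" if "x \<in> G" for s x using that unfolding G_def by (simp add: lin_scE[OF lin_LE])
    show "wrd w \<in> G" for w using w by (cases w) simp
    fix x assume *: "\<And>m. \<exists>y\<in>G. \<forall>l<m. fps_nth y l = fps_nth x l"
    obtain y where y: "y \<in> G" "\<forall>l<1. fps_nth y l = fps_nth x l" using *[of 1] by blast
    have "m0 (LE i k x) = m0 (LE i k y)" for i k using lin_approx[OF lin_LE y(2)] by simp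
    then show "x \<in> G" using y unfolding G_def by simp
  qed
  then show ?thesis unfolding G_def by blast
qed

subsection \<open>The operator relations\<close>

lemma Lgood_base:
  assumes \<phi>: "rhom \<phi>" and \<phi>c: "\<And>z. \<phi> (fls_const z) = fls_const (fls_const z)" and L: "U.Lgood L zp zm A B"
  shows "W.Lgood (Lbase \<phi> L) (fps_map \<phi> zp) (fps_map \<phi> zm) (map_matrix (fps_map (fps_map \<phi>)) A) (map_matrix (fps_map (fps_map \<phi>)) B)"
proof -
  let ?F = "fps_map (fps_map \<phi>)"
  have F1: "rhom (fps_map \<phi>)" by (rule rhom_fps_map[OF \<phi>])
  have F: "rhom ?F" by (rule rhom_fps_map[OF F1])
  have lin: "lin (L i k)" for i k using L by (auto simp: U.Lgood_def)
  have cm: "fps_map \<phi> (cU s) = cW s" for s by (simp add: fps_map_comp \<phi>c)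
  have Z: "?F Zu = Zw" by (simp add: exp_v_def fps_map_comp fps_map_const rhom_zero[OF \<phi>] \<phi>c)
  have Dm: "map_matrix ?F (map_matrix ((*) \<sigma>) (U.Dm (fps_const z) Zu)) = map_matrix ((*) (?F \<sigma>)) (W.Dm (fps_const (fps_map \<phi> z)) Zw)" for \<sigma> z
    by (simp add: vec_eq_iff U.Dm_def W.Dm_def rhom_mult[OF F] rhom_diff[OF F] Z fps_map_const rhom_zero[OF F1] cm del: fps_const_mult)
  obtain \<sigma> where \<sigma>: "map_matrix ((*) \<sigma>) (U.Dm (fps_const zp) Zu) ** A = mat 1" "A ** map_matrix ((*) \<sigma>) (U.Dm (fps_const zp) Zu) = mat 1"
    using L unfolding U.Lgood_def by blast
  obtain \<sigma>' where \<sigma>': "B = flip (map_matrix ((*) \<sigma>') (U.Dm (fps_const zm) Zu))" using L unfolding U.Lgood_def by blast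
  have Sc: "map_matrix (fps_map \<phi>) U.Sc = W.Sc" by (simp add: U.Sc_def W.Sc_def map_matrix_comp cm)
  have one: "Lbase \<phi> L i j 1 = (if i = j then 1 else 0)" for i j
  proof -
    have "Lbase \<phi> L i j (wrd 0) = emap \<phi> (L i j (wrd 0))" by (simp add: Lbase_def lext_wrd)
    then show ?thesis
      using L by (simp add: wrd_zero U.Lgood_def rhom_one[OF rhom_emap[OF \<phi>]] rhom_zero[OF rhom_emap[OF \<phi>]])
  qed
  have "Lrel W.Sc (map_matrix ?F A) (map_matrix ?F B) (Lbase \<phi> L) y" for y
    unfolding Sc[symmetric] by (rule Lrel_Lbase[OF \<phi> lin]) (use L in \<open>auto simp: U.Lgood_def\<close>)
  moreover have "map_matrix ((*) (?F \<sigma>)) (W.Dm (fps_const (fps_map \<phi> zp)) Zw) ** map_matrix ?F A = mat 1"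
    "map_matrix ?F A ** map_matrix ((*) (?F \<sigma>)) (W.Dm (fps_const (fps_map \<phi> zp)) Zw) = mat 1"
    unfolding Dm[symmetric] map_matrix_mult[OF F, symmetric] \<sigma> map_matrix_one[OF F] by (rule refl)+
  moreover have "map_matrix ?F B = flip (map_matrix ((*) (?F \<sigma>')) (W.Dm (fps_const (fps_map \<phi> zm)) Zw))"
    unfolding Dm[symmetric] \<sigma>' map_matrix_flip ..
  ultimately show ?thesis unfolding W.Lgood_def
    by (intro conjI allI lin_Lbase one exI[of _ "?F \<sigma>"] exI[of _ "?F \<sigma>'"])
qed

abbreviation fv :: "complex fls \<Rightarrow> complex fls fls" where "fv \<equiv> fls_map fls_const"
abbreviation Lu where "Lu \<equiv> Lbase fls_const LE"
abbreviation Lv where "Lv \<equiv> Lbase fv LE"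
abbreviation zu where "zu \<equiv> fps_map fls_const Eu"
abbreviation zv where "zv \<equiv> fps_map fv Eu"

lemma RLLmat_LE: "W.RLLmat Lu Lv zu zv = 0"
proof -
  \<comment> \<open>The shift by bh multiplies both spectral parameters by this unit; b = c/2 gives
    the factor \<open>\<epsilon>\<close> and b = -c/2 the factor \<open>\<delta>\<close> of
    \<open>RLLmat_zero\<close>.\<close>
  define E where "E b = cW (fps_exp (2 / a * b))" for b
  have fv: "rhom fv" by (rule rhom_fls_map[OF rhom_fls_const])
  have fvc: "fv (fls_const z) = fls_const (fls_const z)" for z by (simp add: fls_eq_iff nth_fls_map)
  have u: "fps_map fls_const (ze b) = E b * zu" for b
    by (simp add: ze_def E_def exp_h_def rhom_mult[OF rhom_fps_map[OF rhom_fls_const]] fps_map_comp mult.commute)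
  have v: "fps_map fv (ze b) = E b * zv" for b
    by (simp add: ze_def E_def exp_h_def rhom_mult[OF rhom_fps_map[OF fv]] fps_map_comp fvc mult.commute)
  have unit: "E b * E (- b) = 1" for b
    by (simp add: E_def rhom_mult[OF rhom_cW, symmetric] fps_exp_add_mult[symmetric] rhom_one[OF rhom_cW])
  show ?thesis
    using W.RLLmat_zero[OF Lgood_base[OF rhom_fls_const _ Lgood_LE, unfolded u] Lgood_base[OF fv fvc Lgood_LE, unfolded v] unit unit] by simp
qed

text \<open>R(u - v) read in C((u))((v))[[h]], where it multiplies values of both operators.\<close>

abbreviation Hm :: "(complex fls fls fps, 'n) mat2" where "Hm \<equiv> map_matrix hv_swap (Rshift 0 Ru)"

lemma Hm_Dk: "Hm = map_matrix ((*) (hv_swap (sg 0))) (W.Dk zu zv)"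
proof -
  have "ze 0 = Eu" by (simp add: ze_def exp_h_def rhom_one[OF rhom_cU])
  moreover have "hv_swap (fps_const (cU s)) = cW s" for s by (simp add: hv_swap_const fps_map_comp)
  moreover have "hv_swap Zu = zv"
  proof -
    have "Zu = fps_map fps_const (fps_map fls_const (fps_exp (2 / a)))" by (simp add: exp_v_def fps_map_comp)
    then have "hv_swap Zu = fps_const (fps_to_fls (fps_map fls_const (fps_exp (2 / a))))" by (simp only: hv_swap_map_const)
    then show ?thesis by (simp add: fps_to_fls_map exp_u_def fps_map_const rhom_zero[OF rhom_fls_map[OF rhom_fls_const]])
  qed
  ultimately show ?thesis
    by (simp add: vec_eq_iff Rshift_nth W.Dk_def rhom_mult[OF rhom_hv_swap] rhom_diff[OF rhom_hv_swap] hv_swap_const[of Eu] del: fps_const_mult)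
qed

lemma RLL_identity:
  "(\<Sum>k1\<in>UNIV. \<Sum>k2\<in>UNIV. \<Sum>l1\<in>UNIV. \<Sum>l2\<in>UNIV. scE (Hm $ (i1, i2) $ (k1, k2) * cW (RP R $ (l1, k2) $ (j1, l2))) * Lu k1 l1 (Lv l2 j2 z)) =
   (\<Sum>k1\<in>UNIV. \<Sum>k2\<in>UNIV. \<Sum>l1\<in>UNIV. \<Sum>l2\<in>UNIV. scE (cW (flip (RP R) $ (i1, l2) $ (l1, k2)) * flip Hm $ (k1, k2) $ (j1, j2)) * Lv i2 l2 (Lu l1 k1 z))"
  (is "?l = ?r")
proof -
  let ?D = "W.Dk zu zv" and ?s = "hv_swap (sg 0)"
  have L: "(\<Sum>k1\<in>UNIV. \<Sum>k2\<in>UNIV. \<Sum>l1\<in>UNIV. \<Sum>l2\<in>UNIV. scE (?D $ (i1, i2) $ (k1, k2)) * (scE (W.Sc $ (l1, k2) $ (j1, l2)) * Lu k1 l1 (Lv l2 j2 z))) =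
     (\<Sum>k1\<in>UNIV. \<Sum>k2\<in>UNIV. \<Sum>l1\<in>UNIV. \<Sum>l2\<in>UNIV. scE (flip W.Sc $ (i1, l2) $ (l1, k2)) * (scE (flip ?D $ (k1, k2) $ (j1, j2)) * Lv i2 l2 (Lu l1 k1 z)))"
  proof -
    have "ap (W.RLLmat Lu Lv zu zv $ (i1, i2) $ (j1, j2)) z = 0" by (simp add: RLLmat_LE)
    then show ?thesis
      unfolding W.RLLmat_def vector_minus_component rll_entry_left rll_entry_right
      by (simp add: ap_sum ap_Endo_lin lin_Lbase lin_scE[OF lin_Lbase])
  qed
  have fH: "flip Hm = map_matrix ((*) ?s) (flip ?D)" unfolding Hm_Dk by (simp add: map_matrix_flip)
  have fS: "flip W.Sc $ x $ y = cW (flip (RP R) $ x $ y)" for x y by (simp add: W.Sc_def nth_flip)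
  have "?l = scE ?s * (\<Sum>k1\<in>UNIV. \<Sum>k2\<in>UNIV. \<Sum>l1\<in>UNIV. \<Sum>l2\<in>UNIV. scE (?D $ (i1, i2) $ (k1, k2)) * (scE (W.Sc $ (l1, k2) $ (j1, l2)) * Lu k1 l1 (Lv l2 j2 z)))"
    unfolding Hm_Dk by (simp add: sum_distrib_left rhom_mult[OF rhom_scE] mult.assoc W.Sc_def)
  also have "\<dots> = ?r"
    unfolding L fH sum_distrib_left
  proof (intro sum.cong refl)
    fix k1 k2 l1 l2
    have "cW (flip (RP R) $ (i1, l2) $ (l1, k2)) * map_matrix ((*) ?s) (flip ?D) $ (k1, k2) $ (j1, j2) = ?s * (flip W.Sc $ (i1, l2) $ (l1, k2) * flip ?D $ (k1, k2) $ (j1, j2))"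
      unfolding fS by (simp add: mult.left_commute)
    then show "scE ?s * (scE (flip W.Sc $ (i1, l2) $ (l1, k2)) * (scE (flip ?D $ (k1, k2) $ (j1, j2)) * Lv i2 l2 (Lu l1 k1 z))) =
       scE (cW (flip (RP R) $ (i1, l2) $ (l1, k2)) * map_matrix ((*) ?s) (flip ?D) $ (k1, k2) $ (j1, j2)) * Lv i2 l2 (Lu l1 k1 z)"
      by (simp only: rhom_mult[OF rhom_scE] mult.assoc)
  qed
  finally show ?thesis .
qed

text \<open>The operator applied first contributes its own coefficient, which is then constant for
  the second operator. This matches the nested composition in \<open>rll_relation\<close>.\<close>

lemma coeff_Lu_Lv: "ucf r (ucf s (Lu k l (Lv m j (cemb (cemb x))))) = ucf r (LE k l (cemb (ucf s (LE m j (cemb x)))))"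
proof -
  have "ucf s (Lv m j (cemb (cemb x))) = cemb (ucf s (LE m j (cemb x)))"
  proof (rule ucf_eqI)
    fix p
    have "ucf p (ucf s (Lv m j (cemb (cemb x)))) = ucf s (LE m j (cemb (ucf p (cemb x))))"
      by (simp only: ucf_ucf Lbase_v[OF lin_LE] emap_icf_cemb)
    then show "ucf p (ucf s (Lv m j (cemb (cemb x)))) = ucf p (cemb (ucf s (LE m j (cemb x))))"
      by (simp add: ucf_cemb rhom_zero[OF rhom_cemb] lin_zero[OF lin_LE] additive.zero[OF additive_ucf])
  qed
  then show ?thesis by (simp only: Lbase_u[OF lin_LE])
qed

lemma coeff_Lv_Lu: "ucf r (ucf s (Lv i l (Lu m k (cemb (cemb x))))) = ucf s (LE i l (cemb (ucf r (LE m k (cemb x)))))"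
proof -
  have "Lu m k (cemb (cemb x)) = cemb (LE m k (cemb x))"
    by (rule ucf_eqI) (simp add: Lbase_u[OF lin_LE] ucf_cemb lin_zero[OF lin_LE])
  then show ?thesis by (simp only: ucf_ucf Lbase_v[OF lin_LE] emap_icf_cemb)
qed

lemma ucoeff_Hm:
  "ucoeff p (ucoeff q (hv_swap F * cW g)) = (if q \<ge> 0 then ucoeff p (fps_nth F (nat q)) * g else 0)"
  "ucoeff p (ucoeff q (cW g * hv_swap F)) = (if q \<ge> 0 then g * ucoeff p (fps_nth F (nat q)) else 0)"
  for F :: "complex fls fps fps"
proof -
  have cW: "cW g = fps_map fls_const (cU g)" by (simp add: fps_map_comp)
  show "ucoeff p (ucoeff q (hv_swap F * cW g)) = (if q \<ge> 0 then ucoeff p (fps_nth F (nat q)) * g else 0)"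
    "ucoeff p (ucoeff q (cW g * hv_swap F)) = (if q \<ge> 0 then g * ucoeff p (fps_nth F (nat q)) else 0)"
    unfolding cW ucoeff_mult_const ucoeff_hv_swap by (simp_all add: additive.zero[OF additive_ucoeff] ucoeff_mult_const)
qed

lemma rll_fsums_LL:
  "\<exists>t. fsums (\<lambda>(k1, k2, l1, l2, p, q).
         scE (ucoeff p (fps_nth (Rshift 0 Ru $ (i1, i2) $ (k1, k2)) q) * RP R $ (l1, k2) $ (j1, l2))
           * ucf (r - p) (LE k1 l1 (cemb (ucf (s - int q) (LE l2 j2 (cemb x)))))) t \<and>
       fsums (\<lambda>(k1, k2, l1, l2, p, q).
         scE (flip (RP R) $ (i1, l2) $ (l1, k2) * ucoeff p (fps_nth (flip (Rshift 0 Ru) $ (k1, k2) $ (j1, j2)) q))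
           * ucf (s - int q) (LE i2 l2 (cemb (ucf (r - p) (LE l1 k1 (cemb x)))))) t"
proof -
  let ?z = "cemb (cemb x)"
  have additive: "Modules.additive (\<lambda>z. ucf r (ucf s z))" by (intro additive_comp[OF additive_ucf additive_ucf])
  have fH: "flip Hm = map_matrix hv_swap (flip (Rshift 0 Ru))" by (simp add: map_matrix_flip)
  have "fsums (\<lambda>(p, q). scE (ucoeff p (fps_nth (Rshift 0 Ru $ (i1, i2) $ (k1, k2)) q) * RP R $ (l1, k2) $ (j1, l2))
           * ucf (r - p) (LE k1 l1 (cemb (ucf (s - int q) (LE l2 j2 (cemb x))))))
      (ucf r (ucf s (scE (Hm $ (i1, i2) $ (k1, k2) * cW (RP R $ (l1, k2) $ (j1, l2))) * Lu k1 l1 (Lv l2 j2 ?z))))" for k1 k2 l1 l2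
    using fsums_nat[OF fsums_scE_mult2[of "Hm $ (i1, i2) $ (k1, k2) * cW (RP R $ (l1, k2) $ (j1, l2))" r s "Lu k1 l1 (Lv l2 j2 ?z)"]]
    unfolding coeff_Lu_Lv by (simp add: ucoeff_Hm rhom_zero[OF rhom_scE])
  note h = this
  have 1: "fsums (\<lambda>(k1, k2, l1, l2, p, q).
         scE (ucoeff p (fps_nth (Rshift 0 Ru $ (i1, i2) $ (k1, k2)) q) * RP R $ (l1, k2) $ (j1, l2))
           * ucf (r - p) (LE k1 l1 (cemb (ucf (s - int q) (LE l2 j2 (cemb x))))))
      (ucf r (ucf s (\<Sum>k1\<in>UNIV. \<Sum>k2\<in>UNIV. \<Sum>l1\<in>UNIV. \<Sum>l2\<in>UNIV. scE (Hm $ (i1, i2) $ (k1, k2) * cW (RP R $ (l1, k2) $ (j1, l2))) * Lu k1 l1 (Lv l2 j2 ?z))))"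
    unfolding additive.sum[OF additive] by (rule fsums_finite_index6) (rule h)
  have "fsums (\<lambda>(p, q). scE (flip (RP R) $ (i1, l2) $ (l1, k2) * ucoeff p (fps_nth (flip (Rshift 0 Ru) $ (k1, k2) $ (j1, j2)) q))
           * ucf (s - int q) (LE i2 l2 (cemb (ucf (r - p) (LE l1 k1 (cemb x))))))
      (ucf r (ucf s (scE (cW (flip (RP R) $ (i1, l2) $ (l1, k2)) * flip Hm $ (k1, k2) $ (j1, j2)) * Lv i2 l2 (Lu l1 k1 ?z))))" for k1 k2 l1 l2
    using fsums_nat[OF fsums_scE_mult2[of "cW (flip (RP R) $ (i1, l2) $ (l1, k2)) * flip Hm $ (k1, k2) $ (j1, j2)" r s "Lv i2 l2 (Lu l1 k1 ?z)"]]
    unfolding coeff_Lv_Lu fH by (simp add: ucoeff_Hm rhom_zero[OF rhom_scE])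
  note h = this
  have 2: "fsums (\<lambda>(k1, k2, l1, l2, p, q).
         scE (flip (RP R) $ (i1, l2) $ (l1, k2) * ucoeff p (fps_nth (flip (Rshift 0 Ru) $ (k1, k2) $ (j1, j2)) q))
           * ucf (s - int q) (LE i2 l2 (cemb (ucf (r - p) (LE l1 k1 (cemb x))))))
      (ucf r (ucf s (\<Sum>k1\<in>UNIV. \<Sum>k2\<in>UNIV. \<Sum>l1\<in>UNIV. \<Sum>l2\<in>UNIV. scE (cW (flip (RP R) $ (i1, l2) $ (l1, k2)) * flip Hm $ (k1, k2) $ (j1, j2)) * Lv i2 l2 (Lu l1 k1 ?z))))"
    unfolding additive.sum[OF additive] by (rule fsums_finite_index6) (rule h)
  from 1 2 show ?thesis unfolding RLL_identity by blast
qed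

definition Bop :: "'n \<Rightarrow> 'n \<Rightarrow> 'n free_alg fps \<Rightarrow> int \<Rightarrow> 'n free_alg fps" where
  "Bop i j x s = (if s \<ge> 0 then lam i j (nat s) * x else 0)"

text \<open>The recursion \<open>Lrel\<close> multiplied on the left by R(u - v + hc/2), which
  removes its inverse from \<open>Wmat\<close>, and compared in degree n of v.\<close>

lemma Lplus_identity:
  "(\<Sum>k1\<in>UNIV. \<Sum>k2\<in>UNIV. \<Sum>l1\<in>UNIV. \<Sum>l2\<in>UNIV. \<Sum>q\<le>n. scE (fps_nth (Rshift (c / 2) Ru $ (i1, i2) $ (k1, k2)) q * cU (RP R $ (l1, k2) $ (j1, l2))) * LE k1 l1 (lam l2 j2 (n - q) * y)) =
   (\<Sum>k1\<in>UNIV. \<Sum>k2\<in>UNIV. \<Sum>l1\<in>UNIV. \<Sum>l2\<in>UNIV. \<Sum>q\<le>n. scE (cU (flip (RP R) $ (i1, l2) $ (l1, k2)) * fps_nth (RM $ (k1, k2) $ (j1, j2)) q) * (lam i2 l2 (n - q) * LE l1 k1 y))"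
proof -
  let ?X = "(\<chi> i k. LE i k y)"
  let ?N = "Wmat U.Sc RI RM ?X"
  let ?R = "map_matrix vsc (Rshift (c / 2) Ru)" and ?C = "map_matrix vsc (map_matrix fps_const (flip U.Sc))"
  have "?R ** map_matrix vsc RI = (mat 1 :: ((complex fls, 'n) fa fps fps, 'n) mat2)"
    unfolding map_matrix_mult[OF rhom_vsc, symmetric] Rshift_inverse map_matrix_one[OF rhom_vsc] ..
  then have "?R ** ?N = t2 LPm ** ?C ** t1 (map_matrix fps_const ?X) ** map_matrix vsc RM"
    unfolding Wmat_def matrix_mul_assoc by simp
  then have eq: "fps_nth ((?R ** ?N) $ (i1, i2) $ (j1, j2)) n = fps_nth ((t2 LPm ** ?C ** t1 (map_matrix fps_const ?X) ** map_matrix vsc RM) $ (i1, i2) $ (j1, j2)) n"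
    by simp
  have N: "fps_nth (?N $ (k1, k2) $ (j1, j2)) e = (\<Sum>l1\<in>UNIV. \<Sum>l2\<in>UNIV. scE (cU (RP R $ (l1, k2) $ (j1, l2))) * LE k1 l1 (lam l2 j2 e * y))" for k1 k2 e
    using Lrel_LE[of y] unfolding Lrel_def by (simp add: U.Sc_def)
  have "fps_nth ((?R ** ?N) $ (i1, i2) $ (j1, j2)) n =
     (\<Sum>k1\<in>UNIV. \<Sum>k2\<in>UNIV. \<Sum>q\<le>n. \<Sum>l1\<in>UNIV. \<Sum>l2\<in>UNIV. scE (fps_nth (Rshift (c / 2) Ru $ (i1, i2) $ (k1, k2)) q * cU (RP R $ (l1, k2) $ (j1, l2))) * LE k1 l1 (lam l2 j2 (n - q) * y))"
    unfolding nth_matrix_mult sum_pairs fps_sum_nth fps_mult_nth N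
    by (simp add: vsc_def sum_distrib_left rhom_mult[OF rhom_scE] mult.assoc atLeast0AtMost)
  also have "\<dots> = (\<Sum>k1\<in>UNIV. \<Sum>k2\<in>UNIV. \<Sum>l1\<in>UNIV. \<Sum>l2\<in>UNIV. \<Sum>q\<le>n. scE (fps_nth (Rshift (c / 2) Ru $ (i1, i2) $ (k1, k2)) q * cU (RP R $ (l1, k2) $ (j1, l2))) * LE k1 l1 (lam l2 j2 (n - q) * y))"
    by (rule sum.cong[OF refl], rule sum.cong[OF refl], rule sum_rot[symmetric])
  finally have l: "fps_nth ((?R ** ?N) $ (i1, i2) $ (j1, j2)) n = \<dots>" .
  have vsc_const: "vsc (fps_const u) = (fps_const (scE u) :: (complex fls, 'n) fa fps fps)" for u
    by (simp add: vsc_def fps_map_const rhom_zero[OF rhom_scE])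
  have t: "fps_nth (LPm $ i2 $ l2 * fps_const (scE u) * fps_const w * vsc f) n = (\<Sum>q\<le>n. scE (u * fps_nth f q) * (lam i2 l2 (n - q) * w))"
    for l2 u w and f :: "complex fls fps fps"
  proof -
    have "LPm $ i2 $ l2 * fps_const (scE u) * fps_const w * vsc f = fps_const (scE u) * (vsc f * (LPm $ i2 $ l2 * fps_const w))"
    proof -
      have 1: "LPm $ i2 $ l2 * fps_const (scE u) = fps_const (scE u) * LPm $ i2 $ l2"
        by (rule fps_const_scE_central[symmetric])
      have "vsc f * x = x * vsc f" for x :: "(complex fls, 'n) fa fps fps"
        by (rule fps_central) (simp add: vsc_def scE_central)
      then show ?thesis unfolding 1 unfolding mult.assoc by (simp only: mult.assoc)
    qed
    then have "fps_nth (LPm $ i2 $ l2 * fps_const (scE u) * fps_const w * vsc f) n =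
        scE u * (\<Sum>q=0..n. fps_nth (vsc f) q * fps_nth (LPm $ i2 $ l2 * fps_const w) (n - q))"
      by (simp only: fps_mult_left_const_nth fps_mult_nth[of "vsc f"])
    then show ?thesis
      by (simp add: vsc_def LPm_def atLeast0AtMost sum_distrib_left rhom_mult[OF rhom_scE] mult.assoc)
  qed
  have "fps_nth ((t2 LPm ** ?C ** t1 (map_matrix fps_const ?X) ** map_matrix vsc RM) $ (i1, i2) $ (j1, j2)) n =
     (\<Sum>k1\<in>UNIV. \<Sum>k2\<in>UNIV. \<Sum>l1\<in>UNIV. \<Sum>l2\<in>UNIV. \<Sum>q\<le>n. scE (cU (flip (RP R) $ (i1, l2) $ (l1, k2)) * fps_nth (RM $ (k1, k2) $ (j1, j2)) q) * (lam i2 l2 (n - q) * LE l1 k1 y))"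
    unfolding rll_entry_right fps_sum_nth
    by (simp add: t vsc_const U.Sc_def nth_flip del: fps_const_mult)
  then show ?thesis using eq l by simp
qed

lemma rll_fsums_Lplus:
  "\<exists>t. fsums (\<lambda>(k1, k2, l1, l2, p, q).
         scE (ucoeff p (fps_nth (Rshift (c / 2) Ru $ (i1, i2) $ (k1, k2)) q) * RP R $ (l1, k2) $ (j1, l2))
           * ucf (r - p) (LE k1 l1 (cemb (Bop l2 j2 x (s - int q))))) t \<and>
       fsums (\<lambda>(k1, k2, l1, l2, p, q).
         scE (flip (RP R) $ (i1, l2) $ (l1, k2) * ucoeff p (fps_nth (RM $ (k1, k2) $ (j1, j2)) q))
           * Bop i2 l2 (ucf (r - p) (LE l1 k1 (cemb x))) (s - int q)) t"
proof (cases "s \<ge> 0")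
  case False
  then have "Bop i j y (s - int q) = 0" for i j y q by (simp add: Bop_def)
  moreover have "(\<lambda>(k1 :: 'n, k2 :: 'n, l1 :: 'n, l2 :: 'n, p :: int, q :: nat). 0 :: 'n free_alg fps) = (\<lambda>_. 0)" by auto
  ultimately show ?thesis
    using fsums_zero by (intro exI[of _ 0]) (simp add: rhom_zero[OF rhom_cemb] lin_zero[OF lin_LE] additive.zero[OF additive_ucf])
next
  case True
  then obtain n where n: "s = int n" by (metis nonneg_int_cases)
  have B: "Bop i j y (s - int q) = (if q \<le> n then lam i j (n - q) * y else 0)" for i j y q
    by (auto simp: Bop_def n nat_diff_distrib)
  have lam: "(lam i j e :: (complex fls, 'n) fa fps) = cemb (lam i j e)" for i j e
    by (simp only: emap_lam[OF rhom_fls_const, unfolded emap_def])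
  have "fsums (\<lambda>(p, q). scE (ucoeff p (fps_nth (Rshift (c / 2) Ru $ (i1, i2) $ (k1, k2)) q) * RP R $ (l1, k2) $ (j1, l2))
           * ucf (r - p) (LE k1 l1 (cemb (Bop l2 j2 x (s - int q)))))
     (\<Sum>q\<le>n. ucf r (scE (fps_nth (Rshift (c / 2) Ru $ (i1, i2) $ (k1, k2)) q * cU (RP R $ (l1, k2) $ (j1, l2))) * LE k1 l1 (lam l2 j2 (n - q) * cemb x)))" for k1 k2 l1 l2
  proof (rule fsums_nested)
    fix q assume q: "q \<in> {..n}"
    have "LE k1 l1 (lam l2 j2 (n - q) * cemb x) = LE k1 l1 (cemb (Bop l2 j2 x (s - int q)))"
      using q unfolding B lam by (simp add: rhom_mult[OF rhom_cemb])
    then show "fsums (\<lambda>p. scE (ucoeff p (fps_nth (Rshift (c / 2) Ru $ (i1, i2) $ (k1, k2)) q) * RP R $ (l1, k2) $ (j1, l2))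
           * ucf (r - p) (LE k1 l1 (cemb (Bop l2 j2 x (s - int q)))))
       (ucf r (scE (fps_nth (Rshift (c / 2) Ru $ (i1, i2) $ (k1, k2)) q * cU (RP R $ (l1, k2) $ (j1, l2))) * LE k1 l1 (lam l2 j2 (n - q) * cemb x)))"
      unfolding ucoeff_mult_const[symmetric] by (simp only: fsums_scE_mult)
  qed (auto simp: B rhom_zero[OF rhom_cemb] lin_zero[OF lin_LE] additive.zero[OF additive_ucf])
  note h = this
  have 1: "fsums (\<lambda>(k1, k2, l1, l2, p, q).
         scE (ucoeff p (fps_nth (Rshift (c / 2) Ru $ (i1, i2) $ (k1, k2)) q) * RP R $ (l1, k2) $ (j1, l2))
           * ucf (r - p) (LE k1 l1 (cemb (Bop l2 j2 x (s - int q)))))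
     (ucf r (\<Sum>k1\<in>UNIV. \<Sum>k2\<in>UNIV. \<Sum>l1\<in>UNIV. \<Sum>l2\<in>UNIV. \<Sum>q\<le>n. scE (fps_nth (Rshift (c / 2) Ru $ (i1, i2) $ (k1, k2)) q * cU (RP R $ (l1, k2) $ (j1, l2))) * LE k1 l1 (lam l2 j2 (n - q) * cemb x)))"
    unfolding additive.sum[OF additive_ucf] by (rule fsums_finite_index6) (rule h)
  have "fsums (\<lambda>(p, q). scE (flip (RP R) $ (i1, l2) $ (l1, k2) * ucoeff p (fps_nth (RM $ (k1, k2) $ (j1, j2)) q))
           * Bop i2 l2 (ucf (r - p) (LE l1 k1 (cemb x))) (s - int q))
     (\<Sum>q\<le>n. ucf r (scE (cU (flip (RP R) $ (i1, l2) $ (l1, k2)) * fps_nth (RM $ (k1, k2) $ (j1, j2)) q) * (lam i2 l2 (n - q) * LE l1 k1 (cemb x))))" for k1 k2 l1 l2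
  proof (rule fsums_nested)
    fix q assume q: "q \<in> {..n}"
    have "ucf p (lam i2 l2 (n - q) * LE l1 k1 (cemb x)) = Bop i2 l2 (ucf p (LE l1 k1 (cemb x))) (s - int q)" for p
      using q unfolding B lam ucf_cemb_mult by simp
    then have "Bop i2 l2 (ucf p (LE l1 k1 (cemb x))) (s - int q) = ucf p (lam i2 l2 (n - q) * LE l1 k1 (cemb x))" for p by simp
    then show "fsums (\<lambda>p. scE (flip (RP R) $ (i1, l2) $ (l1, k2) * ucoeff p (fps_nth (RM $ (k1, k2) $ (j1, j2)) q))
           * Bop i2 l2 (ucf (r - p) (LE l1 k1 (cemb x))) (s - int q))
      (ucf r (scE (cU (flip (RP R) $ (i1, l2) $ (l1, k2)) * fps_nth (RM $ (k1, k2) $ (j1, j2)) q) * (lam i2 l2 (n - q) * LE l1 k1 (cemb x))))"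
      unfolding ucoeff_mult_const[symmetric] by (simp only: fsums_scE_mult)
  qed (auto simp: B)
  note h = this
  have 2: "fsums (\<lambda>(k1, k2, l1, l2, p, q).
         scE (flip (RP R) $ (i1, l2) $ (l1, k2) * ucoeff p (fps_nth (RM $ (k1, k2) $ (j1, j2)) q))
           * Bop i2 l2 (ucf (r - p) (LE l1 k1 (cemb x))) (s - int q))
     (ucf r (\<Sum>k1\<in>UNIV. \<Sum>k2\<in>UNIV. \<Sum>l1\<in>UNIV. \<Sum>l2\<in>UNIV. \<Sum>q\<le>n. scE (cU (flip (RP R) $ (i1, l2) $ (l1, k2)) * fps_nth (RM $ (k1, k2) $ (j1, j2)) q) * (lam i2 l2 (n - q) * LE l1 k1 (cemb x))))"
    unfolding additive.sum[OF additive_ucf] by (rule fsums_finite_index6) (rule h)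
  from 1 2 show ?thesis unfolding Lplus_identity by blast
qed

end

lemma fps_X_power_dvd: "(\<forall>l<m. fps_nth d l = 0) \<Longrightarrow> d = fps_X ^ m * fps_shift m d" for d :: "'a::ring_1 fps"
  by (auto simp: fps_eq_iff fps_X_power_mult_nth)

text \<open>Each order of h has its own lower bound for the exponents of u; this is the condition
  that defines V((u))_h.\<close>

lemma ucf_tail:
  fixes z :: "('g::monoid_add \<Rightarrow>\<^sub>0 'k::comm_ring_1 fls) fps"
  shows "\<exists>B. \<forall>r<B. \<forall>l<m. fps_nth (ucf r z) l = 0"
proof (induction m)
  case (Suc m)
  obtain B where B: "\<forall>r<B. \<forall>l<m. fps_nth (ucf r z) l = 0" using Suc by blast
  obtain B' where B': "\<forall>r<B'. fls_nth (iota (fps_nth z m)) r = 0" using fls_nth_bounded by blast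
  show ?case
    by (rule exI[of _ "min B B'"]) (use B B' in \<open>auto simp: nth_iota less_Suc_eq\<close>)
qed simp

subsection \<open>The quotient algebra\<close>

context Ydata
begin

abbreviation V where "V \<equiv> Yplus R Ru"
abbreviation cl where "cl \<equiv> ycls R Ru"
abbreviation A :: "'n free_alg fps ring" where "A \<equiv> ring_of_type_algebra"

lemma A_simps: "carrier A = UNIV" "x \<oplus>\<^bsub>A\<^esub> y = x + y" "x \<otimes>\<^bsub>A\<^esub> y = x * y" "\<one>\<^bsub>A\<^esub> = 1" "\<zero>\<^bsub>A\<^esub> = 0"
  by (simp_all add: ring_of_type_algebra_def)

lemma ideal_J: "ideal J A" using hideal_J by (simp add: hideal_iff)

lemma cl_alt: "cl x = {j + x | j. j \<in> J}"
  by (auto simp: ycls_def a_r_coset_def' A_simps)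

lemma cl_eq: "cl x = cl y \<longleftrightarrow> x - y \<in> J"
proof
  assume *: "cl x = cl y"
  have "x \<in> cl x" unfolding cl_alt using hideal_zero[OF hideal_J] by (intro CollectI exI[of _ 0]) simp
  then have "x \<in> cl y" using * by simp
  then obtain j where "x = j + y" "j \<in> J" unfolding cl_alt by blast
  then show "x - y \<in> J" by simp
next
  assume d: "x - y \<in> J"
  show "cl x = cl y" unfolding cl_alt
  proof (intro equalityI subsetI; clarify)
    fix j assume j: "j \<in> J"
    show "\<exists>j'. j + x = j' + y \<and> j' \<in> J"
      using hideal_add[OF hideal_J j d] by (intro exI[of _ "j + (x - y)"]) (simp add: algebra_simps)
    show "\<exists>j'. j + y = j' + x \<and> j' \<in> J"
      using hideal_diff[OF hideal_J j d] by (intro exI[of _ "j - (x - y)"]) (simp add: algebra_simps)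
  qed
qed

lemma V_carrier: "carrier V = range cl"
  by (auto simp: Yplus_def FactRing_def A_RCOSETS_def' A_simps ycls_def)

lemma V_zero: "\<zero>\<^bsub>V\<^esub> = cl 0"
  by (auto simp: Yplus_def FactRing_def cl_alt)

lemma V_one: "\<one>\<^bsub>V\<^esub> = cl 1"
  by (simp add: Yplus_def FactRing_def ycls_def A_simps)

lemma V_add: "cl x \<oplus>\<^bsub>V\<^esub> cl y = cl (x + y)"
  using ideal.a_rcos_sum[OF ideal_J, of x y] by (simp add: Yplus_def FactRing_def ycls_def A_simps)

lemma V_mult: "cl x \<otimes>\<^bsub>V\<^esub> cl y = cl (x * y)"
  using ideal.rcoset_mult_add[OF ideal_J, of x y] by (simp add: Yplus_def FactRing_def ycls_def A_simps)

lemma V_smult: "s \<odot>\<^bsub>V\<^esub> cl x = cl (scE s * x)"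
proof -
  have "s \<odot>\<^bsub>V\<^esub> cl x = cl (scal s) \<otimes>\<^bsub>V\<^esub> cl x" by (simp add: Yplus_def Let_def)
  then show ?thesis by (simp add: V_mult scal_scE)
qed

lemma V_abelian: "abelian_group V"
proof (rule abelian_groupI)
  fix x assume "x \<in> carrier V"
  then obtain a' where "x = cl a'" by (auto simp: V_carrier)
  then show "\<exists>y\<in>carrier V. y \<oplus>\<^bsub>V\<^esub> x = \<zero>\<^bsub>V\<^esub>"
    by (intro bexI[of _ "cl (- a')"]) (simp_all add: V_add V_zero V_carrier)
qed (auto simp: V_carrier V_zero V_add algebra_simps)

lemma V_sum: "(\<Oplus>\<^bsub>V\<^esub>i\<in>F. cl (f i)) = cl (sum f F)" if "finite F"
proof -
  interpret abelian_group V by (rule V_abelian)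
  show ?thesis using that
  proof (induction F rule: finite_induct)
    case empty
    show ?case by (simp add: V_zero)
  next
    case (insert x F)
    have "(\<lambda>i. cl (f i)) \<in> F \<rightarrow> carrier V" "cl (f x) \<in> carrier V" by (auto simp: V_carrier)
    then show ?case using insert by (simp add: finsum_insert V_add)
  qed
qed

lemma V_minus: "cl x \<ominus>\<^bsub>V\<^esub> cl y = cl (x - y)"
proof -
  interpret abelian_group V by (rule V_abelian)
  have "\<ominus>\<^bsub>V\<^esub> cl y = cl (- y)"
    by (rule minus_equality) (auto simp: V_carrier V_add V_zero)
  then show ?thesis by (simp add: a_minus_def V_add)
qed

lemma cl_hsub: "(\<forall>l<m. fps_nth d l = 0) \<Longrightarrow> cl d \<in> hsub V m"
  unfolding hsub_def V_carrier
  by (rule image_eqI[of _ _ "cl (fps_shift m d)"]) (simp_all add: V_smult scE_X_power fps_X_power_dvd[symmetric])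

text \<open>The finite set demanded by h-adic convergence is the union of the supports of all orders
  below m.\<close>

lemma has_hsum_fsums:
  assumes f: "fsums f t"
  shows "has_hsum V (\<lambda>i. cl (f i)) UNIV (cl t)"
  unfolding has_hsum_def
proof (intro conjI ballI allI)
  fix m
  have "\<exists>S. finite S \<and> (\<forall>S'. finite S' \<longrightarrow> S \<subseteq> S' \<longrightarrow> (\<Sum>i\<in>S'. fps_nth (f i) l) = fps_nth t l)" for l
    using f unfolding fsums_def by (metis fin_sum_superset)
  then obtain S where S: "\<And>l. finite (S l)" "\<And>l S'. finite S' \<Longrightarrow> S l \<subseteq> S' \<Longrightarrow> (\<Sum>i\<in>S'. fps_nth (f i) l) = fps_nth t l"
    by metis
  show "\<exists>F0. finite F0 \<and> F0 \<subseteq> UNIV \<and> (\<forall>F. finite F \<and> F0 \<subseteq> F \<and> F \<subseteq> UNIV \<longrightarrow> (\<Oplus>\<^bsub>V\<^esub>i\<in>F. cl (f i)) \<ominus>\<^bsub>V\<^esub> cl t \<in> hsub V m)"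
  proof (intro exI[of _ "\<Union>l<m. S l"] conjI allI impI)
    fix F assume F: "finite F \<and> (\<Union>l<m. S l) \<subseteq> F \<and> F \<subseteq> UNIV"
    then have "\<forall>l<m. fps_nth (sum f F - t) l = 0" using S(2)[of F] by (auto simp: fps_sum_nth)
    then show "(\<Oplus>\<^bsub>V\<^esub>i\<in>F. cl (f i)) \<ominus>\<^bsub>V\<^esub> cl t \<in> hsub V m"
      using F by (simp add: V_sum V_minus cl_hsub)
  qed (use S(1) in auto)
qed (auto simp: V_carrier)

subsection \<open>Operators on the quotient\<close>

text \<open>An arbitrary representative is taken; \<open>opY_cl\<close> shows independence of it for
  \<open>good\<close> operators. Off the carrier the restriction gives \<open>undefined\<close>, as
  the function space in \<open>hom_laurent\<close> requires.\<close>

definition opY :: "('n \<Rightarrow> 'n \<Rightarrow> (complex fls, 'n) fa fps \<Rightarrow> (complex fls, 'n) fa fps) \<Rightarrow> ('n free_alg fps set, 'n) opmat" where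
  "opY T i j = (\<lambda>y\<in>carrier V. \<lambda>r. cl (ucf r (T i j (cemb (SOME x. cl x = y)))))"

definition good :: "('n \<Rightarrow> 'n \<Rightarrow> (complex fls, 'n) fa fps \<Rightarrow> (complex fls, 'n) fa fps) \<Rightarrow> bool" where
  "good T \<longleftrightarrow> (\<forall>i j. lin (T i j)) \<and> (\<forall>i j. \<forall>x\<in>JE J. T i j x \<in> JE J)"

lemma opY_cl:
  assumes T: "good T"
  shows "opY T i j (cl x) r = cl (ucf r (T i j (cemb x)))"
proof -
  have lin: "lin (T i j)" using T by (simp add: good_def)
  define x' where "x' = (SOME x'. cl x' = cl x)"
  have "cl x' = cl x" unfolding x'_def by (rule someI_ex) blast
  then have "cemb (x' - x) \<in> JE J" by (simp add: cl_eq cemb_JE[OF hideal_J])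
  then have "T i j (cemb (x' - x)) \<in> JE J" using T unfolding good_def by blast
  then have "ucf r (T i j (cemb x')) - ucf r (T i j (cemb x)) \<in> J"
    by (simp add: JE_def rhom_diff[OF rhom_cemb] lin_diff[OF lin] additive.diff[OF additive_ucf])
  moreover have "cl x \<in> carrier V" by (auto simp: V_carrier)
  ultimately show ?thesis by (simp add: opY_def cl_eq x'_def)
qed

lemma cemb_scE: "cemb (scE s) = (scE (cU s) :: (complex fls, 'n) fa fps)"
  by (simp only: emap_scE[OF rhom_fls_const, unfolded emap_def])

lemma opY_opmats:
  assumes T: "good T"
  shows "opY T \<in> opmats V"
  unfolding opmats_def hom_laurent_def
proof (intro CollectI allI conjI ballI PiE_I)
  have lin: "lin (T i j)" for i j using T by (simp add: good_def)
  fix i j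
  show "opY T i j y \<in> laurent_h V" if y: "y \<in> carrier V" for y
  proof -
    obtain x where y: "y = cl x" using y by (auto simp: V_carrier)
    have "\<exists>B. \<forall>r<B. opY T i j y r \<in> hsub V m" for m
      using ucf_tail[of m "T i j (cemb x)"] cl_hsub unfolding y opY_cl[OF T] by blast
    then show ?thesis unfolding laurent_h_def by (auto simp: y opY_cl[OF T] V_carrier)
  qed
  show "opY T i j y = undefined" if "y \<notin> carrier V" for y using that by (simp add: opY_def)
  show "opY T i j (x \<oplus>\<^bsub>V\<^esub> y) r = opY T i j x r \<oplus>\<^bsub>V\<^esub> opY T i j y r" if "x \<in> carrier V" "y \<in> carrier V" for x y r
    using that by (auto simp: V_carrier V_add opY_cl[OF T] rhom_add[OF rhom_cemb] lin_add[OF lin] additive.add[OF additive_ucf])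
  show "opY T i j (s \<odot>\<^bsub>V\<^esub> x) r = s \<odot>\<^bsub>V\<^esub> opY T i j x r" if x: "x \<in> carrier V" for s x r
  proof -
    obtain x' where x': "x = cl x'" using x by (auto simp: V_carrier)
    have "ucf r (T i j (cemb (scE s * x'))) = scE s * ucf r (T i j (cemb x'))"
      by (simp only: rhom_mult[OF rhom_cemb] cemb_scE lin_scE[OF lin]) (simp only: cemb_scE[symmetric] ucf_cemb_mult)
    then show ?thesis by (simp add: x' V_smult opY_cl[OF T])
  qed
qed

text \<open>By \<open>fsums_lin_ucf\<close> the coefficients of the composed linear map are the
  convergent convolutions demanded of the product of series.\<close>

lemma op_prod_is_one_opY:
  assumes A: "good S" and B: "good T" and one: "\<And>i j x. (\<Sum>k\<in>UNIV. S i k (T k j x)) = (if i = j then x else 0)"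
  shows "op_prod_is_one V (opY S) (opY T)"
  unfolding op_prod_is_one_def
proof (intro ballI allI)
  fix y i j r assume "y \<in> carrier V"
  then obtain x where y: "y = cl x" by (auto simp: V_carrier)
  have lin: "lin (S i k)" for k using A by (simp add: good_def)
  have "fsums (\<lambda>(k, b). ucf (r - b) (S i k (cemb (ucf b (T k j (cemb x)))))) (\<Sum>k\<in>UNIV. ucf r (S i k (T k j (cemb x))))"
    by (rule fsums_finite_index) (rule fsums_lin_ucf[OF lin])
  also have "(\<Sum>k\<in>UNIV. ucf r (S i k (T k j (cemb x)))) = (if i = j \<and> r = 0 then x else 0)"
    unfolding additive.sum[OF additive_ucf, symmetric] one by (simp add: ucf_cemb additive.zero[OF additive_ucf])
  finally have "has_hsum V (\<lambda>kb. cl (case kb of (k, b) \<Rightarrow> ucf (r - b) (S i k (cemb (ucf b (T k j (cemb x))))))) UNIV (cl (if i = j \<and> r = 0 then x else 0))"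
    by (rule has_hsum_fsums)
  moreover have "(\<lambda>kb. cl (case kb of (k, b) \<Rightarrow> ucf (r - b) (S i k (cemb (ucf b (T k j (cemb x))))))) = (\<lambda>(k, b). opY S i k (opY T k j y b) (r - b))"
    by (auto simp: y opY_cl[OF A] opY_cl[OF B])
  moreover have "cl (if i = j \<and> r = 0 then x else 0) = (if i = j \<and> r = 0 then y else \<zero>\<^bsub>V\<^esub>)" by (simp add: y V_zero)
  ultimately show "has_hsum V (\<lambda>(k, b). opY S i k (opY T k j y b) (r - b)) UNIV (if i = j \<and> r = 0 then y else \<zero>\<^bsub>V\<^esub>)" by simp
qed

abbreviation LY where "LY \<equiv> opY LE"

lemma good_LE: "good LE" by (simp add: good_def lin_LE JE_LE)

lemma LY_invertible: "op_invertible V LY"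
proof (rule lin_matrix_inverse[OF lin_LE LE_mod_h])
  fix K :: "'n \<Rightarrow> 'n \<Rightarrow> (complex fls, 'n) fa fps \<Rightarrow> (complex fls, 'n) fa fps"
  assume K: "\<And>i k. lin (K i k)" "\<And>i j x. (\<Sum>k\<in>UNIV. LE i k (K k j x)) = (if i = j then x else 0)"
    "\<And>i j x. (\<Sum>k\<in>UNIV. K i k (LE k j x)) = (if i = j then x else 0)"
    "\<And>J i k x. hideal J \<Longrightarrow> (\<And>i k x. x \<in> J \<Longrightarrow> LE i k x \<in> J) \<Longrightarrow> x \<in> J \<Longrightarrow> K i k x \<in> J"
  have "good K" using K(1) K(4)[OF hideal_JE[OF hideal_J] JE_LE] by (simp add: good_def)
  then show ?thesis
    unfolding op_invertible_def by (intro bexI[of _ "opY K"] conjI op_prod_is_one_opY opY_opmats good_LE K(2,3))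
qed

lemma rll_LY_LY: "rll_relation V R Ru 0 LY LY"
  unfolding rll_relation_def
proof (intro ballI allI)
  fix y i1 i2 j1 j2 r s assume "y \<in> carrier V"
  then obtain x where y: "y = cl x" by (auto simp: V_carrier)
  from rll_fsums_LL[of i1 i2 j1 r s j2 x]
  obtain t where t: "fsums (\<lambda>(k1, k2, l1, l2, p, q).
         scE (ucoeff p (fps_nth (Rshift 0 Ru $ (i1, i2) $ (k1, k2)) q) * RP R $ (l1, k2) $ (j1, l2))
           * ucf (r - p) (LE k1 l1 (cemb (ucf (s - int q) (LE l2 j2 (cemb x)))))) t"
    "fsums (\<lambda>(k1, k2, l1, l2, p, q).
         scE (flip (RP R) $ (i1, l2) $ (l1, k2) * ucoeff p (fps_nth (flip (Rshift 0 Ru) $ (k1, k2) $ (j1, j2)) q))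
           * ucf (s - int q) (LE i2 l2 (cemb (ucf (r - p) (LE l1 k1 (cemb x)))))) t" by blast
  show "\<exists>t. has_hsum V
          (\<lambda>(k1, k2, l1, l2, p, q).
             (ucoeff p (fps_nth (Rshift 0 Ru $ (i1, i2) $ (k1, k2)) q) * RP R $ (l1, k2) $ (j1, l2))
               \<odot>\<^bsub>V\<^esub> LY k1 l1 (LY l2 j2 y (s - int q)) (r - p)) UNIV t \<and>
        has_hsum V
          (\<lambda>(k1, k2, l1, l2, p, q).
             (flip (RP R) $ (i1, l2) $ (l1, k2)
               * ucoeff p (fps_nth (flip (Rshift (- 0) Ru) $ (k1, k2) $ (j1, j2)) q))
               \<odot>\<^bsub>V\<^esub> LY i2 l2 (LY l1 k1 y (r - p)) (s - int q)) UNIV t"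
    using has_hsum_fsums[OF t(1)] has_hsum_fsums[OF t(2)]
    by (intro exI[of _ "cl t"]) (simp add: y opY_cl[OF good_LE] V_smult split_def)
qed

lemma Lplus_op_cl: "Lplus_op R Ru i j (cl x) r = cl (Bop i j x r)"
  by (simp add: Lplus_op_def Bop_def V_mult V_zero lam_lplus)

lemma rll_LY_Lplus: "rll_relation V R Ru (c / 2) LY (Lplus_op R Ru)"
  unfolding rll_relation_def
proof (intro ballI allI)
  fix y i1 i2 j1 j2 r s assume "y \<in> carrier V"
  then obtain x where y: "y = cl x" by (auto simp: V_carrier)
  from rll_fsums_Lplus[of i1 i2 j1 r j2 x s]
  obtain t where t: "fsums (\<lambda>(k1, k2, l1, l2, p, q).
         scE (ucoeff p (fps_nth (Rshift (c / 2) Ru $ (i1, i2) $ (k1, k2)) q) * RP R $ (l1, k2) $ (j1, l2))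
           * ucf (r - p) (LE k1 l1 (cemb (Bop l2 j2 x (s - int q))))) t"
    "fsums (\<lambda>(k1, k2, l1, l2, p, q).
         scE (flip (RP R) $ (i1, l2) $ (l1, k2) * ucoeff p (fps_nth (RM $ (k1, k2) $ (j1, j2)) q))
           * Bop i2 l2 (ucf (r - p) (LE l1 k1 (cemb x))) (s - int q)) t" by blast
  show "\<exists>t. has_hsum V
          (\<lambda>(k1, k2, l1, l2, p, q).
             (ucoeff p (fps_nth (Rshift (c / 2) Ru $ (i1, i2) $ (k1, k2)) q) * RP R $ (l1, k2) $ (j1, l2))
               \<odot>\<^bsub>V\<^esub> LY k1 l1 (Lplus_op R Ru l2 j2 y (s - int q)) (r - p)) UNIV t \<and>
        has_hsum V
          (\<lambda>(k1, k2, l1, l2, p, q).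
             (flip (RP R) $ (i1, l2) $ (l1, k2)
               * ucoeff p (fps_nth (flip (Rshift (- (c / 2)) Ru) $ (k1, k2) $ (j1, j2)) q))
               \<odot>\<^bsub>V\<^esub> Lplus_op R Ru i2 l2 (LY l1 k1 y (r - p)) (s - int q)) UNIV t"
    using has_hsum_fsums[OF t(1)] has_hsum_fsums[OF t(2)]
    by (intro exI[of _ "cl t"]) (simp add: y opY_cl[OF good_LE] Lplus_op_cl V_smult split_def)
qed

lemma vL_gL: "vL n k = gL n k"
  by (intro ext) (simp only: vL_def gL_def lam_lplus)

lemma Sv_C: "vconst n (leg i k (map_matrix scal (RP R))) = C.Sv n i k"
  by (simp add: C.Sv_def scal_scE)

lemma Lbracket_gLb: "Lbracket n R = C.gLb n"
  by (simp add: Lbracket_def C.gLb_def vL_gL Sv_C cong: map_cong)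

lemma Lminus_arg_C: "Lminus_arg n R = vprod n (map (C.Sv n 0) [1..<Suc n] @ [C.gLb n])"
  by (simp add: Lminus_arg_def Lbracket_gLb Sv_C cong: map_cong)

lemma cemb_Sv: "(\<lambda>e I K. cemb (C.Sv n i k e I K)) = U.Sv n i k"
  by (auto simp: fun_eq_iff C.Sv_def U.Sv_def vconst_def leg_def cemb_scE rhom_zero[OF rhom_cemb])

lemma cemb_gL: "(\<lambda>e I K. cemb (gL n k e I K)) = (gL n k :: ((complex fls, 'n) fa fps, 'n) vtens)"
proof -
  have "cemb (lam i j e) = (lam i j e :: (complex fls, 'n) fa fps)" for i j e
    by (simp only: emap_lam[OF rhom_fls_const, unfolded emap_def])
  then show ?thesis by (auto simp: fun_eq_iff gL_def rhom_zero[OF rhom_cemb])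
qed

lemma cemb_gLb: "(\<lambda>e I K. cemb (C.gLb n e I K)) = U.gLb n"
  by (intro ext) (simp add: C.gLb_def U.gLb_def vprod_hom[OF rhom_cemb] map_concat o_def cemb_Sv cemb_gL del: upt_Suc)

lemma cemb_Lminus_arg: "cemb (Lminus_arg n R e I K) = vprod n (map (U.Sv n 0) [1..<Suc n] @ [U.gLb n]) e I K"
  by (simp add: Lminus_arg_C vprod_hom[OF rhom_cemb] o_def cemb_Sv cemb_gLb del: upt_Suc)

lemma iota_scE: "fps_map iota (scE s) = (scal_u s :: 'n free_alg fls fps)"
  by (simp add: fps_eq_iff fls_eq_iff scE_def scal_u_def iota_cst nth_fls_map emb_cst rhom_zero[OF rhom_cst])

lemma iota_cemb: "fps_map iota (cemb x) = lift_u x"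
  by (auto simp: fps_eq_iff fls_eq_iff lift_u_def nth_iota lookup_pmap poly_mapping_eq_iff fun_eq_iff)

text \<open>The prescribed value has Laurent series over the algebra as entries; it is the image
  under \<open>iota\<close> of the same product formed over the base ring of series in u.\<close>

lemma Lminus_value_U:
  "Lminus_value n R Ru c e I K = fps_map iota (vprod n (map (\<lambda>k. vleg n k 0 k (map_matrix vsc RI)) [1..<Suc n] @ [U.gLb n] @ map (\<lambda>k. U.Sv n k 0) [1..<Suc n]
        @ map (\<lambda>k. vleg n k k 0 (map_matrix vsc (flip RM))) (rev [1..<Suc n])) e I K)"
proof -
  have h: "rhom (fps_map iota :: (complex fls, 'n) fa fps \<Rightarrow> 'n free_alg fls fps)" by (rule rhom_fps_map[OF rhom_iota])
  have leg: "(\<lambda>e I K. (fps_map iota (vleg n k i j (map_matrix vsc B) e I K) :: 'n free_alg fls fps)) = vleg n k i j (map_matrix (fps_map scal_u) B)"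
    for k i j and B :: "(complex fls fps fps, 'n) mat2"
    by (auto simp: fun_eq_iff vleg_def leg_def vsc_def iota_scE rhom_zero[OF h])
  have S: "(\<lambda>e I K. fps_map iota (U.Sv n i k e I K)) = vconst n (leg i k (map_matrix (\<lambda>s. lift_u (scal s)) (RP R)))" for i k
    by (auto simp: fun_eq_iff U.Sv_def vconst_def leg_def cemb_scE[symmetric] iota_cemb scal_scE rhom_zero[OF h])
  have g: "(\<lambda>e I K. fps_map iota (U.gLb n e I K)) = (\<lambda>e I K. lift_u (Lbracket n R e I K))"
    by (simp add: cemb_gLb[symmetric] iota_cemb Lbracket_gLb)
  show ?thesis
    unfolding vprod_hom[OF h] Lminus_value_def by (simp add: o_def leg S g flip_flip rev_map del: upt_Suc)
qed

lemma Lminus_characterization_LY: "Lminus_characterization R Ru c LY"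
  unfolding Lminus_characterization_def
proof (intro conjI allI impI)
  show "LY \<in> opmats V" by (rule opY_opmats[OF good_LE])
  show "LY i j \<one>\<^bsub>V\<^esub> r = (if i = j \<and> r = 0 then \<one>\<^bsub>V\<^esub> else \<zero>\<^bsub>V\<^esub>)" for i j r
  proof -
    have "ucf r (1 :: (complex fls, 'n) fa fps) = (if r = 0 then 1 else 0)" for r
      using ucf_cemb[of r "1 :: (complex, 'n) fa fps"] by (simp add: rhom_one[OF rhom_cemb])
    then show ?thesis
      by (simp add: V_one V_zero opY_cl[OF good_LE] rhom_one[OF rhom_cemb] LE_one additive.zero[OF additive_ucf])
  qed
  fix n i0 r and e :: "nat list" and I K :: "'n list"
  assume n: "1 \<le> n" and len: "length e = n \<and> length I = n \<and> length K = Suc n"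
  have "(\<Oplus>\<^bsub>V\<^esub>k0\<in>UNIV. LY i0 k0 (cl (Lminus_arg n R e (k0 # I) K)) r) = cl (ucf r (\<Sum>k0\<in>UNIV. LE i0 k0 (cemb (Lminus_arg n R e (k0 # I) K))))"
    by (simp add: opY_cl[OF good_LE] V_sum additive.sum[OF additive_ucf])
  also have "(\<Sum>k0\<in>UNIV. LE i0 k0 (cemb (Lminus_arg n R e (k0 # I) K))) =
     vprod n (map (\<lambda>k. vleg n k 0 k (map_matrix vsc RI)) [1..<Suc n] @ [U.gLb n] @ map (\<lambda>k. U.Sv n k 0) [1..<Suc n]
        @ map (\<lambda>k. vleg n k k 0 (map_matrix vsc (flip RM))) (rev [1..<Suc n])) e (i0 # I) K"
    unfolding cemb_Lminus_arg by (rule U.L_formula[OF Lgood_LE n]) (use len in auto)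
  also have "ucf r \<dots> = ucoeff r (Lminus_value n R Ru c e (i0 # I) K)"
    unfolding Lminus_value_U ucoeff_iota ..
  finally show "(\<Oplus>\<^bsub>V\<^esub>k0\<in>UNIV. LY i0 k0 (cl (Lminus_arg n R e (k0 # I) K)) r) = cl (ucoeff r (Lminus_value n R Ru c e (i0 # I) K))" .
qed

end

subsection \<open>Uniqueness\<close>

context Lcalc
begin

lemma eu_SP: "k \<noteq> r \<Longrightarrow> k \<notin> set js \<Longrightarrow> eu k a b * SP r js = SP r js * eu k a b"
  by (rule prod_list_commute) (auto intro!: eu_S)

lemma eu_LL: "k \<notin> set ks \<Longrightarrow> eu k a b * LL ks = LL ks * eu k a b"
proof (induction ks)
  case (Cons j ks)
  then have "eu k a b * LL (j # ks) = Lp j * (eu k a b * (SP j ks * LL ks))"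
    using mult_tail[OF eu_Lp[of k j a b]] by (simp add: mult.assoc)
  also have "\<dots> = Lp j * (SP j ks * (LL ks * eu k a b))"
    using Cons mult_tail[OF eu_SP[of k j ks a b]] by simp
  finally show ?case by (simp add: mult.assoc)
qed simp

lemma zs_eta_SP: "SP r js * zs (eta s) = zs (eta s) * SP r js"
  by (rule prod_list_commute[symmetric]) (auto simp: zs_eta_S)

text \<open>Every label has its own leg and its own variable, so all sums collapse and any product
  of coefficients \<open>lam\<close> occurs as a value on a basis vector.\<close>

lemma prod_Lp_value:
  "distinct ks \<Longrightarrow> ap (prod_list (map Lp ks)) (dl x0 1) x e =
     (if \<forall>j. j \<notin> set ks \<longrightarrow> x j = x0 j \<and> e j = 0 then prod_list (map (\<lambda>k. lam (x k) (x0 k) (e k)) ks) else 0)"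
proof (induction ks arbitrary: x e)
  case Nil
  show ?case by (auto simp: dl_def fun_eq_iff)
next
  case (Cons k ks)
  then have k: "k \<notin> set ks" and d: "distinct ks" by auto
  let ?v = "lam (x k) (x0 k) (e k) * ap (prod_list (map Lp ks)) (dl x0 1) (x(k := x0 k)) (e(k := 0))"
  have "lam (x k) a q * ap (prod_list (map Lp ks)) (dl x0 1) (x(k := a)) (e(k := e k - q)) = (if a = x0 k then (if q = e k then ?v else 0) else 0)"
    if "q \<le> e k" for a q
  proof (cases "a = x0 k \<and> q = e k")
    case False
    then have "\<not> (\<forall>j. j \<notin> set ks \<longrightarrow> (x(k := a)) j = x0 j \<and> (e(k := e k - q)) j = 0)"
      using k that by (intro notI) (auto dest!: spec[of _ k])
    then have "ap (prod_list (map Lp ks)) (dl x0 1) (x(k := a)) (e(k := e k - q)) = 0"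
      unfolding Cons.IH[OF d] by (rule if_not_P)
    then show ?thesis using False by auto
  qed simp
  note summand = this
  have "ap (prod_list (map Lp (k # ks))) (dl x0 1) x e = ap (Lp k) (ap (prod_list (map Lp ks)) (dl x0 1)) x e" by simp
  also have "\<dots> = (\<Sum>a\<in>UNIV. \<Sum>q\<le>e k. lam (x k) a q * ap (prod_list (map Lp ks)) (dl x0 1) (x(k := a)) (e(k := e k - q)))"
    by (rule ap_Lp)
  also have "\<dots> = (\<Sum>a\<in>UNIV. \<Sum>q\<le>e k. if a = x0 k then (if q = e k then ?v else 0) else 0)"
    by (intro sum.cong refl summand) simp
  also have "\<dots> = ?v" by (rule sum_delta2)
  also have "\<dots> = (if \<forall>j. j \<notin> set (k # ks) \<longrightarrow> x j = x0 j \<and> e j = 0 then prod_list (map (\<lambda>k. lam (x k) (x0 k) (e k)) (k # ks)) else 0)"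
  proof -
    have c: "(\<forall>j. j \<notin> set ks \<longrightarrow> (x(k := x0 k)) j = x0 j \<and> (e(k := 0)) j = 0) \<longleftrightarrow> (\<forall>j. j \<notin> set (k # ks) \<longrightarrow> x j = x0 j \<and> e j = 0)"
      by auto
    have m: "map (\<lambda>j. lam ((x(k := x0 k)) j) (x0 j) ((e(k := 0)) j)) ks = map (\<lambda>k. lam (x k) (x0 k) (e k)) ks"
      using k by (intro map_cong) auto
    show ?thesis unfolding Cons.IH[OF d] c m by auto
  qed
  finally show ?case .
qed

text \<open>The cancellation for a property P of vectors that need not be pointwise. Units on leg k
  are applied outside and must preserve P, units on leg r go into the argument; for r = 0 this
  matters, because P will sum over leg 0.\<close>

lemma skew_strip:
  assumes zero: "P 0" and add: "\<And>\<psi> \<phi>. P \<psi> \<Longrightarrow> P \<phi> \<Longrightarrow> P (\<psi> + \<phi>)" and zs: "\<And>s \<psi>. P \<psi> \<Longrightarrow> P (ap (zs (eta s)) \<psi>)"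
    and eu: "\<And>c a \<psi>. P \<psi> \<Longrightarrow> P (ap (eu k c a) \<psi>)"
    and rk: "r \<noteq> k" and T: "\<And>c a. eu k c a * T = T * eu k c a" "\<And>s. T * zs (eta s) = zs (eta s) * T"
    and U: "\<And>c a. eu r c a * U = U * eu r c a"
    and v: "\<And>j m. P (ap (T * S r k * U) (ap (eu r j m) \<psi>))"
  shows "P (ap (T * U) \<psi>)"
proof -
  have sum: "P (sum f I)" if "\<And>i. i \<in> I \<Longrightarrow> P (f i)" for f and I :: "'n set"
    using that by (induction I rule: infinite_finite_induct) (auto simp: zero add)
  have "ap (T * U) \<psi> = (\<Sum>m\<in>UNIV. \<Sum>c\<in>UNIV. \<Sum>a\<in>UNIV. \<Sum>j\<in>UNIV. ap (zs (eta (Q m c a j))) (ap (eu k c a) (ap (T * S r k * U) (ap (eu r j m) \<psi>))))"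
    unfolding skew_cancel[OF rk T U] by (simp add: ap_sum)
  then show ?thesis using v by (auto intro!: sum zs eu)
qed

text \<open>The factor next to U is the last one of the row, hence the induction from the right
  end.\<close>

lemma strip_SP:
  assumes zero: "P 0" and add: "\<And>\<psi> \<phi>. P \<psi> \<Longrightarrow> P \<phi> \<Longrightarrow> P (\<psi> + \<phi>)" and zs: "\<And>s \<psi>. P \<psi> \<Longrightarrow> P (ap (zs (eta s)) \<psi>)"
    and eu: "\<And>k c a \<psi>. k \<in> N \<Longrightarrow> P \<psi> \<Longrightarrow> P (ap (eu k c a) \<psi>)"
    and DD: "\<And>j m \<psi>. \<psi> \<in> DD \<Longrightarrow> ap (eu r j m) \<psi> \<in> DD"
    and T: "\<And>s. T * zs (eta s) = zs (eta s) * T" and U: "\<And>c a. eu r c a * U = U * eu r c a"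
  shows "distinct js \<Longrightarrow> r \<notin> set js \<Longrightarrow> set js \<subseteq> N \<Longrightarrow> (\<And>k c a. k \<in> set js \<Longrightarrow> eu k c a * T = T * eu k c a) \<Longrightarrow>
    \<forall>\<psi>\<in>DD. P (ap (T * (SP r js * U)) \<psi>) \<Longrightarrow> \<forall>\<psi>\<in>DD. P (ap (T * U) \<psi>)"
proof (induction js rule: rev_induct)
  case (snoc k js)
  have "P (ap ((T * SP r js) * U) \<psi>)" if \<psi>: "\<psi> \<in> DD" for \<psi>
  proof (rule skew_strip[where P = P and r = r and k = k])
    have k: "k \<noteq> r" "k \<notin> set js" using snoc.prems by auto
    show "eu k c a * (T * SP r js) = T * SP r js * eu k c a" for c a
      using mult_tail[OF snoc.prems(4)[of k c a], of "SP r js"] eu_SP[OF k, of c a] by (simp add: mult.assoc)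
    show "T * SP r js * zs (eta s) = zs (eta s) * (T * SP r js)" for s
      using mult_tail[OF T[of s], of "SP r js"] zs_eta_SP[of r js s] by (simp add: mult.assoc)
    show "P (ap (T * SP r js * S r k * U) (ap (eu r j m) \<psi>))" for j m
      using snoc.prems(5) DD[OF \<psi>, of j m] by (simp add: mult.assoc)
  qed (use snoc.prems in \<open>auto intro: zero add zs eu U\<close>)
  then have "\<forall>\<psi>\<in>DD. P (ap (T * (SP r js * U)) \<psi>)" by (simp add: mult.assoc)
  then show ?case using snoc.IH snoc.prems by auto
qed simp

text \<open>The leading L^+ is absorbed into T, the row of RP factors behind it is cancelled, and
  the same is repeated for the remaining labels.\<close>

lemma strip_LL:
  assumes zero: "P 0" and add: "\<And>\<psi> \<phi>. P \<psi> \<Longrightarrow> P \<phi> \<Longrightarrow> P (\<psi> + \<phi>)" and zs: "\<And>s \<psi>. P \<psi> \<Longrightarrow> P (ap (zs (eta s)) \<psi>)"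
    and eu: "\<And>k c a \<psi>. k \<in> N \<Longrightarrow> P \<psi> \<Longrightarrow> P (ap (eu k c a) \<psi>)"
    and DD: "\<And>r j m \<psi>. r \<in> N \<Longrightarrow> \<psi> \<in> DD \<Longrightarrow> ap (eu r j m) \<psi> \<in> DD"
  shows "distinct ks \<Longrightarrow> set ks \<subseteq> N \<Longrightarrow> (\<And>k c a. k \<in> set ks \<Longrightarrow> eu k c a * T = T * eu k c a) \<Longrightarrow>
    (\<And>s. T * zs (eta s) = zs (eta s) * T) \<Longrightarrow> \<forall>\<psi>\<in>DD. P (ap (T * LL ks) \<psi>) \<Longrightarrow> \<forall>\<psi>\<in>DD. P (ap (T * prod_list (map Lp ks)) \<psi>)"
proof (induction ks arbitrary: T)
  case (Cons k ks)
  have T: "T * Lp k * zs (eta s) = zs (eta s) * (T * Lp k)" for s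
    using mult_tail[OF Cons.prems(4)[of s], of "Lp k"] zs_eta_Lp[of k s] by (simp add: mult.assoc)
  have e: "eu j c a * (T * Lp k) = T * Lp k * eu j c a" if "j \<in> set ks" for j c a
  proof -
    have "j \<noteq> k" using that Cons.prems(1) by auto
    then show ?thesis
      using mult_tail[OF Cons.prems(3)[of j c a], of "Lp k"] eu_Lp[of j k c a] that by (simp add: mult.assoc)
  qed
  have "\<forall>\<psi>\<in>DD. P (ap (T * Lp k * LL ks) \<psi>)"
  proof (rule strip_SP[where P = P and N = N and r = k and js = ks, OF zero add zs eu _ T])
    show "\<forall>\<psi>\<in>DD. P (ap (T * Lp k * (SP k ks * LL ks)) \<psi>)" using Cons.prems(5) by (simp add: mult.assoc)
  qed (use Cons.prems e in \<open>auto intro: DD eu_LL\<close>)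
  from Cons.IH[OF _ _ e T this] Cons.prems show ?case by (simp add: mult.assoc)
qed simp

end

context Ydata
begin

text \<open>The given operators live on the quotient, while cancellation takes place on vectors over
  the free algebra. Their difference is therefore followed through representatives, and each
  linearity property holds modulo J.\<close>

lemma Lminus_unique:
  assumes L: "Lminus_characterization R Ru c L" and L': "Lminus_characterization R Ru c L'"
  shows "L = L'"
proof -
  define rp where "rp y = (SOME x. cl x = y)" for y
  have rp: "cl (rp y) = y" if y: "y \<in> carrier V" for y
  proof -
    obtain x where "cl x = y" using y unfolding V_carrier by blast
    then show ?thesis unfolding rp_def by (rule someI)
  qed
  have op: "L \<in> opmats V" "L' \<in> opmats V" using L L' by (auto simp: Lminus_characterization_def)
  then have hom: "L i j \<in> hom_laurent V" "L' i j \<in> hom_laurent V" for i j by (auto simp: opmats_def)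
  have clV: "cl x \<in> carrier V" for x by (auto simp: V_carrier)
  have car: "L i j (cl x) r \<in> carrier V" "L' i j (cl x) r \<in> carrier V" for i j x r
  proof -
    have "L i j \<in> carrier V \<rightarrow>\<^sub>E laurent_h V" "L' i j \<in> carrier V \<rightarrow>\<^sub>E laurent_h V"
      using hom[of i j] by (simp_all add: hom_laurent_def)
    from this[THEN PiE_mem, OF clV] show "L i j (cl x) r \<in> carrier V" "L' i j (cl x) r \<in> carrier V"
      by (simp_all add: laurent_h_def)
  qed
  have add: "L i j (cl (x + y)) r = L i j (cl x) r \<oplus>\<^bsub>V\<^esub> L i j (cl y) r" "L' i j (cl (x + y)) r = L' i j (cl x) r \<oplus>\<^bsub>V\<^esub> L' i j (cl y) r" for i j x y r
    using hom[of i j] clV unfolding hom_laurent_def V_add[symmetric] by blast+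
  have smult: "L i j (cl (scE s * x)) r = s \<odot>\<^bsub>V\<^esub> L i j (cl x) r" "L' i j (cl (scE s * x)) r = s \<odot>\<^bsub>V\<^esub> L' i j (cl x) r" for i j s x r
    using hom[of i j] clV unfolding hom_laurent_def V_smult[symmetric] by blast+
  have one: "L i j (cl 1) r = (if i = j \<and> r = 0 then \<one>\<^bsub>V\<^esub> else \<zero>\<^bsub>V\<^esub>)" if "Lminus_characterization R Ru c L" for L i j r
    using that unfolding Lminus_characterization_def V_one by blast
  have val: "(\<Oplus>\<^bsub>V\<^esub>k0\<in>UNIV. L i0 k0 (cl (Lminus_arg n R e (k0 # I) Jl)) r) = cl (ucoeff r (Lminus_value n R Ru c e (i0 # I) Jl))"
    if "Lminus_characterization R Ru c L" "1 \<le> n" "length e = n" "length I = n" "length Jl = Suc n" for L n e i0 I Jl r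
    using that unfolding Lminus_characterization_def by blast
  \<comment> \<open>A representative of the difference of the two values; it lies in J exactly when
    the values agree.\<close>
  define p where "p i j x r = rp (L i j (cl x) r) - rp (L' i j (cl x) r)" for i j x r
  have rL: "cl (rp (L i j (cl x) r)) = L i j (cl x) r" "cl (rp (L' i j (cl x) r)) = L' i j (cl x) r" for i j x r
    by (simp_all add: rp car)
  have p_eq: "p i j x r \<in> J \<longleftrightarrow> L i j (cl x) r = L' i j (cl x) r" for i j x r
    unfolding p_def cl_eq[symmetric] rL ..
  have p_add: "p i j (x + y) r - (p i j x r + p i j y r) \<in> J" for i j x y r
  proof -
    have "cl (rp (L i j (cl (x + y)) r)) = cl (rp (L i j (cl x) r) + rp (L i j (cl y) r))"
      "cl (rp (L' i j (cl (x + y)) r)) = cl (rp (L' i j (cl x) r) + rp (L' i j (cl y) r))"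
      by (simp_all only: rL V_add[where x = "rp u" and y = "rp v" for u v, symmetric]) (rule add)+
    then show ?thesis unfolding cl_eq by (auto dest: hideal_diff[OF hideal_J] simp: p_def algebra_simps)
  qed
  have p_sc: "p i j (scE s * x) r - scE s * p i j x r \<in> J" for i j s x r
  proof -
    have "cl (rp (L i j (cl (scE s * x)) r)) = cl (scE s * rp (L i j (cl x) r))"
      "cl (rp (L' i j (cl (scE s * x)) r)) = cl (scE s * rp (L' i j (cl x) r))"
      by (simp_all only: rL V_smult[where x = "rp u" for u, symmetric]) (rule smult)+
    then show ?thesis unfolding cl_eq by (auto dest: hideal_diff[OF hideal_J] simp: p_def algebra_simps)
  qed
  have addJ: "x \<in> J" if "x - y \<in> J" "y \<in> J" for x y using hideal_add[OF hideal_J that] by simp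
  have p_zero: "p i j 0 r \<in> J" for i j r using hideal_uminus[OF hideal_J p_add[of i j 0 0 r]] by simp
  have p_addJ: "p i j (x + y) r \<in> J" if "p i j x r \<in> J" "p i j y r \<in> J" for i j x y r
    by (rule addJ[OF p_add]) (rule hideal_add[OF hideal_J that])
  have p_scJ: "p i j (scE s * x) r \<in> J" if "p i j x r \<in> J" for i j s x r
    by (rule addJ[OF p_sc]) (rule hideal_mult_left[OF hideal_J that])
  have words: "p i0 k0 (prod_list (map (\<lambda>(a, b, f). lam a b f) ls)) r \<in> J" for i0 k0 ls r
  proof (cases "ls = []")
    case True
    have "L i0 k0 (cl 1) r = L' i0 k0 (cl 1) r" unfolding one[OF L] one[OF L'] ..
    then show ?thesis using True by (simp add: p_eq)
  next
    case False
    define n where "n = length ls"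
    have n: "1 \<le> n" using False by (cases ls) (auto simp: n_def)
    let ?ks = "[1..<Suc n]"
    \<comment> \<open>Agreement of the two operators after contraction over leg 0, which is the form
      of the characterizing formula.\<close>
    define P where "P \<psi> \<longleftrightarrow> (\<forall>e I i r. length e = n \<longrightarrow> length I = Suc n \<longrightarrow> (\<Sum>k\<in>UNIV. p i k (\<psi> ((ix I)(0 := k)) (ex e)) r) \<in> J)"
      for \<psi> :: "(nat \<Rightarrow> 'n) \<Rightarrow> (nat \<Rightarrow> nat) \<Rightarrow> 'n free_alg fps"
    \<comment> \<open>Matrix units send a basis vector to a basis vector or to 0; with 0 included
      the set is stable under them.\<close>
    define D where "D = insert 0 {dl (ix Jl) (1 :: 'n free_alg fps) | Jl :: 'n list. length Jl = Suc n}"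
    have P0: "P 0" by (auto simp: P_def zero_fun_apply intro!: hideal_sum[OF hideal_J] p_zero)
    have Padd: "P (\<psi> + \<phi>)" if \<psi>: "P \<psi>" and \<phi>: "P \<phi>" for \<psi> \<phi>
      unfolding P_def
    proof (intro allI impI)
      fix e :: "nat list" and i r and I :: "'n list" assume l: "length e = n" "length I = Suc n"
      let ?x = "\<lambda>k. (ix I)(0 := k)"
      have "(\<Sum>k\<in>UNIV. p i k ((\<psi> + \<phi>) (?x k) (ex e)) r - (p i k (\<psi> (?x k) (ex e)) r + p i k (\<phi> (?x k) (ex e)) r)) \<in> J"
        by (intro hideal_sum[OF hideal_J]) (simp add: plus_fun_apply p_add)
      then have "(\<Sum>k\<in>UNIV. p i k ((\<psi> + \<phi>) (?x k) (ex e)) r) - ((\<Sum>k\<in>UNIV. p i k (\<psi> (?x k) (ex e)) r) + (\<Sum>k\<in>UNIV. p i k (\<phi> (?x k) (ex e)) r)) \<in> J"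
        by (simp only: sum_subtractf sum.distrib)
      moreover have "(\<Sum>k\<in>UNIV. p i k (\<psi> (?x k) (ex e)) r) \<in> J" "(\<Sum>k\<in>UNIV. p i k (\<phi> (?x k) (ex e)) r) \<in> J"
        using \<psi> \<phi> l unfolding P_def by blast+
      ultimately show "(\<Sum>k\<in>UNIV. p i k ((\<psi> + \<phi>) (?x k) (ex e)) r) \<in> J"
        using addJ hideal_add[OF hideal_J] by blast
    qed
    have Pzs: "P (ap (zs (C.eta s)) \<psi>)" if \<psi>: "P \<psi>" for s \<psi>
      unfolding P_def
    proof (intro allI impI)
      fix e :: "nat list" and i r and I :: "'n list" assume l: "length e = n" "length I = Suc n"
      let ?x = "\<lambda>k. (ix I)(0 := k)"
      have "(\<Sum>k\<in>UNIV. p i k (ap (zs (C.eta s)) \<psi> (?x k) (ex e)) r - scE s * p i k (\<psi> (?x k) (ex e)) r) \<in> J"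
        by (intro hideal_sum[OF hideal_J]) (simp add: C.ap_zs_eta p_sc)
      then have "(\<Sum>k\<in>UNIV. p i k (ap (zs (C.eta s)) \<psi> (?x k) (ex e)) r) - scE s * (\<Sum>k\<in>UNIV. p i k (\<psi> (?x k) (ex e)) r) \<in> J"
        by (simp only: sum_subtractf sum_distrib_left)
      moreover have "(\<Sum>k\<in>UNIV. p i k (\<psi> (?x k) (ex e)) r) \<in> J" using \<psi> l unfolding P_def by blast
      ultimately show "(\<Sum>k\<in>UNIV. p i k (ap (zs (C.eta s)) \<psi> (?x k) (ex e)) r) \<in> J"
        using addJ hideal_mult_left[OF hideal_J] by blast
    qed
    have ix_upd: "ix (I[k := b]) = (ix I)(k := b)" if "k < length I" for I :: "'n list" and k b
      using that by (auto simp: ix_def fun_eq_iff)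
    have Peu: "P (ap (eu k d b) \<psi>)" if k: "k \<in> {1..n}" and \<psi>: "P \<psi>" for k d b \<psi>
      unfolding P_def
    proof (intro allI impI)
      fix e :: "nat list" and i r and I :: "'n list" assume l: "length e = n" "length I = Suc n"
      have "ap (eu k d b) \<psi> ((ix I)(0 := k0)) (ex e) = (if I ! k = d then \<psi> ((ix (I[k := b]))(0 := k0)) (ex e) else 0)" for k0
        using k l by (simp add: ap_eu ix_upd fun_upd_twist zero_fun_apply) (simp add: ix_def)
      then show "(\<Sum>k0\<in>UNIV. p i k0 (ap (eu k d b) \<psi> ((ix I)(0 := k0)) (ex e)) r) \<in> J"
        using \<psi>[unfolded P_def, rule_format, of e "I[k := b]" i r] l
        by (cases "I ! k = d") (simp_all add: hideal_sum[OF hideal_J] p_zero)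
    qed
    have Deu: "ap (eu r j m) \<psi> \<in> D" if r: "r \<le> n" and \<psi>: "\<psi> \<in> D" for r j m \<psi>
    proof (cases "\<psi> = 0")
      case True
      then show ?thesis by (simp add: D_def)
    next
      case False
      then obtain Jl where Jl: "\<psi> = dl (ix Jl) 1" "length Jl = Suc n" using \<psi> by (auto simp: D_def)
      have "ap (eu r j m) \<psi> = (if Jl ! r = m then dl (ix (Jl[r := j])) 1 else 0)"
      proof (intro ext)
        fix x e
        have 1: "ix Jl r = Jl ! r" using r Jl(2) by (simp add: ix_def)
        have 2: "ix (Jl[r := j]) = (ix Jl)(r := j)" using r Jl(2) by (intro ix_upd) simp
        have 3: "(x(r := m) = ix Jl \<and> x r = j) = (x = (ix Jl)(r := j) \<and> ix Jl r = m)"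
          by (metis fun_upd_same fun_upd_triv fun_upd_upd)
        have "ap (eu r j m) \<psi> x e = (if (x(r := m) = ix Jl \<and> x r = j) \<and> e = (\<lambda>_. 0) then 1 else 0)"
          by (simp add: ap_eu dl_def Jl(1) zero_fun_apply)
        also have "\<dots> = (if Jl ! r = m then dl (ix (Jl[r := j])) 1 else 0) x e"
          unfolding 3 1 2 by (simp add: dl_def zero_fun_apply)
        finally show "ap (eu r j m) \<psi> x e = (if Jl ! r = m then dl (ix (Jl[r := j])) 1 else 0) x e" .
      qed
      then show ?thesis using Jl by (auto simp: D_def)
    qed
    have start: "\<forall>\<psi>\<in>D. P (ap (1 * (C.SP 0 ?ks * C.LL ?ks)) \<psi>)"
    proof
      fix \<psi> assume "\<psi> \<in> D"
      then consider "\<psi> = 0" | Jl where "\<psi> = dl (ix Jl) 1" "length Jl = Suc n" by (auto simp: D_def)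
      then show "P (ap (1 * (C.SP 0 ?ks * C.LL ?ks)) \<psi>)"
      proof cases
        case 1
        then show ?thesis using P0 by (simp only: ap_arg)
      next
        case 2
        show ?thesis
          unfolding P_def
        proof (intro allI impI)
          fix e :: "nat list" and i r and I :: "'n list" assume l: "length e = n" "length I = Suc n"
          \<comment> \<open>The head of I is overwritten by the summation index on leg 0.\<close>
          let ?I = "tl I"
          have lI: "length ?I = n" using l by simp
          have ixI: "(ix I)(0 := k) = ix (k # ?I)" for k using l by (cases I) (auto simp: ix_def fun_eq_iff nth_Cons')
          have arg: "ap (1 * (C.SP 0 ?ks * C.LL ?ks)) \<psi> ((ix I)(0 := k)) (ex e) = Lminus_arg n R e (k # ?I) Jl" for k
            using C.rep_Lminus_arg[OF n 2(2)] l lI unfolding rep_def Lminus_arg_C ixI 2(1) by (simp del: upt_Suc)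
          have "(\<Oplus>\<^bsub>V\<^esub>k\<in>UNIV. L i k (cl (Lminus_arg n R e (k # ?I) Jl)) r) = (\<Oplus>\<^bsub>V\<^esub>k\<in>UNIV. L' i k (cl (Lminus_arg n R e (k # ?I) Jl)) r)"
            unfolding val[OF L n l(1) lI 2(2)] val[OF L' n l(1) lI 2(2)] ..
          then have "cl (\<Sum>k\<in>UNIV. rp (L i k (cl (Lminus_arg n R e (k # ?I) Jl)) r)) = cl (\<Sum>k\<in>UNIV. rp (L' i k (cl (Lminus_arg n R e (k # ?I) Jl)) r))"
            by (simp add: V_sum[symmetric] rL)
          then show "(\<Sum>k\<in>UNIV. p i k (ap (1 * (C.SP 0 ?ks * C.LL ?ks)) \<psi> ((ix I)(0 := k)) (ex e)) r) \<in> J"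
            unfolding arg p_def cl_eq by (simp only: sum_subtractf)
        qed
      qed
    qed
    have ks: "distinct ?ks" "0 \<notin> set ?ks" "set ?ks \<subseteq> {1..n}" by auto
    \<comment> \<open>This cancels the factors (RP)_0k in front of L^+_[n](v).\<close>
    have "\<forall>\<psi>\<in>D. P (ap (1 * C.LL ?ks) \<psi>)"
      by (rule C.strip_SP[where P = P and N = "{1..n}" and r = 0 and js = ?ks, OF P0 Padd Pzs Peu])
        (use ks start in \<open>auto intro: Deu C.eu_LL simp del: upt_Suc\<close>)
    \<comment> \<open>This cancels the factors (RP)_ij inside L^+_[n](v), leaving a plain product of
      L^+'s.\<close>
    then have "\<forall>\<psi>\<in>D. P (ap (1 * prod_list (map C.Lp ?ks)) \<psi>)"
      by (intro C.strip_LL[where P = P and N = "{1..n}", OF P0 Padd Pzs Peu])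
        (use ks in \<open>auto intro: Deu simp del: upt_Suc\<close>)
    then have Pprod: "P (ap (prod_list (map C.Lp ?ks)) (dl (ix Jl) 1))" if "length Jl = Suc n" for Jl
      using that unfolding D_def mult_1_left by blast
    \<comment> \<open>The same index k0 is put on leg 0 of rows and columns, so the contraction
      picks the entry k0; the other terms are differences at 0 and lie in J.\<close>
    define I where "I = k0 # map fst ls"
    define Jl where "Jl = k0 # map (\<lambda>l. fst (snd l)) ls"
    define e where "e = map (\<lambda>l. snd (snd l)) ls"
    have l: "length I = Suc n" "length Jl = Suc n" "length e = n" by (auto simp: I_def Jl_def e_def n_def)
    have prodLp: "ap (prod_list (map C.Lp ?ks)) (dl (ix Jl) 1) ((ix I)(0 := k)) (ex e) = (if k = k0 then prod_list (map (\<lambda>(a, b, f). lam a b f) ls) else 0)" for k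
    proof -
      have c: "(\<forall>j. j \<notin> set ?ks \<longrightarrow> ((ix I)(0 := k)) j = ix Jl j \<and> ex e j = 0) \<longleftrightarrow> k = k0"
      proof
        assume *: "\<forall>j. j \<notin> set ?ks \<longrightarrow> ((ix I)(0 := k)) j = ix Jl j \<and> ex e j = 0"
        have "(0::nat) \<notin> set ?ks" by simp
        with * have "((ix I)(0 := k)) 0 = ix Jl 0" by blast
        then show "k = k0" by (simp add: ix_def Jl_def)
      next
        assume "k = k0"
        then show "\<forall>j. j \<notin> set ?ks \<longrightarrow> ((ix I)(0 := k)) j = ix Jl j \<and> ex e j = 0"
          using l by (auto simp: ix_def ex_def Jl_def nth_Cons')
      qed
      have m: "map (\<lambda>j. lam (((ix I)(0 := k)) j) (ix Jl j) (ex e j)) ?ks = map (\<lambda>(a, b, f). lam a b f :: 'n free_alg fps) ls"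
        by (rule nth_equalityI) (auto simp: n_def ix_def ex_def I_def Jl_def e_def case_prod_beta simp del: upt_Suc)
      show ?thesis unfolding C.prod_Lp_value[OF ks(1)] c m ..
    qed
    have "(\<Sum>k\<in>UNIV. p i0 k (if k = k0 then prod_list (map (\<lambda>(a, b, f). lam a b f) ls) else 0) r) \<in> J"
      using Pprod[OF l(2), unfolded P_def, rule_format, of e I i0 r] l unfolding prodLp by blast
    also have "(\<Sum>k\<in>UNIV. p i0 k (if k = k0 then prod_list (map (\<lambda>(a, b, f). lam a b f) ls) else 0) r) =
       p i0 k0 (prod_list (map (\<lambda>(a, b, f). lam a b f) ls)) r + (\<Sum>k\<in>UNIV - {k0}. p i0 k 0 r)"
      by (subst sum.remove[of _ k0]) auto
    finally have "p i0 k0 (prod_list (map (\<lambda>(a, b, f). lam a b f) ls)) r + (\<Sum>k\<in>UNIV - {k0}. p i0 k 0 r) \<in> J" .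
    from hideal_diff[OF hideal_J this hideal_sum[OF hideal_J, of "UNIV - {k0}" "\<lambda>k. p i0 k 0 r"]] show ?thesis
      using p_zero by simp
  qed
  define G where "G = {x. \<forall>i j r. p i j x r \<in> J}"
  have Gadd: "x + y \<in> G" if "x \<in> G" "y \<in> G" for x y using that p_addJ by (auto simp: G_def)
  have Gsc: "scE s * x \<in> G" if "x \<in> G" for s x using that p_scJ by (auto simp: G_def)
  have G0: "0 \<in> G" by (simp add: G_def p_zero)
  \<comment> \<open>The prefix of coefficients \<open>lam\<close> is kept general, so that the next
    letter can be split into a Kronecker delta and a \<open>lam\<close> that joins the
    prefix.\<close>
  have wG: "prod_list (map (\<lambda>(a, b, f). lam a b f) ls) * wrd (Word w) \<in> G" for ls w
  proof (induction w arbitrary: ls)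
    case Nil
    have "wrd (Word []) = (1 :: 'n free_alg fps)" by (simp add: wrd_zero flip: zero_free_monoid_def)
    then show ?case using words by (simp add: G_def)
  next
    case (Cons l w)
    obtain d b f where l: "l = (d, b, f)" by (cases l)
    let ?p = "prod_list (map (\<lambda>(a, b, f). lam a b f) ls) :: 'n free_alg fps"
    have "(wrd (Word (l # w)) :: 'n free_alg fps) = (if d = b \<and> f = 0 then wrd (Word w) else 0) + scE (- 1) * (lam d b f * wrd (Word w))"
      by (simp add: lam_wrd l rhom_minus[OF rhom_scE] rhom_one[OF rhom_scE])
    then have "?p * wrd (Word (l # w)) = (if d = b \<and> f = 0 then ?p * wrd (Word w) else 0) + scE (- 1) * (?p * (lam d b f * wrd (Word w)))"
      by (simp add: distrib_left mult.assoc[symmetric] scE_central[of _ ?p])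
    moreover have "?p * (lam d b f * wrd (Word w)) \<in> G" using Cons[of "ls @ [l]"] by (simp add: l mult.assoc)
    ultimately show ?case using Cons[of ls] G0 Gadd Gsc by simp
  qed
  have "x \<in> G" for x
  proof (rule span_closed[OF G0 Gadd Gsc])
    show "wrd w \<in> G" for w using wG[of "[]" "letters w"] by simp
    fix x assume *: "\<And>m. \<exists>y\<in>G. \<forall>l<m. fps_nth y l = fps_nth x l"
    show "x \<in> G" unfolding G_def
    proof (intro CollectI allI hideal_closed[OF hideal_J])
      fix i j r m
      obtain y where y: "y \<in> G" "\<forall>l<m. fps_nth y l = fps_nth x l" using * by blast
      \<comment> \<open>Continuity modulo J comes from linearity: the error h^m w contributes h^m
        times the difference at w.\<close>
      define w where "w = fps_shift m (x - y)"
      have "x - y = fps_X ^ m * w" unfolding w_def by (rule fps_X_power_dvd) (use y in simp)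
      then have x: "x = y + scE (fps_X ^ m) * w" by (simp add: scE_X_power algebra_simps)
      have "p i j x r - (p i j y r + p i j (scE (fps_X ^ m) * w) r) \<in> J" unfolding x by (rule p_add)
      moreover have "p i j y r \<in> J" using y(1) by (simp add: G_def)
      ultimately have "p i j x r - (p i j y r + p i j (scE (fps_X ^ m) * w) r) + p i j y r + (p i j (scE (fps_X ^ m) * w) r - scE (fps_X ^ m) * p i j w r) \<in> J"
        by (intro hideal_add[OF hideal_J] p_sc)
      then have "p i j x r - fps_X ^ m * p i j w r \<in> J" by (simp add: scE_X_power algebra_simps)
      then show "\<exists>y\<in>J. \<forall>l<m. fps_nth y l = fps_nth (p i j x r) l"
        by (rule bexI[rotated]) (simp add: fps_X_power_mult_nth)
    qed
  qed
  then have eq: "L i j (cl x) r = L' i j (cl x) r" for i j x r using p_eq unfolding G_def by blast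
  have "L i j y = L' i j y" for i j y
  proof (cases "y \<in> carrier V")
    case True
    then show ?thesis using eq by (auto simp: V_carrier)
  next
    case False
    then show ?thesis using hom[of i j] unfolding hom_laurent_def by (auto dest!: PiE_arb)
  qed
  then show ?thesis by (intro ext) simp
qed

end

theorem proposition4p2:
  fixes R :: "complex fps ^ ('n::finite \<times> 'n) ^ ('n \<times> 'n)"
    and M :: nat and a c :: complex and \<psi> :: "complex fps"
    and Ru :: "complex fls fps ^ ('n \<times> 'n) ^ ('n \<times> 'n)"
  assumes N: "CARD('n) \<ge> 2"
    and R: "hecke_symmetry R" "skew_invertible R"
    and M: "M > 0" and a: "a \<noteq> 0"
    and Ru: "Ru = Rmat M a \<psi> R"
    and psi: "\<psi> dvd 1" "unitary Ru"
  shows "(\<exists>!L. Lminus_characterization R Ru c L) \<and>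
         (\<forall>L. Lminus_characterization R Ru c L \<longrightarrow>
            op_invertible (Yplus R Ru) L \<and>
            rll_relation (Yplus R Ru) R Ru 0 L L \<and>
            rll_relation (Yplus R Ru) R Ru (c / 2) L (Lplus_op R Ru))"
proof -
  obtain Q where Q: "\<And>m c m' c'. (\<Sum>a\<in>UNIV. \<Sum>j\<in>UNIV. Q m c a j * RP R $ (m', a) $ (j, c')) = (if m = m' \<and> c = c' then 1 else 0)"
    "\<And>a j a' j'. (\<Sum>m\<in>UNIV. \<Sum>c\<in>UNIV. RP R $ (m, a) $ (j, c) * Q m c a' j') = (if a = a' \<and> j = j' then 1 else 0)"
    by (rule skew_inverse[OF R(2)]) (rule that)
  interpret Ydata R M a c \<psi> Ru Q
    by unfold_locales (rule R(1) a Ru psi(2) Q)+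
  have uniq: "L = LY" if "Lminus_characterization R Ru c L" for L
    by (rule Lminus_unique[OF that Lminus_characterization_LY])
  show ?thesis
  proof (intro conjI ex1I[of _ LY] allI impI uniq Lminus_characterization_LY)
    fix L assume "Lminus_characterization R Ru c L"
    then have "L = LY" by (rule uniq)
    then show "op_invertible V L" "rll_relation V R Ru 0 L L" "rll_relation V R Ru (c / 2) L (Lplus_op R Ru)"
      by (simp_all only: LY_invertible rll_LY_LY rll_LY_Lplus)
  qed
qed

end
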